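(* Let $D$ be a connected finite type Dynkin diagram. There is a face-preserving diffeomorphism between $\mathcal{M}_{D,\ge0}$ and the generalized associahedron of $D^\vee$.
   Context: Cluster set-up. $D$ is a connected finite type Dynkin diagram with vertex set $I=\{1,\dots,n\}$ and Cartan matrix $(a_{ij})$. Fix an orientation of the underlying tree of $D$, with edges written $i\to j$; the associated exchange matrix $B$ (of type $D$) has $B_{ij}=-a_{ij}$ if $i\to j$, $B_{ij}=a_{ij}$ if $j\to i$, and $B_{ij}=0$ otherwise. $D^\vee$ is the Dynkin diagram with transposed Cartan matrix and $B^\vee$ is the exchange matrix of type $D^\vee$ for the same orientation. The exchange relation at a seed with (extended) matrix $(b_{ij})$ is $x_kx_k'=\prod_{b_{ik}>0}x_i^{b_{ik}}+\prod_{b_{ik}<0}x_i^{-b_{ik}}$. Indexing. Put $x_{(0,i)}=x_i$ (initial cluster) and, for $t\ge1$, let the cluster $\{x_{(t,i)}\mid i\in I\}$ be obtained from $\{x_{(t-1,i)}\mid i\in I\}$ by mutating exactly once at each $i\in I$, always at a source of the current orientation ($i\to j$ iff $b_{ij}>0$). Let $r_i+1$ be the least positive $t$ such that $x_{(t,i)}$ is an initial variable and write $x_{(r_i+1,i)}=x_{(0,i^* )}$; $i\mapsto i^*$ is an involution of $I$. Set $\Pi=\{(s,i)\mid i\in I,\ 0\le s\le r_i\}$; then $\gamma\mapsto x_\gamma$ is a bijection from $\Pi$ to the set of mutable cluster variables, and $\Pi$ for $B$ and $B^\vee$ are identified (with the same cluster complex). Put $(-1,i):=(r_{i^*},i^*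 )$ and let $\tau:\Pi\to\Pi$ be the bijection $\tau(t,j)=(t-1,j)$. Compatibility degree. $(\omega\|\gamma)\in\mathbb{Z}_{\ge0}$, for $\omega,\gamma\in\Pi$, is the unique function with $(\tau\omega\|\tau\gamma)=(\omega\|\gamma)$ and such that $((0,i)\|\gamma)$ is $\max(0,d_i)$, where $d_i$ is the exponent of $x_i$ in the denominator of the Laurent expansion of $x_\gamma$ in the initial cluster (so $(\gamma\|\gamma)=0$). $\omega,\gamma$ are compatible if $(\omega\|\gamma)=0$. Cluster configuration space. $\mathbb{C}[u]=\mathbb{C}[u_\gamma\mid\gamma\in\Pi]$, $I_D$ is generated by $R_\gamma=u_\gamma+\prod_{\omega\in\Pi}u_\omega^{(\omega\|\gamma)}-1$, $\gamma\in\Pi$; $\widetilde{\mathcal{M}}_D=\operatorname{Spec}(\mathbb{C}[u]/I_D)$ and $\mathcal{M}_D\subset\widetilde{\mathcal{M}}_D$ is the open subscheme where all $u_\gamma$ are invertible (these are defined over $\mathbb{R}$). The positive part is $\mathcal{M}_{D,>0}=\{x\in\mathcal{M}_D(\mathbb{R})\mid u_\gamma(x)>0\text{ for all }\gamma\in\Pi\}$, and the nonnegative part $\mathcal{M}_{D,\ge0}$ is the closure of $\mathcal{M}_{D,>0}$ in $\widetilde{\mathcal{M}}_D(\mathbb{R})$. It is stratified by $\mathcal{M}_{F,>0}=\mathcal{M}_{D,\ge0}\cap\{u_\gamma=0\ (\gamma\in F),\ u_\gamma\ne0\ (\gamma\notin F)\}$, where $F$ ranges over pairwise compatible subsets of $\Pi$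 (the faces of the generalized associahedron). Generalized associahedron. The $\mathbf{g}$-vector $\mathbf{g}_\gamma\in\mathbb{Z}^n$ of $x_\gamma$ is its degree in the principal coefficient cluster algebra of $B$ (extended matrix with top half $B$, bottom half the identity, frozen variables $y_i$) with $\deg x_i=e_i$, $\deg y_i=-Be_i$. The cluster fan $\mathcal{N}(B)$ is the complete fan whose cones are spanned by the $\mathbf{g}$-vectors of sets of cluster variables contained in a common cluster. A generalized associahedron for $B$ is any polytope with normal fan $\mathcal{N}(B)$; the generalized associahedron of $D^\vee$ means one for $B^\vee$. *)

theory Defs
  imports
    "HOL-Analysis.Analysis"
    "HOL-Library.Poly_Mapping"
    "HOL-Computational_Algebra.Fraction_Field"
begin

section \<open>Dynkin diagrams and exchange matrices\<close>

text \<open>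
  The vertex set \<open>I = {1,\<dots>,n}\<close> is the universe of a finite linearly ordered type.  The linear
  order is only used to make the Laurent polynomial rings below instances of \<^class>\<open>idom\<close>.
\<close>

text \<open>
  The vector types are abbreviated because \<open>_ ^ 'n\<close> forces the sort of \<open>'n\<close> to be exactly \<open>finite\<close>.
\<close>

type_synonym 'n int_vec = "int^'n"
type_synonym 'n int_matrix = "int^'n^'n"
type_synonym 'n real_vec = "real^'n"

definition finite_type_cartan :: "('n::finite) int_matrix \<Rightarrow> bool" where
  "finite_type_cartan A \<longleftrightarrow>
     (\<forall>i. A $ i $ i = 2) \<and>
     (\<forall>i j. i \<noteq> j \<longrightarrow> A $ i $ j \<le> 0) \<and>
     (\<forall>i j. A $ i $ j = 0 \<longleftrightarrow> A $ j $ i = 0) \<and>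
     (\<exists>d :: 'n \<Rightarrow> real.
        (\<forall>i. d i > 0) \<and>
        (\<forall>i j. d i * of_int (A $ i $ j) = d j * of_int (A $ j $ i)) \<and>
        (\<forall>v :: real^'n. v \<noteq> 0 \<longrightarrow>
           (\<Sum>i\<in>UNIV. \<Sum>j\<in>UNIV. v $ i * (d i * of_int (A $ i $ j)) * v $ j) > 0))"

definition connected_diagram :: "('n::finite) int_matrix \<Rightarrow> bool" where
  "connected_diagram A \<longleftrightarrow> (\<forall>i j. (i, j) \<in> {(k, l). A $ k $ l \<noteq> 0}\<^sup>*)"

definition orientation :: "('n::finite) int_matrix \<Rightarrow> ('n \<Rightarrow> 'n \<Rightarrow> bool) \<Rightarrow> bool" where
  "orientation A E \<longleftrightarrow>
     (\<forall>i j. (i \<noteq> j \<and> A $ i $ j \<noteq> 0) \<longleftrightarrow> (E i j \<or> E j i)) \<and>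
     (\<forall>i j. \<not> (E i j \<and> E j i))"

definition exchange_matrix :: "('n::finite) int_matrix \<Rightarrow> ('n \<Rightarrow> 'n \<Rightarrow> bool) \<Rightarrow> 'n int_matrix" where
  "exchange_matrix A E =
     (\<chi> i j. if E i j then - (A $ i $ j) else if E j i then A $ i $ j else 0)"


section \<open>Seeds and mutation\<close>

text \<open>
  A seed is an extended exchange matrix, with columns indexed by \<open>'n\<close> and rows indexed by \<open>'v\<close>,
  together with its extended cluster in a field \<open>'f\<close>.  The injection \<open>\<iota> :: 'n \<Rightarrow> 'v\<close> singles out
  the mutable rows; the remaining rows are frozen.
\<close>

type_synonym ('v, 'n, 'f) seed = "(int^'n^'v) \<times> ('v \<Rightarrow> 'f)"

definition mutate_matrix ::
    "('n::finite \<Rightarrow> 'v::finite) \<Rightarrow> 'n \<Rightarrow> int^'n^'v \<Rightarrow> int^'n^'v" where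
  "mutate_matrix \<iota> k b =
     (\<chi> i j. if i = \<iota> k \<or> j = k then - (b $ i $ j)
             else b $ i $ j + sgn (b $ i $ k) * max 0 (b $ i $ k * b $ \<iota> k $ j))"

definition mutate_cluster ::
    "('n::finite \<Rightarrow> 'v::finite) \<Rightarrow> 'n \<Rightarrow> int^'n^'v \<Rightarrow> ('v \<Rightarrow> 'f::field) \<Rightarrow> ('v \<Rightarrow> 'f)" where
  "mutate_cluster \<iota> k b x =
     x(\<iota> k := ((\<Prod>i | b $ i $ k > 0. x i ^ nat (b $ i $ k)) +
               (\<Prod>i | b $ i $ k < 0. x i ^ nat (- (b $ i $ k)))) / x (\<iota> k))"

definition mutate ::
    "('n::finite \<Rightarrow> 'v::finite) \<Rightarrow> 'n \<Rightarrow> ('v, 'n, 'f::field) seed \<Rightarrow> ('v, 'n, 'f) seed" where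
  "mutate \<iota> k s = (mutate_matrix \<iota> k (fst s), mutate_cluster \<iota> k (fst s) (snd s))"

definition is_source :: "('n::finite \<Rightarrow> 'v::finite) \<Rightarrow> int^'n^'v \<Rightarrow> 'n \<Rightarrow> bool" where
  "is_source \<iota> b k \<longleftrightarrow> (\<forall>i. \<not> b $ \<iota> i $ k > 0)"

primrec source_sequence ::
    "('n::finite \<Rightarrow> 'v::finite) \<Rightarrow> 'n list \<Rightarrow> int^'n^'v \<Rightarrow> bool" where
  "source_sequence \<iota> [] b \<longleftrightarrow> True"
| "source_sequence \<iota> (k # ks) b \<longleftrightarrow>
     is_source \<iota> b k \<and> source_sequence \<iota> ks (mutate_matrix \<iota> k b)"

text \<open>
  One step \<open>t - 1 \<leadsto> t\<close>: every vertex is mutated exactly once, always at a source.  Two such orders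
  differ by transpositions of non-adjacent vertices, so the result does not depend on the choice.
\<close>

definition source_round ::
    "('n::finite \<Rightarrow> 'v::finite) \<Rightarrow> ('v, 'n, 'f::field) seed \<Rightarrow> ('v, 'n, 'f) seed" where
  "source_round \<iota> s =
     fold (mutate \<iota>)
       (SOME ks. distinct ks \<and> set ks = UNIV \<and> source_sequence \<iota> ks (fst s)) s"


section \<open>The coefficient-free cluster algebra and the index set\<close>

text \<open>
  \<open>('n, 'k) laurent\<close> is the ring of Laurent polynomials over \<open>'k\<close> in variables indexed by \<open>'n\<close>;
  its field of fractions is the field of rational functions in these variables.
\<close>

type_synonym ('n, 'k) laurent = "('n \<Rightarrow>\<^sub>0 int) \<Rightarrow>\<^sub>0 'k"

definition laurent_var :: "'n \<Rightarrow> ('n, 'k::zero_neq_one) laurent" where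
  "laurent_var i = Poly_Mapping.single (Poly_Mapping.single i 1) 1"

definition initial_seed ::
    "('n::{finite,linorder}) int_matrix \<Rightarrow> ('n, 'n, ('n, rat) laurent fract) seed" where
  "initial_seed B = (B, \<lambda>i. Fract (laurent_var i) 1)"

definition cluster_var ::
    "('n::{finite,linorder}) int_matrix \<Rightarrow> nat \<times> 'n \<Rightarrow> ('n, rat) laurent fract" where
  "cluster_var B \<gamma> = snd ((source_round id ^^ fst \<gamma>) (initial_seed B)) (snd \<gamma>)"

text \<open>The number \<open>r_i + 1\<close>:\<close>

definition return_time :: "('n::{finite,linorder}) int_matrix \<Rightarrow> 'n \<Rightarrow> nat" where
  "return_time B i = (LEAST t. t > 0 \<and> (\<exists>j. cluster_var B (t, i) = cluster_var B (0, j)))"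

definition r_index :: "('n::{finite,linorder}) int_matrix \<Rightarrow> 'n \<Rightarrow> nat" where
  "r_index B i = return_time B i - 1"

definition star :: "('n::{finite,linorder}) int_matrix \<Rightarrow> 'n \<Rightarrow> 'n" where
  "star B i = (THE j. cluster_var B (r_index B i + 1, i) = cluster_var B (0, j))"

definition Pi_index :: "('n::{finite,linorder}) int_matrix \<Rightarrow> (nat \<times> 'n) set" where
  "Pi_index B = {(s, i). s \<le> r_index B i}"

definition tau :: "('n::{finite,linorder}) int_matrix \<Rightarrow> nat \<times> 'n \<Rightarrow> nat \<times> 'n" where
  "tau B \<gamma> = (case \<gamma> of (t, j) \<Rightarrow>
      if t = 0 then (r_index B (star B j), star B j) else (t - 1, j))"


section \<open>Compatibility degree\<close>

text \<open>
  Writing a Laurent polynomial as \<open>N / \<Prod>i. x_i ^ d_i\<close> with \<open>N\<close> a polynomial divisible by no \<open>x_i\<close>,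
  the exponent \<open>d_i\<close> is the maximum of \<open>- a_i\<close> over the monomials \<open>x ^ a\<close> that occur.
\<close>

definition denominator_exponent ::
    "('n::{finite,linorder}, rat) laurent fract \<Rightarrow> 'n \<Rightarrow> int" where
  "denominator_exponent z i =
     (let L = (THE L. z = Fract L 1)
      in Max ((\<lambda>a. - Poly_Mapping.lookup a i) ` Poly_Mapping.keys L))"

text \<open>The last clause makes the function unique by fixing its values outside \<open>\<Pi> \<times> \<Pi>\<close>.\<close>

definition is_compat_degree ::
    "('n::{finite,linorder}) int_matrix \<Rightarrow> (nat \<times> 'n \<Rightarrow> nat \<times> 'n \<Rightarrow> nat) \<Rightarrow> bool" where
  "is_compat_degree B c \<longleftrightarrow>
     (\<forall>\<omega>\<in>Pi_index B. \<forall>\<gamma>\<in>Pi_index B. c (tau B \<omega>) (tau B \<gamma>) = c \<omega> \<gamma>) \<and>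
     (\<forall>i. \<forall>\<gamma>\<in>Pi_index B.
        int (c (0, i) \<gamma>) = max 0 (denominator_exponent (cluster_var B \<gamma>) i)) \<and>
     (\<forall>\<omega> \<gamma>. \<omega> \<notin> Pi_index B \<or> \<gamma> \<notin> Pi_index B \<longrightarrow> c \<omega> \<gamma> = 0)"

definition compat_degree ::
    "('n::{finite,linorder}) int_matrix \<Rightarrow> nat \<times> 'n \<Rightarrow> nat \<times> 'n \<Rightarrow> nat" where
  "compat_degree B = (THE c. is_compat_degree B c)"

definition pairwise_compatible ::
    "('n::{finite,linorder}) int_matrix \<Rightarrow> (nat \<times> 'n) set \<Rightarrow> bool" where
  "pairwise_compatible B F \<longleftrightarrow>
     F \<subseteq> Pi_index B \<and> (\<forall>\<omega>\<in>F. \<forall>\<gamma>\<in>F. compat_degree B \<omega> \<gamma> = 0)"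


section \<open>Real points of the cluster configuration space\<close>

text \<open>
  The coordinates \<open>u_\<gamma>\<close>, \<open>\<gamma> \<in> \<Pi>\<close>, are numbered by a finite type \<open>'k\<close> through a bijection
  \<open>lab\<close> from \<open>'k\<close> onto \<open>\<Pi>\<close>, so that real points live in the Euclidean space \<open>real^'k\<close>.
\<close>

definition M_tilde ::
    "('n::{finite,linorder}) int_matrix \<Rightarrow> ('k::finite \<Rightarrow> nat \<times> 'n) \<Rightarrow> 'k real_vec set" where
  "M_tilde B lab =
     {u. \<forall>k. u $ k + (\<Prod>l\<in>UNIV. (u $ l) ^ compat_degree B (lab l) (lab k)) - 1 = 0}"

definition M_open ::
    "('n::{finite,linorder}) int_matrix \<Rightarrow> ('k::finite \<Rightarrow> nat \<times> 'n) \<Rightarrow> 'k real_vec set" where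
  "M_open B lab = {u \<in> M_tilde B lab. \<forall>k. u $ k \<noteq> 0}"

definition M_pos ::
    "('n::{finite,linorder}) int_matrix \<Rightarrow> ('k::finite \<Rightarrow> nat \<times> 'n) \<Rightarrow> 'k real_vec set" where
  "M_pos B lab = {u \<in> M_open B lab. \<forall>k. u $ k > 0}"

definition M_nonneg ::
    "('n::{finite,linorder}) int_matrix \<Rightarrow> ('k::finite \<Rightarrow> nat \<times> 'n) \<Rightarrow> 'k real_vec set" where
  "M_nonneg B lab = M_tilde B lab \<inter> closure (M_pos B lab)"

definition M_stratum ::
    "('n::{finite,linorder}) int_matrix \<Rightarrow> ('k::finite \<Rightarrow> nat \<times> 'n) \<Rightarrow> (nat \<times> 'n) set \<Rightarrow> 'k real_vec set" where
  "M_stratum B lab F = {u \<in> M_nonneg B lab. \<forall>k. u $ k = 0 \<longleftrightarrow> lab k \<in> F}"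


section \<open>Principal coefficients, g-vectors and the cluster fan\<close>

text \<open>
  The ambient field consists of the fractions of Laurent polynomials in the \<open>x_i\<close> whose
  coefficients are Laurent polynomials in the frozen variables \<open>y_i\<close>.  Rows \<open>Inl i\<close> of the extended
  matrix belong to \<open>x_i\<close>, rows \<open>Inr i\<close> to \<open>y_i\<close>.
\<close>

type_synonym 'n principal_field = "('n, ('n, rat) laurent) laurent fract"

definition principal_seed ::
    "('n::{finite,linorder}) int_matrix \<Rightarrow> ('n + 'n, 'n, 'n principal_field) seed" where
  "principal_seed B =
     (\<chi> v. case v of Inl i \<Rightarrow> B $ i | Inr i \<Rightarrow> mat 1 $ i,
      \<lambda>v. case v of Inl i \<Rightarrow> Fract (laurent_var i) 1
                  | Inr i \<Rightarrow> Fract (Poly_Mapping.single 0 (laurent_var i)) 1)"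

text \<open>The degree of \<open>x ^ a * y ^ b\<close>, where \<open>deg x_i = e_i\<close> and \<open>deg y_i = - B e_i\<close>:\<close>

definition monomial_degree ::
    "('n::finite) int_matrix \<Rightarrow> ('n \<Rightarrow>\<^sub>0 int) \<Rightarrow> ('n \<Rightarrow>\<^sub>0 int) \<Rightarrow> 'n int_vec" where
  "monomial_degree B a b =
     (\<Sum>i\<in>UNIV. Poly_Mapping.lookup a i *s axis i 1) +
     (\<Sum>i\<in>UNIV. Poly_Mapping.lookup b i *s (- (B *v axis i 1)))"

definition has_degree ::
    "('n::{finite,linorder}) int_matrix \<Rightarrow> 'n principal_field \<Rightarrow> 'n int_vec \<Rightarrow> bool" where
  "has_degree B z g \<longleftrightarrow>
     (\<exists>L. z = Fract L 1 \<and>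
        (\<forall>a\<in>Poly_Mapping.keys L. \<forall>b\<in>Poly_Mapping.keys (Poly_Mapping.lookup L a).
           monomial_degree B a b = g))"

definition g_vector ::
    "('n::{finite,linorder}) int_matrix \<Rightarrow> 'n principal_field \<Rightarrow> 'n real_vec" where
  "g_vector B z = (\<chi> i. of_int ((THE g. has_degree B z g) $ i))"

definition principal_cluster_var ::
    "('n::{finite,linorder}) int_matrix \<Rightarrow> nat \<times> 'n \<Rightarrow> 'n principal_field" where
  "principal_cluster_var B \<gamma> =
     snd ((source_round Inl ^^ fst \<gamma>) (principal_seed B)) (Inl (snd \<gamma>))"

definition clusters :: "('n::{finite,linorder}) int_matrix \<Rightarrow> 'n principal_field set set" where
  "clusters B = {range (\<lambda>i. snd (fold (mutate Inl) ks (principal_seed B)) (Inl i)) |ks. True}"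

definition cluster_fan :: "('n::{finite,linorder}) int_matrix \<Rightarrow> 'n real_vec set set" where
  "cluster_fan B = {convex_cone hull (g_vector B ` X) |X K. K \<in> clusters B \<and> X \<subseteq> K}"


section \<open>Generalized associahedra\<close>

text \<open>
  Outer normal cones are used.  Replacing \<open>P\<close> by \<open>- P\<close> exchanges the outer and the inner normal
  fan, together with the faces attached to each cone, so statements about all polytopes with a given
  normal fan do not depend on this convention.
\<close>

definition normal_cone :: "'a::real_inner set \<Rightarrow> 'a set \<Rightarrow> 'a set" where
  "normal_cone P Q = {c. \<forall>q\<in>Q. \<forall>p\<in>P. c \<bullet> p \<le> c \<bullet> q}"

definition normal_fan :: "'a::real_inner set \<Rightarrow> 'a set set" where
  "normal_fan P = {normal_cone P Q |Q. Q face_of P \<and> Q \<noteq> {}}"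

definition generalized_associahedron ::
    "('n::{finite,linorder}) int_matrix \<Rightarrow> 'n real_vec set \<Rightarrow> bool" where
  "generalized_associahedron B P \<longleftrightarrow> polytope P \<and> normal_fan P = cluster_fan B"

text \<open>
  The face of \<open>P\<close> labelled by \<open>F \<subseteq> \<Pi>\<close>, whose normal cone is the cone of the fan spanned by the
  g-vectors of the elements of \<open>F\<close>.
\<close>

definition associahedron_face ::
    "('n::{finite,linorder}) int_matrix \<Rightarrow> 'n real_vec set \<Rightarrow> (nat \<times> 'n) set \<Rightarrow> 'n real_vec set" where
  "associahedron_face B P F =
     {q \<in> P. \<forall>c \<in> convex_cone hull ((\<lambda>\<gamma>. g_vector B (principal_cluster_var B \<gamma>)) ` F).
        \<forall>p\<in>P. c \<bullet> p \<le> c \<bullet> q}"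


section \<open>Smooth maps between subsets of Euclidean spaces\<close>

text \<open>\<open>C\<close>-\<open>m\<close> functions; meant for open \<open>U\<close>.\<close>

primrec Ck_on ::
    "nat \<Rightarrow> ('a::euclidean_space \<Rightarrow> 'b::euclidean_space) \<Rightarrow> 'a set \<Rightarrow> bool" where
  "Ck_on 0 f U \<longleftrightarrow> continuous_on U f"
| "Ck_on (Suc m) f U \<longleftrightarrow>
     (\<forall>x\<in>U. f differentiable (at x)) \<and>
     (\<forall>v. Ck_on m (\<lambda>x. frechet_derivative f (at x) v) U)"

text \<open>
  A map on an arbitrary subset is smooth if near every point it extends to a smooth map on an open
  set of the ambient space (the usual notion for manifolds with corners and polytopes).
\<close>

definition smooth_map_on ::
    "'a::euclidean_space set \<Rightarrow> ('a \<Rightarrow> 'b::euclidean_space) \<Rightarrow> bool" where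
  "smooth_map_on S f \<longleftrightarrow>
     (\<forall>x\<in>S. \<exists>U g. open U \<and> x \<in> U \<and> (\<forall>m. Ck_on m g U) \<and> (\<forall>y\<in>S \<inter> U. g y = f y))"

definition diffeomorphism ::
    "'a::euclidean_space set \<Rightarrow> 'b::euclidean_space set \<Rightarrow> ('a \<Rightarrow> 'b) \<Rightarrow> bool" where
  "diffeomorphism S T f \<longleftrightarrow>
     bij_betw f S T \<and> smooth_map_on S f \<and> smooth_map_on T (inv_into S f)"

text \<open>
  The index set and the cluster complex of \<open>B\<close> and of its dual \<open>B'\<close> are identified, so that a
  pairwise compatible \<open>F \<subseteq> \<Pi>\<close> names both a stratum for \<open>B\<close> and a face of \<open>P\<close>.
\<close>

definition face_preserving ::
    "('n::{finite,linorder}) int_matrix \<Rightarrow> 'n int_matrix \<Rightarrow> ('k::finite \<Rightarrow> nat \<times> 'n) \<Rightarrow>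
     'n real_vec set \<Rightarrow> ('k real_vec \<Rightarrow> 'n real_vec) \<Rightarrow> bool" where
  "face_preserving B B' lab P f \<longleftrightarrow>
     (\<forall>F. pairwise_compatible B F \<longrightarrow>
        f ` M_stratum B lab F = rel_interior (associahedron_face B' P F))"

end

theory Submission
  imports Defs "HOL-Real_Asymp.Real_Asymp"
begin

text \<open>
 A point \<open>u\<close> of the nonnegative part is sent to the minimizer \<open>p\<close> of the Kullback--Leibler divergence of
 the slacks \<open>\<sigma>\<^sub>r p = h\<^sub>r - g\<^sub>r \<bullet> p\<close> of the polytope from the coordinates \<open>u\<^sub>r\<close>, on the face cut out by the
 zeros of \<open>u\<close>.  By convexity the minimizer is the unique \<open>p\<close> with \<open>\<Sum>\<^sub>r ln (\<sigma>\<^sub>r p) g\<^sub>r = \<Sum>\<^sub>r ln u\<^sub>r g\<^sub>r\<close>,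
 suitably interpreted at the boundary, so the map is smooth there by the inverse function theorem.

 The inverse rests on a rigidity property of the \<open>u\<close>-equations: a relation \<open>\<Sum>\<^sub>r e\<^sub>r g\<^sub>r = 0\<close> in which
 \<open>e\<^sub>r\<close> and \<open>\<Sum>\<^sub>q (q\<parallel>r) e\<^sub>q\<close> always have opposite signs is trivial.  Applied to logarithms of quotients
 of coordinates it gives injectivity, applied to logarithmic derivatives the immersion property.
 Surjectivity onto the interior comes from evaluating the \<open>F\<close>-polynomials at positive points, and onto
 the whole polytope from compactness.

 The combinatorial input is that \<open>(q\<parallel>r)\<close>, the denominators and the \<open>g\<close>-vectors are all expressed by the
 roots \<open>R t k\<close> obtained from the dimension vectors \<open>P k\<close> of projectives by the Coxeter element.
\<close>

text \<open>The dual diagram enters through the symmetrizer: the g-vectors of the transposed matrix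
  are the Euler pairings \<open>eul (R t k) (unit i) / d k\<close> of the roots of the original
  diagram, whose coordinates are the exponents of the \<open>u\<close>-equations. Equations and
  polytope are thus governed by one set of roots. The divergence is chosen because its gradient
  contains logarithms of slacks, which can be matched with \<open>ln u\<close>, and because its
  infinite slope at slack zero keeps minimizers off smaller faces; no particular realization of the
  polytope is singled out. A nonnegative solution of the \<open>u\<close>-equations is not a limit
  of positive ones by definition. This follows at the end from injectivity on all nonnegative
  solutions and surjectivity from the closure. Heights stand for the orientation, and a vertex set
  \<open>J\<close> that may be any subset permits induction by deleting a vertex, which corresponds
  to passing to the link of an initial variable. That cluster variables do not vanish and that
  leading terms do not cancel is always drawn from the recursions being free of subtraction.\<close>

abbreviation "lkp \<equiv> Poly_Mapping.lookup"

abbreviation "pms \<equiv> Poly_Mapping.single"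

abbreviation "kys \<equiv> Poly_Mapping.keys"

subsection \<open>Roots and the Coxeter element\<close>

text \<open>The height encodes the orientation: edges point upwards, and adjacent heights differ by
  one, which is possible on a forest. Subdiagrams are instances with a smaller \<open>J\<close> and
  the same \<open>a\<close>, \<open>d\<close>, \<open>ht\<close>; the uniform bound in
  \<open>pdef\<close> passes to them directly.\<close>

locale dynkin =
 fixes J :: "'n set" and a :: "'n => 'n => int" and d :: "'n => real" and ht :: "'n => nat"
 assumes finJ: "finite J"
  and diag: "i \<in> J ==> a i i = 2"
  and offd: "i \<in> J ==> j \<in> J ==> i ~= j ==> a i j <= 0"
  and dpos: "i \<in> J ==> d i > 0"
  and symd: "i \<in> J ==> j \<in> J ==> d i * a i j = d j * a j i"
  and pdef: "\<exists>\<kappa>>0. \<forall>v::'n => real.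
   (\<Sum>i\<in>J. \<Sum>j\<in>J. v i * (d i * a i j) * v j) \<ge> \<kappa> * (\<Sum>i\<in>J. (v i)\<^sup>2)"
  and adj_ht: "i \<in> J ==> j \<in> J ==> i ~= j ==> a i j ~= 0 ==> ht j = ht i + 1 \<or> ht i = ht j + 1"
begin

lemma a_zero_sym: "i \<in> J ==> j \<in> J ==> a i j = 0 \<longleftrightarrow> a j i = 0"
 using symd[of i j] dpos[of i] dpos[of j] by auto

definition bel :: "'n => 'n set" where "bel k = {i \<in> J. ht i < ht k}"
definition abv :: "'n => 'n set" where "abv k = {i \<in> J. ht k < ht i}"

lemma fin_bel [simp]: "finite (bel k)" and fin_abv [simp]: "finite (abv k)" using finJ by (auto simp: bel_def abv_def)

lemma sum_split_J:
 fixes f :: "'n => 'b::comm_monoid_add"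
 assumes "k \<in> J" and "!!i. i \<in> J ==> i ~= k ==> ht i = ht k ==> f i = 0"
 shows "(\<Sum>i\<in>J. f i) = f k + ((\<Sum>i\<in>bel k. f i) + (\<Sum>i\<in>abv k. f i))"
proof -
 have J: "J = {k} \<union> (bel k \<union> (abv k \<union> {i\<in>J. i ~= k & ht i = ht k}))"
  using assms(1) by (auto simp: bel_def abv_def)
 have z: "(\<Sum>i\<in>{i\<in>J. i ~= k & ht i = ht k}. f i) = 0" by (rule sum.neutral) (use assms(2) in auto)
 have "(\<Sum>i\<in>J. f i) = f k + ((\<Sum>i\<in>bel k. f i) + ((\<Sum>i\<in>abv k. f i) + (\<Sum>i\<in>{i\<in>J. i ~= k & ht i = ht k}. f i)))"
  apply (subst J)
  apply (subst sum.union_disjoint; (auto simp: finJ bel_def abv_def; fail)?)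
  apply (subst sum.union_disjoint; (auto simp: finJ bel_def abv_def; fail)?)
  apply (subst sum.union_disjoint; (auto simp: finJ bel_def abv_def; fail)?)
  done
 thus ?thesis using z by simp
qed

lemma a_same_ht: "i \<in> J ==> k \<in> J ==> i ~= k ==> ht i = ht k ==> a i k = 0" using adj_ht[of i k] by auto

lemma a_far: "i \<in> J ==> k \<in> J ==> i ~= k ==> a i k ~= 0 ==> ht i < ht k ==> ht k = ht i + 1"
 using adj_ht[of i k] by auto

text \<open>The dimension vector of the projective at \<open>k\<close>: its radical is the sum of
  the projectives at the lower neighbours \<open>i\<close>, taken \<open>- a i k\<close>
  times.\<close>

function P :: "'n => 'n => int" where
 "P k l = of_bool (l = k) - (\<Sum>i\<in>bel k. a i k * P i l)" by pat_completeness auto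
termination by (relation "Wellfounded.measure (%(k,l). ht k)") (auto simp: bel_def)

declare P.simps [simp del]

lemma P_rec: "P k = (%l. of_bool (l = k) - (\<Sum>i\<in>bel k. a i k * P i l))" by (rule ext) (rule P.simps)

lemma P_supp: "k \<in> J ==> l \<notin> J ==> P k l = 0"
 by (induction k l rule: P.induct) (subst P.simps, auto simp: bel_def intro!: sum.neutral)

lemma P_above: "k \<in> J ==> l ~= k ==> ht k <= ht l ==> P k l = 0"
proof (induction k l rule: P.induct)
 case (1 k l)
 have "P i l = 0" if "i \<in> bel k" for i by (rule 1(1)[OF that]) (use that 1 in "auto simp: bel_def")
 thus ?case using 1(3) by (subst P.simps) simp
qed

lemma P_self [simp]: "k \<in> J ==> P k k = 1" by (subst P.simps) (auto simp: bel_def intro!: sum.neutral P_above)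

lemma P_nonneg: "k \<in> J ==> 0 <= P k l"
proof (induction k l rule: P.induct)
 case (1 k l)
 have "(\<Sum>i\<in>bel k. a i k * P i l) <= 0"
  by (rule sum_nonpos) (use 1 offd in "auto simp: bel_def intro!: mult_nonpos_nonneg")
 thus ?case by (subst P.simps) auto
qed

lemma P_inj: "k \<in> J ==> m \<in> J ==> P k = P m ==> k = m" by (metis P_above P_self nat_le_linear zero_neq_one)

lemma P_adj:
 assumes "k \<in> J" "i \<in> J" "ht k = ht i + 1"
 shows "P k i = - a i k"
proof -
 have "(\<Sum>l\<in>bel k. a l k * P l i) = (\<Sum>l\<in>bel k. if l = i then a i k else 0)"
 proof (rule sum.cong)
  fix l assume l: "l \<in> bel k"
  show "a l k * P l i = (if l = i then a i k else 0)"
  proof (cases "l = i \<or> a l k = 0")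
   case True thus ?thesis using assms by auto
  next
   case False
   moreover have "l ~= k" using l by (auto simp: bel_def)
   ultimately have "ht k = ht l + 1" using l assms a_far[of l k] by (simp add: bel_def)
   thus ?thesis using False l assms P_above[of l i] by (auto simp: bel_def)
  qed
 qed simp
 also have "\<dots> = a i k" using assms by (simp add: bel_def finJ)
 finally show ?thesis using assms by (subst P.simps) auto
qed

definition pr :: "'n => ('n => int) => int" where
 "pr i v = (\<Sum>j\<in>J. a i j * v j)"

text \<open>The product of all simple reflections in the order of heights
  (\<open>cox_foldr\<close>), written in closed form so that no ordering has to be chosen.\<close>

definition cox :: "('n => int) => ('n => int)" where
 "cox v = (%l. v l - (\<Sum>i\<in>J. pr i v * P i l))"

text \<open>The Euler form of the oriented diagram, scaled by \<open>d\<close>. Its symmetrization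
  is \<open>sf\<close>, and the \<open>P j\<close> are dual to the coordinates for it
  (\<open>eul_P\<close>).\<close>

definition eul :: "('n => int) => ('n => int) => real" where
 "eul u v = (\<Sum>k\<in>J. u k * (d k * v k + (\<Sum>i\<in>bel k. d k * a k i * v i)))"

definition sf :: "('n => int) => ('n => int) => real" where
 "sf u v = (\<Sum>i\<in>J. \<Sum>j\<in>J. u i * (d i * a i j) * v j)"

lemma eul_add1: "eul (%l. u l + w l) v = eul u v + eul w v" by (simp add: eul_def algebra_simps sum.distrib)
lemma eul_diff1: "eul (%l. u l - w l) v = eul u v - eul w v" by (simp add: eul_def algebra_simps sum_subtractf)
lemma eul_scale1: "eul (%l. x * u l) v = x * eul u v" by (simp add: eul_def algebra_simps sum_distrib_left)
lemma eul_sum1: "eul (%l. \<Sum>i\<in>S. u i l) v = (\<Sum>i\<in>S. eul (u i) v)"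
 unfolding eul_def by (simp add: sum_distrib_right) (rule sum.swap)
lemma eul_minus1: "eul (%l. - u l) v = - eul u v" using eul_scale1[of "-1" u v] by simp
lemma eul_add2: "eul v (%l. u l + w l) = eul v u + eul v w" by (simp add: eul_def algebra_simps sum.distrib)
lemma eul_diff2: "eul v (%l. u l - w l) = eul v u - eul v w" by (simp add: eul_def algebra_simps sum_subtractf)
lemma eul_scale2: "eul v (%l. x * u l) = x * eul v u" by (simp add: eul_def algebra_simps sum_distrib_left)
lemma eul_minus2: "eul v (%l. - u l) = - eul v u" using eul_scale2[of v "-1" u] by simp
lemma eul_sum2: "finite S ==> eul v (%l. \<Sum>i\<in>S. u i l) = (\<Sum>i\<in>S. eul v (u i))"
proof (induction S rule: finite_induct)
 case empty show ?case by (simp add: eul_def)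
next
 case (insert x F) thus ?case by (simp add: eul_add2)
qed

lemma eul_cong: "(!!l. l \<in> J ==> u l = u' l) ==> (!!l. l \<in> J ==> v l = v' l) ==> eul u v = eul u' v'"
 unfolding eul_def by (auto simp: bel_def intro!: sum.cong)

definition unit :: "'n => 'n => int" where "unit k = (%l. of_bool (l = k))"

lemma eul_unit1: "k \<in> J ==> eul (unit k) v = d k * v k + (\<Sum>i\<in>bel k. d k * a k i * v i)"
proof -
 assume k: "k \<in> J"
 have "eul (unit k) v = (\<Sum>k'\<in>J. if k' = k then d k * v k + (\<Sum>i\<in>bel k. d k * a k i * v i) else 0)"
  unfolding eul_def by (rule sum.cong) (auto simp: unit_def)
 thus ?thesis using k finJ by simp
qed

text \<open>The sum in the recursion of \<open>P j\<close> cancels the off-diagonal part of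
  \<open>eul (unit j)\<close>, because \<open>d i * a i j = d j * a j i\<close>.\<close>

lemma eul_P: "j \<in> J ==> eul (P j) v = d j * v j"
proof (induction "ht j" arbitrary: j rule: less_induct)
 case less
 have "eul (P j) v = eul (unit j) v - (\<Sum>i\<in>bel j. a i j * eul (P i) v)"
  by (subst P_rec) (simp add: eul_diff1 eul_sum1 eul_scale1 flip: unit_def)
 also have "(\<Sum>i\<in>bel j. a i j * eul (P i) v) = (\<Sum>i\<in>bel j. d j * a j i * v i)"
 proof (rule sum.cong)
  fix i assume "i \<in> bel j"
  hence i: "i \<in> J" "ht i < ht j" by (auto simp: bel_def)
  have "a i j * eul (P i) v = (d i * a i j) * v i" using less(1)[OF i(2,1)] by simp
  thus "a i j * eul (P i) v = d j * a j i * v i" using symd[OF i(1) less(2)] by simp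
 qed simp
 finally show ?case using eul_unit1[OF less(2)] by simp
qed

lemma sf_pr: "sf u v = (\<Sum>i\<in>J. v i * (d i * pr i u))"
proof -
 have "sf u v = (\<Sum>j\<in>J. \<Sum>i\<in>J. u i * (d i * a i j) * v j)" unfolding sf_def by (rule sum.swap)
 also have "\<dots> = (\<Sum>j\<in>J. v j * (d j * pr j u))"
  unfolding pr_def by (rule sum.cong) (auto simp: sum_distrib_left symd algebra_simps intro!: sum.cong)
 finally show ?thesis .
qed

lemma sf_sym: "sf u v = sf v u"
proof -
 have "sf u v = (\<Sum>j\<in>J. \<Sum>i\<in>J. u i * (d i * a i j) * v j)" unfolding sf_def by (rule sum.swap)
 also have "\<dots> = sf v u" unfolding sf_def by (intro sum.cong) (auto simp: symd algebra_simps)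
 finally show ?thesis .
qed

lemma sf_eul: "sf u v = eul u v + eul v u"
proof -
 have 1: "(\<Sum>j\<in>J. u i * (d i * a i j) * v j) =
   2 * d i * u i * v i + ((\<Sum>j\<in>bel i. u i * (d i * a i j) * v j) + (\<Sum>j\<in>abv i. u i * (d i * a i j) * v j))" if "i \<in> J" for i
  by (subst sum_split_J[OF that]) (use that in "auto simp: diag a_same_ht")
 have 2: "(\<Sum>i\<in>J. \<Sum>j\<in>abv i. u i * (d i * a i j) * v j) = (\<Sum>k\<in>J. v k * (\<Sum>i\<in>bel k. d k * a k i * u i))"
 proof -
  have "(\<Sum>i\<in>J. \<Sum>j\<in>abv i. u i * (d i * a i j) * v j) = (\<Sum>i\<in>J. \<Sum>j\<in>J. if ht i < ht j then u i * (d i * a i j) * v j else 0)"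
   by (rule sum.cong[OF refl]) (simp add: abv_def sum.inter_filter finJ)
  also have "\<dots> = (\<Sum>j\<in>J. \<Sum>i\<in>J. if ht i < ht j then u i * (d i * a i j) * v j else 0)"
   by (rule sum.swap)
  also have "\<dots> = (\<Sum>k\<in>J. v k * (\<Sum>i\<in>bel k. d k * a k i * u i))"
  proof (rule sum.cong[OF refl])
   fix j assume j: "j \<in> J"
   have "(\<Sum>i\<in>J. if ht i < ht j then u i * (d i * a i j) * v j else 0) = (\<Sum>i\<in>bel j. u i * (d i * a i j) * v j)"
    by (simp add: bel_def sum.inter_filter finJ)
   also have "\<dots> = v j * (\<Sum>i\<in>bel j. d j * a j i * u i)"
    unfolding sum_distrib_left by (rule sum.cong) (use j in "auto simp: bel_def symd")
   finally show "(\<Sum>i\<in>J. if ht i < ht j then u i * (d i * a i j) * v j else 0) = v j * (\<Sum>i\<in>bel j. d j * a j i * u i)" .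
  qed
  finally show ?thesis .
 qed
 have "sf u v = (\<Sum>i\<in>J. 2 * d i * u i * v i + ((\<Sum>j\<in>bel i. u i * (d i * a i j) * v j) + (\<Sum>j\<in>abv i. u i * (d i * a i j) * v j)))"
  unfolding sf_def using 1 by (intro sum.cong) auto
 also have "\<dots> = eul u v + eul v u" using 2 by (simp add: eul_def sum.distrib algebra_simps sum_distrib_left)
 finally show ?thesis .
qed

text \<open>Serre duality: by \<open>eul_P\<close> the correction term of \<open>cox\<close> pairs
  to the whole symmetric form \<open>sf u v\<close>.\<close>

lemma eul_cox: "eul (cox u) v = - eul v u"
proof -
 have "eul (cox u) v = eul u v - (\<Sum>i\<in>J. pr i u * eul (P i) v)"
  by (simp add: cox_def eul_diff1 eul_sum1 eul_scale1)
 also have "(\<Sum>i\<in>J. pr i u * eul (P i) v) = sf u v" unfolding sf_pr by (rule sum.cong) (auto simp: eul_P)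
 finally show ?thesis using sf_eul[of u v] by simp
qed

lemma eul_cox_cox: "eul (cox u) (cox v) = eul u v" by (simp add: eul_cox)

lemma cox_add: "cox (%l. u l + w l) = (%l. cox u l + cox w l)"
 by (rule ext) (simp add: cox_def pr_def algebra_simps sum.distrib sum_distrib_left)
lemma cox_scale: "cox (%l. x * u l) = (%l. x * cox u l)"
proof (rule ext)
 fix l
 have "pr i (%l. x * u l) = x * pr i u" for i by (simp add: pr_def sum_distrib_left algebra_simps)
 thus "cox (%l. x * u l) l = x * cox u l" by (simp add: cox_def sum_distrib_left algebra_simps)
qed
lemma cox_minus: "cox (%l. - u l) = (%l. - cox u l)" using cox_scale[of "-1" u] by simp
lemma cox_diff: "cox (%l. u l - w l) = (%l. cox u l - cox w l)"
 using cox_add[of u "%l. - w l"] cox_minus[of w] by simp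
lemma cox_sum: "finite S ==> cox (%l. \<Sum>i\<in>S. u i l) = (%l. \<Sum>i\<in>S. cox (u i) l)"
proof (induction S rule: finite_induct)
 case empty show ?case by (simp add: cox_def pr_def)
next
 case (insert x F) thus ?case by (simp add: cox_add)
qed

definition supp :: "('n => int) => bool" where "supp v \<longleftrightarrow> (\<forall>l. l \<notin> J --> v l = 0)"

lemma supp_P: "k \<in> J ==> supp (P k)" by (simp add: supp_def P_supp)
lemma supp_cox: "supp v ==> supp (cox v)" by (auto simp: supp_def cox_def P_supp intro!: sum.neutral)

lemma supp_eqI: "supp u ==> supp v ==> (!!j. j \<in> J ==> u j = v j) ==> u = v" by (rule ext) (metis supp_def)

lemma pr_unit: "k \<in> J ==> pr i (unit k) = a i k"
 unfolding pr_def unit_def by (simp add: finJ if_distrib of_bool_def cong: if_cong)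

definition R :: "nat => 'n => 'n => int" where "R t k = (cox ^^ t) (P k)"

lemma R_0 [simp]: "R 0 k = P k" and R_Suc: "R (Suc t) k = cox (R t k)" by (auto simp: R_def)

lemma supp_R: "k \<in> J ==> supp (R t k)" by (induction t) (auto simp: R_Suc supp_P supp_cox)

lemma eul_R_shift: "eul (R (s + t) j) (R (s' + t) k) = eul (R s j) (R s' k)"
 by (induction t) (auto simp: R_Suc eul_cox_cox)

text \<open>The knitting relation of the Auslander-Reiten quiver. For \<open>t = 0\<close> it
  compares two computations of \<open>cox (unit k)\<close>, one from the expansion of
  \<open>unit k\<close> in the \<open>P i\<close>, one from the definition; applying
  \<open>cox\<close> gives the other cases.\<close>

lemma mesh:
 assumes k: "k \<in> J"
 shows "R (Suc t) k l + R t k l = - (\<Sum>i\<in>bel k. a i k * R (Suc t) i l) - (\<Sum>i\<in>abv k. a i k * R t i l)"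
proof (induction t arbitrary: l)
 case 0
 have u: "unit k = (%l. P k l + (\<Sum>i\<in>bel k. a i k * P i l))" by (subst P_rec) (simp add: unit_def)
 have "cox (unit k) l = cox (P k) l + (\<Sum>i\<in>bel k. a i k * cox (P i) l)"
  unfolding u cox_add cox_sum[OF fin_bel] cox_scale by simp
 moreover have "cox (unit k) l = unit k l - (\<Sum>i\<in>J. a i k * P i l)"
  unfolding cox_def by (auto simp: pr_unit k)
 moreover have "(\<Sum>i\<in>J. a i k * P i l) = 2 * P k l + ((\<Sum>i\<in>bel k. a i k * P i l) + (\<Sum>i\<in>abv k. a i k * P i l))"
  by (subst sum_split_J[OF k]) (use k in "auto simp: diag a_same_ht")
 ultimately show ?case unfolding u by (simp add: R_Suc)
next
 case (Suc t)
 have "(%l. R (Suc t) k l + R t k l) = (%l. - (\<Sum>i\<in>bel k. a i k * R (Suc t) i l) - (\<Sum>i\<in>abv k. a i k * R t i l))"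
  using Suc by blast
 hence "cox (%l. R (Suc t) k l + R t k l) l = cox (%l. - (\<Sum>i\<in>bel k. a i k * R (Suc t) i l) - (\<Sum>i\<in>abv k. a i k * R t i l)) l"
  by simp
 thus ?case unfolding cox_add cox_diff cox_minus cox_sum[OF fin_bel] cox_sum[OF fin_abv] cox_scale
  by (simp add: R_Suc)
qed

end

section \<open>Roots, their signs, and the eventual sign change under the Coxeter element\<close>

context dynkin
begin

definition nonneg :: "('n => int) => bool" where "nonneg v \<longleftrightarrow> (\<forall>l. 0 <= v l)"
definition nonpos :: "('n => int) => bool" where "nonpos v \<longleftrightarrow> (\<forall>l. v l <= 0)"

text \<open>The last condition says that the coroot of \<open>v\<close> is integral; it makes \<open>sf v v\<close> a multiple of
 \<open>2 d\<^sub>k\<close> on the lattice of such vectors, so that a root of mixed sign would be too long.\<close>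

definition root :: "'n => ('n => int) => bool" where
 "root k v \<longleftrightarrow> supp v & sf v v = 2 * d k & (\<forall>j\<in>J. \<exists>n::int. d j * v j = d k * n)"

lemma sf_diff1: "sf (%l. u l - w l) v = sf u v - sf w v" by (simp add: sf_eul eul_diff1 eul_diff2)
lemma sf_diff2: "sf v (%l. u l - w l) = sf v u - sf v w" by (simp add: sf_eul eul_diff1 eul_diff2)
lemma sf_scale1: "sf (%l. x * u l) v = x * sf u v" by (simp add: sf_eul eul_scale1 eul_scale2 algebra_simps)
lemma sf_scale2: "sf v (%l. x * u l) = x * sf v u" by (simp add: sf_eul eul_scale1 eul_scale2 algebra_simps)

lemma sf_pos: "0 <= sf v v" and sf_zero: "supp v ==> sf v v = 0 ==> v = (%_. 0)"
proof -
 obtain \<kappa> where k: "\<kappa> > 0" "\<forall>v::'n => real. (\<Sum>i\<in>J. \<Sum>j\<in>J. v i * (d i * a i j) * v j) \<ge> \<kappa> * (\<Sum>i\<in>J. (v i)\<^sup>2)"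
  using pdef by blast
 have *: "sf v v \<ge> \<kappa> * (\<Sum>i\<in>J. (real_of_int (v i))\<^sup>2)"
  using k(2)[rule_format, of "%i. real_of_int (v i)"] by (simp add: sf_def)
 have "\<kappa> * (\<Sum>i\<in>J. (real_of_int (v i))\<^sup>2) \<ge> 0" using k(1) by (simp add: sum_nonneg)
 with * show "0 <= sf v v" by linarith
 assume s: "supp v" and "sf v v = 0"
 hence "(\<Sum>i\<in>J. (real_of_int (v i))\<^sup>2) <= 0" using * k(1) by (simp add: mult_le_0_iff)
 hence "\<forall>i\<in>J. (real_of_int (v i))\<^sup>2 = 0"
  by (metis (mono_tags, lifting) finJ sum_nonneg_eq_0_iff zero_le_power2 sum_nonneg order_antisym)
 thus "v = (%_. 0)" using s by (auto simp: supp_def fun_eq_iff)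
qed

lemma sf_multiple:
 assumes "0 < d k" "!!j. j \<in> J ==> \<exists>n::int. d j * v j = d k * n"
 shows "\<exists>n::int. sf v v = 2 * d k * n"
proof -
 obtain n :: "'n => int" where n: "!!j. j \<in> J ==> d j * v j = d k * n j" using assms(2) by metis
 have "eul v v = (\<Sum>i\<in>J. d k * of_int (n i * v i + (\<Sum>j\<in>bel i. n i * a i j * v j)))" unfolding eul_def
 proof (rule sum.cong[OF refl])
  fix i assume i: "i \<in> J"
  have "v i * (d i * v i + (\<Sum>j\<in>bel i. d i * a i j * v j)) = (d i * v i) * (v i + (\<Sum>j\<in>bel i. a i j * v j))"
   by (simp add: algebra_simps sum_distrib_left)
  also have "\<dots> = d k * of_int (n i * v i + (\<Sum>j\<in>bel i. n i * a i j * v j))"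
   unfolding n[OF i] by (simp add: algebra_simps sum_distrib_left)
  finally show "v i * (d i * v i + (\<Sum>j\<in>bel i. d i * a i j * v j)) = d k * of_int (n i * v i + (\<Sum>j\<in>bel i. n i * a i j * v j))" .
 qed
 hence "sf v v = 2 * d k * of_int (\<Sum>i\<in>J. n i * v i + (\<Sum>j\<in>bel i. n i * a i j * v j))"
  by (simp add: sf_eul sum_distrib_left algebra_simps)
 thus ?thesis by blast
qed

lemma root_long:
 assumes "0 < d k" "supp v" "!!j. j \<in> J ==> \<exists>n::int. d j * v j = d k * n" "v ~= (%_. 0)"
 shows "sf v v \<ge> 2 * d k"
proof -
 obtain n :: int where n: "sf v v = 2 * d k * n" using sf_multiple[OF assms(1,3)] by blast
 have "sf v v > 0" using sf_pos[of v] sf_zero[OF assms(2)] assms(4) by fastforce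
 hence "n \<ge> 1" using n assms(1) by (simp add: zero_less_mult_iff)
 thus ?thesis using n assms(1) by simp
qed

text \<open>The positive and the negative part of \<open>v\<close> lie in the same lattice and pair
  to at most zero, so if both were nonzero, \<open>v\<close> would have at least twice the squared
  length of a root.\<close>

lemma root_sign:
 assumes k: "0 < d k" and r: "root k v"
 shows "nonneg v \<or> nonpos v"
proof (rule ccontr)
 assume c: "\<not> ?thesis"
 define p where "p = (%l. max 0 (v l))"
 define q where "q = (%l. max 0 (- v l))"
 have v: "v = (%l. p l - q l)" by (auto simp: p_def q_def)
 have s: "supp p" "supp q" using r by (auto simp: root_def supp_def p_def q_def)
 have nz: "p ~= (%_. 0)" "q ~= (%_. 0)"
  using c by (auto simp: p_def q_def nonneg_def nonpos_def fun_eq_iff max_def split: if_splits) (metis le_cases)+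
 have 1: "\<exists>n::int. d j * p j = d k * n" "\<exists>n::int. d j * q j = d k * n" if "j \<in> J" for j
 proof -
  have "\<forall>j\<in>J. \<exists>n::int. d j * v j = d k * n" using r by (simp add: root_def)
  then obtain n :: int where n: "d j * v j = d k * n" using \<open>j \<in> J\<close> by blast
  have z: "\<exists>n::int. d j * real_of_int 0 = d k * n" by (rule exI[of _ 0]) simp
  show "\<exists>n::int. d j * p j = d k * n" using n z by (cases "v j \<ge> 0") (auto simp: p_def max_def)
  have "d j * real_of_int (- v j) = d k * of_int (-n)" using n by simp
  hence "\<exists>n::int. d j * real_of_int (- v j) = d k * n" by blast
  thus "\<exists>n::int. d j * q j = d k * n" using z by (cases "0 <= - v j") (simp_all add: q_def max_def)
 qed
 have pq: "sf p q <= 0" unfolding sf_def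
 proof (intro sum_nonpos)
  fix i j assume ij: "i \<in> J" "j \<in> J"
  show "p i * (d i * a i j) * q j <= 0"
  proof (cases "i = j")
   case True thus ?thesis by (auto simp: p_def q_def max_def)
  next
   case False
   hence "a i j <= 0" using offd ij by blast
   moreover have "0 <= p i" "0 <= q j" by (auto simp: p_def q_def)
   ultimately show ?thesis using dpos[OF ij(1)]
    by (simp add: mult_nonneg_nonpos mult_nonneg_nonpos2 mult_nonpos_nonneg)
  qed
 qed
 have "sf v v = sf p p + sf q q - 2 * sf p q" unfolding v sf_diff1 sf_diff2 using sf_sym[of p q] by simp
 hence "sf v v \<ge> 4 * d k" using root_long[OF k s(1) 1(1) nz(1)] root_long[OF k s(2) 1(2) nz(2)] pq by simp
 moreover have "sf v v = 2 * d k" using r by (simp add: root_def)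
 ultimately show False using k by simp
qed

lemma root_nonzero: "0 < d k ==> root k v ==> \<exists>l\<in>J. v l ~= 0"
proof (rule ccontr)
 assume k: "0 < d k" "root k v" "\<not> (\<exists>l\<in>J. v l ~= 0)"
 hence "sf v v = 0" by (simp add: sf_def)
 thus False using k(2) k(1) by (simp add: root_def)
qed

lemma P_dual: "k \<in> J ==> j \<in> J ==> \<exists>n::int. d j * P k j = d k * n"
proof (induction "ht k" arbitrary: k rule: less_induct)
 case less
 have "\<exists>n::int. d j * P i j = d i * n" if "i \<in> bel k" for i using less that by (auto simp: bel_def)
 then obtain n :: "'n => int" where n: "!!i. i \<in> bel k ==> d j * P i j = d i * n i" by metis
 have "d j * P k j = d j * of_bool (j = k) - (\<Sum>i\<in>bel k. a i k * (d j * P i j))"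
  by (subst P.simps) (simp add: algebra_simps sum_distrib_left)
 also have "(\<Sum>i\<in>bel k. a i k * (d j * P i j)) = (\<Sum>i\<in>bel k. d k * (a k i * n i))"
 proof (rule sum.cong[OF refl])
  fix i assume i: "i \<in> bel k"
  have "a i k * (d i * n i) = (d i * a i k) * n i" by simp
  also have "d i * a i k = d k * a k i" using i less(2) symd by (auto simp: bel_def)
  finally show "a i k * (d j * P i j) = d k * (a k i * n i)" using n[OF i] by simp
 qed
 also have "d j * of_bool (j = k) - \<dots> = d k * real_of_int (of_bool (j = k) - (\<Sum>i\<in>bel k. a k i * n i))"
  by (auto simp: algebra_simps sum_distrib_left)
 finally show ?case by blast
qed

lemma root_P: "k \<in> J ==> root k (P k)" by (auto simp: root_def supp_P sf_eul eul_P P_dual)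

lemma pr_dual:
 assumes k: "0 < d k" and i: "i \<in> J" and n: "!!j. j \<in> J ==> \<exists>n::int. d j * v j = d k * n"
 shows "\<exists>m::int. d i * pr i v = d k * m"
proof -
 obtain n :: "'n => int" where n: "!!j. j \<in> J ==> d j * v j = d k * n j" using n by metis
 have "d i * pr i v = (\<Sum>j\<in>J. (d i * a i j) * v j)" by (simp add: pr_def sum_distrib_left algebra_simps)
 also have "\<dots> = (\<Sum>j\<in>J. a j i * (d j * v j))" by (rule sum.cong) (use i in "auto simp: symd")
 also have "\<dots> = (\<Sum>j\<in>J. d k * (a j i * n j))" by (rule sum.cong) (auto simp: n)
 also have "\<dots> = d k * real_of_int (\<Sum>j\<in>J. a j i * n j)" by (simp add: sum_distrib_left)
 finally show ?thesis by blast
qed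

lemma root_cox: assumes k: "0 < d k" and r: "root k v" shows "root k (cox v)"
proof -
 have "\<exists>n::int. d j * cox v j = d k * n" if j: "j \<in> J" for j
 proof -
  have "\<forall>i\<in>J. \<exists>m::int. d i * pr i v = d k * m" using pr_dual[OF k] r by (auto simp: root_def)
  then obtain m :: "'n => int" where m: "!!i. i \<in> J ==> d i * pr i v = d k * m i" by metis
  have "\<forall>i\<in>J. \<exists>n::int. d j * P i j = d i * n" using P_dual j by blast
  then obtain n :: "'n => int" where n: "!!i. i \<in> J ==> d j * P i j = d i * n i" by metis
  obtain q :: int where q: "d j * v j = d k * q" using r j by (auto simp: root_def)
  have "d j * cox v j = d j * v j - (\<Sum>i\<in>J. pr i v * (d j * P i j))"
   by (simp add: cox_def algebra_simps sum_distrib_left)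
  also have "(\<Sum>i\<in>J. pr i v * (d j * P i j)) = (\<Sum>i\<in>J. d k * (m i * n i))"
  proof (rule sum.cong[OF refl])
   fix i assume i: "i \<in> J"
   have "pr i v * (d i * n i) = (d i * pr i v) * n i" by simp
   thus "pr i v * (d j * P i j) = d k * (m i * n i)" using m[OF i] n[OF i] by simp
  qed
  also have "d j * v j - \<dots> = d k * real_of_int (q - (\<Sum>i\<in>J. m i * n i))"
   by (simp add: q algebra_simps sum_distrib_left)
  finally show ?thesis by blast
 qed
 thus ?thesis using r by (auto simp: root_def supp_cox sf_eul eul_cox_cox)
qed

lemma root_R: "k \<in> J ==> root k (R t k)" by (induction t) (auto simp: root_P R_Suc root_cox dpos)

definition refl :: "'n => ('n => int) => ('n => int)" where
 "refl i v = (%l. v l - pr i v * unit i l)"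

lemma refl_other: "l ~= i ==> refl i v l = v l" by (simp add: refl_def unit_def)

lemma sf_unit: assumes i: "i \<in> J" shows "sf v (unit i) = d i * pr i v"
proof -
 have "sf v (unit i) = (\<Sum>j\<in>J. if j = i then d i * pr i v else 0)"
  unfolding sf_pr by (rule sum.cong) (auto simp: unit_def)
 thus ?thesis using i finJ by simp
qed

lemma root_refl: assumes k: "0 < d k" and i: "i \<in> J" and r: "root k v" shows "root k (refl i v)"
proof -
 have s1: "sf (unit i) (unit i) = 2 * d i" using sf_unit[OF i, of "unit i"] i by (simp add: pr_unit diag)
 have s2: "sf v (unit i) = d i * pr i v" by (rule sf_unit[OF i])
 have "sf (refl i v) (refl i v) = sf v v" unfolding refl_def sf_diff1 sf_diff2 sf_scale1 sf_scale2
  using sf_sym[of v "unit i"] s1 s2 by (simp add: algebra_simps)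
 moreover have "supp (refl i v)" using r i by (auto simp: root_def supp_def refl_def unit_def)
 moreover have "\<exists>n::int. d j * refl i v j = d k * n" if j: "j \<in> J" for j
 proof (cases "j = i")
  case True
  obtain m :: int where "d i * pr i v = d k * m" using pr_dual[OF k i, of v] r by (auto simp: root_def)
  moreover obtain q :: int where "d j * v j = d k * q" using r j by (auto simp: root_def)
  ultimately have "d j * refl i v j = d k * real_of_int (q - m)" using True by (simp add: refl_def unit_def algebra_simps)
  thus ?thesis by blast
 next
  case False thus ?thesis using r j by (auto simp: root_def refl_other)
 qed
 ultimately show ?thesis using r by (auto simp: root_def)
qed

text \<open>A reflection changes one coordinate only, so a positive root that it makes negative is
  supported at \<open>i\<close>; length and integrality then leave \<open>unit i\<close>.\<close>

lemma refl_negative: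
 assumes k: "0 < d k" and i: "i \<in> J" and r: "root k v" and v: "nonneg v" and n: "\<not> nonneg (refl i v)"
 shows "v = unit i"
proof -
 have "nonpos (refl i v)" using root_sign[OF k root_refl[OF k i r]] n by blast
 hence z: "v l = 0" if "l ~= i" for l
 proof -
  have "refl i v l <= 0" "0 <= v l" using v \<open>nonpos (refl i v)\<close> by (auto simp: nonneg_def nonpos_def)
  thus ?thesis using refl_other[OF that, of v] by simp
 qed
 hence v': "v = (%l. v i * unit i l)" by (auto simp: unit_def fun_eq_iff)
 have s1: "sf (unit i) (unit i) = 2 * d i" using sf_unit[OF i, of "unit i"] i by (simp add: pr_unit diag)
 have "sf v v = v i * v i * (2 * d i)" by (subst (1 2) v') (simp add: sf_scale1 sf_scale2 s1)
 hence 1: "v i * (d i * v i) = d k" using r by (simp add: root_def algebra_simps)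
 obtain m :: int where "d i * v i = d k * m" using r i by (auto simp: root_def)
 hence "real_of_int (v i) * (d k * real_of_int m) = d k" using 1 by simp
 hence "d k * real_of_int (v i * m) = d k * 1" by (simp add: mult.left_commute)
 hence "real_of_int (v i * m) = 1" unfolding mult_cancel_left using k by simp
 hence "v i * m = 1" by linarith
 moreover have "0 <= v i" using v by (simp add: nonneg_def)
 ultimately have "v i = 1" by (auto simp: zmult_eq_1_iff)
 have "v = (%l. 1 * unit i l)" using v' unfolding \<open>v i = 1\<close> .
 thus ?thesis by simp
qed

lemma pr_diff: "pr i (%l. u l - x * w l) = pr i u - x * pr i w"
 by (simp add: pr_def algebra_simps sum_subtractf sum_distrib_left)

lemma refl_lin: "refl i (%l. u l - x * w l) = (%l. refl i u l - x * refl i w l)"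
 by (simp add: refl_def pr_diff fun_eq_iff algebra_simps)
lemma foldr_refl_lin: "foldr refl ks (%l. u l - x * w l) = (%l. foldr refl ks u l - x * foldr refl ks w l)"
 by (induction ks) (simp_all add: refl_lin)

definition order_list :: "'n list => bool" where
 "order_list ks \<longleftrightarrow> distinct ks & set ks = J & sorted (map ht ks)"

lemma ex_order_list: "\<exists>ks. order_list ks"
proof -
 obtain xs where xs: "set xs = J" "distinct xs" using finite_distinct_list[OF finJ] by blast
 have "order_list (sort_key ht xs)" using xs by (simp add: order_list_def)
 thus ?thesis by blast
qed

lemma P_prefix:
 assumes o: "order_list (ks @ k # ks')"
 shows "P k l = unit k l - (\<Sum>i\<in>set ks. a i k * P i l)"
proof -
 have k: "k \<in> J" and ks: "set ks \<subseteq> J" "k \<notin> set ks" using o by (auto simp: order_list_def)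
 have b: "bel k \<subseteq> set ks"
 proof
  fix i assume i: "i \<in> bel k"
  have "ht k <= ht x" if "x \<in> set ks'" for x using o that by (auto simp: order_list_def sorted_append)
  hence "i \<notin> set ks'" using i by (force simp: bel_def)
  thus "i \<in> set ks" using i o by (auto simp: order_list_def bel_def)
 qed
 have "a i k = 0" if "i \<in> set ks - bel k" for i
 proof (rule a_same_ht[OF _ k])
  show "i \<in> J" "i ~= k" using that ks by auto
  have "ht i <= ht k" using that o by (auto simp: order_list_def sorted_append)
  thus "ht i = ht k" using that ks by (auto simp: bel_def)
 qed
 hence "(\<Sum>i\<in>bel k. a i k * P i l) = (\<Sum>i\<in>set ks. a i k * P i l)"
  by (intro sum.mono_neutral_left) (use b in auto)
 thus ?thesis by (subst P_rec) (simp add: unit_def)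
qed

lemma foldr_refl:
 assumes "order_list (ks @ ks')"
 shows "foldr refl ks v = (%l. v l - (\<Sum>i\<in>set ks. pr i v * P i l))" using assms
proof (induction ks arbitrary: v ks' rule: rev_induct)
 case Nil show ?case by simp
next
 case (snoc k ks)
 have o: "order_list (ks @ (k # ks'))" using snoc(2) by simp
 have k: "k \<in> J" and ks: "set ks \<subseteq> J" "k \<notin> set ks" using snoc(2) by (auto simp: order_list_def)
 have Pk: "foldr refl ks (unit k) = P k"
  unfolding snoc(1)[OF o] by (rule ext) (simp add: P_prefix[OF o] pr_unit[OF k])
 have "foldr refl (ks @ [k]) v = foldr refl ks (%l. v l - pr k v * unit k l)" by (simp add: refl_def)
 also have "\<dots> = (%l. foldr refl ks v l - pr k v * P k l)" unfolding foldr_refl_lin Pk by simp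
 finally show ?case unfolding snoc(1)[OF o] using ks(2) by (simp add: fun_eq_iff)
qed

lemma foldr_refl_unit:
 assumes "order_list (ks @ k # ks')" shows "foldr refl ks (unit k) = P k"
proof -
 have k: "k \<in> J" using assms by (auto simp: order_list_def)
 show ?thesis unfolding foldr_refl[OF assms] by (rule ext) (simp add: P_prefix[OF assms] pr_unit[OF k])
qed

text \<open>At the first reflection that destroys positivity the vector is a simple root
  \<open>unit m\<close>, and the reflections still to come carry \<open>- unit m\<close> to
  \<open>- P m\<close>.\<close>

lemma foldr_refl_negative:
 assumes "order_list (ks @ ks')" "0 < d k" "root k v" "nonneg v" "\<not> nonneg (foldr refl ks v)"
 shows "\<exists>m\<in>J. foldr refl ks v = (%l. - P m l)" using assms
proof (induction ks arbitrary: v ks' rule: rev_induct)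
 case Nil thus ?case by simp
next
 case (snoc m ks)
 have o: "order_list (ks @ (m # ks'))" using snoc(2) by simp
 have m: "m \<in> J" using snoc(2) by (auto simp: order_list_def)
 show ?case
 proof (cases "nonneg (refl m v)")
  case True
  thus ?thesis using snoc(1)[OF o snoc(3) root_refl[OF snoc(3) m snoc(4)]] snoc(6) by simp
 next
  case False
  hence v: "v = unit m" using refl_negative[OF snoc(3) m snoc(4,5)] by blast
  have "refl m v = (%l. unit m l - 2 * unit m l)" unfolding v by (simp add: refl_def pr_unit m diag)
  hence "foldr refl (ks @ [m]) v = (%l. foldr refl ks (unit m) l - 2 * foldr refl ks (unit m) l)"
   using foldr_refl_lin[of ks "unit m" 2 "unit m"] by simp
  hence "foldr refl (ks @ [m]) v = (%l. - P m l)" unfolding foldr_refl_unit[OF o] by simp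
  thus ?thesis using m by blast
 qed
qed

lemma cox_foldr: "order_list ks ==> cox v = foldr refl ks v"
 using foldr_refl[of ks "[]" v] by (simp add: cox_def order_list_def)

lemma cox_negative:
 assumes "0 < d k" "root k v" "nonneg v" "\<not> nonneg (cox v)"
 shows "\<exists>m\<in>J. cox v = (%l. - P m l)"
proof -
 obtain ks where ks: "order_list ks" using ex_order_list by blast
 show ?thesis using foldr_refl_negative[of ks "[]" k v] ks assms unfolding cox_foldr[OF ks] by simp
qed

text \<open>If the orbit stayed nonnegative, its partial sums would satisfy
  \<open>sf (S T) (S T) = 2 * eul v (S T)\<close>, equating a definite quadratic expression with a
  linear one. This bounds \<open>S T\<close>, yet every step adds at least one to the sum of its
  coordinates.\<close>

lemma ex_negative:
 assumes k: "0 < d k" and r: "root k v"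
 shows "\<exists>t. \<not> nonneg ((cox ^^ t) v)"
proof (rule ccontr)
 assume "\<not> ?thesis"
 hence pos: "nonneg ((cox ^^ t) v)" for t by blast
 have rt: "root k ((cox ^^ t) v)" for t by (induction t) (auto simp: r root_cox k)
 have sh: "eul ((cox ^^ (s + t)) v) ((cox ^^ t) v) = eul ((cox ^^ s) v) v" for s t
  by (induction t) (auto simp: eul_cox_cox)
 define S where "S = (%T l. \<Sum>t<T. (cox ^^ t) v l)"
 have cS: "cox (S T) l = S T l + (cox ^^ T) v l - v l" for T l
 proof -
  have "cox (S T) l = (\<Sum>t<T. (cox ^^ Suc t) v l)" unfolding S_def cox_sum[OF finite_lessThan] by simp
  also have "\<dots> = (\<Sum>t<T. (cox ^^ t) v l) + (cox ^^ T) v l - v l" by (induction T) simp_all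
  finally show ?thesis by (simp add: S_def)
 qed
 have Sv: "sf (S T) (S T) = 2 * eul v (S T)" for T
 proof -
  have 1: "sf u w = eul u w - eul (cox u) w" for u w by (simp add: eul_cox sf_eul)
  have "cox (S T) = (%l. (S T l + (cox ^^ T) v l) - v l)" using cS by (rule ext)
  hence "sf (S T) (S T) = eul v (S T) - eul ((cox ^^ T) v) (S T)"
   using 1[of "S T" "S T"] eul_diff1[of "%l. S T l + (cox ^^ T) v l" v "S T"] eul_add1[of "S T" "(cox ^^ T) v" "S T"]
   by simp
  moreover have "eul ((cox ^^ T) v) (S T) = - eul v (S T)"
  proof -
   \<comment> \<open>Both arguments are shifted back by \<open>t\<close> and the duality is applied
     once; the resulting sum runs through the orbit in reverse order.\<close>
   have e: "eul ((cox ^^ T) v) ((cox ^^ t) v) = - eul v ((cox ^^ (T - Suc t)) v)" if "t < T" for t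
   proof -
    have "eul ((cox ^^ T) v) ((cox ^^ t) v) = eul ((cox ^^ (Suc (T - Suc t) + t)) v) ((cox ^^ t) v)" using that by simp
    also have "\<dots> = eul ((cox ^^ (Suc (T - Suc t))) v) v" by (rule sh)
    finally show ?thesis by (simp add: eul_cox)
   qed
   have "eul ((cox ^^ T) v) (S T) = (\<Sum>t<T. - eul v ((cox ^^ (T - Suc t)) v))"
    unfolding S_def eul_sum2[OF finite_lessThan] by (rule sum.cong) (auto simp: e)
   also have "\<dots> = - (\<Sum>t<T. eul v ((cox ^^ (T - Suc t)) v))" by (simp add: sum_negf)
   also have "(\<Sum>t<T. eul v ((cox ^^ (T - Suc t)) v)) = (\<Sum>t<T. eul v ((cox ^^ t) v))"
    by (rule sum.nat_diff_reindex)
   finally show ?thesis by (simp add: S_def eul_sum2)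
  qed
  ultimately show ?thesis by simp
 qed
 obtain \<kappa> where kk: "\<kappa> > 0" "\<forall>v::'n => real. (\<Sum>i\<in>J. \<Sum>j\<in>J. v i * (d i * a i j) * v j) \<ge> \<kappa> * (\<Sum>i\<in>J. (v i)\<^sup>2)"
  using pdef by blast
 have S0: "0 <= S T l" for T l using pos by (auto simp: S_def nonneg_def intro!: sum_nonneg)
 have "supp ((cox ^^ t) v)" for t using rt[of t] by (simp add: root_def)
 hence supS: "supp (S T)" for T by (simp add: S_def supp_def)
 define C where "C = (\<Sum>l\<in>J. \<bar>eul v (unit l)\<bar>)"
 define N where "N = (%T. \<Sum>i\<in>J. real_of_int (S T i))"
 have evS: "eul v (S T) <= C * N T" for T
 proof -
  have e: "S T l = (\<Sum>i\<in>J. S T i * unit i l)" for l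
  proof -
   have "(\<Sum>i\<in>J. S T i * unit i l) = (\<Sum>i\<in>J. if i = l then S T l else 0)"
    by (rule sum.cong) (auto simp: unit_def)
   thus ?thesis using supS[of T] finJ by (simp add: supp_def)
  qed
  have "eul v (S T) = eul v (%l. \<Sum>i\<in>J. S T i * unit i l)" by (intro eul_cong refl e)
  also have "\<dots> = (\<Sum>i\<in>J. S T i * eul v (unit i))" by (simp add: eul_sum2 finJ eul_scale2)
  also have "\<dots> <= (\<Sum>i\<in>J. S T i * C)"
  proof (intro sum_mono mult_left_mono)
   fix i assume i: "i \<in> J"
   have "\<bar>eul v (unit i)\<bar> <= C" unfolding C_def using i finJ by (intro member_le_sum) auto
   thus "eul v (unit i) <= C" by linarith
   show "0 <= real_of_int (S T i)" using S0 by simp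
  qed
  finally show ?thesis by (simp add: N_def sum_distrib_left mult.commute)
 qed
 have N0: "0 <= N T" for T using S0 by (simp add: N_def sum_nonneg)
 have b: "N T <= 2 * card J * C / \<kappa>" for T
 proof (cases "N T = 0")
  case True
  have "0 <= C" by (simp add: C_def sum_nonneg)
  thus ?thesis using True kk(1) by simp
 next
  case False
  have "(N T)\<^sup>2 <= card J * (\<Sum>i\<in>J. (real_of_int (S T i))\<^sup>2)"
   unfolding N_def using sum_squared_le_sum_of_squares[of "%i. real_of_int (S T i)" J] by (simp add: mult.commute)
  hence "\<kappa> * (N T)\<^sup>2 <= \<kappa> * (card J * (\<Sum>i\<in>J. (real_of_int (S T i))\<^sup>2))"
   by (rule mult_left_mono) (use kk(1) in simp)
  hence "\<kappa> * (N T)\<^sup>2 <= card J * (\<kappa> * (\<Sum>i\<in>J. (real_of_int (S T i))\<^sup>2))"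
   by (simp only: mult.left_commute)
  also have "\<dots> <= card J * (2 * (C * N T))"
  proof (rule mult_left_mono)
   have "\<kappa> * (\<Sum>i\<in>J. (real_of_int (S T i))\<^sup>2) <= sf (S T) (S T)"
    using kk(2)[rule_format, of "%i. real_of_int (S T i)"] by (simp add: sf_def)
   thus "\<kappa> * (\<Sum>i\<in>J. (real_of_int (S T i))\<^sup>2) <= 2 * (C * N T)" using Sv[of T] evS[of T] by linarith
  qed simp
  finally have "(\<kappa> * N T) * N T <= (2 * card J * C) * N T" by (simp add: power2_eq_square algebra_simps)
  hence "\<kappa> * N T <= 2 * card J * C" by (rule mult_right_le_imp_le) (use False N0[of T] in linarith)
  thus ?thesis using kk(1) by (simp add: field_simps)
 qed
 have grow: "real T <= N T" for T
 proof (induction T)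
  case 0 show ?case by (simp add: S_def N_def)
 next
  case (Suc T)
  let ?w = "(cox ^^ T) v"
  obtain l where l: "l \<in> J" "?w l ~= 0" using root_nonzero[OF k rt] by blast
  have "0 <= ?w l" using pos[of T] by (simp add: nonneg_def)
  hence "1 <= ?w l" using l(2) by linarith
  also have "?w l <= (\<Sum>i\<in>J. ?w i)" using l finJ pos[of T] by (intro member_le_sum) (auto simp: nonneg_def)
  finally have "1 <= real_of_int (\<Sum>i\<in>J. ?w i)" by linarith
  thus ?case using Suc by (simp add: S_def N_def sum.distrib)
 qed
 have "real T <= 2 * card J * C / \<kappa>" for T using grow[of T] b[of T] by linarith
 thus False by (meson not_le reals_Archimedean2)
qed

end

section \<open>Row lengths and the involution of the vertices\<close>

context dynkin
begin

text \<open>For the full diagram \<open>rr\<close> and \<open>st\<close> turn out to be the numbers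
  \<open>r_i\<close> and the map \<open>i^*\<close> of the index set (\<open>r_index\<close>,
  \<open>star\<close>). Here they are read off the first negative vector of a row.\<close>

definition rr :: "'n => nat" where "rr k = (LEAST t. \<not> nonneg (R t k))"
definition st :: "'n => 'n" where "st k = (THE m. m \<in> J & R (rr k) k = (%l. - P m l))"

lemma rr_neg: "k \<in> J ==> \<not> nonneg (R (rr k) k)"
 unfolding rr_def R_def by (rule LeastI_ex) (rule ex_negative[OF dpos root_P])

lemma rr_pos: "t < rr k ==> nonneg (R t k)" unfolding rr_def by (metis not_less_Least)

lemma R_nonneg: "t < rr k ==> 0 <= R t k l" using rr_pos[of t k] by (simp add: nonneg_def)

lemma rr_ge1: "k \<in> J ==> 0 < rr k" using rr_neg[of k] by (cases "rr k") (auto simp: nonneg_def P_nonneg)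

lemma st_ex: assumes k: "k \<in> J" shows "st k \<in> J & R (rr k) k = (%l. - P (st k) l)"
proof -
 obtain t where t: "rr k = Suc t" using rr_ge1[OF k] by (cases "rr k") auto
 have "\<exists>m\<in>J. cox (R t k) = (%l. - P m l)"
  by (rule cox_negative[OF dpos[OF k] root_R[OF k] rr_pos]) (use t rr_neg[OF k] in "auto simp: R_Suc")
 then obtain m where m: "m \<in> J" "R (rr k) k = (%l. - P m l)" by (auto simp: t R_Suc)
 show ?thesis unfolding st_def
 proof (rule theI)
  show "m \<in> J & R (rr k) k = (%l. - P m l)" using m by simp
  show "x = m" if "x \<in> J & R (rr k) k = (%l. - P x l)" for x using that m P_inj[of x m] by (simp add: fun_eq_iff)
 qed
qed

lemma st_J: "k \<in> J ==> st k \<in> J" and R_rr: "k \<in> J ==> R (rr k) k = (%l. - P (st k) l)" using st_ex by auto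

lemma st_unique:
 assumes "k \<in> J" "m \<in> J" "R t k = (%l. - P m l)" "!!s. s < t ==> nonneg (R s k)"
 shows "rr k = t" "st k = m"
proof -
 have n: "\<not> nonneg (R t k)" using assms(2,3) P_self[of m] by (auto simp: nonneg_def intro!: exI[of _ m])
 show t: "rr k = t" unfolding rr_def by (rule Least_equality) (use n assms(4) in "auto simp: not_le[symmetric]")
 show "st k = m" using R_rr[OF assms(1)] assms(3) st_J[OF assms(1)] assms(2) P_inj[of "st k" m]
  unfolding t by (simp add: fun_eq_iff)
qed

lemma R_add: "R (s + t) k = (cox ^^ s) (R t k)" by (simp add: R_def funpow_add)

lemma cox_pow_minus: "(cox ^^ t) (%l. - v l) = (%l. - (cox ^^ t) v l)" by (induction t) (simp_all add: cox_minus)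

lemma R_past: "k \<in> J ==> R (t + rr k) k = (%l. - R t (st k) l)"
 by (simp add: R_add R_rr cox_pow_minus) (simp add: R_def)

lemma d_st: assumes k: "k \<in> J" shows "d (st k) = d k"
proof -
 have "sf (R (rr k) k) (R (rr k) k) = 2 * d k" using root_R[OF k] by (simp add: root_def)
 moreover have "sf (%l. - P (st k) l) (%l. - P (st k) l) = 2 * d (st k)"
  using root_P[OF st_J[OF k]] by (simp add: root_def sf_eul eul_minus1 eul_minus2)
 ultimately show ?thesis using R_rr[OF k] by simp
qed

lemma eul_PR: "j \<in> J ==> eul (P j) (R t k) = d j * R t k j" by (rule eul_P)
lemma eul_RP: "j \<in> J ==> eul (R (Suc t) k) (P j) = - (d j * R t k j)" by (simp add: R_Suc eul_cox eul_P)
lemma eul_RR: "j \<in> J ==> eul (R s j) (R (s + t) k) = d j * R t k j"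
 using eul_R_shift[of 0 s j t k] by (simp add: eul_P add.commute)
lemma eul_RR': "j \<in> J ==> eul (R (Suc (s + t)) k) (R s j) = - (d j * R t k j)"
 using eul_R_shift[of "Suc t" s k 0 j] eul_RP[of j t k] by (simp add: add.commute)

lemma eul_nondeg: "supp u ==> supp v ==> (!!j. j \<in> J ==> eul (P j) u = eul (P j) v) ==> u = v"
 using dpos by (intro supp_eqI) (auto simp: eul_P less_imp_neq[symmetric])

lemma cox_inj: assumes s: "supp u" "supp v" and c: "cox u = cox v" shows "u = v"
proof (rule eul_nondeg[OF s])
 fix j assume "j \<in> J"
 have "- eul (P j) u = - eul (P j) v" using c eul_cox by metis
 thus "eul (P j) u = eul (P j) v" by simp
qed

lemma cox_pow_inj: "supp u ==> supp v ==> (cox ^^ t) u = (cox ^^ t) v ==> u = v"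
proof (induction t)
 case (Suc t)
 have "supp ((cox ^^ t) w)" if "supp w" for w by (induction t) (auto simp: that supp_cox)
 thus ?case using Suc cox_inj by simp
qed simp

text \<open>The vector \<open>P k\<close> has Euler norm \<open>d k\<close>, whereas duality would
  make it \<open>- d k * v k\<close>.\<close>

lemma P_not_cox: assumes "k \<in> J" "nonneg v" shows "cox v ~= P k"
proof
 assume c: "cox v = P k"
 have "d k = eul (P k) (P k)" using assms by (simp add: eul_P)
 also have "\<dots> = - (d k * v k)" using eul_cox[of v "P k"] assms by (simp add: c eul_P)
 finally have "d k * (1 + v k) = 0" by (simp add: algebra_simps)
 hence "1 + real_of_int (v k) = 0" using dpos[OF assms(1)] by simp
 moreover have "0 <= v k" using assms(2) by (simp add: nonneg_def)
 ultimately show False by linarith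
qed

lemma cox_pow_not_P: "k \<in> J ==> nonneg ((cox ^^ t) v) ==> (cox ^^ Suc t) v ~= P k" using P_not_cox by simp

lemma R_not_P: "m \<in> J ==> 0 < t ==> t <= rr k ==> R t k ~= P m"
 using P_not_cox[of m "R (t - 1) k"] rr_pos[of "t - 1" k] by (cases t) (auto simp: R_Suc)

lemma R_eq_cases:
 assumes "k \<in> J" "k' \<in> J" "R t k = R t' k'" "t < rr k" "t' < rr k'"
 shows "t = t' & k = k'"
proof -
 have *: "t = t' & k = k'" if "t <= t'" "k \<in> J" "k' \<in> J" "R t k = R t' k'" "t' < rr k'" for t t' k k'
 proof -
  have "(cox ^^ t) (R (t' - t) k') = (cox ^^ t) (P k)" using that(1,4) R_add[of t "t' - t" k'] by (simp add: R_def)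
  hence e: "R (t' - t) k' = P k" using cox_pow_inj supp_R supp_P that(2,3) by metis
  have "t' - t <= rr k'" using that(5) by simp
  hence "\<not> 0 < t' - t" using R_not_P[OF that(2), of "t' - t" k'] e by auto
  hence "t' = t" using that(1) by simp
  thus ?thesis using e P_inj that by auto
 qed
 show ?thesis using *[of t t' k k'] *[of t' t k' k] assms by (metis nat_le_linear)
qed

lemma st_inj: "inj_on st J"
proof (rule inj_onI)
 have *: "k = k'" if "rr k <= rr k'" "k \<in> J" "k' \<in> J" "st k = st k'" for k k'
 proof -
  have "(cox ^^ rr k) (P k) = (cox ^^ rr k) (R (rr k' - rr k) k')"
   using R_rr[OF that(2)] R_rr[OF that(3)] that(1,4) R_add[of "rr k" "rr k' - rr k" k'] by (simp add: R_def)
  hence e: "R (rr k' - rr k) k' = P k" using cox_pow_inj supp_R supp_P that(2,3) by metis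
  have "\<not> 0 < rr k' - rr k" using R_not_P[OF that(2), of "rr k' - rr k" k'] e by auto
  hence "rr k' - rr k = 0" by blast
  thus ?thesis using e P_inj that by auto
 qed
 show "k = k'" if "k \<in> J" "k' \<in> J" "st k = st k'" for k k'
  using *[of k k'] *[of k' k] that by (metis nat_le_linear)
qed

lemma st_surj: "st ` J = J" using st_inj st_J finJ by (meson endo_inj_surj image_subsetI)

text \<open>The root is followed until it becomes \<open>- P m\<close>. With \<open>m = st l\<close>
  this is also the end of row \<open>l\<close>, so by injectivity of \<open>cox\<close> the root
  lies on that row; it cannot start before the row, since \<open>P l\<close> is not the image of a
  nonnegative vector.\<close>

lemma root_enum:
 assumes k: "0 < d k" and r: "root k v" and n: "nonneg v"
 shows "\<exists>l\<in>J. \<exists>t<rr l. v = R t l"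
proof -
 define t where "t = (LEAST t. \<not> nonneg ((cox ^^ t) v))"
 have t: "\<not> nonneg ((cox ^^ t) v)" unfolding t_def by (rule LeastI_ex) (rule ex_negative[OF k r])
 have t': "nonneg ((cox ^^ s) v)" if "s < t" for s using that unfolding t_def by (metis not_less_Least)
 obtain s where s: "t = Suc s" using t n by (cases t) auto
 have rt: "root k ((cox ^^ s) v)" by (induction s) (auto simp: r root_cox k)
 have "\<exists>m\<in>J. cox ((cox ^^ s) v) = (%l. - P m l)" by (rule cox_negative[OF k rt]) (use t t' s in auto)
 then obtain m where m: "m \<in> J" "(cox ^^ t) v = (%l. - P m l)" using s by auto
 obtain l where l: "l \<in> J" "m = st l" using st_surj m(1) by blast
 have e: "(cox ^^ t) v = (cox ^^ rr l) (P l)" using m(2) l R_rr[OF l(1)] by (simp add: R_def)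
 have sv: "supp v" using r by (simp add: root_def)
 show ?thesis
 proof (cases "t <= rr l")
  case True
  hence "(cox ^^ t) v = (cox ^^ t) (R (rr l - t) l)" using e R_add[of t "rr l - t" l] by (simp add: R_def)
  hence "v = R (rr l - t) l" using cox_pow_inj sv supp_R[OF l(1)] by metis
  moreover have "rr l - t < rr l" using s True by simp
  ultimately show ?thesis using l by blast
 next
  case False
  hence "(cox ^^ rr l) ((cox ^^ (t - rr l)) v) = (cox ^^ rr l) (P l)"
   using e by (simp flip: funpow_add[unfolded comp_def, THEN fun_cong] add: funpow_add[symmetric, THEN fun_cong, unfolded comp_def])
  moreover have "supp ((cox ^^ n) v)" for n by (induction n) (auto simp: sv supp_cox)
  ultimately have "(cox ^^ (t - rr l)) v = P l" using cox_pow_inj supp_P[OF l(1)] by metis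
  moreover have "t - rr l = Suc (t - rr l - 1)" using False by simp
  ultimately show ?thesis using cox_pow_not_P[OF l(1) t'[of "t - rr l - 1"]] rr_ge1[OF l(1)] s False by (metis diff_Suc_less diff_less less_imp_diff_less not_less zero_less_Suc zero_less_diff One_nat_def diff_is_0_eq' lessI)
 qed
qed

text \<open>The duality behind the symmetry of the compatibility degree under the wrap-around of \<open>\<tau>\<close>.\<close>

lemma R_dual:
 assumes "l \<in> J" "k \<in> J" "t < rr l"
 shows "d l * R t k (st l) = d k * R (rr l - Suc t) l k"
proof -
 have "d (st l) * R t k (st l) = eul (P (st l)) (R t k)" using assms by (simp add: eul_P st_J)
 also have "\<dots> = - eul (R (rr l) l) (R t k)" by (simp add: R_rr[OF assms(1)] eul_minus1)
 also have "\<dots> = d k * R (rr l - Suc t) l k" using eul_RR'[OF assms(2), of t "rr l - Suc t" l] assms(3) by simp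
 finally show ?thesis by (simp add: d_st assms)
qed

text \<open>The same pairing with \<open>- P (st l)\<close>, now from the end of row
  \<open>l\<close> on. Where both coordinates are known to be nonnegative, the minus sign makes them
  vanish.\<close>

lemma R_dual':
 assumes "l \<in> J" "k \<in> J"
 shows "R (t + rr l) k (st l) = - R t k l"
proof -
 have "d (st l) * R (t + rr l) k (st l) = eul (P (st l)) (R (t + rr l) k)" using assms by (simp add: eul_P st_J)
 also have "\<dots> = - eul (R (rr l) l) (R (rr l + t) k)" by (simp add: R_rr[OF assms(1)] eul_minus1 add.commute)
 also have "\<dots> = - (d l * R t k l)" using eul_RR[OF assms(1), of "rr l" t k] by simp
 finally show ?thesis using dpos[OF assms(1)] by (simp add: d_st assms flip: mult_minus_right of_int_minus)
qed

lemma R1_far: "l \<in> J ==> i \<in> J ==> ht l + 2 <= ht i ==> R 1 l i = 0"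
proof (induction "ht l" arbitrary: l rule: less_induct)
 case less
 have "P l i = 0" using less by (intro P_above) auto
 moreover have "(\<Sum>j\<in>bel l. a j l * R 1 j i) = 0" by (rule sum.neutral) (use less in "auto simp: bel_def")
 moreover have "(\<Sum>j\<in>abv l. a j l * P j i) = 0"
 proof (rule sum.neutral, rule ballI)
  fix j assume that: "j \<in> abv l"
  show "a j l * P j i = 0"
 proof (cases "a j l = 0")
  case False
  hence "ht j = ht l + 1" using a_far[of l j] a_zero_sym[of j l] that less by (auto simp: abv_def)
  thus ?thesis using that less by (subst P_above) (auto simp: abv_def)
 qed simp
 qed
 ultimately show ?case using mesh[OF less(2), of 0 i] by simp
qed

lemma R1_adj: assumes "k \<in> J" "i \<in> J" "ht i = ht k + 1" shows "R 1 k i = - a i k"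
proof -
 have "P k i = 0" using assms by (intro P_above) auto
 moreover have "(\<Sum>j\<in>bel k. a j k * R 1 j i) = 0"
 proof (rule sum.neutral, rule ballI)
  fix j assume "j \<in> bel k"
  hence "R 1 j i = 0" using assms by (intro R1_far) (auto simp: bel_def)
  thus "a j k * R 1 j i = 0" by simp
 qed
 moreover have "(\<Sum>j\<in>abv k. a j k * P j i) = (\<Sum>j\<in>abv k. if j = i then a i k else 0)"
 proof (rule sum.cong[OF refl])
  fix j assume j: "j \<in> abv k"
  show "a j k * P j i = (if j = i then a i k else 0)"
  proof (cases "a j k = 0 \<or> j = i")
   case False
   hence "ht j = ht k + 1" using a_far[of k j] a_zero_sym[of j k] j assms by (auto simp: abv_def)
   thus ?thesis using False j assms by (subst P_above) (auto simp: abv_def)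
  qed (use assms j in "auto simp: abv_def")
 qed
 ultimately show ?thesis using mesh[OF assms(1), of 0 i] assms by (simp add: abv_def finJ)
qed

text \<open>If a row were longer than claimed, a nonnegative coordinate of it would pair with
  \<open>- P (st i)\<close> or \<open>- P (st k)\<close> to a nonpositive number;
  \<open>P_adj\<close> and \<open>R1_adj\<close> show that the pairing is
  \<open>- d i * a i k\<close> or \<open>- d k * a k i\<close>, which is positive.\<close>

lemma rr_bel:
 assumes "k \<in> J" "i \<in> J" "ht i < ht k" "a i k ~= 0"
 shows "rr k <= rr i" "rr i <= rr k + 1"
proof -
 have h: "ht k = ht i + 1" using a_far assms by blast
 have neg: "a i k < 0" "a k i < 0" using offd[of i k] offd[of k i] assms a_zero_sym[of i k] by force+
 show "rr k <= rr i"
 proof (rule ccontr)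
  assume "\<not> ?thesis"
  hence "0 <= R (rr i) k (st i)" by (intro R_nonneg) auto
  hence "eul (R (rr i) i) (R (rr i) k) <= 0"
   using assms dpos st_J[of i] by (simp add: R_rr eul_minus1 eul_P less_imp_le)
  moreover have "eul (R (rr i) i) (R (rr i) k) = d i * - a i k"
   using eul_RR[OF assms(2), of "rr i" 0 k] P_adj[OF assms(1,2) h] by simp
  ultimately show False using neg dpos[OF assms(2)] by (simp add: mult_le_0_iff zero_le_mult_iff)
 qed
 show "rr i <= rr k + 1"
 proof (rule ccontr)
  assume "\<not> ?thesis"
  hence "0 <= R (rr k + 1) i (st k)" by (intro R_nonneg) auto
  hence "eul (R (rr k) k) (R (rr k + 1) i) <= 0"
   using assms dpos st_J[of k] by (simp add: R_rr eul_minus1 eul_P less_imp_le)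
  moreover have "eul (R (rr k) k) (R (rr k + 1) i) = d k * - a k i"
   using eul_RR[OF assms(1), of "rr k" 1 i] R1_adj[OF assms(2,1) h] by simp
  ultimately show False using neg dpos[OF assms(1)] by (simp add: mult_le_0_iff zero_le_mult_iff)
 qed
qed

lemma eul_st_pos:
 assumes "i \<in> J" "k \<in> J" "P (st k) (st i) > 0"
 shows "rr i <= rr k & R (rr k - rr i) k i = P (st k) (st i)"
proof -
 have e: "eul (R (rr i) i) (R (rr k) k) = d i * P (st k) (st i)"
  using assms by (simp add: R_rr eul_minus1 eul_minus2 eul_P st_J d_st)
 hence p: "eul (R (rr i) i) (R (rr k) k) > 0" using assms dpos by simp
 have le: "rr i <= rr k"
 proof (rule ccontr)
  assume n: "\<not> ?thesis"
  hence "eul (R (rr i) i) (R (rr k) k) = - (d k * R (rr i - Suc (rr k)) i k)"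
   using eul_RR'[OF assms(2), of "rr k" "rr i - Suc (rr k)" i] by simp
  moreover have "0 <= R (rr i - Suc (rr k)) i k" using n by (intro R_nonneg) auto
  ultimately show False using p dpos[OF assms(2)] by (simp add: mult_less_0_iff)
 qed
 hence "d i * P (st k) (st i) = d i * R (rr k - rr i) k i" using e eul_RR[OF assms(1), of "rr i" "rr k - rr i" k] by simp
 thus ?thesis using le dpos[OF assms(1)] by simp
qed

text \<open>Computing \<open>eul (R (rr i) i) (R (rr k) k)\<close> inside the rows and again from
  their ends gives \<open>P (st k) (st i) = - a i k\<close>, so a path descends from
  \<open>st k\<close> to \<open>st i\<close>. Its first vertex \<open>st l\<close> after
  \<open>st k\<close> must be \<open>st i\<close>, since otherwise the height of \<open>l\<close>
  would lie strictly between two consecutive numbers.\<close>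

lemma st_adj:
 assumes i: "i \<in> J" and k: "k \<in> J" and nz: "a i k ~= 0"
  and c: "ht i < ht k & rr i = rr k \<or> ht k < ht i & rr k = rr i + 1"
 shows "st i \<in> bel (st k) & a (st i) (st k) = a i k"
proof -
 have ne: "i ~= k" using c by auto
 have neg: "a i k < 0" using offd[OF i k ne] nz by simp
 have h: "ht i < ht k & ht k = ht i + 1 \<or> ht k < ht i & ht i = ht k + 1"
  using c a_far[OF i k ne nz] a_far[of k i] i k ne nz a_zero_sym by auto
 have "eul (R (rr i) i) (R (rr k) k) = d i * - a i k" using c
 proof
  assume "ht i < ht k & rr i = rr k"
  thus ?thesis using eul_RR[OF i, of "rr i" 0 k] P_adj[OF k i] h by simp
 next
  assume "ht k < ht i & rr k = rr i + 1"
  thus ?thesis using eul_RR[OF i, of "rr i" 1 k] R1_adj[OF k i] h by simp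
 qed
 moreover have "eul (R (rr i) i) (R (rr k) k) = d i * P (st k) (st i)"
  using i k by (simp add: R_rr eul_minus1 eul_minus2 eul_P st_J d_st)
 ultimately have "d i * real_of_int (P (st k) (st i) + a i k) = 0" by (simp add: algebra_simps)
 hence "real_of_int (P (st k) (st i) + a i k) = 0" using dpos[OF i] by simp
 hence Pe: "P (st k) (st i) = - a i k" by linarith
 have ne': "st i ~= st k" using st_inj i k ne by (auto simp: inj_on_def)
 have b: "st i \<in> bel (st k)" using P_above[of "st k" "st i"] Pe nz ne' st_J i k by (force simp: bel_def)
 have "(\<Sum>j\<in>bel (st k). a j (st k) * P j (st i)) ~= 0" using Pe nz ne' P.simps[of "st k" "st i"] by auto
 then obtain j where j: "j \<in> bel (st k)" "a j (st k) ~= 0" "P j (st i) ~= 0"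
  by (metis (no_types, lifting) mult_eq_0_iff sum.neutral)
 have jJ: "j \<in> J" using j by (simp add: bel_def)
 obtain l where l: "l \<in> J" "j = st l" using st_surj jJ by blast
 have hj: "ht (st k) = ht j + 1" using a_far[of j "st k"] j jJ st_J[OF k] by (auto simp: bel_def)
 have "P (st k) (st l) = - a j (st k)" using P_adj[OF st_J[OF k] jJ hj] l by simp
 hence p1: "P (st k) (st l) > 0" using offd[OF jJ st_J[OF k]] j(1,2) by (force simp: bel_def)
 have p2: "P (st l) (st i) > 0" using j(3) P_nonneg[of j "st i"] jJ l by force
 note q1 = eul_st_pos[OF l(1) k p1] and q2 = eul_st_pos[OF i l(1) p2]
 have lk: "l ~= k" using j(1) l by (auto simp: bel_def)
 have "l = i"
 proof (rule ccontr)
  assume li: "l ~= i"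
  show False using c
  proof
   assume A: "ht i < ht k & rr i = rr k"
   hence "rr l = rr k" "rr l = rr i" using q1 q2 by auto
   hence "P k l ~= 0" "P l i ~= 0" using q1 q2 p1 p2 by auto
   hence "ht l < ht k" "ht i < ht l" using P_above[OF k, of l] P_above[OF l(1), of i] lk li by force+
   thus False using h A by auto
  next
   assume A: "ht k < ht i & rr k = rr i + 1"
   hence "rr l = rr i \<or> rr l = rr k" using q1 q2 by auto
   thus False
   proof
    assume e: "rr l = rr i"
    hence "P l i ~= 0" "R 1 k l ~= 0" using q1 q2 p1 p2 A by auto
    hence "ht i < ht l" "ht l < ht k + 2" using P_above[OF l(1), of i] li R1_far[OF k l(1)] by force+
    thus False using h A by auto
   next
    assume e: "rr l = rr k"
    hence "R 1 l i ~= 0" "P k l ~= 0" using q1 q2 p1 p2 A by auto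
    hence "ht i < ht l + 2" "ht l < ht k" using P_above[OF k, of l] lk R1_far[OF l(1) i] by force+
    thus False using h A by auto
   qed
  qed
 qed
 hence "P (st k) (st i) = - a (st i) (st k)" using P_adj[OF st_J[OF k] jJ hj] l by simp
 thus ?thesis using Pe b by simp
qed

end

section \<open>Independence of the involution from the orientation\<close>

context dynkin
begin

lemma dynkin_change_ht:
 assumes "!!i j. i \<in> J ==> j \<in> J ==> i ~= j ==> a i j ~= 0 ==> ht' j = ht' i + 1 \<or> ht' i = ht' j + 1"
 shows "dynkin J a d ht'" using assms finJ diag offd dpos symd pdef unfolding dynkin_def by auto

text \<open>Reversing all arrows transposes the Euler form and inverts \<open>cox\<close>, so rows
  are traversed backwards: the new row of \<open>st k\<close> is the old row of \<open>k\<close>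
  read from its end.\<close>

lemma st_reverse:
 assumes D': "dynkin J a d ht'" and h: "!!k. k \<in> J ==> ht k <= C & ht' k = C - ht k" and k: "k \<in> J"
 shows "dynkin.st J a ht' (st k) = k"
proof -
 interpret D': dynkin J a d ht' by fact
 have b: "D'.bel i = abv i" if "i \<in> J" for i
  using h that by (auto simp: D'.bel_def abv_def) (metis diff_less_mono2 le_antisym not_le order_trans less_imp_le diff_le_mono2 less_le_trans)+
 have e: "D'.eul u v = eul v u" for u v
 proof -
  have "sf u v = (\<Sum>i\<in>J. u i * (2 * d i * v i) + ((\<Sum>j\<in>bel i. u i * (d i * a i j) * v j) + (\<Sum>j\<in>abv i. u i * (d i * a i j) * v j)))"
   unfolding sf_def
  proof (rule sum.cong[OF refl])
   fix i assume i: "i \<in> J"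
   show "(\<Sum>j\<in>J. u i * (d i * a i j) * v j) =
     u i * (2 * d i * v i) + ((\<Sum>j\<in>bel i. u i * (d i * a i j) * v j) + (\<Sum>j\<in>abv i. u i * (d i * a i j) * v j))"
    by (subst sum_split_J[OF i]) (use i in "auto simp: diag a_same_ht")
  qed
  also have "\<dots> = eul u v + (\<Sum>i\<in>J. u i * (d i * v i + (\<Sum>j\<in>abv i. d i * a i j * v j)))"
   by (simp add: eul_def sum.distrib algebra_simps sum_distrib_left)
  also have "(\<Sum>i\<in>J. u i * (d i * v i + (\<Sum>j\<in>abv i. d i * a i j * v j))) = D'.eul u v"
   unfolding D'.eul_def by (rule sum.cong) (simp_all add: b)
  finally show ?thesis using sf_eul[of u v] by simp
 qed
 have nd: "x = y" if "supp x" "supp y" "!!w. eul w x = eul w y" for x y using that eul_nondeg by blast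
 have cc: "D'.cox (cox u) = u" if "supp u" for u
 proof (rule nd)
  show "supp (D'.cox (cox u))" by (intro D'.supp_cox supp_cox that)
  show "eul w (D'.cox (cox u)) = eul w u" for w using D'.eul_cox[of "cox u" w] eul_cox[of u w] by (simp add: e)
 qed fact
 have eP: "eul w (D'.P j) = d j * w j" if "j \<in> J" for w j using D'.eul_P[OF that, of w] by (simp add: e)
 note m = st_J[OF k] and r = rr_ge1[OF k]
 have P': "D'.P (st k) = R (rr k - 1) k"
 proof (rule nd)
  show "eul w (D'.P (st k)) = eul w (R (rr k - 1) k)" for w
  proof -
   have "R (rr k) k = cox (R (rr k - 1) k)" using r R_Suc[of "rr k - 1" k] by simp
   hence "eul w (R (rr k - 1) k) = - eul (R (rr k) k) w" by (simp add: eul_cox)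
   also have "\<dots> = d (st k) * w (st k)" by (simp add: R_rr[OF k] eul_minus1 eul_P m)
   finally show ?thesis by (simp add: eP m)
  qed
 qed (use m k in "auto simp: D'.supp_P supp_R")
 have R': "D'.R t (st k) = R (rr k - 1 - t) k" if "t < rr k" for t using that
 proof (induction t)
  case 0 thus ?case by (simp add: P')
 next
  case (Suc t)
  hence "R (rr k - 1 - t) k = cox (R (rr k - 1 - Suc t) k)" using R_Suc[of "rr k - 1 - Suc t" k] by (simp add: Suc_diff_Suc)
  thus ?case using Suc cc[OF supp_R[OF k]] by (simp add: D'.R_Suc)
 qed
 have "D'.R (rr k) (st k) = D'.cox (P k)" using R'[of "rr k - 1"] r D'.R_Suc[of "rr k - 1" "st k"] by simp
 also have "\<dots> = (%l. - D'.P k l)"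
 proof (rule nd)
  show "supp (D'.cox (P k))" by (intro D'.supp_cox supp_P k)
  show "supp (%l. - D'.P k l)" using D'.supp_P[OF k] by (simp add: supp_def)
  show "eul w (D'.cox (P k)) = eul w (%l. - D'.P k l)" for w
   using D'.eul_cox[of "P k" w] by (simp add: e eul_minus2 eP k eul_P)
 qed
 finally have "D'.R (rr k) (st k) = (%l. - D'.P k l)" .
 thus ?thesis by (rule D'.st_unique(2)[OF m k]) (simp add: R' rr_pos r)
qed

lemma refl_sum: "finite S ==> refl v (%l. \<Sum>i\<in>S. f i l) = (%l. \<Sum>i\<in>S. refl v (f i) l)"
proof (induction S rule: finite_induct)
 case empty show ?case by (simp add: refl_def pr_def)
next
 case (insert x F)
 have "refl v (%l. f x l - (-1) * (\<Sum>i\<in>F. f i l)) = (%l. refl v (f x) l - (-1) * (\<Sum>i\<in>F. refl v (f i) l))"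
  unfolding refl_lin insert(3) ..
 thus ?case using insert by simp
qed

lemma refl_scale: "refl v (%l. x * f l) = (%l. x * refl v f l)"
proof -
 have "refl v (%l. (%_. 0) l - (- x) * f l) = (%l. refl v (%_. 0) l - (- x) * refl v f l)" by (rule refl_lin)
 thus ?thesis by (simp add: refl_def pr_def)
qed

text \<open>Making the source \<open>v\<close> a sink conjugates \<open>cox\<close> by the
  reflection at \<open>v\<close>. All rows are reflected, and the row of \<open>v\<close> in
  addition loses its first entry. Among positive roots only \<open>unit v\<close> changes sign, so a
  row end moves only next to an occurrence of \<open>unit v\<close>, which the final case
  distinction locates.\<close>

lemma st_flip:
 assumes v: "v \<in> J" and src: "!!i. i \<in> J ==> i ~= v ==> a i v ~= 0 ==> ht i = ht v + 1"
 defines "ht' \<equiv> ht(v := ht v + 2)"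
 shows "dynkin J a d ht'" and "k \<in> J ==> dynkin.st J a ht' k = st k"
proof -
 show D': "dynkin J a d ht'"
 proof (rule dynkin_change_ht)
  fix i j assume ij: "i \<in> J" "j \<in> J" "i ~= j" "a i j ~= 0"
  consider "i = v" | "j = v" | "i ~= v" "j ~= v" by blast
  thus "ht' j = ht' i + 1 \<or> ht' i = ht' j + 1"
  proof cases
   case 1
   hence "ht j = ht v + 1" using src[of j] ij a_zero_sym[of i j] by auto
   thus ?thesis using 1 ij by (simp add: ht'_def)
  next
   case 2
   hence "ht i = ht v + 1" using src[of i] ij by auto
   thus ?thesis using 2 ij by (simp add: ht'_def)
  qed (use adj_ht ij in "auto simp: ht'_def")
 qed
 interpret D': dynkin J a d ht' by fact
 assume k: "k \<in> J"
 have nb: "a i v = 0" if "i \<in> bel v" for i using src[of i] that by (auto simp: bel_def)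
 have Pv: "P v = unit v" by (subst P_rec) (simp add: nb unit_def)
 have rv: "refl v (unit v) = (%l. - unit v l)" by (rule ext) (simp add: refl_def pr_unit v diag)
 have P': "D'.P k = refl v (P k)" if "k \<in> J" "k ~= v" for k using that
 proof (induction "ht k" arbitrary: k rule: less_induct)
  case less
  have B: "D'.bel k - {v} = bel k - {v}" using less(3) unfolding D'.bel_def bel_def by (auto simp: ht'_def)
  have adj: "ht k = ht v + 1" if "a v k ~= 0" using src[of k] that less(2,3) v a_zero_sym[of v k] by auto
  have z': "a v k = 0" if "v \<in> D'.bel k" using that less(3) adj unfolding D'.bel_def by (auto simp: ht'_def)
  have z: "a v k = 0" if "v \<notin> bel k" using that v adj by (auto simp: bel_def)
  have 1: "D'.P k l = unit k l - (\<Sum>i\<in>bel k - {v}. a i k * refl v (P i) l)" for l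
  proof -
   have "(\<Sum>i\<in>D'.bel k. a i k * D'.P i l) = (\<Sum>i\<in>D'.bel k - {v}. a i k * D'.P i l)"
    by (rule sum.mono_neutral_right) (use z' in auto)
   also have "\<dots> = (\<Sum>i\<in>bel k - {v}. a i k * refl v (P i) l)"
    unfolding B by (rule sum.cong[OF refl]) (use less(1) in "auto simp: bel_def")
   finally show ?thesis by (subst D'.P_rec) (simp add: unit_def)
  qed
  have "refl v (P k) = refl v (%l. unit k l - 1 * (\<Sum>i\<in>bel k. a i k * P i l))"
   by (subst P_rec) (simp add: unit_def)
  also have "\<dots> = (%l. refl v (unit k) l - (\<Sum>i\<in>bel k. a i k * refl v (P i) l))"
   unfolding refl_lin by (simp add: refl_sum refl_scale)
  also have "\<dots> = (%l. unit k l - (\<Sum>i\<in>bel k - {v}. a i k * refl v (P i) l))"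
  proof (rule ext)
   fix l
   have "(\<Sum>i\<in>bel k. a i k * refl v (P i) l) = - a v k * unit v l + (\<Sum>i\<in>bel k - {v}. a i k * refl v (P i) l)"
   proof (cases "v \<in> bel k")
    case True thus ?thesis by (simp add: sum.remove Pv rv)
   next
    case False thus ?thesis by (simp add: z)
   qed
   thus "refl v (unit k) l - (\<Sum>i\<in>bel k. a i k * refl v (P i) l) = unit k l - (\<Sum>i\<in>bel k - {v}. a i k * refl v (P i) l)"
    by (simp add: refl_def pr_unit less(2))
  qed
  finally show ?case using 1 by (simp add: fun_eq_iff)
 qed
 have P'v: "D'.P v l = unit v l - (\<Sum>i\<in>J - {v}. a i v * refl v (P i) l)" for l
 proof -
  have "(\<Sum>i\<in>D'.bel v. a i v * D'.P i l) = (\<Sum>i\<in>D'.bel v. a i v * refl v (P i) l)"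
  proof (rule sum.cong[OF refl])
   fix i assume "i \<in> D'.bel v"
   hence "i \<in> J" "i ~= v" by (auto simp: D'.bel_def)
   thus "a i v * D'.P i l = a i v * refl v (P i) l" using P' by simp
  qed
  also have "\<dots> = (\<Sum>i\<in>J - {v}. a i v * refl v (P i) l)"
   unfolding D'.bel_def by (rule sum.mono_neutral_left) (use src finJ in "auto simp: ht'_def")
  finally show ?thesis by (subst D'.P_rec) (simp add: unit_def)
 qed
 have cr: "D'.cox (refl v x) = refl v (cox x)" for x
 proof (rule ext)
  fix l
  have pr1: "pr i (refl v x) = pr i x - pr v x * a i v" for i unfolding refl_def pr_diff by (simp add: pr_unit v)
  have "D'.cox (refl v x) l = refl v x l - (\<Sum>i\<in>J. pr i (refl v x) * D'.P i l)"
   by (simp add: D'.cox_def D'.pr_def pr_def)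
  also have "(\<Sum>i\<in>J. pr i (refl v x) * D'.P i l) = - pr v x * D'.P v l + (\<Sum>i\<in>J - {v}. pr i (refl v x) * D'.P i l)"
   by (subst sum.remove[OF finJ v]) (simp add: pr1 diag v)
  also have "(\<Sum>i\<in>J - {v}. pr i (refl v x) * D'.P i l) =
   (\<Sum>i\<in>J - {v}. pr i x * refl v (P i) l) - pr v x * (\<Sum>i\<in>J - {v}. a i v * refl v (P i) l)"
   by (simp add: P' pr1 sum_subtractf sum_distrib_left algebra_simps)
  finally have 1: "D'.cox (refl v x) l = refl v x l + pr v x * unit v l - (\<Sum>i\<in>J - {v}. pr i x * refl v (P i) l)"
   by (simp add: P'v algebra_simps)
  have "refl v (cox x) = refl v (%l. x l - 1 * (\<Sum>i\<in>J. pr i x * P i l))" by (simp add: cox_def)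
  also have "\<dots> = (%l. refl v x l - (\<Sum>i\<in>J. pr i x * refl v (P i) l))"
   unfolding refl_lin by (simp add: refl_sum finJ refl_scale)
  finally have "refl v (cox x) l = refl v x l - (\<Sum>i\<in>J. pr i x * refl v (P i) l)" by simp
  also have "(\<Sum>i\<in>J. pr i x * refl v (P i) l) = - pr v x * unit v l + (\<Sum>i\<in>J - {v}. pr i x * refl v (P i) l)"
   by (subst sum.remove[OF finJ v]) (simp add: Pv rv)
  finally show "D'.cox (refl v x) l = refl v (cox x) l" using 1 by simp
 qed
 have P'v': "D'.P v = refl v (R 1 v)"
 proof -
  have "R 1 v l = - unit v l - (\<Sum>i\<in>J - {v}. a i v * P i l)" for l
  proof -
   have "(\<Sum>i\<in>abv v. a i v * P i l) = (\<Sum>i\<in>J - {v}. a i v * P i l)"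
    by (rule sum.mono_neutral_left) (use src finJ in "auto simp: abv_def")
   thus ?thesis using mesh[OF v, of 0 l] nb Pv by simp
  qed
  hence "R 1 v = (%l. - 1 * unit v l - 1 * (\<Sum>i\<in>J - {v}. a i v * P i l))" by auto
  hence "refl v (R 1 v) = refl v (%l. (- 1 * unit v l) - 1 * (\<Sum>i\<in>J - {v}. a i v * P i l))" by simp
  also have "\<dots> = (%l. - 1 * refl v (unit v) l - (\<Sum>i\<in>J - {v}. a i v * refl v (P i) l))"
   unfolding refl_lin refl_scale by (simp add: refl_sum finJ refl_scale)
  finally show ?thesis unfolding rv by (auto simp: P'v)
 qed
 have R'k: "D'.R t k = refl v (R t k)" if "k \<in> J" "k ~= v" for t k
  by (induction t) (simp_all add: P' that D'.R_Suc R_Suc cr)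
 have R'v: "D'.R t v = refl v (R (Suc t) v)" for t by (induction t) (simp_all add: P'v' D'.R_Suc R_Suc cr)
 \<comment> \<open>A reflected root stays nonnegative unless it is \<open>unit v = P v\<close>, and
   within the rows this occurs only as the first entry of row \<open>v\<close>.\<close>
 have nn: "nonneg (refl v (R s j))" if "s < rr j" "j \<in> J" "0 < s \<or> j ~= v" for s j
 proof (rule ccontr)
  assume "\<not> ?thesis"
  hence "R s j = P v" using refl_negative[OF dpos[OF that(2)] v root_R[OF that(2)] rr_pos[OF that(1)]] Pv by simp
  thus False using R_not_P[OF v, of s j] that P_inj[of j v] v by (cases "s = 0") auto
 qed
 have uv: "nonneg (unit v)" by (simp add: nonneg_def unit_def)
 have rm: "refl v (%l. - w l) = (%l. - refl v w l)" for w using refl_scale[of v "-1" w] by simp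
 have last: "refl v (R (Suc (rr j)) j) = (%l. - D'.P v l)" if "j \<in> J" "st j = v" for j
  using R_past[OF that(1), of 1] that P'v' by (simp add: rm)
 have rrv: "refl v (R (rr j) j) = unit v" if "j \<in> J" "st j = v" for j
  using R_rr[OF that(1)] that rv by (simp add: rm Pv)
 show "D'.st k = st k"
 proof (cases "k = v")
  case False
  show ?thesis
  proof (cases "st k = v")
   case False
   have "D'.R (rr k) k = (%l. - D'.P (st k) l)"
    using R'k[OF k \<open>k ~= v\<close>] R_rr[OF k] P'[OF st_J[OF k] False] by (simp add: rm)
   thus ?thesis by (rule D'.st_unique(2)[OF k st_J[OF k]]) (simp add: R'k k \<open>k ~= v\<close> nn)
  next
   case True
   have "D'.R (Suc (rr k)) k = (%l. - D'.P (st k) l)"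
    using R'k[OF k \<open>k ~= v\<close>] last[OF k True] True by simp
   thus ?thesis by (rule D'.st_unique(2)[OF k st_J[OF k]])
      (use nn k \<open>k ~= v\<close> uv rrv[OF k True] in "auto simp: R'k less_Suc_eq")
  qed
 next
  case True
  note r = rr_ge1[OF v]
  show ?thesis
  proof (cases "st v = v")
   case False
   have "D'.R (rr v - 1) v = (%l. - D'.P (st v) l)"
    using R'v[of "rr v - 1"] r R_rr[OF v] P'[OF st_J[OF v] False] by (simp add: rm)
   thus ?thesis unfolding True by (rule D'.st_unique(2)[OF v st_J[OF v]]) (simp add: R'v nn v)
  next
   case st: True
   have "D'.R (rr v) v = (%l. - D'.P (st v) l)" using R'v last[OF v st] st by simp
   moreover have "nonneg (D'.R s v)" if "s < rr v" for s
   proof (cases "Suc s = rr v")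
    case True thus ?thesis using rrv[OF v st] uv by (simp add: R'v)
   next
    case False thus ?thesis using nn[of "Suc s" v] v that by (simp add: R'v)
   qed
   ultimately show ?thesis unfolding True by (rule D'.st_unique(2)[OF v st_J[OF v]])
  qed
 qed
qed

text \<open>A lowest vertex \<open>v\<close> among those below their target is a source: a lower
  neighbour would already be at its target, too far from the target of \<open>v\<close>. Raising
  \<open>v\<close> by two is the move of \<open>st_flip\<close>, and by parity it does not
  overshoot.\<close>

lemma st_any_ht:
 assumes T: "dynkin J a d T" and g: "dynkin J a d g"
  and le: "!!k. k \<in> J ==> g k <= T k & even (T k - g k)" and out: "!!k. k \<notin> J ==> g k = T k"
  and k: "k \<in> J"
 shows "dynkin.st J a g k = dynkin.st J a T k" using g le out
proof (induction "\<Sum>k\<in>J. T k - g k" arbitrary: g rule: less_induct)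
 case less
 interpret T: dynkin J a d T by fact
 interpret G: dynkin J a d g by fact
 show ?case
 proof (cases "\<forall>k\<in>J. g k = T k")
  case True
  hence "g = T" using less(4) by (intro ext) blast
  thus ?thesis by simp
 next
  case False
  hence ne: "{k\<in>J. g k < T k} ~= {}" using less(3) by (force simp: le_less)
  obtain v where v: "v \<in> J" "g v < T v" and mn: "!!u. u \<in> J ==> g u < T u ==> g v <= g u"
  proof -
   let ?S = "{k\<in>J. g k < T k}"
   have "Min (g ` ?S) \<in> g ` ?S" by (rule Min_in) (use ne finJ in auto)
   then obtain v where "v \<in> ?S" "g v = Min (g ` ?S)" by force
   moreover have "Min (g ` ?S) <= g u" if "u \<in> ?S" for u by (rule Min_le) (use that finJ in auto)
   ultimately show ?thesis using that by auto
  qed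
  have ge2: "g v + 2 <= T v" using v less(3)[OF v(1)] by presburger
  have src: "g i = g v + 1" if "i \<in> J" "i ~= v" "a i v ~= 0" for i
  proof (rule ccontr)
   assume n: "g i ~= g v + 1"
   hence gi: "g v = g i + 1" using G.adj_ht[OF that(1) v(1) that(2,3)] by auto
   hence "g i = T i" using mn[OF that(1)] less(3)[OF that(1)] by fastforce
   thus False using T.adj_ht[OF that(1) v(1) that(2,3)] ge2 gi by auto
  qed
  define g' where "g' = g(v := g v + 2)"
  have D': "dynkin J a d g'" unfolding g'_def by (rule G.st_flip(1)[OF v(1) src])
  have "dynkin.st J a g' k = dynkin.st J a T k"
  proof (rule less(1)[OF _ D'])
   have "(\<Sum>k\<in>J. T k - g' k) < (\<Sum>k\<in>J. T k - g k)"
    by (rule sum_strict_mono_ex1) (use finJ v in "auto simp: g'_def")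
   thus "(\<Sum>k\<in>J. T k - g' k) < (\<Sum>k\<in>J. T k - g k)" .
   show "g' u <= T u & even (T u - g' u)" if "u \<in> J" for u
   proof (cases "u = v")
    case True
    have "even (T v - g v)" using less(3)[OF v(1)] by blast
    hence "even (T v - (g v + 2))" using ge2 by presburger
    thus ?thesis using True ge2 by (simp add: g'_def)
   qed (use less(3)[OF that] in "auto simp: g'_def")
  qed (use less(4) v in "auto simp: g'_def")
  moreover have "dynkin.st J a g' k = G.st k" unfolding g'_def by (rule G.st_flip(2)[OF v(1) src k])
  ultimately show ?thesis by simp
 qed
qed

text \<open>The involution property: \<open>st\<close> does not change when a source becomes a sink, and
 such moves lead to the opposite orientation, for which \<open>st\<close> is the inverse.\<close>

lemma st_st: assumes k: "k \<in> J" shows "st (st k) = k"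
proof -
 \<comment> \<open>This \<open>C\<close> is even and at least twice every height, so
   \<open>C - ht\<close> is a height function lying above \<open>ht\<close> with the same
   parity.\<close>
 define C where "C = 2 * (\<Sum>i\<in>J. ht i)"
 define T where "T = (%k. if k \<in> J then C - ht k else ht k)"
 have le: "2 * ht k <= C" if "k \<in> J" for k using member_le_sum[of k J ht] that finJ by (simp add: C_def)
 have ad: "T j = T i + 1 \<or> T i = T j + 1" if "i \<in> J" "j \<in> J" "i ~= j" "a i j ~= 0" for i j
  using adj_ht[OF that] le[OF that(1)] le[OF that(2)] that by (auto simp: T_def)
 have T: "dynkin J a d T" by (rule dynkin_change_ht) (use ad in auto)
 have g: "dynkin J a d ht" by unfold_locales
 have "even (T k - ht k)" if "k \<in> J" for k using le[OF that] that by (simp add: T_def C_def)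
 hence "st (st k) = dynkin.st J a T (st k)"
  by (intro st_any_ht[OF T g _ _ st_J[OF k]]) (use le in "force simp: T_def")+
 also have "\<dots> = k" by (rule st_reverse[OF T _ k, of C]) (use le in "force simp: T_def")
 finally show ?thesis .
qed

lemma rr_st: "k \<in> J ==> R (rr (st k)) (st k) = (%l. - P k l)" using R_rr[of "st k"] st_J st_st by simp

end

context dynkin
begin

subsection \<open>The index set and the compatibility degree\<close>

definition PI :: "(nat \<times> 'n) set" where "PI = {(t, k). k \<in> J & t <= rr k}"

lemma PI_iff: "(t, k) \<in> PI \<longleftrightarrow> k \<in> J & t <= rr k" by (simp add: PI_def)

lemma fin_PI: "finite PI"
proof (rule finite_subset)
 show "PI \<subseteq> {..Max (rr ` J)} \<times> J" using finJ by (auto simp: PI_def intro: order_trans[OF _ Max_ge])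
qed (simp add: finJ)

text \<open>By \<open>\<tau>\<close>-invariance the degree is read off a denominator vector: for \<open>s < t\<close> shift \<open>(s, j)\<close> to the
 initial cluster; for \<open>t < s\<close> use the symmetry up to the factors \<open>d\<close>.\<close>

definition md :: "nat \<times> 'n => nat \<times> 'n => nat" where
 "md q r = (case (q, r) of ((s, j), (t, k)) =>
   if s < t then nat (R (t - Suc s) k j)
   else if t < s then nat \<lfloor>d k * R (s - Suc t) j k / d j\<rfloor> else 0)"

text \<open>The degree without truncation and rounding, so that identities can be checked over the
  reals; it agrees with \<open>md\<close> on \<open>PI\<close> by \<open>md_real\<close>.\<close>

definition rmd :: "nat \<times> 'n => nat \<times> 'n => real" where
 "rmd q r = (case (q, r) of ((s, j), (t, k)) =>
   if s < t then R (t - Suc s) k j else if t < s then d k * R (s - Suc t) j k / d j else 0)"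

lemma md_real: assumes "q \<in> PI" "r \<in> PI" shows "real (md q r) = rmd q r"
proof -
 obtain s j t k where e: "q = (s, j)" "r = (t, k)" by (cases q, cases r)
 have jk: "j \<in> J" "k \<in> J" "s <= rr j" "t <= rr k" using assms by (auto simp: e PI_iff)
 consider "s < t" | "s = t" | "t < s" by linarith
 thus ?thesis
 proof cases
  case 1
  have "t - Suc s < rr k" using 1 jk by simp
  hence "0 <= R (t - Suc s) k j" by (rule R_nonneg)
  thus ?thesis using 1 by (simp add: e md_def rmd_def)
 next
  case 3
  have "\<forall>i\<in>J. \<exists>n::int. d i * R (s - Suc t) j i = d j * n" using root_R[OF jk(1)] by (simp add: root_def)
  then obtain n :: int where n: "d k * R (s - Suc t) j k = d j * n" using jk by blast
  have "s - Suc t < rr j" using 3 jk by simp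
  hence "0 <= R (s - Suc t) j k" by (rule R_nonneg)
  hence "0 <= d j * real_of_int n" using dpos[OF jk(2)] by (simp flip: n)
  hence "0 <= n" using dpos[OF jk(1)] by (simp add: zero_le_mult_iff)
  thus ?thesis using 3 n dpos[OF jk(1)] by (simp add: e md_def rmd_def)
 qed (simp add: e md_def rmd_def)
qed

lemma md_self [simp]: "md r r = 0" by (cases r) (simp add: md_def)

lemma rmd_sym: assumes "q \<in> PI" "r \<in> PI"
 shows "d (snd q) * rmd q r = d (snd r) * rmd r q"
proof -
 obtain s j t k where e: "q = (s, j)" "r = (t, k)" by (cases q, cases r)
 have "d j > 0" "d k > 0" using assms by (auto simp: e PI_iff dpos)
 thus ?thesis by (auto simp: e rmd_def not_less)
qed

lemma md_zero_sym: assumes "q \<in> PI" "r \<in> PI" shows "md q r = 0 \<longleftrightarrow> md r q = 0"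
proof -
 have "d (snd q) > 0" "d (snd r) > 0" using assms by (auto simp: PI_def dpos)
 hence "rmd q r = 0 \<longleftrightarrow> rmd r q = 0" using rmd_sym[OF assms] by auto
 thus ?thesis using md_real[OF assms] md_real[OF assms(2,1)] by (metis of_nat_eq_0_iff)
qed

definition tauD :: "nat \<times> 'n => nat \<times> 'n" where
 "tauD r = (case r of (t, k) => if t = 0 then (rr (st k), st k) else (t - 1, k))"

lemma tauD_PI: "r \<in> PI ==> tauD r \<in> PI" by (auto simp: tauD_def PI_def st_J split: prod.splits)

text \<open>The wrap-around of \<open>tauD\<close>. With \<open>l = st j\<close> this is
  \<open>R_dual\<close> as long as \<open>t < rr l\<close>; from \<open>t = rr l\<close> on,
  \<open>R_dual'\<close> equates nonnegative coordinates with opposite signs, so both sides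
  vanish.\<close>

lemma rmd_tau1:
 assumes jk: "j \<in> J" "k \<in> J" and t: "t < rr k"
 shows "rmd (rr (st j), st j) (t, k) = R t k j"
proof -
 define l where "l = st j"
 have l: "l \<in> J" "st l = j" using st_st st_J jk by (auto simp: l_def)
 have dl: "d l > 0" using dpos l by blast
 have p: "0 <= R t k j" using t by (rule R_nonneg)
 consider "t < rr l" | "t = rr l" | "rr l < t" by linarith
 thus ?thesis unfolding l_def[symmetric]
 proof cases
  case 1
  thus "rmd (rr l, l) (t, k) = R t k j" using R_dual[OF l(1) jk(2) 1] dl l by (simp add: rmd_def field_simps)
 next
  case 2
  have "R t k j = - R 0 k l" using R_dual'[OF l(1) jk(2), of 0] l 2 by simp
  hence "R t k j = 0" using p P_nonneg[OF jk(2), of l] by simp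
  thus "rmd (rr l, l) (t, k) = R t k j" using 2 by (simp add: rmd_def)
 next
  case 3
  have "R t k j = - R (t - rr l) k l" using R_dual'[OF l(1) jk(2), of "t - rr l"] l 3 by simp
  moreover have "0 <= R (t - rr l) k l" using t by (intro R_nonneg) simp
  ultimately have z: "R t k j = 0" using p by simp
  have "R (t - 1) k j = - R (t - Suc (rr l)) k l" using R_dual'[OF l(1) jk(2), of "t - Suc (rr l)"] l 3 by simp
  moreover have "0 <= R (t - Suc (rr l)) k l" "0 <= R (t - 1) k j" using t by (auto intro!: R_nonneg)
  ultimately have "R (t - Suc (rr l)) k l = 0" by simp
  thus "rmd (rr l, l) (t, k) = R t k j" using z 3 by (simp add: rmd_def)
 qed
qed

lemma rmd_tau2:
 assumes jk: "j \<in> J" "k \<in> J"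
 shows "rmd (rr (st j), st j) (rr (st k), st k) = 0"
proof -
 have *: "R (rr m - Suc (rr l)) m l = 0" if "l \<in> J" "m \<in> J" "rr l < rr m" for l m
 proof -
  have "R (rr m - 1) m (st l) = - R (rr m - Suc (rr l)) m l" using R_dual'[OF that(1,2), of "rr m - Suc (rr l)"] that by simp
  moreover have "0 <= R (rr m - Suc (rr l)) m l" "0 <= R (rr m - 1) m (st l)" using that by (auto intro!: R_nonneg)
  ultimately show ?thesis by simp
 qed
 show ?thesis using *[of "st j" "st k"] *[of "st k" "st j"] st_J jk by (auto simp: rmd_def)
qed

lemma rmd_tau: assumes "q \<in> PI" "r \<in> PI" shows "rmd (tauD q) (tauD r) = rmd q r"
proof -
 obtain s j t k where e: "q = (s, j)" "r = (t, k)" by (cases q, cases r)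
 have jk: "j \<in> J" "k \<in> J" "s <= rr j" "t <= rr k" using assms by (auto simp: e PI_iff)
 consider "s = 0" "t = 0" | "s = 0" "t > 0" | "s > 0" "t = 0" | "s > 0" "t > 0" by blast
 thus ?thesis
 proof cases
  case 1 thus ?thesis using rmd_tau2 jk by (simp add: e tauD_def rmd_def)
 next
  case 2
  hence "t - 1 < rr k" using jk by simp
  thus ?thesis using rmd_tau1[OF jk(1,2)] 2 by (simp add: e tauD_def rmd_def)
 next
  case 3
  hence "s - 1 < rr j" using jk by simp
  hence "rmd (tauD r) (tauD q) = rmd r q" using rmd_tau1[OF jk(2,1)] 3 by (simp add: e tauD_def rmd_def)
  moreover have "d (snd (tauD q)) = d j" "d (snd (tauD r)) = d k" using d_st jk by (auto simp: e tauD_def)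
  moreover have "d j > 0" using jk dpos by blast
  ultimately have "d j * rmd (tauD q) (tauD r) = d j * rmd q r"
   using rmd_sym[OF assms] rmd_sym[OF tauD_PI[OF assms(1)] tauD_PI[OF assms(2)]] by (simp add: e)
  thus ?thesis using \<open>d j > 0\<close> by simp
 next
  case 4 thus ?thesis by (auto simp: e tauD_def rmd_def)
 qed
qed

lemma md_tau: assumes "q \<in> PI" "r \<in> PI" shows "md (tauD q) (tauD r) = md q r"
 using rmd_tau[OF assms] md_real[OF assms] md_real[OF tauD_PI[OF assms(1)] tauD_PI[OF assms(2)]]
 by (metis of_nat_eq_iff)

definition tauI :: "nat \<times> 'n => nat \<times> 'n" where
 "tauI r = (case r of (t, k) => if t = rr k then (0, st k) else (t + 1, k))"

lemma tauI_PI: "r \<in> PI ==> tauI r \<in> PI" by (auto simp: tauI_def PI_def st_J split: prod.splits)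
lemma tau_tauI: "r \<in> PI ==> tauD (tauI r) = r" by (auto simp: tauI_def tauD_def PI_def st_st split: prod.splits)
lemma tauI_tau: "r \<in> PI ==> tauI (tauD r) = r" by (auto simp: tauI_def tauD_def PI_def st_st split: prod.splits)

text \<open>The root of a cluster variable: minus its denominator vector, where the initial variables
 carry \<open>- P\<close> rather than a negative simple root.\<close>

definition rho :: "nat \<times> 'n => 'n => int" where
 "rho r = (case r of (t, k) => if t = 0 then (%l. - P k l) else R (t - 1) k)"

lemma rho_0: "rho (0, k) = (%l. - P k l)" and rho_Suc: "rho (Suc t, k) = R t k" by (auto simp: rho_def)

lemma md_0: "j \<in> J ==> (Suc t, k) \<in> PI ==> real (md (0, j) (Suc t, k)) = R t k j"
 by (subst md_real) (auto simp: PI_iff rmd_def)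
lemma md_0': "j \<in> J ==> (Suc t, k) \<in> PI ==> real (md (Suc t, k) (0, j)) = d j * R t k j / d k"
 by (subst md_real) (auto simp: PI_iff rmd_def)
lemma md_00: "md (0, j) (0, k) = 0" by (simp add: md_def)

text \<open>The two summands are extension dimensions in the two directions, and at most one of them
  is nonzero. Only the roots and the Euler form enter, so the value is unchanged when the roots are
  viewed in a larger diagram.\<close>

lemma md_eul:
 assumes "(Suc s, j) \<in> PI" "(Suc t, k) \<in> PI"
 shows "d j * real (md (Suc s, j) (Suc t, k)) = max 0 (- eul (R s j) (R t k)) + max 0 (- eul (R t k) (R s j))"
proof -
 have jk: "j \<in> J" "k \<in> J" "s < rr j" "t < rr k" using assms by (auto simp: PI_iff)
 have dj: "d j > 0" "d k > 0" using jk dpos by auto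
 consider "s < t" | "s = t" | "t < s" by linarith
 thus ?thesis
 proof cases
  case 1
  have "eul (R t k) (R s j) = - (d j * R (t - Suc s) k j)" using eul_RR'[OF jk(1), of s "t - Suc s" k] 1 by simp
  moreover have "eul (R s j) (R t k) = d j * R (t - s) k j" using eul_RR[OF jk(1), of s "t - s" k] 1 by simp
  moreover have "0 <= R (t - s) k j" "0 <= R (t - Suc s) k j" using jk by (auto intro!: R_nonneg)
  ultimately show ?thesis using dj 1 by (subst md_real[OF assms]) (auto simp: rmd_def max_def mult_le_0_iff)
 next
  case 2
  have "eul (R s j) (R t k) = d j * P k j" "eul (R t k) (R s j) = d k * P j k"
   using eul_RR[OF jk(1), of s 0 k] eul_RR[OF jk(2), of s 0 j] 2 by auto
  moreover have "0 <= d j * real_of_int (P k j)" "0 <= d k * real_of_int (P j k)" using dj P_nonneg jk by auto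
  ultimately show ?thesis using 2 by (subst md_real[OF assms]) (simp add: rmd_def)
 next
  case 3
  have "eul (R s j) (R t k) = - (d k * R (s - Suc t) j k)" using eul_RR'[OF jk(2), of t "s - Suc t" j] 3 by simp
  moreover have "eul (R t k) (R s j) = d k * R (s - t) j k" using eul_RR[OF jk(2), of t "s - t" j] 3 by simp
  moreover have "0 <= R (s - t) j k" "0 <= R (s - Suc t) j k" using jk by (auto intro!: R_nonneg)
  ultimately show ?thesis using dj 3 by (subst md_real[OF assms]) (auto simp: rmd_def max_def mult_le_0_iff)
 qed
qed

definition compat :: "(nat \<times> 'n) set => bool" where
 "compat F \<longleftrightarrow> F \<subseteq> PI & (\<forall>q\<in>F. \<forall>r\<in>F. md q r = 0)"

lemma compat_finite: "compat F ==> finite F" using fin_PI finite_subset by (auto simp: compat_def)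

lemma compat_tauD: "compat F ==> compat (tauD ` F)" unfolding compat_def by (auto simp: tauD_PI md_tau subset_iff)
lemma md_tauI: "q \<in> PI ==> r \<in> PI ==> md (tauI q) (tauI r) = md q r"
 using md_tau[of "tauI q" "tauI r"] by (simp add: tauI_PI tau_tauI)
lemma compat_tauI: "compat F ==> compat (tauI ` F)" unfolding compat_def by (auto simp: tauI_PI md_tauI subset_iff)

end

section \<open>Subdiagrams and links of initial variables\<close>

context dynkin
begin

lemma sum_zero_out:
 fixes f :: "'n => 'b::comm_monoid_add"
 assumes "J' \<subseteq> J" "!!k. k \<in> J - J' ==> f k = 0"
 shows "(\<Sum>k\<in>J. f k) = (\<Sum>k\<in>J'. f k)" by (rule sum.mono_neutral_right) (use assms finJ in auto)

lemma sub_dynkin: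
 assumes sub: "J' \<subseteq> J"
 shows "dynkin J' a d ht"
proof
 show "finite J'" using sub finJ finite_subset by blast
 obtain \<kappa> where k: "\<kappa> > 0" "\<forall>v::'n => real. (\<Sum>i\<in>J. \<Sum>j\<in>J. v i * (d i * a i j) * v j) \<ge> \<kappa> * (\<Sum>i\<in>J. (v i)\<^sup>2)"
  using pdef by blast
 show "\<exists>\<kappa>>0. \<forall>v::'n => real. \<kappa> * (\<Sum>i\<in>J'. (v i)\<^sup>2) <= (\<Sum>i\<in>J'. \<Sum>j\<in>J'. v i * (d i * a i j) * v j)"
 proof (intro exI[of _ \<kappa>] conjI allI k(1))
  fix v :: "'n => real"
  let ?w = "%l. if l \<in> J' then v l else 0"
  have 1: "(\<Sum>j\<in>J. ?w i * (d i * a i j) * ?w j) = (\<Sum>j\<in>J'. ?w i * (d i * a i j) * ?w j)" for i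
   by (rule sum_zero_out[OF sub]) auto
  have "(\<Sum>i\<in>J. \<Sum>j\<in>J. ?w i * (d i * a i j) * ?w j) = (\<Sum>i\<in>J'. \<Sum>j\<in>J'. v i * (d i * a i j) * v j)"
   unfolding 1 by (subst sum_zero_out[OF sub]) (auto intro!: sum.cong)
  moreover have "(\<Sum>i\<in>J. (?w i)\<^sup>2) = (\<Sum>i\<in>J'. (v i)\<^sup>2)"
   by (subst sum_zero_out[OF sub]) (auto intro!: sum.cong)
  ultimately show "\<kappa> * (\<Sum>i\<in>J'. (v i)\<^sup>2) <= (\<Sum>i\<in>J'. \<Sum>j\<in>J'. v i * (d i * a i j) * v j)"
   using k(2)[rule_format, of ?w] by simp
 qed
 show "a i i = 2" "0 < d i" if "i \<in> J'" for i using diag dpos sub that by blast+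
 fix i j assume ij: "i \<in> J'" "j \<in> J'"
 hence ij': "i \<in> J" "j \<in> J" using sub by auto
 show "d i * a i j = d j * a j i" by (rule symd[OF ij'])
 show "a i j <= 0" if "i ~= j" by (rule offd[OF ij' that])
 show "ht j = ht i + 1 \<or> ht i = ht j + 1" if "i ~= j" "a i j ~= 0" by (rule adj_ht[OF ij' that])
qed

lemma sub_eul:
 assumes sub: "J' \<subseteq> J" and u: "!!l. l \<notin> J' ==> u l = 0" and v: "!!l. l \<notin> J' ==> v l = 0"
 shows "dynkin.eul J' a d ht u v = eul u v"
proof -
 interpret D': dynkin J' a d ht by (rule sub_dynkin[OF sub])
 have "(\<Sum>i\<in>D'.bel k. d k * a k i * v i) = (\<Sum>i\<in>bel k. d k * a k i * v i)" for k
  by (rule sum.mono_neutral_left) (use sub v in "auto simp: D'.bel_def bel_def finJ")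
 thus ?thesis unfolding D'.eul_def eul_def using u by (subst sum_zero_out[OF sub]) auto
qed

lemma sub_root:
 assumes sub: "J' \<subseteq> J"
 shows "dynkin.root J' a d k v \<longleftrightarrow> root k v & (\<forall>l\<in>J - J'. v l = 0)"
proof -
 interpret D': dynkin J' a d ht by (rule sub_dynkin[OF sub])
 have s: "D'.supp v \<longleftrightarrow> supp v & (\<forall>l\<in>J - J'. v l = 0)" using sub by (auto simp: D'.supp_def supp_def)
 show ?thesis
 proof (cases "D'.supp v")
  case True
  hence "!!l. l \<notin> J' ==> v l = 0" by (simp add: D'.supp_def)
  hence e: "D'.sf v v = sf v v" using sub_eul[OF sub, of v v] by (simp add: D'.sf_eul sf_eul)
  have z: "\<exists>n::int. d j * v j = d k * n" if "j \<in> J - J'" for j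
   by (rule exI[of _ 0]) (use True s that in auto)
  have "(\<forall>j\<in>J'. \<exists>n::int. d j * v j = d k * n) \<longleftrightarrow> (\<forall>j\<in>J. \<exists>n::int. d j * v j = d k * n)"
   using z sub by blast
  thus ?thesis using True s e unfolding D'.root_def root_def by simp
 qed (use s in "auto simp: D'.root_def root_def")
qed

text \<open>Cluster variables of a subdiagram, viewed as the cluster variables with the same root.\<close>

definition emb :: "'n set => nat \<times> 'n => nat \<times> 'n" where
 "emb J' r = (if fst r = 0 then r
   else SOME r'. r' \<in> PI & 0 < fst r' & rho r' = dynkin.rho J' a ht r)"

lemma d_root_eq: "0 < d k ==> k' \<in> J ==> root k (R t k') ==> d k = d k'"
 using root_R[of k' t] by (simp add: root_def)

text \<open>A positive root of the subdiagram is a positive root for \<open>J\<close> and so occurs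
  in its rows by \<open>root_enum\<close>, in general at another time and another vertex.\<close>

lemma emb_Suc:
 assumes sub: "J' \<subseteq> J" and g: "(Suc t, k) \<in> dynkin.PI J' a ht"
 shows "\<exists>s l. emb J' (Suc t, k) = (Suc s, l) & (Suc s, l) \<in> PI & R s l = dynkin.R J' a ht t k & d l = d k"
proof -
 interpret D': dynkin J' a d ht by (rule sub_dynkin[OF sub])
 have k: "k \<in> J'" "t < D'.rr k" using g by (auto simp: D'.PI_iff)
 have r: "root k (D'.R t k)" using D'.root_R[OF k(1)] sub_root[OF sub] by blast
 have dk: "0 < d k" using k sub dpos by auto
 have "nonneg (D'.R t k)" using D'.R_nonneg[OF k(2)] by (simp add: nonneg_def)
 then obtain l s where l: "l \<in> J" "s < rr l" "D'.R t k = R s l" using root_enum[OF dk r] by blast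
 define g where "g = emb J' (Suc t, k)"
 have "\<exists>r'. r' \<in> PI & 0 < fst r' & rho r' = D'.rho (Suc t, k)"
  by (rule exI[of _ "(Suc s, l)"]) (use l in "simp add: PI_iff rho_Suc D'.rho_Suc")
 from someI_ex[OF this] have "g \<in> PI & 0 < fst g & rho g = D'.rho (Suc t, k)"  by (simp add: g_def emb_def)
 moreover obtain s' l' where "g = (s', l')" by (cases g)
 ultimately have g': "g = (Suc (s' - 1), l')" "(Suc (s' - 1), l') \<in> PI" "R (s' - 1) l' = D'.R t k"
  by (auto simp: rho_def D'.rho_def)
 have "d l' = d k" using d_root_eq[OF dk, of l' "s' - 1"] r g' by (simp add: PI_iff)
 thus ?thesis using g' unfolding g_def[symmetric] by blast
qed

lemma emb_0 [simp]: "emb J' (0, k) = (0, k)" by (simp add: emb_def)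

lemma emb_PI:
 assumes sub: "J' \<subseteq> J" and g: "r \<in> dynkin.PI J' a ht"
 shows "emb J' r \<in> PI" "d (snd (emb J' r)) = d (snd r)"
proof -
 interpret D': dynkin J' a d ht by (rule sub_dynkin[OF sub])
 obtain t k where e: "r = (t, k)" by (cases r)
 have "emb J' r \<in> PI & d (snd (emb J' r)) = d (snd r)"
 proof (cases t)
  case 0
  thus ?thesis using g sub by (auto simp: e D'.PI_iff PI_iff)
 next
  case (Suc s)
  thus ?thesis using emb_Suc[OF sub, of s k] g by (metis e snd_conv)
 qed
 thus "emb J' r \<in> PI" "d (snd (emb J' r)) = d (snd r)" by auto
qed

lemma emb_inj:
 assumes sub: "J' \<subseteq> J"
 shows "inj_on (emb J') (dynkin.PI J' a ht)"
proof (rule inj_onI)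
 interpret D': dynkin J' a d ht by (rule sub_dynkin[OF sub])
 fix x y assume xy: "x \<in> D'.PI" "y \<in> D'.PI" "emb J' x = emb J' y"
 obtain t k t' k' where e: "x = (t, k)" "y = (t', k')" by (cases x, cases y)
 show "x = y"
 proof (cases t)
  case 0
  show ?thesis
  proof (cases t')
   case (Suc s') thus ?thesis using emb_Suc[OF sub, of s' k'] xy 0 by (auto simp: e)
  qed (use xy 0 in "simp add: e")
 next
  case (Suc s)
  obtain s1 l1 where 1: "emb J' x = (Suc s1, l1)" "R s1 l1 = D'.R s k" using emb_Suc[OF sub, of s k] xy Suc by (auto simp: e)
  hence "t' ~= 0" using xy by (cases t') (auto simp: e)
  then obtain s' where s': "t' = Suc s'" by (cases t') auto
  obtain s2 l2 where 2: "emb J' y = (Suc s2, l2)" "R s2 l2 = D'.R s' k'" using emb_Suc[OF sub, of s' k'] xy s' by (auto simp: e)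
  have "D'.R s k = D'.R s' k'" using 1 2 xy by simp
  thus ?thesis using D'.R_eq_cases[of k k' s s'] xy Suc s' by (auto simp: e D'.PI_iff)
 qed
qed

lemma emb_md:
 assumes sub: "J' \<subseteq> J" and w: "q \<in> dynkin.PI J' a ht" and g: "r \<in> dynkin.PI J' a ht"
 shows "md (emb J' q) (emb J' r) = dynkin.md J' a d ht q r"
proof -
 interpret D': dynkin J' a d ht by (rule sub_dynkin[OF sub])
 obtain s j t k where e: "q = (s, j)" "r = (t, k)" by (cases q, cases r)
 have jk: "j \<in> J'" "k \<in> J'" using w g by (auto simp: e D'.PI_iff)
 hence jkJ: "j \<in> J" "k \<in> J" using sub by auto
 have z: "D'.R t k l = 0" if "l \<notin> J'" "k \<in> J'" for t k l using D'.supp_R[OF that(2)] that(1) by (simp add: D'.supp_def)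
 consider "s = 0" "t = 0" | t' where "s = 0" "t = Suc t'" | s' where "s = Suc s'" "t = 0" | s' t' where "s = Suc s'" "t = Suc t'"
  by (cases s; cases t) auto
 thus ?thesis
 proof cases
  case 1 thus ?thesis by (simp add: e md_00 D'.md_00)
 next
  case 2
  obtain s1 l1 where 1: "emb J' (Suc t', k) = (Suc s1, l1)" "(Suc s1, l1) \<in> PI" "R s1 l1 = D'.R t' k"
   using emb_Suc[OF sub, of t' k] g 2 by (auto simp: e)
  have "real (md (0, j) (Suc s1, l1)) = real (D'.md (0, j) (Suc t', k))"
   using md_0[OF jkJ(1) 1(2)] D'.md_0[OF jk(1)] g 2 1(3) by (simp add: e)
  thus ?thesis using 1 2 by (simp add: e)
 next
  case 3
  obtain s1 l1 where 1: "emb J' (Suc s', j) = (Suc s1, l1)" "(Suc s1, l1) \<in> PI" "R s1 l1 = D'.R s' j" "d l1 = d j"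
   using emb_Suc[OF sub, of s' j] w 3 by (auto simp: e)
  have "real (md (Suc s1, l1) (0, k)) = real (D'.md (Suc s', j) (0, k))"
   using md_0'[OF jkJ(2) 1(2)] D'.md_0'[OF jk(2)] w 3 1(3,4) by (simp add: e)
  thus ?thesis using 1 3 by (simp add: e)
 next
  case 4
  obtain s1 l1 where 1: "emb J' (Suc s', j) = (Suc s1, l1)" "(Suc s1, l1) \<in> PI" "R s1 l1 = D'.R s' j" "d l1 = d j"
   using emb_Suc[OF sub, of s' j] w 4 by (auto simp: e)
  obtain s2 l2 where 2: "emb J' (Suc t', k) = (Suc s2, l2)" "(Suc s2, l2) \<in> PI" "R s2 l2 = D'.R t' k" "d l2 = d k"
   using emb_Suc[OF sub, of t' k] g 4 by (auto simp: e)
  have "d l1 * real (md (Suc s1, l1) (Suc s2, l2)) = d j * real (D'.md (Suc s', j) (Suc t', k))"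
   using md_eul[OF 1(2) 2(2)] D'.md_eul[of s' j t' k] w g 4 z jk by (simp add: e 1(3) 2(3) sub_eul[OF sub])
  hence "real (md (Suc s1, l1) (Suc s2, l2)) = real (D'.md (Suc s', j) (Suc t', k))"
   using 1(4) dpos[OF jkJ(1)] by simp
  thus ?thesis using 1 2 4 by (simp add: e)
 qed
qed

text \<open>The degree of \<open>(0, i)\<close> with a root is the coordinate of the root at
  \<open>i\<close>, and this vanishes exactly for the roots of \<open>J - {i}\<close>. So the link
  of \<open>(0, i)\<close> is the index set of the smaller diagram.\<close>

lemma emb_image:
 assumes i: "i \<in> J"
 shows "emb (J - {i}) ` dynkin.PI (J - {i}) a ht = {r \<in> PI. r ~= (0, i) & md (0, i) r = 0}"
proof -
 have sub: "J - {i} \<subseteq> J" by auto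
 interpret D': dynkin "J - {i}" a d ht by (rule sub_dynkin[OF sub])
 show ?thesis
 proof (intro equalityI subsetI)
  fix y assume "y \<in> emb (J - {i}) ` D'.PI"
  then obtain t k where x: "(t, k) \<in> D'.PI" "y = emb (J - {i}) (t, k)" by auto
  have yPI: "y \<in> PI" using emb_PI[OF sub x(1)] x(2) by simp
  show "y \<in> {r \<in> PI. r ~= (0, i) & md (0, i) r = 0}"
  proof (cases t)
   case 0 thus ?thesis using x yPI by (auto simp: D'.PI_iff md_00)
  next
   case (Suc s)
   obtain s1 l1 where 1: "y = (Suc s1, l1)" "R s1 l1 = D'.R s k" using emb_Suc[OF sub, of s k] x Suc by auto
   have "D'.R s k i = 0" using D'.supp_R[of k s] x(1) by (auto simp: D'.supp_def D'.PI_iff)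
   hence "real (md (0, i) y) = 0" using md_0[OF i, of s1 l1] yPI 1 by simp
   thus ?thesis using yPI 1 by simp
  qed
 next
  fix y assume y: "y \<in> {r \<in> PI. r ~= (0, i) & md (0, i) r = 0}"
  obtain t k where e: "y = (t, k)" by (cases y)
  show "y \<in> emb (J - {i}) ` D'.PI"
  proof (cases t)
   case 0
   hence "(0, k) \<in> D'.PI" using y by (auto simp: e D'.PI_iff PI_iff)
   thus ?thesis using emb_0[of "J - {i}" k] e 0 by (metis imageI)
  next
   case (Suc s)
   hence k: "k \<in> J" "s < rr k" "(Suc s, k) \<in> PI" using y by (auto simp: e PI_iff)
   have "R s k i = 0" using md_0[OF i k(3)] y Suc by (simp add: e)
   hence r: "D'.root k (R s k)" using sub_root[OF sub] root_R[OF k(1)] by auto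
   have "D'.nonneg (R s k)" using R_nonneg[OF k(2)] by (simp add: D'.nonneg_def)
   then obtain l s' where l: "l \<in> J - {i}" "s' < D'.rr l" "R s k = D'.R s' l"
    using D'.root_enum[OF dpos[OF k(1)] r] by blast
   hence xP: "(Suc s', l) \<in> D'.PI" by (simp add: D'.PI_iff)
   obtain s1 l1 where 1: "emb (J - {i}) (Suc s', l) = (Suc s1, l1)" "(Suc s1, l1) \<in> PI" "R s1 l1 = D'.R s' l"
    using emb_Suc[OF sub xP] by metis
   have "(Suc s1, l1) = y" using R_eq_cases[of l1 k s1 s] 1 l k Suc by (auto simp: e PI_iff)
   thus ?thesis using 1 xP by (metis imageI)
  qed
 qed
qed

lemma compat_emb:
 assumes i: "i \<in> J" and F: "compat F" "(0, i) \<in> F"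
 obtains F' where "dynkin.compat (J - {i}) a d ht F'" "F = insert (0, i) (emb (J - {i}) ` F')"
  "(0, i) \<notin> emb (J - {i}) ` F'" "card F = Suc (card F')"
proof -
 have sub: "J - {i} \<subseteq> J" by auto
 interpret D': dynkin "J - {i}" a d ht by (rule sub_dynkin[OF sub])
 have "F - {(0, i)} \<subseteq> emb (J - {i}) ` D'.PI" using F by (auto simp: emb_image[OF i] compat_def)
 then obtain F' where F': "F' \<subseteq> D'.PI" "F - {(0, i)} = emb (J - {i}) ` F'" by (auto simp: subset_image_iff)
 have "D'.md q r = 0" if "q \<in> F'" "r \<in> F'" for q r
 proof -
  have "emb (J - {i}) q \<in> F" "emb (J - {i}) r \<in> F" using F'(2) that by blast+
  hence "md (emb (J - {i}) q) (emb (J - {i}) r) = 0" using F(1) by (auto simp: compat_def)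
  thus ?thesis using emb_md[OF sub, of q r] F'(1) that by auto
 qed
 hence c: "D'.compat F'" using F' by (auto simp: D'.compat_def)
 have "card (F - {(0, i)}) = card F'" using F' emb_inj[OF sub] by (simp add: card_image inj_on_subset)
 hence "card F = Suc (card F')" using F compat_finite[OF F(1)] by (metis card_Suc_Diff1)
 moreover have "F = insert (0, i) (emb (J - {i}) ` F')" using F' F by blast
 moreover have "(0, i) \<notin> emb (J - {i}) ` F'" using F' by blast
 ultimately show ?thesis using that c by blast
qed

lemma compat_emb':
 assumes i: "i \<in> J" and F: "dynkin.compat (J - {i}) a d ht F'"
 shows "compat (insert (0, i) (emb (J - {i}) ` F'))" "card (insert (0, i) (emb (J - {i}) ` F')) = Suc (card F')"
proof -
 have sub: "J - {i} \<subseteq> J" by auto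
 interpret D': dynkin "J - {i}" a d ht by (rule sub_dynkin[OF sub])
 have F'P: "F' \<subseteq> D'.PI" using F by (auto simp: D'.compat_def)
 have im: "emb (J - {i}) ` F' \<subseteq> {r \<in> PI. r ~= (0, i) & md (0, i) r = 0}"
  unfolding emb_image[OF i, symmetric] using F'P by (rule image_mono)
 have i0: "(0, i) \<in> PI" using i by (simp add: PI_iff)
 have *: "md (emb (J - {i}) q) (emb (J - {i}) r) = 0" if "q \<in> F'" "r \<in> F'" for q r
 proof -
  have "D'.md q r = 0" using F that unfolding D'.compat_def by blast
  moreover have "q \<in> D'.PI" "r \<in> D'.PI" using F'P that by blast+
  ultimately show ?thesis using emb_md[OF sub] by simp
 qed
 show "compat (insert (0, i) (emb (J - {i}) ` F'))"
 proof -
  have "md (0, i) r = 0 & md r (0, i) = 0 & r \<in> PI" if "r \<in> emb (J - {i}) ` F'" for r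
  proof -
   have g: "r \<in> PI" "md (0, i) r = 0" using im that by auto
   thus ?thesis using md_zero_sym[OF i0 g(1)] by simp
  qed
  note ** = this
  show ?thesis unfolding compat_def
  proof (intro conjI ballI)
   show "insert (0, i) (emb (J - {i}) ` F') \<subseteq> PI" using ** i0 by blast
   fix q r assume w: "q \<in> insert (0, i) (emb (J - {i}) ` F')" and g: "r \<in> insert (0, i) (emb (J - {i}) ` F')"
   consider "q = (0, i)" "r = (0, i)" | "q = (0, i)" "r \<in> emb (J - {i}) ` F'"
    | "q \<in> emb (J - {i}) ` F'" "r = (0, i)" | "q \<in> emb (J - {i}) ` F'" "r \<in> emb (J - {i}) ` F'"
    using w g by blast
   thus "md q r = 0"
   proof cases
    case 1 thus ?thesis by simp
   next
    case 2 thus ?thesis using **[of r] by simp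
   next
    case 3 thus ?thesis using **[of q] by simp
   next
    case 4 thus ?thesis by (elim imageE) (simp add: *)
   qed
  qed
 qed
 have "card (emb (J - {i}) ` F') = card F'" using emb_inj[OF sub] F'P by (simp add: card_image inj_on_subset)
 moreover have "(0, i) \<notin> emb (J - {i}) ` F'" using im by blast
 ultimately show "card (insert (0, i) (emb (J - {i}) ` F')) = Suc (card F')" using D'.compat_finite[OF F] by simp
qed

lemma tau_reach: "(t, k) \<in> PI ==> (tauD ^^ t) (t, k) = (0, k)"
proof (induction t)
 case (Suc t)
 have "tauD (Suc t, k) = (t, k)" by (simp add: tauD_def)
 hence "(tauD ^^ Suc t) (Suc t, k) = (tauD ^^ t) (t, k)" by (simp add: funpow_swap1)
 thus ?case using Suc by (simp add: PI_iff)
qed simp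

lemma compat_pow: "compat F ==> compat ((tauD ^^ n) ` F)"
proof (induction n)
 case (Suc n) thus ?case using compat_tauD[of "(tauD ^^ n) ` F"] by (simp add: image_image)
qed simp
lemma compat_powI: "compat F ==> compat ((tauI ^^ n) ` F)"
proof (induction n)
 case (Suc n) thus ?case using compat_tauI[of "(tauI ^^ n) ` F"] by (simp add: image_image)
qed simp

lemma powI_pow: "r \<in> PI ==> (tauI ^^ n) ((tauD ^^ n) r) = r"
proof (induction n arbitrary: r)
 case (Suc n)
 have "(tauI ^^ Suc n) ((tauD ^^ Suc n) r) = tauI ((tauI ^^ n) ((tauD ^^ n) (tauD r)))" by (simp add: funpow_swap1)
 thus ?case using Suc by (simp add: tauD_PI tauI_tau)
qed simp

lemma pow_powI: "r \<in> PI ==> (tauD ^^ n) ((tauI ^^ n) r) = r"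
proof (induction n arbitrary: r)
 case (Suc n)
 have "(tauD ^^ Suc n) ((tauI ^^ Suc n) r) = tauD ((tauD ^^ n) ((tauI ^^ n) (tauI r)))" by (simp add: funpow_swap1)
 thus ?case using Suc by (simp add: tauI_PI tau_tauI)
qed simp

lemma pow_image: "F \<subseteq> PI ==> (tauI ^^ n) ` ((tauD ^^ n) ` F) = F"
 by (auto simp: image_image powI_pow subset_iff intro!: image_eqI)

lemma pow_inj: "inj_on (tauD ^^ n) PI" by (rule inj_on_inverseI[of _ "tauI ^^ n"]) (rule powI_pow)
lemma powI_inj: "inj_on (tauI ^^ n) PI" by (rule inj_on_inverseI[of _ "tauD ^^ n"]) (rule pow_powI)

lemma card_pow: "F \<subseteq> PI ==> card ((tauD ^^ n) ` F) = card F" "F \<subseteq> PI ==> card ((tauI ^^ n) ` F) = card F"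
 by (auto intro!: card_image inj_on_subset[OF pow_inj] inj_on_subset[OF powI_inj])

end

text \<open>Rotation by \<open>tauD\<close> turns some member of \<open>F\<close> into an initial
  index \<open>(0, i)\<close>; the other members lie in its link, to which the induction on the
  number of vertices applies, and the result is rotated back. \<open>J\<close> is a variable here
  because the induction changes it.\<close>

lemma compat_extend_aux:
 fixes J :: "'n set"
 assumes "finite J" "dynkin J a d ht" "dynkin.compat J a d ht F"
 shows "\<exists>G. F \<subseteq> G & dynkin.compat J a d ht G & card G = card J" using assms
proof (induction "card J" arbitrary: J F)
 case 0
 then interpret D: dynkin J a d ht by simp
 have JE: "J = {}" using 0 by simp
 have "F \<subseteq> D.PI" using 0(4) unfolding D.compat_def by blast
 moreover have "D.PI = {}" unfolding D.PI_def using JE by simp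
 ultimately have "F = {}" by simp
 thus ?case using 0 JE by (intro exI[of _ "{}"]) simp
next
 case (Suc n)
 interpret D: dynkin J a d ht by fact
 have main: "\<exists>G. F \<subseteq> G & D.compat G & card G = card J" if F: "D.compat F" "(0, i) \<in> F" for F i
 proof -
  have i: "i \<in> J" using F by (auto simp: D.compat_def D.PI_def)
  have sub: "J - {i} \<subseteq> J" by auto
  interpret D': dynkin "J - {i}" a d ht by (rule D.sub_dynkin[OF sub])
  obtain F' where F': "D'.compat F'" "F = insert (0, i) (D.emb (J - {i}) ` F')" by (rule D.compat_emb[OF i F]) blast
  have "n = card (J - {i})" using Suc(2) i Suc(3) by simp
  then obtain G' where G': "F' \<subseteq> G'" "D'.compat G'" "card G' = card (J - {i})"
   using Suc(1)[OF _ _ D'.dynkin_axioms F'(1)] Suc(3) by auto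
  show ?thesis by (rule exI[of _ "insert (0, i) (D.emb (J - {i}) ` G')"])
     (use D.compat_emb'[OF i G'(2)] F' G' i Suc(2,3) in auto)
 qed
 show ?case
 proof (cases "F = {}")
  case True
  obtain i where "i \<in> J" using Suc(2) by fastforce
  hence "D.compat {(0, i)}" by (auto simp: D.compat_def D.PI_iff)
  thus ?thesis using main True by blast
 next
  case False
  then obtain t k where tk: "(t, k) \<in> F" by auto
  have FP: "F \<subseteq> D.PI" using Suc(5) by (auto simp: D.compat_def)
  have "(0, k) \<in> (D.tauD ^^ t) ` F" using tk FP D.tau_reach[of t k] by (metis imageI subsetD)
  then obtain G where G: "(D.tauD ^^ t) ` F \<subseteq> G" "D.compat G" "card G = card J"
   using main D.compat_pow[OF Suc(5)] by blast
  have "F = (D.tauI ^^ t) ` ((D.tauD ^^ t) ` F)" using D.pow_image[OF FP] by simp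
  hence "F \<subseteq> (D.tauI ^^ t) ` G" using G(1) by blast
  moreover have "card ((D.tauI ^^ t) ` G) = card J" using G D.card_pow by (auto simp: D.compat_def)
  ultimately show ?thesis using D.compat_powI[OF G(2)] by blast
 qed
qed

lemma (in dynkin) compat_extend: "compat F ==> \<exists>G. F \<subseteq> G & compat G & card G = card J"
 by (rule compat_extend_aux[OF finJ dynkin_axioms])

text \<open>The same descent to a link, but the member rotated to the initial slice has to differ
  from \<open>r\<close>, so that \<open>r\<close> survives in the link. If \<open>F = {r}\<close>,
  any other index can replace \<open>r\<close>.\<close>

lemma compat_flip_aux:
 fixes J :: "'n set"
 assumes "finite J" "dynkin J a d ht" "dynkin.compat J a d ht F" "card F = card J" "r \<in> F"
 shows "\<exists>r'. r' \<notin> F & dynkin.compat J a d ht (insert r' (F - {r}))" using assms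
proof (induction "card J" arbitrary: J F r)
 case 0
 then interpret D: dynkin J a d ht by simp
 have "F \<subseteq> D.PI" using 0(4) unfolding D.compat_def by blast
 moreover have "D.PI = {}" unfolding D.PI_def using 0 by simp
 ultimately show ?case using 0 by blast
next
 case (Suc n)
 interpret D: dynkin J a d ht by fact
 have finF: "finite F" using D.compat_finite Suc by blast
 have FP: "F \<subseteq> D.PI" using Suc(5) by (auto simp: D.compat_def)
 show ?case
 proof (cases "F = {r}")
  case True
  obtain t k where tk: "r = (t, k)" by (cases r)
  have k: "(t, k) \<in> D.PI" "k \<in> J" using True tk FP by (auto simp: D.PI_iff)
  have "D.rr k > 0" using D.rr_ge1 k by blast
  hence "(0, k) \<in> D.PI" "(1, k) \<in> D.PI" using k by (auto simp: D.PI_iff)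
  then obtain r' where "r' \<in> D.PI" "r' ~= r" using tk by (cases "t = 0") auto
  thus ?thesis using True by (intro exI[of _ r']) (auto simp: D.compat_def)
 next
  case False
  then obtain t k where tk: "(t, k) \<in> F" "(t, k) ~= r" using Suc(7) by auto
  let ?F = "(D.tauD ^^ t) ` F"
  have i0: "(0, k) \<in> ?F" using tk FP D.tau_reach[of t k] by (metis imageI subsetD)
  have k: "k \<in> J" using tk FP by (auto simp: D.PI_iff)
  have sub: "J - {k} \<subseteq> J" by auto
  interpret D': dynkin "J - {k}" a d ht by (rule D.sub_dynkin[OF sub])
  let ?e = "D.emb (J - {k})"
  obtain F' where F': "D'.compat F'" "?F = insert (0, k) (?e ` F')" "(0, k) \<notin> ?e ` F'" "card ?F = Suc (card F')"
   by (rule D.compat_emb[OF k D.compat_pow[OF Suc(5)] i0])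
  have "Suc (card F') = card J" using F'(4) D.card_pow(1)[OF FP, of t] Suc(6) by simp
   hence cF: "card F' = card (J - {k})" using k Suc(3) by simp
  have "(D.tauD ^^ t) r ~= (0, k)"
   using D.tau_reach[of t k] tk FP Suc(7) inj_onD[OF D.pow_inj[of t], of r "(t, k)"] by auto
  then obtain z where z: "z \<in> F'" "(D.tauD ^^ t) r = ?e z" using F' Suc(7) by blast
  have "n = card (J - {k})" using Suc(2) k Suc(3) by simp
  then obtain z' where z': "z' \<notin> F'" "D'.compat (insert z' (F' - {z}))"
   using Suc(1)[OF _ _ D'.dynkin_axioms F'(1) cF z(1)] Suc(3) by auto
  have FP': "F' \<subseteq> D'.PI" "z' \<in> D'.PI" using F' z' by (auto simp: D'.compat_def)
  note inj = D.emb_inj[OF sub]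
  define G where "G = insert (0, k) (?e ` insert z' (F' - {z}))"
  have G: "D.compat G" unfolding G_def by (rule D.compat_emb'[OF k z'(2)])
  have eP: "?e z' \<in> D.PI" using D.emb_PI[OF sub FP'(2)] by simp
  define r' where "r' = (D.tauI ^^ t) (?e z')"
  have n1: "?e z' \<notin> ?F"
  proof
   assume "?e z' \<in> ?F"
   hence "?e z' \<in> ?e ` F' \<or> ?e z' = (0, k)" using F' by blast
   moreover have "?e z' ~= (0, k)" using D.emb_image[OF k] FP' by blast
   ultimately show False using inj_on_image_mem_iff[OF inj FP'(2) FP'(1)] z' by blast
  qed
  have "r' \<notin> F" using n1 D.pow_powI[OF eP, of t] unfolding r'_def by (metis imageI)
  moreover have "insert r' (F - {r}) = (D.tauI ^^ t) ` G"
  proof -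
   have "?e ` insert z' (F' - {z}) = insert (?e z') (?e ` F' - {?e z})"
    using inj_on_image_set_diff[OF inj, of F' "{z}"] FP' z(1) by auto
   hence "G = insert (?e z') (?F - {(D.tauD ^^ t) r})" unfolding G_def F'(2) using F'(3) z by auto
   moreover have "?F - {(D.tauD ^^ t) r} = (D.tauD ^^ t) ` (F - {r})"
    using inj_on_image_set_diff[OF D.pow_inj, of F "{r}" t] FP Suc(7) by auto
   ultimately show ?thesis unfolding r'_def using D.pow_image[of "F - {r}" t] FP by auto
  qed
  ultimately show ?thesis using D.compat_powI[OF G, of t] by metis
 qed
qed

lemma (in dynkin) compat_flip:
 "compat F ==> card F = card J ==> r \<in> F ==> \<exists>r'. r' \<notin> F & compat (insert r' (F - {r}))"
 by (rule compat_flip_aux[OF finJ dynkin_axioms])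

section \<open>Laurent monomials and the evaluation of Laurent polynomials\<close>

definition mon :: "('n::finite => 'f::field) => ('n => int) => 'f" where
 "mon x m = (\<Prod>i\<in>UNIV. x i powi m i)"

lemma mon_0 [simp]: "mon x (%_. 0) = 1" by (simp add: mon_def)
lemma mon_nz: "(!!i. x i ~= 0) ==> mon x m ~= 0" by (simp add: mon_def power_int_not_zero)
lemma mon_add: "(!!i. x i ~= 0) ==> mon x (%i. m i + m' i) = mon x m * mon x m'"
 by (simp add: mon_def power_int_add prod.distrib)
lemma mon_minus: "mon x (%i. - m i) = inverse (mon x m)"
 by (simp add: mon_def power_int_minus prod_inversef[unfolded comp_def])
lemma mon_diff: "(!!i. x i ~= 0) ==> mon x (%i. m i - m' i) = mon x m / mon x m'"
 using mon_add[of x m "%i. - m' i"] by (simp add: mon_minus divide_inverse)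
lemma mon_sum: "(!!i. x i ~= 0) ==> mon x (%l. \<Sum>i\<in>S. m i l) = (\<Prod>i\<in>S. mon x (m i))"
 by (induction S rule: infinite_finite_induct) (simp_all add: mon_add)
lemma mon_scale: "mon x (%l. c * m l) = mon x m powi c"
proof -
 have "(\<Prod>i\<in>S. x i powi m i) powi c = (\<Prod>i\<in>S. (x i powi m i) powi c)" for S
  by (induction S rule: infinite_finite_induct) (simp_all add: power_int_mult_distrib)
 thus ?thesis unfolding mon_def by (simp add: power_int_mult mult.commute[of c])
qed
lemma mon_unit: "mon x (%l. of_bool (l = i)) = x i"
proof -
 have "(\<Prod>l\<in>UNIV. x l powi of_bool (l = i)) = (\<Prod>l\<in>UNIV. if l = i then x i else 1)"
  by (rule prod.cong) auto
 thus ?thesis by (simp add: mon_def)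
qed
lemma mon_pos: "(!!i. (x i :: real) > 0) ==> mon x m > 0" by (simp add: mon_def prod_pos)

definition pm :: "('n::finite => int) => ('n \<Rightarrow>\<^sub>0 int)" where "pm m = Abs_poly_mapping m"

lemma lookup_pm [simp]: "lkp (pm m) = m" by (simp add: pm_def)
lemma pm_lookup [simp]: "pm (lkp m) = m" by (rule poly_mapping_eqI) simp
lemma lookup_0: "lkp 0 = (%_. 0)" by (rule ext) simp
lemma single_nz: "pms m (1::'k::zero_neq_one) ~= 0" by (metis lookup_single_eq lookup_zero zero_neq_one)

locale ring_hom =
 fixes \<psi> :: "'k::comm_ring_1 => 'f::comm_ring_1"
 assumes h0 [simp]: "\<psi> 0 = 0" and h1 [simp]: "\<psi> 1 = 1"
  and hadd: "\<psi> (a + b) = \<psi> a + \<psi> b" and hmult: "\<psi> (a * b) = \<psi> a * \<psi> b"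
begin
lemma hsum: "\<psi> (sum f S) = (\<Sum>i\<in>S. \<psi> (f i))"
 by (induction S rule: infinite_finite_induct) (simp_all add: hadd)
lemma hprod: "\<psi> (prod f S) = (\<Prod>i\<in>S. \<psi> (f i))"
 by (induction S rule: infinite_finite_induct) (simp_all add: hmult)
lemma hpow: "\<psi> (a ^ n) = \<psi> a ^ n" by (induction n) (simp_all add: hmult)
lemma hminus: "\<psi> (- a) = - \<psi> a" using hadd[of a "- a"] by (simp add: add_eq_0_iff)
end

locale fhom = ring_hom \<psi> for \<psi> :: "'k::comm_ring_1 => 'f::field"

definition lev :: "('k::comm_ring_1 => 'f::field) => ('n::finite => 'f) => ('n, 'k) laurent => 'f" where
 "lev \<psi> x L = (\<Sum>m\<in>kys L. \<psi> (lkp L m) * mon x (lkp m))"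

lemma lev_superset:
 assumes "\<psi> 0 = 0" "finite S" "kys L \<subseteq> S"
 shows "lev \<psi> x L = (\<Sum>m\<in>S. \<psi> (lkp L m) * mon x (lkp m))"
 unfolding lev_def by (rule sum.mono_neutral_left) (use assms in "auto simp: in_keys_iff")

lemma (in fhom) lev_0 [simp]: "lev \<psi> x 0 = 0" by (simp add: lev_def)

lemma (in fhom) lev_single: "lev \<psi> x (pms m c) = \<psi> c * mon x (lkp m)"
 by (subst lev_superset[of _ "{m}"]) auto

lemma (in fhom) lev_add: "lev \<psi> x (L + M) = lev \<psi> x L + lev \<psi> x M"
proof -
 let ?S = "kys L \<union> kys M"
 have "lev \<psi> x (L + M) = (\<Sum>m\<in>?S. \<psi> (lkp (L + M) m) * mon x (lkp m))"
  by (rule lev_superset) (use keys_add[of L M] in auto)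
 moreover have "lev \<psi> x L = (\<Sum>m\<in>?S. \<psi> (lkp L m) * mon x (lkp m))"
  "lev \<psi> x M = (\<Sum>m\<in>?S. \<psi> (lkp M m) * mon x (lkp m))" by (rule lev_superset; simp)+
 ultimately show ?thesis by (simp add: lookup_add hadd algebra_simps sum.distrib)
qed

lemma (in fhom) lev_sum: "lev \<psi> x (sum f S) = (\<Sum>i\<in>S. lev \<psi> x (f i))"
 by (induction S rule: infinite_finite_induct) (simp_all add: lev_add)

lemma laurent_expand:
 fixes L :: "('n, 'k::comm_ring_1) laurent"
 shows "L = (\<Sum>m\<in>kys L. pms m (lkp L m))"
proof (rule poly_mapping_eqI)
 fix k
 have "(\<Sum>m\<in>kys L. lkp L m when m = k) = (\<Sum>m\<in>kys L. if m = k then lkp L k else 0)"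
  by (rule sum.cong) (auto simp: when_def)
 thus "lkp L k = lkp (\<Sum>m\<in>kys L. pms m (lkp L m)) k" by (auto simp: lookup_sum lookup_single in_keys_iff)
qed

lemma (in fhom) lev_mult:
 assumes x: "!!i. x i ~= 0"
 shows "lev \<psi> x (L * M) = lev \<psi> x L * lev \<psi> x M"
proof -
 have "lev \<psi> x (L * M) = lev \<psi> x ((\<Sum>m\<in>kys L. pms m (lkp L m)) *
   (\<Sum>m\<in>kys M. pms m (lkp M m)))" using laurent_expand[of L] laurent_expand[of M] by simp
 also have "\<dots> = (\<Sum>m\<in>kys L. \<Sum>m'\<in>kys M.
   (\<psi> (lkp L m) * mon x (lkp m)) * (\<psi> (lkp M m') * mon x (lkp m')))"
  unfolding sum_product lev_sum mult_single lev_single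
 proof (intro sum.cong refl)
  fix m m' :: "'a \<Rightarrow>\<^sub>0 int"
  have "lkp (m + m') = (%i. lkp m i + lkp m' i)" by (rule ext) (rule lookup_add)
  thus "\<psi> (lkp L m * lkp M m') * mon x (lkp (m + m')) =
   (\<psi> (lkp L m) * mon x (lkp m)) * (\<psi> (lkp M m') * mon x (lkp m'))" by (simp add: hmult mon_add[OF x])
 qed
 also have "\<dots> = lev \<psi> x L * lev \<psi> x M" by (simp add: lev_def sum_product)
 finally show ?thesis .
qed

lemma (in fhom) lev_hom: "(!!i. x i ~= 0) ==> fhom (lev \<psi> x)"
proof
 show "lev \<psi> x 1 = 1" using lev_single[of x 0 1] by (simp add: lookup_0 flip: single_one)
qed (simp_all add: lev_add lev_mult)

lemma ring_hom_of_int: "fhom (of_int :: int => 'f::field)" by unfold_locales auto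
lemma ring_hom_of_rat: "fhom (of_rat :: rat => 'f::field_char_0)" by unfold_locales (auto simp: of_rat_add of_rat_mult)

subsection \<open>A Laurent polynomial is determined by its values at positive points\<close>

text \<open>After division by the fastest growing exponential the limit isolates its coefficient,
  which is therefore zero; this exponent is then removed.\<close>

lemma exp_sum_zero:
 fixes c :: "real => real"
 assumes "finite S" "!!s. (\<Sum>e\<in>S. c e * exp (s * e)) = 0" "e \<in> S"
 shows "c e = 0" using assms
proof (induction "card S" arbitrary: S e)
 case 0 thus ?case by simp
next
 case (Suc n)
 define m where "m = Max S"
 have m: "m \<in> S" "!!e. e \<in> S ==> e <= m"
 proof -
  have "S ~= {}" using Suc(5) by blast
  thus "m \<in> S" unfolding m_def by (rule Max_in[OF Suc(3)])
  show "!!e. e \<in> S ==> e <= m" unfolding m_def using Suc(3) by simp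
 qed
 have "((%s. \<Sum>e\<in>S. c e * exp (s * (e - m))) \<longlongrightarrow> (\<Sum>e\<in>S. if e = m then c m else 0)) at_top"
 proof (rule tendsto_sum)
  fix e assume e: "e \<in> S"
  show "((%s. c e * exp (s * (e - m))) \<longlongrightarrow> (if e = m then c m else 0)) at_top"
  proof (cases "e = m")
   case False
   hence "e - m < 0" using m(2)[OF e] by simp
   hence "filterlim (%s. (e - m) * s) at_bot at_top"
    by (subst filterlim_tendsto_neg_mult_at_bot_iff[OF tendsto_const]) (auto intro: filterlim_ident)
   hence "((%s. exp ((e - m) * s)) \<longlongrightarrow> 0) at_top" by (rule filterlim_compose[OF exp_at_bot])
   hence "((%s. c e * exp ((e - m) * s)) \<longlongrightarrow> c e * 0) at_top" by (intro tendsto_intros)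
   thus ?thesis using False by (simp add: mult.commute)
  qed simp
 qed
 moreover have "(\<Sum>e\<in>S. c e * exp (s * (e - m))) = 0" for s
 proof -
  have "(\<Sum>e\<in>S. c e * exp (s * (e - m))) = exp (- (s * m)) * (\<Sum>e\<in>S. c e * exp (s * e))"
   unfolding sum_distrib_left by (rule sum.cong) (auto simp: right_diff_distrib exp_diff exp_minus divide_inverse)
  thus ?thesis using Suc(4) by simp
 qed
 ultimately have "((%s::real. 0::real) \<longlongrightarrow> (\<Sum>e\<in>S. if e = m then c m else 0)) at_top" by simp
 hence "(\<Sum>e\<in>S. if e = m then c m else 0) = 0" by (simp add: tendsto_const_iff)
 hence cm: "c m = 0" using m(1) Suc(3) by simp
 show ?case
 proof (cases "e = m")
  case False
  show ?thesis
  proof (rule Suc(1)[of "S - {m}"])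
   show "n = card (S - {m})" "finite (S - {m})" "e \<in> S - {m}" using Suc(2,3,5) m(1) False by auto
   show "(\<Sum>e\<in>S - {m}. c e * exp (s * e)) = 0" for s
    using Suc(4)[of s] sum.remove[OF Suc(3) m(1), of "%e. c e * exp (s * e)"] cm by simp
  qed
 qed (simp add: cm)
qed

text \<open>Weights \<open>z ^ f i\<close> with distinct exponents \<open>f i\<close> separate two
  given vectors unless \<open>z\<close> is a root of a nonzero polynomial, and finitely many pairs
  exclude finitely many \<open>z\<close>.\<close>

lemma separating_weight:
 fixes S :: "('n::finite => int) set"
 assumes "finite S"
 obtains w :: "'n => real" where "inj_on (%m. \<Sum>i\<in>UNIV. w i * of_int (m i)) S"
proof -
 obtain f :: "'n => nat" where f: "inj f" using finite_imp_inj_to_nat_seg[of "UNIV :: 'n set"] by auto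
 define p where "p = (%m m'. \<Sum>i\<in>UNIV. monom (real_of_int (m i - m' i)) (f i))"
 have p: "p m m' ~= 0" if "m ~= m'" for m m'
 proof -
  obtain i where i: "m i ~= m' i" using \<open>m ~= m'\<close> by (auto simp: fun_eq_iff)
  have "coeff (p m m') (f i) = (\<Sum>j\<in>UNIV. if j = i then real_of_int (m i - m' i) else 0)"
   unfolding p_def coeff_sum by (rule sum.cong) (use f in "auto simp: inj_def")
  thus ?thesis using i by auto
 qed
 have "finite (\<Union>(m, m')\<in>{(m, m'). m \<in> S & m' \<in> S & m ~= m'}. {z. poly (p m m') z = 0})"
 proof (rule finite_UN_I)
  show "finite {(m, m'). m \<in> S & m' \<in> S & m ~= m'}"
   by (rule finite_subset[of _ "S \<times> S"]) (use assms in auto)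
 qed (auto intro!: poly_roots_finite p)
 then obtain z :: real where z: "z \<notin> (\<Union>(m, m')\<in>{(m, m'). m \<in> S & m' \<in> S & m ~= m'}. {z. poly (p m m') z = 0})"
  using ex_new_if_finite[OF infinite_UNIV_char_0] by blast
 have "inj_on (%m. \<Sum>i\<in>UNIV. z ^ f i * of_int (m i)) S"
 proof (rule inj_onI, rule ccontr)
  fix m m' assume *: "m \<in> S" "m' \<in> S" "(\<Sum>i\<in>UNIV. z ^ f i * of_int (m i)) = (\<Sum>i\<in>UNIV. z ^ f i * of_int (m' i))" "m ~= m'"
  have "poly (p m m') z = (\<Sum>i\<in>UNIV. z ^ f i * of_int (m i)) - (\<Sum>i\<in>UNIV. z ^ f i * of_int (m' i))"
   by (simp add: p_def poly_sum poly_monom algebra_simps sum_subtractf)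
  thus False using * z by auto
 qed
 thus ?thesis by (rule that)
qed

text \<open>On the curve \<open>x i = exp (w i * s)\<close> with separating weights
  \<open>w\<close>, distinct monomials become distinct exponentials in \<open>s\<close>.\<close>

lemma lev_faithful:
 fixes L :: "('n::finite, 'k::comm_ring_1) laurent" and \<psi> :: "'k => real"
 assumes z: "!!x. (!!i. x i > 0) ==> lev \<psi> x L = 0" and inj: "!!c. \<psi> c = 0 ==> c = 0"
 shows "L = 0"
proof -
 let ?K = "lkp ` kys L"
 obtain w :: "'n => real" where w: "inj_on (%m. \<Sum>i\<in>UNIV. w i * of_int (m i)) ?K"
  using separating_weight[of ?K] by auto
 define h where "h = (%m::'n \<Rightarrow>\<^sub>0 int. \<Sum>i\<in>UNIV. w i * of_int (lkp m i))"
 have h: "inj_on h (kys L)"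
 proof (rule inj_onI)
  fix m m' assume *: "m \<in> kys L" "m' \<in> kys L" "h m = h m'"
  have "lkp m = lkp m'" by (rule inj_onD[OF w]) (use * in "auto simp: h_def")
  thus "m = m'" by (intro poly_mapping_eqI) simp
 qed
 define c where "c = (%e. \<psi> (lkp L (the_inv_into (kys L) h e)))"
 have "(\<Sum>e\<in>h ` kys L. c e * exp (s * e)) = 0" for s
 proof -
  have m: "mon (%i. exp (w i * s)) (lkp m) = exp (s * h m)" for m :: "'n \<Rightarrow>\<^sub>0 int"
   by (simp add: mon_def h_def exp_power_int sum_distrib_left exp_sum algebra_simps)
  have "(\<Sum>e\<in>h ` kys L. c e * exp (s * e)) = (\<Sum>m\<in>kys L. c (h m) * exp (s * h m))"
   by (simp add: sum.reindex[OF h])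
  also have "\<dots> = lev \<psi> (%i. exp (w i * s)) L"
   unfolding lev_def m by (rule sum.cong) (auto simp: c_def the_inv_into_f_f[OF h])
  finally show ?thesis using z[of "%i. exp (w i * s)"] by simp
 qed
 hence "c e = 0" if "e \<in> h ` kys L" for e using exp_sum_zero[of "h ` kys L" c e] that by simp
 hence "lkp L m = 0" if "m \<in> kys L" for m
  using inj[of "lkp L m"] that by (force simp: c_def the_inv_into_f_f[OF h])
 hence "lkp L m = 0" for m by (cases "m \<in> kys L") (auto simp: in_keys_iff)
 thus ?thesis by (intro poly_mapping_eqI) simp
qed

subsection \<open>Positive and Laurent elements of the field of fractions\<close>

text \<open>Everything that the exchange recursions divide by is kept inside such a set and is
  thereby nonzero.\<close>

definition semifield :: "'f::field set => bool" where
 "semifield S \<longleftrightarrow> 1 \<in> S & 0 \<notin> S & (\<forall>a\<in>S. \<forall>b\<in>S. a + b \<in> S & a * b \<in> S & a / b \<in> S)"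

lemma semifield_prod: "semifield S ==> (!!i. i \<in> A ==> f i \<in> S) ==> prod f A \<in> S"
 by (induction A rule: infinite_finite_induct) (auto simp: semifield_def)
lemma semifield_pow: "semifield S ==> a \<in> S ==> a ^ n \<in> S" by (induction n) (auto simp: semifield_def)

lemma semifield_pos_real: "semifield {x::real. 0 < x}" by (auto simp: semifield_def)

text \<open>Positivity is tested only at the point with all coordinates one; this already keeps
  sums, products and quotients away from zero.\<close>

definition posf :: "('k::idom => real) => ('n::{finite,linorder}, 'k) laurent fract set" where
 "posf \<psi> = {z. \<exists>N D. z = Fract N D & lev \<psi> (%_. 1) N > 0 & lev \<psi> (%_. 1) D > 0}"

lemma semifield_posf:
 assumes "fhom \<psi>"
 shows "semifield (posf \<psi> :: ('n::{finite,linorder}, 'k::idom) laurent fract set)"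
proof -
 interpret fhom \<psi> by fact
 interpret L: fhom "lev \<psi> (%_::'n. 1)" by (rule lev_hom) simp
 have nz: "D ~= 0" if "lev \<psi> (%_. 1) D > 0" for D :: "('n, 'k) laurent" using that by auto
 show ?thesis unfolding semifield_def
 proof (intro conjI ballI)
  show "1 \<in> (posf \<psi> :: ('n, 'k) laurent fract set)" unfolding posf_def One_fract_def by (auto intro!: exI[of _ 1])
  show "0 \<notin> (posf \<psi> :: ('n, 'k) laurent fract set)"
   unfolding posf_def Zero_fract_def using nz by (auto simp: eq_fract)
  fix a b :: "('n, 'k) laurent fract" assume "a \<in> posf \<psi>" "b \<in> posf \<psi>"
  then obtain N D N' D' where *: "a = Fract N D" "b = Fract N' D'" "lev \<psi> (%_. 1) N > 0" "lev \<psi> (%_. 1) D > 0"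
   "lev \<psi> (%_. 1) N' > 0" "lev \<psi> (%_. 1) D' > 0" by (auto simp: posf_def)
  show "a + b \<in> posf \<psi>" unfolding posf_def mem_Collect_eq
   by (rule exI[of _ "N * D' + N' * D"], rule exI[of _ "D * D'"])
     (use * nz in "simp add: lev_add L.hmult add_pos_pos")
  show "a * b \<in> posf \<psi>" unfolding posf_def mem_Collect_eq
   by (rule exI[of _ "N * N'"], rule exI[of _ "D * D'"]) (use * in "simp add: L.hmult")
  show "a / b \<in> posf \<psi>" unfolding posf_def mem_Collect_eq
   by (rule exI[of _ "N * D'"], rule exI[of _ "D * N'"]) (use * in "simp add: L.hmult")
 qed
qed

definition laur :: "('n::{finite,linorder}, 'k::idom) laurent fract set" where
 "laur = range (%L. Fract L 1)"

lemma Fract1_inj: "Fract (L :: 'k::idom) 1 = Fract M 1 \<longleftrightarrow> L = M" by (simp add: eq_fract)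
lemma Fract1_hom: "ring_hom (%L :: 'k::idom. Fract L 1)" by unfold_locales (auto simp: Zero_fract_def One_fract_def)

lemma laur_ops: "1 \<in> laur" "0 \<in> laur" "a \<in> laur ==> b \<in> laur ==> a + b \<in> laur" "a \<in> laur ==> b \<in> laur ==> a * b \<in> laur"
 "a \<in> laur ==> b \<in> laur ==> a - b \<in> laur" "a \<in> laur ==> a ^ n \<in> laur"
proof -
 show 1: "1 \<in> laur" "0 \<in> laur" by (auto simp: laur_def One_fract_def Zero_fract_def)
 show "a \<in> laur ==> b \<in> laur ==> a + b \<in> laur" "a \<in> laur ==> b \<in> laur ==> a - b \<in> laur" by (auto simp: laur_def)
 show 2: "a \<in> laur ==> b \<in> laur ==> a * b \<in> laur" for a b by (auto simp: laur_def)
 show "a \<in> laur ==> a ^ n \<in> laur" by (induction n) (auto intro: 1 2)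
qed
lemma laur_prod: "(!!i. i \<in> S ==> f i \<in> laur) ==> prod f S \<in> laur"
 by (induction S rule: infinite_finite_induct) (auto intro: laur_ops)
definition lvar :: "'n::{finite,linorder} => ('n, 'k::idom) laurent fract" where
 "lvar i = Fract (laurent_var i) 1"

lemma lvar_powi:
 "(lvar i :: ('n::{finite,linorder}, 'k::idom) laurent fract) powi n = Fract (pms (pms i n) 1) 1"
proof -
 have pw: "(lvar i :: ('n, 'k) laurent fract) ^ k = Fract (pms (pms i (int k)) 1) 1" for k
  by (induction k) (auto simp: lvar_def laurent_var_def mult_single single_add[symmetric] One_fract_def add.commute)
 show ?thesis
 proof (cases "n \<ge> 0")
  case True thus ?thesis using pw[of "nat n"] by (simp add: power_int_nonneg_exp)
 next
  case False
  hence "(lvar i :: ('n, 'k) laurent fract) powi n = inverse (lvar i ^ nat (- n))" by (simp add: power_int_def power_inverse)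
  also have "\<dots> = Fract 1 (pms (pms i (- n)) 1)" using pw[of "nat (- n)"] False by simp
  also have "\<dots> = Fract (pms (pms i n) 1) 1"
  proof -
   have "pms (pms i (- n)) (1::'k) ~= 0" by (rule single_nz)
   moreover have "pms i n + pms i (- n) = 0" by (simp flip: single_add)
   ultimately show ?thesis by (simp add: eq_fract mult_single)
  qed
  finally show ?thesis .
 qed
qed

lemma lvar_nz: "lvar i ~= 0" unfolding lvar_def laurent_var_def Zero_fract_def by (simp add: eq_fract single_nz)

lemma prod_single: "(\<Prod>i\<in>S. pms (f i) (1::'k::comm_ring_1)) = pms (\<Sum>i\<in>S. f i) 1"
 by (induction S rule: infinite_finite_induct) (auto simp: mult_single)

lemma mon_lvar: "mon lvar m = Fract (pms (pm m) 1) 1"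
proof -
 interpret F: ring_hom "%L :: ('a, 'b) laurent. Fract L 1" by (rule Fract1_hom)
 have "pm m = (\<Sum>i\<in>UNIV. pms i (m i))"
 proof (rule poly_mapping_eqI)
  fix k
  have "(\<Sum>i\<in>UNIV. m i when i = k) = (\<Sum>i\<in>UNIV. if i = k then m k else 0)" by (rule sum.cong) (auto simp: when_def)
  thus "lkp (pm m) k = lkp (\<Sum>i\<in>UNIV. pms i (m i)) k" by (simp add: lookup_sum lookup_single)
 qed
 thus ?thesis by (simp add: mon_def lvar_powi F.hprod[symmetric] prod_single)
qed

lemma laur_mon: "mon lvar m \<in> laur" by (auto simp: mon_lvar laur_def)
lemma posf_lvar:
 assumes "fhom \<psi>"
 shows "(lvar i :: ('n::{finite,linorder}, 'k::idom) laurent fract) \<in> posf \<psi>"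
proof -
 interpret fhom \<psi> by fact
 interpret L: fhom "lev \<psi> (%_::'n. 1)" by (rule lev_hom) simp
 show ?thesis unfolding posf_def lvar_def laurent_var_def mem_Collect_eq
  by (rule exI[of _ "pms (pms i 1) 1"], rule exI[of _ 1]) (simp add: lev_single mon_def)
qed

subsection \<open>Clusters along source rounds\<close>

text \<open>The map \<open>\<iota>\<close> places the vertices among the rows of an extended matrix.
  All rows outside the image of \<open>J\<close> are treated as frozen, also those of vertices not
  in \<open>J\<close>, so freezing a vertex means passing to a smaller \<open>J\<close>.\<close>

locale belt = dynkin J a d ht for J :: "'n::finite set" and a d ht +
 fixes \<iota> :: "'n => 'v::finite"
 assumes inj_iota: "inj \<iota>"
begin

definition Bm :: "'n => 'n => int" where
 "Bm i j = (if ht i < ht j then - a i j else if ht j < ht i then a i j else 0)"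

definition Jblock :: "int^'n^'v => bool" where
 "Jblock b \<longleftrightarrow> (\<forall>i\<in>J. \<forall>j\<in>J. b $ \<iota> i $ j = Bm i j)"

text \<open>The entries of a frozen row and their signs at the moment of mutation determine the coefficients
 of the exchange relations: \<open>cc t\<close> is the row entry met at \<open>k\<close> in round \<open>t + 1\<close>.\<close>

function crow :: "('n => int) => 'n => int" where
 "crow r k = r k - (\<Sum>j\<in>bel k. a j k * max 0 (crow r j))" by pat_completeness auto
termination by (relation "Wellfounded.measure (%(r,k). ht k)") (auto simp: bel_def)
declare crow.simps [simp del]

definition nrow :: "('n => int) => 'n => int" where
 "nrow r k = - crow r k - (\<Sum>j\<in>abv k. a j k * max 0 (crow r j))"

definition cc :: "nat => ('n => int) => 'n => int" where
 "cc t r k = crow ((nrow ^^ t) r) k"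

lemma crow_cong: "(!!k. k \<in> J ==> r k = r' k) ==> k \<in> J ==> crow r k = crow r' k"
proof (induction r k rule: crow.induct)
 case (1 r k)
 have "(\<Sum>j\<in>bel k. a j k * max 0 (crow r j)) = (\<Sum>j\<in>bel k. a j k * max 0 (crow r' j))"
  by (rule sum.cong) (use 1 in "auto simp: bel_def")
 thus ?case using 1 by (simp add: crow.simps[of r k] crow.simps[of r' k])
qed

lemma nrow_cong: "(!!k. k \<in> J ==> r k = r' k) ==> k \<in> J ==> nrow r k = nrow r' k"
proof -
 assume *: "!!k. k \<in> J ==> r k = r' k" "k \<in> J"
 have "(\<Sum>j\<in>abv k. a j k * max 0 (crow r j)) = (\<Sum>j\<in>abv k. a j k * max 0 (crow r' j))"
  by (rule sum.cong) (use crow_cong[OF *(1)] in "auto simp: abv_def")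
 thus ?thesis using crow_cong[OF *] by (simp add: nrow_def)
qed

lemma cc_mesh: "cc (Suc t) r k + cc t r k = - (\<Sum>j\<in>bel k. a j k * max 0 (cc (Suc t) r j)) - (\<Sum>j\<in>abv k. a j k * max 0 (cc t r j))"
proof -
 have "cc (Suc t) r k = nrow ((nrow ^^ t) r) k - (\<Sum>j\<in>bel k. a j k * max 0 (cc (Suc t) r j))"
  unfolding cc_def by (subst crow.simps) simp
 thus ?thesis by (simp add: nrow_def cc_def)
qed

text \<open>One round of exchange relations, with \<open>pp\<close> and \<open>qq\<close> the
  coefficients of the two terms. When \<open>k\<close> is mutated, its lower neighbours already
  carry the new values and its higher ones still the old values \<open>x\<close>.\<close>

function zr :: "('n => 'f) => ('n => 'f) => ('n => 'f) => 'n => 'f::field" where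
 "zr pp qq x k = (pp k + qq k * ((\<Prod>i\<in>bel k. zr pp qq x i ^ nat (- a i k)) * (\<Prod>i\<in>abv k. x i ^ nat (- a i k)))) / x k"
 by pat_completeness auto
termination by (relation "Wellfounded.measure (%(pp,qq,x,k). ht k)") (auto simp: bel_def)
declare zr.simps [simp del]

primrec Z :: "(nat => 'n => 'f) => (nat => 'n => 'f) => ('n => 'f) => nat => 'n => 'f::field" where
 "Z pp qq x 0 = x"
| "Z pp qq x (Suc t) = zr (pp t) (qq t) (Z pp qq x t)"

lemma zr_cong: "(!!k. k \<in> J ==> pp k = pp' k) ==> (!!k. k \<in> J ==> qq k = qq' k) ==> (!!k. k \<in> J ==> x k = x' k) ==>
  k \<in> J ==> zr pp qq x k = zr pp' qq' x' k"
proof (induction "ht k" arbitrary: k rule: less_induct)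
 case less
 have "(\<Prod>i\<in>bel k. zr pp qq x i ^ nat (- a i k)) = (\<Prod>i\<in>bel k. zr pp' qq' x' i ^ nat (- a i k))"
  by (rule prod.cong) (use less in "auto simp: bel_def")
 moreover have "(\<Prod>i\<in>abv k. x i ^ nat (- a i k)) = (\<Prod>i\<in>abv k. x' i ^ nat (- a i k))"
  by (rule prod.cong) (use less in "auto simp: abv_def")
 ultimately show ?case using less by (simp add: zr.simps[of pp qq x k] zr.simps[of pp' qq' x' k])
qed

definition fpos :: "('v => 'f) => ('v => int) => 'f::field" where
 "fpos x c = (\<Prod>v\<in>- \<iota> ` J. x v ^ nat (c v))"

definition row :: "int^'n^'v => 'v => 'n => int" where "row b v k = b $ v $ k"

text \<open>The seed in the middle of a source round, after mutation at the vertices in \<open>S\<close>.\<close>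

definition mid :: "int^'n^'v => ('v => 'f::field) => 'n set => ('v, 'n, 'f) seed => bool" where
 "mid b0 x0 S s \<longleftrightarrow>
   (\<forall>i\<in>J. \<forall>j\<in>J. fst s $ \<iota> i $ j = (if (i \<in> S) = (j \<in> S) then Bm i j else - Bm i j)) &
   (\<forall>v\<in>- \<iota> ` J. \<forall>k\<in>J. fst s $ v $ k =
    (if k \<in> S then - crow (row b0 v) k - (\<Sum>j\<in>abv k \<inter> S. a j k * max 0 (crow (row b0 v) j))
     else row b0 v k - (\<Sum>j\<in>bel k \<inter> S. a j k * max 0 (crow (row b0 v) j)))) &
   (\<forall>k\<in>J. snd s (\<iota> k) = (if k \<in> S then
    zr (%k. fpos x0 (%v. crow (row b0 v) k)) (%k. fpos x0 (%v. - crow (row b0 v) k)) (%k. x0 (\<iota> k)) k else x0 (\<iota> k))) &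
   (\<forall>v\<in>- \<iota> ` J. snd s v = x0 v)"

text \<open>This is the state in which \<open>k\<close> is a source: among its neighbours exactly
  the lower ones have been mutated.\<close>

definition okstep :: "'n set => 'n => bool" where
 "okstep S k \<longleftrightarrow> k \<in> J - S & (\<forall>i\<in>J. i ~= k --> a i k ~= 0 --> (i \<in> S \<longleftrightarrow> ht i < ht k))"

primrec oksteps :: "'n set => 'n list => bool" where
 "oksteps S [] \<longleftrightarrow> True"
| "oksteps S (k # ks) \<longleftrightarrow> okstep S k & oksteps (insert k S) ks"

lemma Bm_self [simp]: "Bm k k = 0" by (simp add: Bm_def)

lemma Bm_antisym_cases:
 assumes "i \<in> J" "k \<in> J" "i ~= k"
 shows "ht i < ht k ==> Bm i k = - a i k" "ht k < ht i ==> Bm i k = a i k" "a i k = 0 ==> Bm i k = 0" "ht i = ht k ==> a i k = 0"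
 using a_same_ht[OF assms] by (auto simp: Bm_def)

lemma mid_col:
 assumes m: "mid b0 x0 S s" and k: "okstep S k" and i: "i \<in> J" "i ~= k"
 shows "fst s $ \<iota> i $ k = a i k" "fst s $ \<iota> k $ i = - a k i"
proof -
 have kJ: "k \<in> J" "k \<notin> S" using k by (auto simp: okstep_def)
 have c: "i \<in> S \<longleftrightarrow> ht i < ht k" if "a i k ~= 0" using k i that by (auto simp: okstep_def)
 note B = Bm_antisym_cases[OF i(1) kJ(1) i(2)] Bm_antisym_cases[OF kJ(1) i(1) i(2)[symmetric]]
 have z: "a i k = 0 \<longleftrightarrow> a k i = 0" using a_zero_sym i kJ by blast
 have "fst s $ \<iota> i $ k = (if i \<in> S then - Bm i k else Bm i k)" "fst s $ \<iota> k $ i = (if i \<in> S then - Bm k i else Bm k i)"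
  using m i kJ by (auto simp: mid_def)
 note e = this
 show "fst s $ \<iota> i $ k = a i k" "fst s $ \<iota> k $ i = - a k i"
 proof -
  consider "a i k = 0" "a k i = 0" | "a i k ~= 0" "i \<in> S" "ht i < ht k" | "a i k ~= 0" "i \<notin> S" "ht k < ht i"
   using z c B(4) by (metis not_less_iff_gr_or_eq)
  hence "fst s $ \<iota> i $ k = a i k & fst s $ \<iota> k $ i = - a k i"
  proof cases
   case 1 thus ?thesis using e B(3) B(7) by simp
  next
   case 2 thus ?thesis using e B(1) B(6) by simp
  next
   case 3 thus ?thesis using e B(2) B(5) by simp
  qed
  thus "fst s $ \<iota> i $ k = a i k" "fst s $ \<iota> k $ i = - a k i" by auto
 qed
qed

lemma mid_row:
 assumes m: "mid b0 x0 S s" and k: "okstep S k" and v: "v \<notin> \<iota> ` J"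
 shows "fst s $ v $ k = crow (row b0 v) k"
proof -
 have kJ: "k \<in> J" "k \<notin> S" using k by (auto simp: okstep_def)
 have "(\<Sum>j\<in>bel k \<inter> S. a j k * max 0 (crow (row b0 v) j)) = (\<Sum>j\<in>bel k. a j k * max 0 (crow (row b0 v) j))"
  by (rule sum.mono_neutral_left) (use k in "auto simp: okstep_def bel_def")
 thus ?thesis using m kJ v by (subst crow.simps) (simp add: mid_def)
qed

lemma sgn_max: "0 <= p ==> sgn c * max 0 (c * p) = p * max 0 (c::int)"
 by (auto simp: sgn_if max_def mult_le_0_iff zero_le_mult_iff mult.commute)
lemma sgn_max0: "c <= 0 ==> 0 <= p ==> sgn c * max 0 (c * p) = (0::int)"
 using mult_nonpos_nonneg[of c p] by (simp add: max_absorb1)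

text \<open>At a source the mutable entries of column \<open>k\<close> are nonpositive and those of
  row \<open>k\<close> nonnegative, so entries between other mutable rows do not change; frozen rows
  change when their entry at \<open>k\<close> is positive. For the same reason one monomial of the
  exchange relation involves frozen variables only.\<close>

lemma mid_step:
 assumes m: "mid b0 x0 S (b, x)" and k: "okstep S k"
 shows "mid b0 x0 (insert k S) (mutate \<iota> k (b, x))"
proof -
 have kJ: "k \<in> J" "k \<notin> S" using k by (auto simp: okstep_def)
 have inj: "\<iota> i = \<iota> j \<longleftrightarrow> i = j" for i j using inj_iota by (auto simp: inj_def)
 have adj: "i \<in> S \<longleftrightarrow> ht i < ht k" if "i \<in> J" "i ~= k" "a i k ~= 0" for i using k that by (auto simp: okstep_def)
 have adj': "i \<in> S \<longleftrightarrow> ht i < ht k" if "i \<in> J" "i ~= k" "a k i ~= 0" for i using adj[OF that(1,2)] that a_zero_sym[of i k] kJ by auto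
 have ht_ne: "ht i ~= ht k" if "i \<in> J" "i ~= k" "a k i ~= 0" for i using a_same_ht[of k i] that kJ by auto
 note col = mid_col[OF m k, simplified] and rw = mid_row[OF m k, simplified]
 have ofd: "a k j <= 0" "a j k <= 0" if "j \<in> J" "j ~= k" for j using offd[of k j] offd[of j k] that kJ by auto
 define b' where "b' = mutate_matrix \<iota> k b"
 define x' where "x' = mutate_cluster \<iota> k b x"
 have b': "b' $ i $ j = (if i = \<iota> k \<or> j = k then - (b $ i $ j) else b $ i $ j + sgn (b $ i $ k) * max 0 (b $ i $ k * b $ \<iota> k $ j))" for i j
  by (simp add: b'_def mutate_matrix_def)
 have 1: "b' $ \<iota> i $ j = (if (i \<in> insert k S) = (j \<in> insert k S) then Bm i j else - Bm i j)" if ij: "i \<in> J" "j \<in> J" for i j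
 proof -
  have o: "b $ \<iota> i $ j = (if (i \<in> S) = (j \<in> S) then Bm i j else - Bm i j)" using m ij by (simp add: mid_def)
  show ?thesis
  proof (cases "i = k \<or> j = k")
   case True thus ?thesis using o kJ by (auto simp: b' inj)
  next
   case False
   have "sgn (b $ \<iota> i $ k) * max 0 (b $ \<iota> i $ k * b $ \<iota> k $ j) = 0"
    using False ij col ofd by (intro sgn_max0) auto
   thus ?thesis using o False by (simp add: b' inj)
  qed
 qed
 have 2: "b' $ v $ j = (if j \<in> insert k S then - crow (row b0 v) j - (\<Sum>i\<in>abv j \<inter> insert k S. a i j * max 0 (crow (row b0 v) i))
     else row b0 v j - (\<Sum>i\<in>bel j \<inter> insert k S. a i j * max 0 (crow (row b0 v) i)))" if v: "v \<in> - \<iota> ` J" and j: "j \<in> J" for v j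
 proof -
  have vk: "v ~= \<iota> k" using v kJ by auto
  let ?c = "%i. max 0 (crow (row b0 v) i)"
  have o: "b $ v $ j = (if j \<in> S then - crow (row b0 v) j - (\<Sum>i\<in>abv j \<inter> S. a i j * ?c i)
     else row b0 v j - (\<Sum>i\<in>bel j \<inter> S. a i j * ?c i))" using m v j by (simp add: mid_def)
  show ?thesis
  proof (cases "j = k")
   case True
   have "(\<Sum>i\<in>abv k \<inter> insert k S. a i k * ?c i) = 0"
    by (rule sum.neutral) (use adj in "force simp: abv_def")
   thus ?thesis using True vk rw[of v] v by (simp add: b')
  next
   case False
   have "sgn (b $ v $ k) * max 0 (b $ v $ k * b $ \<iota> k $ j) = (- a k j) * ?c k"
    using False j col(2)[of j] rw[of v] v ofd[of j] by (subst sgn_max) auto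
   hence n: "b' $ v $ j = b $ v $ j - a k j * ?c k" using False vk by (simp add: b')
   show ?thesis
   proof (cases "j \<in> S")
    case True
    have "(\<Sum>i\<in>abv j \<inter> insert k S. a i j * ?c i) = a k j * ?c k + (\<Sum>i\<in>abv j \<inter> S. a i j * ?c i)"
    proof (cases "k \<in> abv j")
     case True thus ?thesis using kJ by (simp add: Int_insert_right)
    next
     case False
     hence "a k j = 0" using adj'[OF j \<open>j ~= k\<close>] \<open>j \<in> S\<close> kJ by (auto simp: abv_def)
     thus ?thesis using False by (simp add: Int_insert_right)
    qed
    thus ?thesis using n o True by simp
   next
    case F: False
    have "(\<Sum>i\<in>bel j \<inter> insert k S. a i j * ?c i) = a k j * ?c k + (\<Sum>i\<in>bel j \<inter> S. a i j * ?c i)"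
    proof (cases "k \<in> bel j")
     case True thus ?thesis using kJ by (simp add: Int_insert_right)
    next
     case False
     hence "a k j = 0" using adj'[OF j \<open>j ~= k\<close>] ht_ne[OF j \<open>j ~= k\<close>] F kJ by (auto simp: bel_def)
     thus ?thesis using False by (simp add: Int_insert_right)
    qed
    thus ?thesis using n o F \<open>j ~= k\<close> by simp
   qed
  qed
 qed
 let ?pp = "%k. fpos x0 (%v. crow (row b0 v) k)" and ?qq = "%k. fpos x0 (%v. - crow (row b0 v) k)" and ?x0 = "%k. x0 (\<iota> k)"
 let ?z = "zr ?pp ?qq ?x0"
 have xv: "x v = x0 v" if "v \<in> - \<iota> ` J" for v using m that by (simp add: mid_def)
 have xk: "x (\<iota> i) = (if i \<in> S then ?z i else x0 (\<iota> i))" if "i \<in> J" for i using m that by (simp add: mid_def)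
 have pr1: "(\<Prod>i | 0 < f i. x i ^ nat (f i)) = (\<Prod>i\<in>J. x (\<iota> i) ^ nat (f (\<iota> i))) * (\<Prod>v\<in>- \<iota> ` J. x v ^ nat (f v))" for f :: "'v => int"
 proof -
  have "(\<Prod>i | 0 < f i. x i ^ nat (f i)) = (\<Prod>i\<in>UNIV. x i ^ nat (f i))"
   by (rule prod.mono_neutral_left) auto
  also have "\<dots> = (\<Prod>i\<in>\<iota> ` J. x i ^ nat (f i)) * (\<Prod>v\<in>- \<iota> ` J. x v ^ nat (f v))"
   by (subst prod.union_disjoint[symmetric]) (auto simp: Compl_partition)
  also have "(\<Prod>i\<in>\<iota> ` J. x i ^ nat (f i)) = (\<Prod>i\<in>J. x (\<iota> i) ^ nat (f (\<iota> i)))"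
   by (subst prod.reindex) (auto intro: inj_on_subset[OF inj_iota])
  finally show ?thesis .
 qed
 have bkk: "b $ \<iota> k $ k = 0" using m kJ by (simp add: mid_def)
 have colk: "b $ \<iota> i $ k <= 0" if "i \<in> J" for i using col(1)[of i] ofd[of i] bkk that by (cases "i = k") auto
 have p1: "(\<Prod>i | 0 < b $ i $ k. x i ^ nat (b $ i $ k)) = ?pp k"
 proof -
  have "(\<Prod>i\<in>J. x (\<iota> i) ^ nat (b $ \<iota> i $ k)) = 1" by (rule prod.neutral) (use colk in auto)
  moreover have "(\<Prod>v\<in>- \<iota> ` J. x v ^ nat (b $ v $ k)) = ?pp k"
   unfolding fpos_def by (rule prod.cong) (auto simp: xv rw)
  ultimately show ?thesis by (subst pr1) simp
 qed
 have p2: "(\<Prod>i | b $ i $ k < 0. x i ^ nat (- (b $ i $ k))) = ?qq k * ((\<Prod>i\<in>bel k. ?z i ^ nat (- a i k)) * (\<Prod>i\<in>abv k. x0 (\<iota> i) ^ nat (- a i k)))"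
 proof -
  have "(\<Prod>i | b $ i $ k < 0. x i ^ nat (- (b $ i $ k))) = (\<Prod>i | 0 < - (b $ i $ k). x i ^ nat (- (b $ i $ k)))" by simp
  also have "\<dots> = (\<Prod>i\<in>J. x (\<iota> i) ^ nat (- (b $ \<iota> i $ k))) * (\<Prod>v\<in>- \<iota> ` J. x v ^ nat (- (b $ v $ k)))" by (rule pr1)
  also have "(\<Prod>v\<in>- \<iota> ` J. x v ^ nat (- (b $ v $ k))) = ?qq k"
   unfolding fpos_def by (rule prod.cong) (auto simp: xv rw)
  also have "(\<Prod>i\<in>J. x (\<iota> i) ^ nat (- (b $ \<iota> i $ k))) = (\<Prod>i\<in>bel k \<union> abv k. x (\<iota> i) ^ nat (- a i k))"
  proof -
   have "(\<Prod>i\<in>J. x (\<iota> i) ^ nat (- (b $ \<iota> i $ k))) = (\<Prod>i\<in>bel k \<union> abv k. x (\<iota> i) ^ nat (- (b $ \<iota> i $ k)))"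
   proof (rule prod.mono_neutral_right)
    show "\<forall>i\<in>J - (bel k \<union> abv k). x (\<iota> i) ^ nat (- (b $ \<iota> i $ k)) = 1"
    proof
     fix i assume i: "i \<in> J - (bel k \<union> abv k)"
     hence "b $ \<iota> i $ k = 0" using col(1)[of i] bkk a_same_ht[of i k] kJ by (cases "i = k") (auto simp: bel_def abv_def)
     thus "x (\<iota> i) ^ nat (- (b $ \<iota> i $ k)) = 1" by simp
    qed
   qed (auto simp: finJ bel_def abv_def)
   also have "\<dots> = (\<Prod>i\<in>bel k \<union> abv k. x (\<iota> i) ^ nat (- a i k))"
   proof (rule prod.cong[OF refl])
    fix i assume "i \<in> bel k \<union> abv k"
    hence "i \<in> J" "i ~= k" by (auto simp: bel_def abv_def)
    thus "x (\<iota> i) ^ nat (- (b $ \<iota> i $ k)) = x (\<iota> i) ^ nat (- a i k)" by (simp add: col)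
   qed
   finally show ?thesis .
  qed
  also have "\<dots> = (\<Prod>i\<in>bel k. x (\<iota> i) ^ nat (- a i k)) * (\<Prod>i\<in>abv k. x (\<iota> i) ^ nat (- a i k))"
   by (rule prod.union_disjoint) (auto simp: bel_def abv_def)
  also have "(\<Prod>i\<in>bel k. x (\<iota> i) ^ nat (- a i k)) = (\<Prod>i\<in>bel k. ?z i ^ nat (- a i k))"
  proof (rule prod.cong[OF refl])
   fix i assume i: "i \<in> bel k"
   show "x (\<iota> i) ^ nat (- a i k) = ?z i ^ nat (- a i k)"
    using adj[of i] i xk[of i] by (cases "a i k = 0") (auto simp: bel_def)
  qed
  also have "(\<Prod>i\<in>abv k. x (\<iota> i) ^ nat (- a i k)) = (\<Prod>i\<in>abv k. x0 (\<iota> i) ^ nat (- a i k))"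
  proof (rule prod.cong[OF refl])
   fix i assume i: "i \<in> abv k"
   show "x (\<iota> i) ^ nat (- a i k) = x0 (\<iota> i) ^ nat (- a i k)"
    using adj[of i] i xk[of i] by (cases "a i k = 0") (auto simp: abv_def)
  qed
  finally show ?thesis by (simp add: mult.commute)
 qed
 have x'k: "x' (\<iota> k) = ?z k"
  using p1 p2 xk[OF kJ(1)] kJ(2) by (simp add: x'_def mutate_cluster_def zr.simps[of ?pp ?qq ?x0 k])
 have x'o: "x' v = x v" if "v ~= \<iota> k" for v using that by (simp add: x'_def mutate_cluster_def)
 have 3: "x' (\<iota> i) = (if i \<in> insert k S then ?z i else x0 (\<iota> i))" if "i \<in> J" for i
  using x'k x'o[of "\<iota> i"] xk[OF that] by (cases "i = k") (auto simp: inj)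
 have 4: "x' v = x0 v" if v: "v \<in> - \<iota> ` J" for v
 proof -
  have "v ~= \<iota> k" using v kJ by auto
  thus ?thesis using x'o xv[OF v] by simp
 qed
 show ?thesis unfolding mid_def mutate_def fst_conv snd_conv b'_def[symmetric] x'_def[symmetric]
  using 1 2 3 4 by blast
qed

lemma mid_fold: "mid b0 x0 S s ==> oksteps S ks ==> mid b0 x0 (S \<union> set ks) (fold (mutate \<iota>) ks s)"
proof (induction ks arbitrary: S s)
 case (Cons k ks)
 have "mid b0 x0 (insert k S) (mutate \<iota> k s)" using mid_step[of b0 x0 S "fst s" "snd s" k] Cons(2,3) by simp
 hence "mid b0 x0 (insert k S \<union> set ks) (fold (mutate \<iota>) ks (mutate \<iota> k s))" using Cons by (intro Cons(1)) auto
 thus ?case by simp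
qed simp

lemma mid_init: "Jblock b ==> mid b x {} (b, x)" by (auto simp: mid_def Jblock_def row_def)

lemma order_oksteps: "order_list (pre @ ks) ==> oksteps (set pre) ks"
proof (induction ks arbitrary: pre)
 case (Cons k ks)
 have "i \<in> set pre \<longleftrightarrow> ht i < ht k" if i: "i \<in> J" "i ~= k" "a i k ~= 0" for i
 proof -
  have "ht i ~= ht k" using a_same_ht[of i k] i Cons(2) by (auto simp: order_list_def)
  moreover have "i \<in> set pre ==> ht i <= ht k" using Cons(2) by (auto simp: order_list_def sorted_append)
  moreover have "i \<in> set ks ==> ht k <= ht i" using Cons(2) by (auto simp: order_list_def sorted_append)
  moreover have "i \<in> set pre \<or> i \<in> set ks" using i Cons(2) by (auto simp: order_list_def)
  ultimately show ?thesis by linarith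
 qed
 moreover have "k \<in> J - set pre" using Cons(2) by (auto simp: order_list_def)
 ultimately have "okstep (set pre) k" by (auto simp: okstep_def)
 thus ?case using Cons(1)[of "pre @ [k]"] Cons(2) by simp
qed simp

lemma order_source_sequence:
 "mid b0 x0 S s ==> oksteps S ks ==> (!!i. i \<in> J) ==> source_sequence \<iota> ks (fst s)"
proof (induction ks arbitrary: S s)
 case (Cons k ks)
 have "is_source \<iota> (fst s) k" unfolding is_source_def
 proof
  fix i
  have "i \<in> J" using Cons(4) by simp
  show "\<not> fst s $ \<iota> i $ k > 0"
  proof (cases "i = k")
   case True
   thus ?thesis using Cons by (simp add: mid_def)
  next
   case False
   thus ?thesis using mid_col(1)[OF Cons(2), of k i] Cons(3,4) offd[of i k] by auto
  qed
 qed
 moreover have "source_sequence \<iota> ks (fst (mutate \<iota> k s))"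
  using Cons(1)[of "insert k S" "mutate \<iota> k s"] mid_step[of b0 x0 S "fst s" "snd s" k] Cons(2-) by simp
 ultimately show ?case by (simp add: mutate_def)
qed simp

text \<open>The order picked by \<open>source_round\<close> is unspecified, but a source sequence
  without repetitions respects the heights of neighbours, which is what \<open>mid_fold\<close> asks
  for.\<close>

lemma source_oksteps:
 "mid b0 x0 S s ==> source_sequence \<iota> ks (fst s) ==> (!!i. i \<in> J) ==> distinct ks ==> set ks \<inter> S = {} ==> oksteps S ks"
proof (induction ks arbitrary: S s)
 case (Cons k ks)
 have kS: "k \<notin> S" using Cons by auto
 have src: "\<not> fst s $ \<iota> i $ k > 0" for i using Cons(3) by (auto simp: is_source_def)
 have "okstep S k" unfolding okstep_def
 proof (intro conjI ballI impI)
  show "k \<in> J - S" using Cons by auto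
  fix i assume i: "i \<in> J" "i ~= k" "a i k ~= 0"
  have e: "fst s $ \<iota> i $ k = (if i \<in> S then - Bm i k else Bm i k)" using Cons(2,4) kS by (auto simp: mid_def)
  have "k \<in> J" using Cons(4) by simp
  note B = Bm_antisym_cases[OF i(1) this i(2)] and o = offd[OF i(1) this i(2)]
  have "a i k < 0" using o i(3) by simp
  thus "i \<in> S \<longleftrightarrow> ht i < ht k" using e src[of i] B i(3) by (cases "ht i" "ht k" rule: linorder_cases) (auto split: if_splits)
 qed
 thus ?case using Cons(1)[of "insert k S" "mutate \<iota> k s"] mid_step[of b0 x0 S "fst s" "snd s" k] Cons(2-)
  by (simp add: mutate_def)
qed simp

text \<open>The variables at the vertices after \<open>t\<close> rounds
  (\<open>after_source_rounds\<close>), as the solution of a scalar recursion from which the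
  matrices have disappeared.\<close>

definition Xb :: "int^'n^'v => ('v => 'f::field) => nat => 'n => 'f" where
 "Xb b x = Z (%t k. fpos x (%v. cc t (row b v) k)) (%t k. fpos x (%v. - cc t (row b v) k)) (%k. x (\<iota> k))"

definition after :: "int^'n^'v => ('v => 'f::field) => nat => ('v, 'n, 'f) seed => bool" where
 "after b x t s \<longleftrightarrow> Jblock (fst s) & (\<forall>v\<in>- \<iota> ` J. \<forall>k\<in>J. fst s $ v $ k = (nrow ^^ t) (row b v) k) &
   (\<forall>k\<in>J. snd s (\<iota> k) = Xb b x t k) & (\<forall>v\<in>- \<iota> ` J. snd s v = x v)"

lemma after_0: "Jblock b ==> after b x 0 (b, x)" by (simp add: after_def Xb_def row_def)

lemma after_Suc:
 assumes A: "after b x t s" and m: "mid (fst s) (snd s) J s'"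
 shows "after b x (Suc t) s'"
proof -
 have cr: "crow (row (fst s) v) k = cc t (row b v) k" if "v \<in> - \<iota> ` J" "k \<in> J" for v k
  unfolding cc_def by (rule crow_cong) (use A that in "auto simp: after_def row_def")
 have 1: "Jblock (fst s')" using m by (auto simp: mid_def Jblock_def)
 have 2: "fst s' $ v $ k = (nrow ^^ Suc t) (row b v) k" if "v \<in> - \<iota> ` J" "k \<in> J" for v k
 proof -
  have "abv k \<inter> J = abv k" by (auto simp: abv_def)
  hence "fst s' $ v $ k = nrow (row (fst s) v) k" using m that by (simp add: mid_def nrow_def)
  also have "\<dots> = nrow ((nrow ^^ t) (row b v)) k" by (rule nrow_cong) (use A that in "auto simp: after_def row_def")
  finally show ?thesis by simp
 qed
 have f: "fpos (snd s) (%v. crow (row (fst s) v) k) = fpos x (%v. cc t (row b v) k)"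
  "fpos (snd s) (%v. - crow (row (fst s) v) k) = fpos x (%v. - cc t (row b v) k)" if "k \<in> J" for k
  unfolding fpos_def by (rule prod.cong; use A cr that in "auto simp: after_def")+
 have 3: "snd s' (\<iota> k) = Xb b x (Suc t) k" if "k \<in> J" for k unfolding Xb_def Z.simps using m that
  by (subst zr_cong[of _ "%k. fpos (snd s) (%v. crow (row (fst s) v) k)" _ "%k. fpos (snd s) (%v. - crow (row (fst s) v) k)" _ "%k. snd s (\<iota> k)"])
    (use A in "auto simp: f mid_def after_def Xb_def")
 have 4: "snd s' v = x v" if "v \<in> - \<iota> ` J" for v using m A that by (simp add: mid_def after_def)
 show ?thesis using 1 2 3 4 by (simp add: after_def del: funpow.simps)
qed

lemma after_fold:
 assumes "after b x t s" "order_list ks"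
 shows "after b x (Suc t) (fold (mutate \<iota>) ks s)"
proof (rule after_Suc[OF assms(1)])
 have "mid (fst s) (snd s) {} s" using mid_init[of "fst s" "snd s"] assms by (simp add: after_def)
 hence "mid (fst s) (snd s) ({} \<union> set ks) (fold (mutate \<iota>) ks s)"
  by (rule mid_fold) (use order_oksteps[of "[]" ks] assms in simp)
 thus "mid (fst s) (snd s) J (fold (mutate \<iota>) ks s)" using assms by (simp add: order_list_def)
qed

lemma ex_rounds:
 assumes "Jblock b" shows "\<exists>ks. set ks \<subseteq> J & after b x t (fold (mutate \<iota>) ks (b, x))"
proof (induction t)
 case 0 show ?case using after_0[OF assms, of x] by (intro exI[of _ "[]"]) simp
next
 case (Suc t)
 then obtain ks where ks: "set ks \<subseteq> J" "after b x t (fold (mutate \<iota>) ks (b, x))" by blast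
 obtain ks' where o: "order_list ks'" using ex_order_list by blast
 show ?case using after_fold[OF ks(2) o] ks(1) o by (intro exI[of _ "ks @ ks'"]) (simp add: order_list_def)
qed

lemma after_source_round:
 assumes "after b x t s" "!!i. i \<in> J"
 shows "after b x (Suc t) (source_round \<iota> s)"
proof (rule after_Suc[OF assms(1)])
 have m: "mid (fst s) (snd s) {} s" using mid_init[of "fst s" "snd s"] assms by (simp add: after_def)
 obtain ks0 where o: "order_list ks0" using ex_order_list by blast
 have "\<exists>ks. distinct ks & set ks = UNIV & source_sequence \<iota> ks (fst s)"
  by (rule exI[of _ ks0]) (use o assms(2) order_source_sequence[OF m, of ks0] order_oksteps[of "[]" ks0] in "auto simp: order_list_def")
 note ex = this
 define ks where "ks = (SOME ks. distinct ks & set ks = UNIV & source_sequence \<iota> ks (fst s))"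
 have ks: "distinct ks" "set ks = UNIV" "source_sequence \<iota> ks (fst s)"
  using someI_ex[OF ex] by (simp_all add: ks_def)
 have ks': "source_round \<iota> s = fold (mutate \<iota>) ks s" by (simp add: source_round_def ks_def)
 have "mid (fst s) (snd s) ({} \<union> set ks) (fold (mutate \<iota>) ks s)"
  by (rule mid_fold[OF m]) (rule source_oksteps[OF m ks(3) assms(2) ks(1)], simp)
 moreover have "J = UNIV" using assms(2) by blast
 ultimately show "mid (fst s) (snd s) J (source_round \<iota> s)" using ks ks' by simp
qed

lemma after_source_rounds: "Jblock b ==> (!!i. i \<in> J) ==> after b x t ((source_round \<iota> ^^ t) (b, x))"
 by (induction t) (auto intro: after_0 after_source_round)

end

subsection \<open>Orders of vanishing along curves\<close>

text \<open>The function behaves like \<open>A * s powi e\<close> as \<open>s\<close> decreases to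
  zero. Since \<open>A\<close> is positive, leading terms cannot cancel in a sum and the order of a
  sum is the minimum of the orders; hence orders obey tropical recursions.\<close>

definition asy :: "(real => real) => int => real => bool" where
 "asy h e A \<longleftrightarrow> A > 0 & ((%s. h s * s powi (- e)) \<longlongrightarrow> A) (at_right 0)"

lemma ev_pos: "eventually (%s::real. 0 < s) (at_right 0)" by (simp add: eventually_at_right_less)

lemma asy_cong: "asy h e A ==> (!!s. 0 < s ==> h s = h' s) ==> asy h' e A" unfolding asy_def
 by (auto elim!: Lim_transform_eventually intro: eventually_mono[OF ev_pos])

lemma asy_const: "c > 0 ==> asy (%_. c) 0 c" by (simp add: asy_def)

lemma asy_mult: assumes "asy h e A" "asy h' e' A'" shows "asy (%s. h s * h' s) (e + e') (A * A')"
proof -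
 have "((%s. (h s * s powi (- e)) * (h' s * s powi (- e'))) \<longlongrightarrow> A * A') (at_right 0)"
  using assms by (intro tendsto_mult) (auto simp: asy_def)
 hence "((%s. (h s * h' s) * s powi (- (e + e'))) \<longlongrightarrow> A * A') (at_right 0)"
  by (rule Lim_transform_eventually)
    (rule eventually_mono[OF ev_pos], simp add: power_int_diff power_int_minus power_int_add field_simps)
 thus ?thesis using assms by (simp add: asy_def)
qed

lemma asy_div: assumes "asy h e A" "asy h' e' A'" shows "asy (%s. h s / h' s) (e - e') (A / A')"
proof -
 have "((%s. (h s * s powi (- e)) / (h' s * s powi (- e'))) \<longlongrightarrow> A / A') (at_right 0)"
  using assms by (intro tendsto_divide) (auto simp: asy_def)
 hence "((%s. (h s / h' s) * s powi (- (e - e'))) \<longlongrightarrow> A / A') (at_right 0)"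
  by (rule Lim_transform_eventually)
    (rule eventually_mono[OF ev_pos], simp add: power_int_diff power_int_minus power_int_add field_simps)
 thus ?thesis using assms by (simp add: asy_def)
qed

lemma asy_pow: "asy h e A ==> asy (%s. h s ^ n) (int n * e) (A ^ n)"
proof (induction n)
 case 0 show ?case using asy_const[of 1] by simp
next
 case (Suc n)
 thus ?case using asy_mult[OF Suc(2) Suc(1)[OF Suc(2)]] by (simp add: algebra_simps)
qed

lemma asy_prod: "finite S ==> (!!i. i \<in> S ==> asy (h i) (e i) (A i)) ==> asy (%s. \<Prod>i\<in>S. h i s) (\<Sum>i\<in>S. e i) (\<Prod>i\<in>S. A i)"
 by (induction S rule: finite_induct) (simp_all add: asy_mult asy_const)

lemma powi_tendsto_0: "0 < e ==> ((%s::real. s powi e) \<longlongrightarrow> 0) (at_right 0)"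
proof -
 assume e: "0 < e"
 have "((%s::real. s ^ nat e) \<longlongrightarrow> 0 ^ nat e) (at_right 0)" by (intro tendsto_intros)
 moreover have "0 < nat e" using e by simp
 ultimately show ?thesis using e by (simp add: power_int_def zero_power)
qed

lemma asy_add:
 assumes h: "asy h e A" "asy h' e' A'"
 shows "asy (%s. h s + h' s) (min e e') ((if e <= e' then A else 0) + (if e' <= e then A' else 0))"
proof -
 have *: "((%s. h s * s powi (- m)) \<longlongrightarrow> (if e = m then A else 0)) (at_right 0)" if "asy h e A" "m <= e" for h e A m
 proof (cases "e = m")
  case True thus ?thesis using that by (simp add: asy_def)
 next
  case False
  have "((%s. (h s * s powi (- e)) * s powi (e - m)) \<longlongrightarrow> A * 0) (at_right 0)"
   using that False by (intro tendsto_mult powi_tendsto_0) (auto simp: asy_def)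
  hence "((%s. h s * s powi (- m)) \<longlongrightarrow> A * 0) (at_right 0)" by (rule Lim_transform_eventually)
     (rule eventually_mono[OF ev_pos], simp add: power_int_diff power_int_minus field_simps)
  thus ?thesis using False by simp
 qed
 have "((%s. h s * s powi (- min e e') + h' s * s powi (- min e e')) \<longlongrightarrow>
   (if e = min e e' then A else 0) + (if e' = min e e' then A' else 0)) (at_right 0)"
  by (intro tendsto_add *[OF h(1)] *[OF h(2)]) auto
 moreover have "(if e = min e e' then A else 0) + (if e' = min e e' then A' else 0) =
   (if e <= e' then A else 0) + (if e' <= e then A' else 0)" by auto
 moreover have "(if e <= e' then A else 0) + (if e' <= e then A' else 0) > 0" using h by (auto simp: asy_def)
 ultimately show ?thesis by (simp add: asy_def algebra_simps)
qed

lemma asy_unique: assumes "asy h e A" "asy h e' A'" shows "e = e'"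
proof (rule ccontr)
 assume ne: "e ~= e'"
 have *: False if "asy h e A" "asy h e' A'" "e < e'" for e e' A A'
 proof -
  have "((%s. (h s * s powi (- e')) * s powi (e' - e)) \<longlongrightarrow> A' * 0) (at_right 0)"
   using that by (intro tendsto_mult powi_tendsto_0) (auto simp: asy_def)
  hence "((%s. h s * s powi (- e)) \<longlongrightarrow> A' * 0) (at_right 0)" by (rule Lim_transform_eventually)
     (rule eventually_mono[OF ev_pos], simp add: power_int_diff power_int_minus field_simps)
  moreover have "((%s. h s * s powi (- e)) \<longlongrightarrow> A) (at_right 0)" "A > 0" using that by (auto simp: asy_def)
  ultimately show False using tendsto_unique[OF trivial_limit_at_right_real] by fastforce
 qed
 show False using *[OF assms] *[OF assms(2,1)] ne by linarith
qed

definition cv :: "('n => real) => ('n => int) => real => 'n => real" where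
 "cv y w s = (%l. y l * s powi w l)"

lemma mon_cv:
 fixes y :: "'n::finite => real"
 assumes s: "s > 0" shows "mon (cv y w s) m = mon y m * s powi (\<Sum>l\<in>UNIV. w l * m l)"
proof -
 have "(\<Prod>l\<in>S. (s powi w l) powi m l) = s powi (\<Sum>l\<in>S. w l * m l)" for S
  by (induction S rule: infinite_finite_induct) (use s in "simp_all add: power_int_add power_int_mult")
 thus ?thesis by (simp add: mon_def cv_def power_int_mult_distrib prod.distrib)
qed

lemma asy_mon:
 assumes "!!l. y l > 0" shows "asy (%s. mon (cv y w s) m) (\<Sum>l\<in>UNIV. w l * m l) (mon y m)"
proof -
 have "asy (%s. mon y m * s powi (\<Sum>l\<in>UNIV. w l * m l)) (\<Sum>l\<in>UNIV. w l * m l) (mon y m)"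
  unfolding asy_def
 proof
  show "((%s. mon y m * s powi (\<Sum>l\<in>UNIV. w l * m l) * s powi - (\<Sum>l\<in>UNIV. w l * m l)) \<longlongrightarrow> mon y m) (at_right 0)"
   by (rule Lim_transform_eventually[OF tendsto_const])
     (rule eventually_mono[OF ev_pos], simp add: power_int_minus)
 qed (use assms in "simp add: mon_pos")
 thus ?thesis by (rule asy_cong) (simp add: mon_cv)
qed

text \<open>The part \<open>L0\<close> of lowest weight may vanish at particular points, so the
  order is assumed along all curves and tested on one through a point where \<open>L0\<close> is
  nonzero. The conclusion is one support number of the Newton polytope.\<close>

lemma lev_order:
 fixes L :: "('n::finite, 'k::comm_ring_1) laurent" and \<psi> :: "'k => real"
 assumes hom: "fhom \<psi>" and inj: "!!c. \<psi> c = 0 ==> c = 0"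
  and as: "!!y. (!!l. y l > 0) ==> \<exists>A. asy (%s. lev \<psi> (cv y w s) L) e A"
 shows "(\<forall>m\<in>kys L. e <= (\<Sum>l\<in>UNIV. w l * lkp m l)) &
  (\<exists>m\<in>kys L. e = (\<Sum>l\<in>UNIV. w l * lkp m l))"
proof -
 interpret fhom \<psi> by fact
 define g where "g = (%m::'n \<Rightarrow>\<^sub>0 int. \<Sum>l\<in>UNIV. w l * lkp m l)"
 let ?K = "kys L"
 have Kne: "?K ~= {}"
 proof
  assume "?K = {}"
  hence "lev \<psi> (cv (%_. 1) w s) L = 0" for s by (simp add: lev_def)
  then obtain A where "asy (%s. 0) e A" using as[of "%_. 1"] by auto
  hence "((%s::real. 0::real) \<longlongrightarrow> A) (at_right 0)" "A > 0" by (auto simp: asy_def)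
  thus False using tendsto_unique[OF trivial_limit_at_right_real, of "%_. 0" A 0] by auto
 qed
 define e0 where "e0 = Min (g ` ?K)"
 have e0: "e0 \<in> g ` ?K" "!!m. m \<in> ?K ==> e0 <= g m" using Kne by (auto simp: e0_def)
 define L0 where "L0 = (\<Sum>m\<in>{m\<in>?K. g m = e0}. pms m (lkp L m))"
 have lk: "lkp L0 m = (if g m = e0 then lkp L m else 0)" for m
 proof -
  have "lkp L0 m = (\<Sum>m'\<in>{m\<in>?K. g m = e0}. if m' = m then lkp L m else 0)"
   unfolding L0_def lookup_sum by (rule sum.cong) (auto simp: lookup_single when_def)
  thus ?thesis by (auto simp: in_keys_iff)
 qed
 have "L0 ~= 0"
 proof -
  obtain m where "m \<in> ?K" "g m = e0" using e0(1) by auto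
  hence "lkp L0 m ~= 0" using lk by (simp add: in_keys_iff)
  thus ?thesis by auto
 qed
 then obtain y where y: "!!i. y i > 0" "lev \<psi> y L0 ~= 0" using lev_faithful[of \<psi> L0, OF _ inj] by blast
 have lim: "((%s. lev \<psi> (cv y w s) L * s powi (- e0)) \<longlongrightarrow> lev \<psi> y L0) (at_right 0)"
 proof -
  have "((%s. \<Sum>m\<in>?K. \<psi> (lkp L m) * mon y (lkp m) * s powi (g m - e0)) \<longlongrightarrow>
    (\<Sum>m\<in>?K. if g m = e0 then \<psi> (lkp L m) * mon y (lkp m) else 0)) (at_right 0)"
  proof (rule tendsto_sum)
   fix m assume m: "m \<in> ?K"
   show "((%s. \<psi> (lkp L m) * mon y (lkp m) * s powi (g m - e0)) \<longlongrightarrow>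
     (if g m = e0 then \<psi> (lkp L m) * mon y (lkp m) else 0)) (at_right 0)"
   proof (cases "g m = e0")
    case False
    hence "0 < g m - e0" using e0(2)[OF m] by simp
    thus ?thesis using False tendsto_mult[OF tendsto_const powi_tendsto_0] by fastforce
   qed simp
  qed
  also have "(\<Sum>m\<in>?K. if g m = e0 then \<psi> (lkp L m) * mon y (lkp m) else 0) = lev \<psi> y L0"
   by (subst lev_superset[where S = ?K]) (auto simp: lk in_keys_iff split: if_splits intro!: sum.cong)
  finally show ?thesis
  proof (rule Lim_transform_eventually)
   show "\<forall>\<^sub>F s in at_right 0. (\<Sum>m\<in>?K. \<psi> (lkp L m) * mon y (lkp m) * s powi (g m - e0)) =
     lev \<psi> (cv y w s) L * s powi - e0"
   proof (rule eventually_mono[OF ev_pos])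
    fix s :: real assume s: "0 < s"
    show "(\<Sum>m\<in>?K. \<psi> (lkp L m) * mon y (lkp m) * s powi (g m - e0)) =
     lev \<psi> (cv y w s) L * s powi - e0" unfolding lev_def sum_distrib_right
     by (rule sum.cong) (use s in "auto simp: mon_cv g_def power_int_diff power_int_minus field_simps")
   qed
  qed
 qed
 obtain A where A: "asy (%s. lev \<psi> (cv y w s) L) e A" using as y(1) by blast
 have "e = e0"
 proof (rule ccontr)
  assume ne: "e ~= e0"
  let ?h = "%s. lev \<psi> (cv y w s) L"
  consider "e < e0" | "e0 < e" using ne by linarith
  thus False
  proof cases
   case 1
   have "((%s. (?h s * s powi (- e0)) * s powi (e0 - e)) \<longlongrightarrow> lev \<psi> y L0 * 0) (at_right 0)"
    using 1 by (intro tendsto_mult powi_tendsto_0 lim) auto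
   hence "((%s. ?h s * s powi (- e)) \<longlongrightarrow> lev \<psi> y L0 * 0) (at_right 0)"
    by (rule Lim_transform_eventually)
      (rule eventually_mono[OF ev_pos], simp add: power_int_diff power_int_minus field_simps)
   hence "A = 0" using A tendsto_unique[of "at_right (0::real)" "%s. ?h s * s powi (- e)" A 0] by (simp add: asy_def)
   thus False using A by (simp add: asy_def)
  next
   case 2
   have "((%s. (?h s * s powi (- e)) * s powi (e - e0)) \<longlongrightarrow> A * 0) (at_right 0)"
    using 2 A by (intro tendsto_mult powi_tendsto_0) (auto simp: asy_def)
   hence "((%s. ?h s * s powi (- e0)) \<longlongrightarrow> A * 0) (at_right 0)" by (rule Lim_transform_eventually)
      (rule eventually_mono[OF ev_pos], simp add: power_int_diff power_int_minus field_simps)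
   hence "lev \<psi> y L0 = 0" using lim tendsto_unique[of "at_right (0::real)" "%s. ?h s * s powi (- e0)"] by fastforce
   thus False using y by simp
  qed
 qed
 thus ?thesis using e0 by (auto simp: g_def)
qed

subsection \<open>F-polynomials\<close>

locale fdyn = dynkin J a d ht for J :: "'n::{finite,linorder} set" and a d ht

sublocale fdyn \<subseteq> belt J a d ht "id :: 'n => 'n" by unfold_locales simp

context belt
begin

text \<open>The product over the neighbours in the exchange relation at \<open>k\<close> between
  rounds \<open>t\<close> and \<open>t + 1\<close>; \<open>nbs\<close> is its additive
  counterpart.\<close>

definition nbp :: "(nat => 'n => 'f) => nat => 'n => 'f::comm_ring_1" where
 "nbp X t k = (\<Prod>i\<in>bel k. X (Suc t) i ^ nat (- a i k)) * (\<Prod>i\<in>abv k. X t i ^ nat (- a i k))"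

lemma Z_rec: "Z pp qq x t k ~= 0 ==> Z pp qq x (Suc t) k * Z pp qq x t k = pp t k + qq t k * nbp (Z pp qq x) t k"
 by (subst Z.simps, subst zr.simps) (simp add: nbp_def)

lemma Z_semifield:
 assumes S: "semifield S" and p: "!!t k. k \<in> J ==> pp t k \<in> S" "!!t k. k \<in> J ==> qq t k \<in> S" "!!k. k \<in> J ==> x k \<in> S"
 shows "k \<in> J ==> Z pp qq x t k \<in> S"
proof (induction t arbitrary: k)
 case 0 thus ?case using p by simp
next
 case (Suc t)
 have "zr (pp t) (qq t) (Z pp qq x t) k \<in> S" if "k \<in> J" for k using that
 proof (induction "ht k" arbitrary: k rule: less_induct)
  case less
  have "(\<Prod>i\<in>bel k. zr (pp t) (qq t) (Z pp qq x t) i ^ nat (- a i k)) \<in> S"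
   by (intro semifield_prod[OF S] semifield_pow[OF S]) (use less in "auto simp: bel_def")
  moreover have "(\<Prod>i\<in>abv k. Z pp qq x t i ^ nat (- a i k)) \<in> S"
   by (intro semifield_prod[OF S] semifield_pow[OF S]) (use Suc in "auto simp: abv_def")
  ultimately show ?case using p less(2) Suc(1)[OF less(2)] S by (subst zr.simps) (auto simp: semifield_def)
 qed
 thus ?case using Suc(2) by simp
qed

lemma Z_unique:
 assumes nz: "!!t k. k \<in> J ==> X t k ~= 0" and x0: "!!k. k \<in> J ==> X 0 k = x k"
  and rec: "!!t k. k \<in> J ==> X (Suc t) k * X t k = pp t k + qq t k * nbp X t k"
 shows "k \<in> J ==> Z pp qq x t k = X t k"
proof (induction t arbitrary: k)
 case 0 thus ?case using x0 by simp
next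
 case (Suc t)
 have "zr (pp t) (qq t) (Z pp qq x t) k = X (Suc t) k" if "k \<in> J" for k using that
 proof (induction "ht k" arbitrary: k rule: less_induct)
  case less
  have "(\<Prod>i\<in>bel k. zr (pp t) (qq t) (Z pp qq x t) i ^ nat (- a i k)) = (\<Prod>i\<in>bel k. X (Suc t) i ^ nat (- a i k))"
   by (rule prod.cong) (use less in "auto simp: bel_def")
  moreover have "(\<Prod>i\<in>abv k. Z pp qq x t i ^ nat (- a i k)) = (\<Prod>i\<in>abv k. X t i ^ nat (- a i k))"
   by (rule prod.cong) (use Suc in "auto simp: abv_def")
  ultimately show ?case using rec[OF less(2), of t] nz[OF less(2), of t] Suc(1)[OF less(2)]
   by (subst zr.simps) (simp add: nbp_def field_simps)
 qed
 thus ?case using Suc(2) by simp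
qed


end

lemma laur_pow_expand:
 fixes f :: "('n::{finite,linorder}, 'k::idom) laurent fract"
 assumes "f \<in> laur" "y \<in> laur" "q \<in> laur"
 shows "\<exists>Q\<in>laur. (y + f * q) ^ n = y ^ n + f * Q"
proof (induction n)
 case 0 show ?case by (rule bexI[of _ 0]) (auto intro: laur_ops)
next
 case (Suc n)
 then obtain Q where Q: "Q \<in> laur" "(y + f * q) ^ n = y ^ n + f * Q" by blast
 show ?case
  by (rule bexI[of _ "y * Q + q * y ^ n + f * q * Q"]) (use Q assms in "auto simp: algebra_simps intro!: laur_ops")
qed

text \<open>Congruence modulo \<open>f\<close> with explicit cofactors. Factors with exponent
  \<open>0\<close> are exempt because the products run over all lower or higher vertices, and
  non-neighbours satisfy no congruence.\<close>

lemma laur_prod_expand: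
 fixes f :: "('n::{finite,linorder}, 'k::idom) laurent fract"
 assumes f: "f \<in> laur" and z: "!!i. i \<in> S ==> y i \<in> laur & (n i = 0 \<or> (\<exists>q\<in>laur. z i = y i + f * q))"
 shows "\<exists>Q\<in>laur. (\<Prod>i\<in>S. z i ^ n i) = (\<Prod>i\<in>S. y i ^ n i) + f * Q" using z
proof (induction S rule: infinite_finite_induct)
 case (infinite A) thus ?case by (intro bexI[of _ 0]) (auto intro: laur_ops)
next
 case empty show ?case by (rule bexI[of _ 0]) (auto intro: laur_ops)
next
 case (insert i S)
 then obtain Q where Q: "Q \<in> laur" "(\<Prod>i\<in>S. z i ^ n i) = (\<Prod>i\<in>S. y i ^ n i) + f * Q" by blast
 have yl: "y i \<in> laur" "(\<Prod>i\<in>S. y i ^ n i) \<in> laur" using insert by (auto intro!: laur_prod laur_ops)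
 obtain Q' where Q': "Q' \<in> laur" "z i ^ n i = y i ^ n i + f * Q'"
 proof (cases "n i = 0")
  case True thus ?thesis using that[of 0] laur_ops by auto
 next
  case False
  then obtain q where q: "q \<in> laur" "z i = y i + f * q" using insert(4)[OF insertI1] by auto
  thus ?thesis using laur_pow_expand[OF f yl(1) q(1), of "n i"] that by auto
 qed
 show ?case by (rule bexI[of _ "y i ^ n i * Q + Q' * (\<Prod>i\<in>S. y i ^ n i) + f * Q * Q'"])
    (use Q Q' yl f insert(1,2) in "auto simp: algebra_simps intro!: laur_ops")
qed

lemma semifield_powi: "semifield S ==> c \<in> S ==> c powi n \<in> S"
proof -
 assume S: "semifield S" and c: "c \<in> S"
 have "1 / c ^ m \<in> S" for m using S semifield_pow[OF S c] by (auto simp: semifield_def)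
 thus ?thesis using semifield_pow[OF S c] by (simp add: power_int_def power_one_over inverse_eq_divide)
qed

lemma semifield_mon: "semifield S ==> (!!i. x i \<in> S) ==> mon x m \<in> S"
 unfolding mon_def by (intro semifield_prod semifield_powi) auto

lemma mult_cancel_helper: "m * z = w ==> n * m = 1 ==> z = n * (w :: 'f::field)" by (auto simp flip: mult.assoc)

context fdyn
begin

text \<open>Substituting \<open>y\<close> by the variables \<open>lvar\<close>, the \<open>F\<close>-polynomials are the solution of the exchange
 recursion with initial values \<open>1\<close> and principal coefficients \<open>y\<^sup>R\<close>.\<close>

definition Ff :: "nat => 'n => ('n, int) laurent fract" where
 "Ff = Z (%t k. mon lvar (R t k)) (%_ _. 1) (%_. 1)"

lemma semi_int: "semifield (posf (of_int :: int => real) :: ('n, int) laurent fract set)"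
 by (rule semifield_posf) (rule ring_hom_of_int)

lemma Ff_pos: "k \<in> J ==> Ff t k \<in> posf of_int" unfolding Ff_def
 by (rule Z_semifield[OF semi_int]) (auto intro!: semifield_mon[OF semi_int] posf_lvar ring_hom_of_int simp: semi_int[unfolded semifield_def])

lemma Ff_nz: "k \<in> J ==> Ff t k ~= 0" using Ff_pos[of k t] semi_int by (auto simp: semifield_def)

lemma Ff_0 [simp]: "Ff 0 k = 1" by (simp add: Ff_def)

lemma Ff_rec: "k \<in> J ==> Ff (Suc t) k * Ff t k = mon lvar (R t k) + nbp Ff t k"
 using Z_rec[of "%t k. mon lvar (R t k)" "%_ _. 1" "%_. 1" t k] Ff_nz[of k t] by (simp add: Ff_def)

lemma prod_mon: "(\<Prod>i\<in>S. mon lvar (m i) ^ n i) = mon lvar (%l. \<Sum>i\<in>S. int (n i) * m i l)"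
 by (simp add: mon_sum lvar_nz mon_scale)

text \<open>With \<open>M\<close> and \<open>M'\<close> the neighbour products in two consecutive relations for the vertex \<open>k\<close> and
 \<open>f\<close> the variable between them, \<open>M M'\<close> is congruent to a monomial modulo \<open>f\<close>, since every
 relation of a neighbour contains \<open>f\<close> as a factor; this makes the division by \<open>f\<close> exact.\<close>

lemma Ff_laur: "k \<in> J ==> Ff t k \<in> laur"
proof (induction t arbitrary: k rule: less_induct)
 case (less t)
 note IHt = less(1)
 consider "t = 0" | "t = 1" | t' where "t = Suc (Suc t')" by (metis One_nat_def not0_implies_Suc)
 thus ?case
 proof cases
  case 1 thus ?thesis by (simp add: laur_ops)
 next
  case 2
  have "Ff 1 k \<in> laur" using less(2)
  proof (induction "ht k" arbitrary: k rule: less_induct)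
   case (less k)
   have "Ff 1 k = mon lvar (R 0 k) + nbp Ff 0 k" using Ff_rec[OF less(2), of 0] by simp
   thus ?case using less(1) by (auto simp: nbp_def bel_def intro!: laur_ops laur_mon laur_prod)
  qed
  thus ?thesis using 2 by simp
 next
  case 3
  have "Ff (Suc (Suc t')) k \<in> laur" using less(2)
  proof (induction "ht k" arbitrary: k rule: less_induct)
   case (less k)
   have k: "k \<in> J" by fact
   have l1: "Ff (Suc t') i \<in> laur" "Ff t' i \<in> laur" if "i \<in> J" for i using IHt that 3 by auto
   have l2: "Ff (Suc (Suc t')) i \<in> laur" if "i \<in> bel k" for i using less(1) that by (auto simp: bel_def)
   let ?G = "Ff (Suc (Suc t'))" and ?H = "Ff (Suc t')" and ?R = "R (Suc t')" and ?m = "mon (lvar :: 'n => ('n, int) laurent fract)"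
   define f where "f = ?H k"
   have fl: "f \<in> laur" using l1 k by (simp add: f_def)
   define M where "M = nbp Ff t' k"
   define M' where "M' = nbp Ff (Suc t') k"
   have r1: "f * Ff t' k = ?m (R t' k) + M" using Ff_rec[OF k, of t'] by (simp add: f_def M_def)
   have r2: "?G k * f = ?m (?R k) + M'" using Ff_rec[OF k, of "Suc t'"] by (simp add: f_def M'_def)
   have M'l: "M' \<in> laur" unfolding M'_def nbp_def
    by (intro laur_ops laur_prod) (use l1 l2 in "auto simp: abv_def")
   define n where "n = (%i. nat (- a i k))"
   have zb: "n i = 0 \<or> (\<exists>q\<in>laur. ?G i * ?H i = ?m (?R i) + f * q)" if i: "i \<in> bel k" for i
   proof (cases "n i = 0")
    case False
    have iJ: "i \<in> J" "i ~= k" using i by (auto simp: bel_def)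
    have ki: "k \<in> abv i" using i k by (auto simp: bel_def abv_def)
    have "a i k ~= 0" using False by (auto simp: n_def)
    hence "a k i < 0" using offd[OF k iJ(1)] iJ(2) a_zero_sym[OF iJ(1) k] by force
    then obtain p where p: "nat (- a k i) = Suc p" by (metis gr0_implies_Suc neg_0_less_iff_less zero_less_nat_eq)
    define q where "q = (\<Prod>j\<in>bel i. ?G j ^ nat (- a j i)) * (f ^ p * (\<Prod>j\<in>abv i - {k}. ?H j ^ nat (- a j i)))"
    have "nbp Ff (Suc t') i = f * q" unfolding nbp_def q_def using ki p by (simp add: prod.remove[of "abv i" k] f_def)
    moreover have "q \<in> laur" unfolding q_def
     by (intro laur_ops laur_prod fl) (use l1 less(1) i in "auto simp: bel_def abv_def")
    ultimately show ?thesis using Ff_rec[OF iJ(1), of "Suc t'"] by auto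
   qed simp
   have za: "n i = 0 \<or> (\<exists>q\<in>laur. ?H i * Ff t' i = ?m (R t' i) + f * q)" if i: "i \<in> abv k" for i
   proof (cases "n i = 0")
    case False
    have iJ: "i \<in> J" "i ~= k" using i by (auto simp: abv_def)
    have ki: "k \<in> bel i" using i k by (auto simp: bel_def abv_def)
    have "a i k ~= 0" using False by (auto simp: n_def)
    hence "a k i < 0" using offd[OF k iJ(1)] iJ(2) a_zero_sym[OF iJ(1) k] by force
    then obtain p where p: "nat (- a k i) = Suc p" by (metis gr0_implies_Suc neg_0_less_iff_less zero_less_nat_eq)
    define q where "q = (f ^ p * (\<Prod>j\<in>bel i - {k}. ?H j ^ nat (- a j i))) * (\<Prod>j\<in>abv i. Ff t' j ^ nat (- a j i))"
    have "nbp Ff t' i = f * q" unfolding nbp_def q_def using ki p by (simp add: prod.remove[of "bel i" k] f_def)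
    moreover have "q \<in> laur" unfolding q_def
     by (intro laur_ops laur_prod fl) (use l1 in "auto simp: bel_def abv_def")
    ultimately show ?thesis using Ff_rec[OF iJ(1), of t'] by auto
   qed simp
   obtain Q1 where Q1: "Q1 \<in> laur" "(\<Prod>i\<in>bel k. (?G i * ?H i) ^ n i) = (\<Prod>i\<in>bel k. ?m (?R i) ^ n i) + f * Q1"
    by (rule bexE[OF laur_prod_expand[OF fl, of "bel k" "%i. ?m (?R i)" n]]) (use zb laur_mon in auto)
   obtain Q2 where Q2: "Q2 \<in> laur" "(\<Prod>i\<in>abv k. (?H i * Ff t' i) ^ n i) = (\<Prod>i\<in>abv k. ?m (R t' i) ^ n i) + f * Q2"
    by (rule bexE[OF laur_prod_expand[OF fl, of "abv k" "%i. ?m (R t' i)" n]]) (use za laur_mon in auto)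
   define Q where "Q = (\<Prod>i\<in>bel k. ?m (?R i) ^ n i) * Q2 + Q1 * (\<Prod>i\<in>abv k. ?m (R t' i) ^ n i) + f * (Q1 * Q2)"
   have Ql: "Q \<in> laur" unfolding Q_def by (intro laur_ops laur_prod laur_mon Q1 Q2 fl)
   have "M * M' = (\<Prod>i\<in>bel k. (?G i * ?H i) ^ n i) * (\<Prod>i\<in>abv k. (?H i * Ff t' i) ^ n i)"
    by (simp add: M_def M'_def nbp_def n_def power_mult_distrib prod.distrib algebra_simps)
   also have "\<dots> = (\<Prod>i\<in>bel k. ?m (?R i) ^ n i) * (\<Prod>i\<in>abv k. ?m (R t' i) ^ n i) + f * Q"
    unfolding Q1 Q2 Q_def by (simp add: algebra_simps)
   also have "(\<Prod>i\<in>bel k. ?m (?R i) ^ n i) * (\<Prod>i\<in>abv k. ?m (R t' i) ^ n i) =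
     ?m (%l. (\<Sum>i\<in>bel k. int (n i) * ?R i l) + (\<Sum>i\<in>abv k. int (n i) * R t' i l))"
    by (simp add: prod_mon mon_add lvar_nz)
   also have "(%l. (\<Sum>i\<in>bel k. int (n i) * ?R i l) + (\<Sum>i\<in>abv k. int (n i) * R t' i l)) = (%l. ?R k l + R t' k l)"
   proof (rule ext)
    fix l
    have "int (n i) = - a i k" if "i \<in> bel k \<union> abv k" for i
     using offd[of i k] that k by (auto simp: n_def bel_def abv_def)
    hence "(\<Sum>i\<in>bel k. int (n i) * ?R i l) = - (\<Sum>i\<in>bel k. a i k * ?R i l)"
     "(\<Sum>i\<in>abv k. int (n i) * R t' i l) = - (\<Sum>i\<in>abv k. a i k * R t' i l)"
     by (simp_all flip: sum_negf)
    thus "(\<Sum>i\<in>bel k. int (n i) * ?R i l) + (\<Sum>i\<in>abv k. int (n i) * R t' i l) = ?R k l + R t' k l"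
     using mesh[OF k, of t' l] by simp
   qed
   finally have MM: "M * M' = ?m (?R k) * ?m (R t' k) + f * Q" by (simp add: mon_add lvar_nz)
   \<comment> \<open>The later relation is multiplied by the monomial of the earlier one, and the
     congruence for \<open>M * M'\<close> is inserted; the earlier relation then supplies the factor
     \<open>f\<close>.\<close>
   have "?m (R t' k) * (?G k * f) = f * (M' * Ff t' k - Q)"
   proof -
    have "?m (R t' k) * (?G k * f) = ?m (R t' k) * ?m (?R k) + ?m (R t' k) * M'"
     unfolding r2 by (simp add: algebra_simps)
    also have "?m (R t' k) * ?m (?R k) = M * M' - f * Q" using MM by (simp add: algebra_simps)
    also have "M * M' - f * Q + ?m (R t' k) * M' = M' * (?m (R t' k) + M) - f * Q" by (simp add: algebra_simps)
    also have "\<dots> = f * (M' * Ff t' k - Q)" unfolding r1[symmetric] by (simp add: algebra_simps)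
    finally show ?thesis .
   qed
   hence "f * (?m (R t' k) * ?G k) = f * (M' * Ff t' k - Q)" by (simp add: algebra_simps)
   moreover have "f ~= 0" using Ff_nz k by (simp add: f_def)
   ultimately have "?m (R t' k) * ?G k = M' * Ff t' k - Q" by simp
   moreover have "?m (%l. - R t' k l) * ?m (R t' k) = (1 :: _)" by (simp add: mon_minus mon_nz[OF lvar_nz])
   ultimately have "?G k = ?m (%l. - R t' k l) * (M' * Ff t' k - Q)" by (rule mult_cancel_helper)
   thus ?case using M'l l1 k Ql by (auto intro!: laur_ops laur_mon)
  qed
  thus ?thesis using 3 by simp
 qed
qed

definition FL :: "nat => 'n => ('n, int) laurent" where
 "FL t k = (if t = 0 then 1 else SOME L. Ff t k = Fract L 1)"

lemma FL_Ff: "k \<in> J ==> Ff t k = Fract (FL t k) 1"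
proof -
 assume "k \<in> J"
 hence "\<exists>L. Ff t k = Fract L 1" using Ff_laur[of k t] by (auto simp: laur_def)
 thus ?thesis unfolding FL_def using someI_ex[of "%L. Ff t k = Fract L 1"] by (simp add: One_fract_def)
qed

lemma FL_0 [simp]: "FL 0 k = 1" by (simp add: FL_def)

lemma FL_rec: assumes k: "k \<in> J" shows "FL (Suc t) k * FL t k = pms (pm (R t k)) 1 + nbp FL t k"
proof -
 interpret H: ring_hom "%L :: ('n, int) laurent. Fract L 1" by (rule Fract1_hom)
 have "nbp Ff t k = nbp (%t k. Fract (FL t k) 1) t k"
  unfolding nbp_def using FL_Ff by (intro arg_cong2[where f = "(*)"] prod.cong) (auto simp: bel_def abv_def)
 also have "\<dots> = Fract (nbp FL t k) 1" by (simp add: nbp_def H.hmult H.hprod H.hpow)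
 finally have "Fract (FL (Suc t) k * FL t k) 1 = Fract (pms (pm (R t k)) 1 + nbp FL t k) 1"
  using Ff_rec[OF k, of t] FL_Ff[OF k, of t] FL_Ff[OF k, of "Suc t"] by (simp add: mon_lvar)
 thus ?thesis by (simp only: Fract1_inj)
qed

text \<open>An integral Laurent polynomial can be evaluated at nonzero points of any field, unlike
  the fraction \<open>Ff\<close>; this is the use of \<open>Ff_laur\<close>.\<close>

definition Fe :: "('n => 'f::field) => nat => 'n => 'f" where
 "Fe y t k = lev of_int y (FL t k)"

lemma Fe_rec:
 assumes "!!i. y i ~= 0" "k \<in> J"
 shows "Fe y (Suc t) k * Fe y t k = mon y (R t k) + nbp (Fe y) t k"
proof -
 interpret I: fhom "of_int :: int => 'a" by (rule ring_hom_of_int)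
 interpret H: fhom "lev of_int y" by (rule I.lev_hom) (rule assms)
 have "lev of_int y (nbp FL t k) = nbp (Fe y) t k" by (simp add: nbp_def H.hmult H.hprod H.hpow Fe_def)
 thus ?thesis using arg_cong[OF FL_rec[OF assms(2), of t], of "lev of_int y"]
  by (simp add: H.hmult H.hadd I.lev_single Fe_def)
qed

lemma Fe_0 [simp]: "(!!i. y i ~= 0) ==> Fe y 0 k = 1"
proof -
 assume y: "!!i. y i ~= 0"
 interpret I: fhom "of_int :: int => 'a" by (rule ring_hom_of_int)
 interpret H: fhom "lev of_int y" by (rule I.lev_hom) (rule y)
 show ?thesis by (simp add: Fe_def)
qed

lemma Fe_semifield:
 assumes S: "semifield S" and y: "!!i. y i \<in> S"
 shows "k \<in> J ==> Fe y t k \<in> S"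
proof (induction t arbitrary: k)
 have nz: "y i ~= 0" for i using S y[of i] by (auto simp: semifield_def)
 {
  case 0
  have "1 \<in> S" using S by (simp add: semifield_def)
  thus ?case using nz by simp
 next
  case (Suc t)
  show ?case using Suc(2)
  proof (induction "ht k" arbitrary: k rule: less_induct)
   case less
   have "nbp (Fe y) t k \<in> S"
   proof -
    have "(\<Prod>i\<in>bel k. Fe y (Suc t) i ^ nat (- a i k)) \<in> S"
     by (intro semifield_prod[OF S] semifield_pow[OF S]) (use less in "auto simp: bel_def")
    moreover have "(\<Prod>i\<in>abv k. Fe y t i ^ nat (- a i k)) \<in> S"
     by (intro semifield_prod[OF S] semifield_pow[OF S]) (use Suc in "auto simp: abv_def")
    ultimately show ?thesis using S by (auto simp: nbp_def semifield_def)
   qed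
   hence "mon y (R t k) + nbp (Fe y) t k \<in> S" using semifield_mon[OF S, where x=y and m="R t k"] y S by (auto simp: semifield_def)
   hence "(mon y (R t k) + nbp (Fe y) t k) / Fe y t k \<in> S" using Suc(1)[OF less(2)] S by (auto simp: semifield_def)
   moreover have "Fe y t k ~= 0" using Suc(1)[OF less(2)] S by (auto simp: semifield_def)
   moreover have "(mon y (R t k) + nbp (Fe y) t k) / Fe y t k = Fe y (Suc t) k"
    using Fe_rec[where y = y and t = t, OF nz less(2)] \<open>Fe y t k ~= 0\<close> by (simp add: divide_eq_eq)
   ultimately show ?case by simp
  qed
 }
qed

lemma Fe_pos: "(!!i. (y i :: real) > 0) ==> k \<in> J ==> Fe y t k > 0"
 using Fe_semifield[OF semifield_pos_real, of y k] by simp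

end

section \<open>Neighbour sums and the ends of rows\<close>

context dynkin
begin

definition nbs :: "(nat => 'n => 'b) => nat => 'n => 'b::comm_ring_1" where
 "nbs X t k = (\<Sum>i\<in>bel k. of_int (- a i k) * X (Suc t) i) + (\<Sum>i\<in>abv k. of_int (- a i k) * X t i)"

lemma nbs_mesh: "k \<in> J ==> nbs (%t k. R t k l) t k = R (Suc t) k l + R t k l" by (simp add: nbs_def mesh sum_negf)

lemma nbs_0 [simp]: "nbs (%_ _. 0) t k = 0" by (simp add: nbs_def)

lemma nbs_cong:
 assumes "!!i. i \<in> bel k ==> a i k ~= 0 ==> X (Suc t) i = Y (Suc t) i"
  "!!i. i \<in> abv k ==> a i k ~= 0 ==> X t i = Y t i"
 shows "nbs X t k = nbs Y t k"
proof -
 have "(\<Sum>i\<in>bel k. of_int (- a i k) * X (Suc t) i) = (\<Sum>i\<in>bel k. of_int (- a i k) * Y (Suc t) i)"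
  "(\<Sum>i\<in>abv k. of_int (- a i k) * X t i) = (\<Sum>i\<in>abv k. of_int (- a i k) * Y t i)"
  by (rule sum.cong[OF refl], use assms in fastforce)+
 thus ?thesis by (simp add: nbs_def)
qed

lemma nbr_dom:
 assumes k: "k \<in> J" and i: "i \<in> J" "a i k ~= 0"
 shows "ht i < ht k ==> rr k <= rr i & rr i <= rr k + 1" "ht k < ht i ==> rr i <= rr k & rr k <= rr i + 1"
 using rr_bel[OF k i(1) _ i(2)] rr_bel[OF i(1) k] a_zero_sym[OF k i(1)] i by auto

text \<open>The neighbours \<open>i\<close> of \<open>k\<close> whose index in the last relation at \<open>k\<close> is already \<open>rr i + 1\<close>.\<close>

definition ended :: "'n => 'n => bool" where
 "ended i k \<longleftrightarrow> ht i < ht k & rr i = rr k \<or> ht k < ht i & rr k = rr i + 1"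

lemma ended_cases:
 assumes "i \<in> J" "k \<in> J" "i ~= k" "a i k ~= 0"
 shows "ended i k \<or> ended k i" using nbr_dom[OF assms(2,1,4)] a_same_ht[OF assms(1-3)] assms(4)
 by (cases "ht i" "ht k" rule: linorder_cases) (auto simp: ended_def)

lemma ended_st: "i \<in> J ==> k \<in> J ==> a i k ~= 0 ==> ended i k ==> st i \<in> bel (st k) & a (st i) (st k) = a i k"
 using st_adj[of i k] by (simp add: ended_def)

text \<open>Under \<open>st\<close>, the neighbours already past their ends become the lower
  neighbours of \<open>st k\<close>. Surjectivity uses that \<open>st\<close> is an involution and
  that every edge is ended from at least one side.\<close>

lemma ended_image:
 assumes k: "k \<in> J"
 shows "st ` {i \<in> J. a i k ~= 0 & ended i k} = {i \<in> bel (st k). a i (st k) ~= 0}"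
proof
 show "st ` {i \<in> J. a i k ~= 0 & ended i k} \<subseteq> {i \<in> bel (st k). a i (st k) ~= 0}"
  using ended_st[OF _ k] by auto
 show "{i \<in> bel (st k). a i (st k) ~= 0} \<subseteq> st ` {i \<in> J. a i k ~= 0 & ended i k}"
 proof
  fix i' assume i': "i' \<in> {i \<in> bel (st k). a i (st k) ~= 0}"
  hence b: "i' \<in> J" "ht i' < ht (st k)" "i' ~= st k" by (auto simp: bel_def)
  note sk = st_J[OF k]
  define i where "i = st i'"
  have i: "i \<in> J" "st i = i'" using st_J[OF b(1)] st_st[OF b(1)] by (auto simp: i_def)
  have nz: "a i k ~= 0"
  proof (rule disjE[OF ended_cases[OF b(1) sk b(3)]])
   assume "ended i' (st k)"
   thus ?thesis using ended_st[OF b(1) sk] i' st_st[OF k] by (simp add: i_def)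
  next
   assume "ended (st k) i'"
   thus ?thesis using ended_st[OF sk b(1)] i' st_st[OF k] a_zero_sym[OF b(1) sk] a_zero_sym[OF i(1) k] by (simp add: i_def)
  qed (use i' in simp)
  have "i ~= k" using i b by auto
  moreover have "\<not> ended k i" using ended_st[OF k i(1)] nz a_zero_sym[OF i(1) k] i(2) b by (auto simp: bel_def)
  ultimately show "i' \<in> st ` {i \<in> J. a i k ~= 0 & ended i k}" using ended_cases[OF i(1) k _ nz] i nz by auto
 qed
qed

text \<open>Evaluates the neighbour sum in the relation that leads one step past row
  \<open>k\<close>: the neighbours also past their ends contribute, and \<open>st\<close> turns
  their sum into the sum in the recursion of \<open>P (st k)\<close>.\<close>

lemma nbs_ended:
 assumes k: "k \<in> J"
 shows "nbs (%t i. if t = Suc (rr i) then f (st i) else 0) (rr k) k = - (\<Sum>i\<in>bel (st k). of_int (a i (st k)) * f i)"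
proof -
 let ?E = "{i \<in> J. a i k ~= 0 & ended i k}" and ?g = "%i. - of_int (a i k) * f (st i)"
 have z: "\<not> ended k k" by (simp add: ended_def)
 have "nbs (%t i. if t = Suc (rr i) then f (st i) else 0) (rr k) k =
   (\<Sum>i\<in>bel k. if i \<in> ?E then ?g i else 0) + (\<Sum>i\<in>abv k. if i \<in> ?E then ?g i else 0)"
  unfolding nbs_def by (intro arg_cong2[where f = "(+)"] sum.cong) (auto simp: bel_def abv_def ended_def)
 also have "\<dots> = (\<Sum>i\<in>J. if i \<in> ?E then ?g i else 0)"
  by (subst sum_split_J[OF k]) (use z in "auto simp: ended_def")
 also have "\<dots> = (\<Sum>i\<in>?E. ?g i)" by (subst sum.inter_filter[symmetric]) (auto simp: finJ intro: sum.cong)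
 also have "\<dots> = (\<Sum>i\<in>?E. - of_int (a (st i) (st k)) * f (st i))"
  by (rule sum.cong) (use ended_st[OF _ k] in auto)
 also have "\<dots> = (\<Sum>i\<in>st ` ?E. - of_int (a i (st k)) * f i)"
  by (rule sum.reindex[symmetric, unfolded comp_def, OF inj_on_subset[OF st_inj]]) auto
 also have "\<dots> = (\<Sum>i\<in>bel (st k). - of_int (a i (st k)) * f i)"
  unfolding ended_image[OF k] by (rule sum.mono_neutral_left) (auto simp: bel_def finJ)
 finally show ?thesis by (simp add: sum_negf)
qed

end

section \<open>Orders of vanishing of F-polynomials and periodicity\<close>

context belt
begin

lemma asy_nbp:
 assumes k: "k \<in> J"
  and b: "!!i. i \<in> bel k ==> a i k ~= 0 ==> asy (%s. X s (Suc t) i) (e (Suc t) i) (A (Suc t) i)"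
  and c: "!!i. i \<in> abv k ==> a i k ~= 0 ==> asy (%s. X s t i) (e t i) (A t i)"
 shows "asy (%s. nbp (X s) t k) (nbs e t k) (nbp A t k)"
proof -
 have n: "int (nat (- a i k)) = - a i k" if "i \<in> J" "i ~= k" for i using offd[OF that(1) k that(2)] by simp
 have 1: "asy (%s. h s ^ nat (- a i k)) (- a i k * e') (A' ^ nat (- a i k))"
  if "i \<in> J" "i ~= k" "a i k ~= 0 ==> asy h e' A'" for i h e' A'
 proof (cases "a i k = 0")
  case True thus ?thesis using asy_const[of 1] by simp
 next
  case False thus ?thesis using asy_pow[OF that(3)[OF False], of "nat (- a i k)"] n[OF that(1,2)] by simp
 qed
 have "asy (%s. nbp (X s) t k) ((\<Sum>i\<in>bel k. - a i k * e (Suc t) i) + (\<Sum>i\<in>abv k. - a i k * e t i)) (nbp A t k)"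
  unfolding nbp_def by (intro asy_mult asy_prod 1 b c) (auto simp: bel_def abv_def)
 thus ?thesis by (simp add: nbs_def)
qed

lemma asy_belt:
 fixes X :: "real => nat => 'n => real"
 assumes nz: "!!s t k. s > 0 ==> k \<in> J ==> X s t k ~= 0"
  and rec: "!!s t k. s > 0 ==> k \<in> J ==> X s (Suc t) k * X s t k = p s t k + q s t k * nbp (X s) t k"
  and p: "!!t k. k \<in> J ==> t < rr k + c ==> \<exists>A. asy (%s. p s t k) (\<alpha> t k) A & (one --> A = 1)"
  and q: "!!t k. k \<in> J ==> t < rr k + c ==> \<exists>A. asy (%s. q s t k) (\<beta> t k) A & (one --> A = 1)"
  and i: "!!k. k \<in> J ==> \<exists>A. asy (%s. X s 0 k) (e 0 k) A & (one --> A = 1)"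
  and e: "!!t k. k \<in> J ==> t < rr k + c ==> e (Suc t) k + e t k = min (\<alpha> t k) (\<beta> t k + nbs e t k)"
  and ne: "!!t k. k \<in> J ==> t < rr k + c ==> one ==> \<alpha> t k ~= \<beta> t k + nbs e t k"
 shows "k \<in> J ==> t <= rr k + c ==> \<exists>A. asy (%s. X s t k) (e t k) A & (one --> A = 1)"
proof (induction t arbitrary: k)
 case 0 thus ?case using i by simp
next
 case (Suc t)
 show ?case using Suc(2,3)
 proof (induction "ht k" arbitrary: k rule: less_induct)
  case (less k)
  note k = less(2) and IH = less(1)
  have t: "t < rr k + c" using less by simp
  define A where "A = (%t i. SOME A. asy (%s. X s t i) (e t i) A & (one --> A = 1))"
  have A: "asy (%s. X s t i) (e t i) (A t i) & (one --> A t i = 1)"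
   if "\<exists>A. asy (%s. X s t i) (e t i) A & (one --> A = 1)" for t i unfolding A_def by (rule someI_ex[OF that])
  have b: "asy (%s. X s (Suc t) i) (e (Suc t) i) (A (Suc t) i) & (one --> A (Suc t) i = 1)" if "i \<in> bel k" "a i k ~= 0" for i
  proof (rule A, rule IH)
   show "ht i < ht k" "i \<in> J" using that by (auto simp: bel_def)
   show "Suc t <= rr i + c" using nbr_dom(1)[OF k, of i] that t by (auto simp: bel_def)
  qed
  have c: "asy (%s. X s t i) (e t i) (A t i) & (one --> A t i = 1)" if "i \<in> abv k" "a i k ~= 0" for i
  proof (rule A, rule Suc(1))
   show "i \<in> J" using that by (auto simp: abv_def)
   show "t <= rr i + c" using nbr_dom(2)[OF k, of i] that t by (auto simp: abv_def)
  qed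
  have nb: "asy (%s. nbp (X s) t k) (nbs e t k) (nbp A t k)" by (rule asy_nbp[OF k]) (use b c in auto)
  have o: "nbp A t k = 1" if one
  proof -
   have *: "x ^ nat (- a i k) = 1" if "a i k ~= 0 ==> x = (1::real)" for x i using that by (cases "a i k = 0") auto
   have "(\<Prod>i\<in>bel k. A (Suc t) i ^ nat (- a i k)) = 1" "(\<Prod>i\<in>abv k. A t i ^ nat (- a i k)) = 1"
    by (intro prod.neutral ballI *; use b c \<open>one\<close> in auto)+
   thus ?thesis by (simp add: nbp_def)
  qed
  obtain Ap where Ap: "asy (%s. p s t k) (\<alpha> t k) Ap" "one --> Ap = 1" using p[OF k t] by blast
  obtain Aq where Aq: "asy (%s. q s t k) (\<beta> t k) Aq" "one --> Aq = 1" using q[OF k t] by blast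
  obtain At where At: "asy (%s. X s t k) (e t k) At" "one --> At = 1" using Suc(1)[OF k] t by auto
  define B where "B = (if \<alpha> t k <= \<beta> t k + nbs e t k then Ap else 0) + (if \<beta> t k + nbs e t k <= \<alpha> t k then Aq * nbp A t k else 0)"
  have "asy (%s. (p s t k + q s t k * nbp (X s) t k) / X s t k) (min (\<alpha> t k) (\<beta> t k + nbs e t k) - e t k) (B / At)"
   unfolding B_def by (intro asy_div asy_add asy_mult Ap Aq At nb)
  hence "asy (%s. X s (Suc t) k) (min (\<alpha> t k) (\<beta> t k + nbs e t k) - e t k) (B / At)"
   by (rule asy_cong) (use rec[OF _ k, of _ t] nz[OF _ k] in "simp add: divide_eq_eq")
  moreover have "min (\<alpha> t k) (\<beta> t k + nbs e t k) - e t k = e (Suc t) k" using e[OF k t] by simp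
  moreover have "B / At = 1" if one
   using ne[OF k t that] that Ap Aq At o[OF that] by (cases "\<alpha> t k <= \<beta> t k + nbs e t k") (auto simp: B_def)
  ultimately show ?case by auto
 qed
qed

end

context fdyn
begin

lemma Fe_asy:
 fixes y :: "'n => real"
 assumes y: "!!l. y l > 0" and e0: "!!k. e 0 k = 0"
  and e: "!!t k. k \<in> J ==> t <= rr k ==> e (Suc t) k + e t k = min (\<Sum>l\<in>UNIV. w l * R t k l) (nbs e t k)"
  and one: "one ==> y = (%_. 1)" "!!t k. k \<in> J ==> t <= rr k ==> one ==> (\<Sum>l\<in>UNIV. w l * R t k l) ~= nbs e t k"
  and kt: "k \<in> J" "t <= Suc (rr k)"
 shows "\<exists>A. asy (%s. Fe (cv y w s) t k) (e t k) A & (one --> A = 1)"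
proof (rule asy_belt[where \<beta> = "%_ _. 0" and q = "%_ _ _. 1" and p = "%s t k. mon (cv y w s) (R t k)" and \<alpha> = "%t k. \<Sum>l\<in>UNIV. w l * R t k l" and c = 1, OF _ _ _ _ _ _ _ kt(1)])
 have cp: "cv y w s l > 0" if "s > 0" for s l using y that by (simp add: cv_def)
 have cn: "cv y w s l ~= 0" if "s > 0" for s l using cp[OF that, of l] by simp
 show "Fe (cv y w s) t k ~= 0" if "s > 0" "k \<in> J" for s t k using Fe_pos[of "cv y w s" k t] cp that by simp
 show "Fe (cv y w s) (Suc t) k * Fe (cv y w s) t k = mon (cv y w s) (R t k) + 1 * nbp (Fe (cv y w s)) t k"
  if "s > 0" "k \<in> J" for s t k using Fe_rec[of "cv y w s" k t] cn[OF that(1)] that(2) by simp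
 show "\<exists>A. asy (%s. mon (cv y w s) (R t k)) (\<Sum>l\<in>UNIV. w l * R t k l) A & (one --> A = 1)" for t k
  using asy_mon[where y = y and w = w and m = "R t k", OF y] one(1) by (auto simp: mon_def intro!: exI[of _ "mon y (R t k)"])
 show "\<exists>A. asy (%s. 1) 0 A & (one --> A = 1)" using asy_const[of 1] by auto
 show "\<exists>A. asy (%s. Fe (cv y w s) 0 k) (e 0 k) A & (one --> A = 1)" for k
  by (rule exI[of _ 1]) (use asy_cong[OF asy_const[of 1], of "%s. Fe (cv y w s) 0 k"] cn e0 in simp)
qed (use e one kt in auto)

lemma sum_unit: "(\<Sum>j\<in>(UNIV::'n set). of_bool (j = l) * m j) = (m l :: int)" "(\<Sum>j\<in>(UNIV::'n set). - of_bool (j = l) * m j) = - (m l :: int)"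
 by (simp_all add: sum_negf of_bool_def if_distrib[of "%x. x * _"] cong: if_cong)

lemma nbs_le_0:
 assumes k: "k \<in> J" and t: "t < rr k"
 shows "nbs (%t i. if t = Suc (rr i) then f i else 0) t k = 0"
proof -
 have "nbs (%t i. if t = Suc (rr i) then f i else 0) t k = nbs (%_ _. 0) t k"
  by (rule nbs_cong) (use nbr_dom[OF k] t in "force simp: bel_def abv_def")+
 thus ?thesis by simp
qed

lemma nbs_ended_neg:
 "k \<in> J ==> nbs (%t i. if t = Suc (rr i) then - P (st i) l else 0) (rr k) k = of_bool (l = st k) - P (st k) l"
 using nbs_ended[of k "%i. - P i l"] P_rec[of "st k"] by (simp add: sum_negf)

text \<open>On a curve tending to zero in coordinate \<open>l\<close> only, the order is the least
  exponent of \<open>y l\<close>. It stays zero while the roots are nonnegative; past the row end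
  the negative root \<open>- P (st k)\<close> takes over.\<close>

lemma Fe_asy_up:
 assumes y: "!!l. (y l::real) > 0" and k: "k \<in> J" and t: "t <= Suc (rr k)"
 shows "\<exists>A. asy (%s. Fe (cv y (%j. of_bool (j = l)) s) t k) (if t = Suc (rr k) then - P (st k) l else 0) A"
proof -
 have "\<exists>A. asy (%s. Fe (cv y (%j. of_bool (j = l)) s) t k) (if t = Suc (rr k) then - P (st k) l else 0) A & (False --> A = 1)"
 proof (rule Fe_asy[where e = "%t k. if t = Suc (rr k) then - P (st k) l else 0", OF y _ _ _ _ k t])
  fix t k assume k: "k \<in> J" and t: "t <= rr k"
  let ?e = "%t k. if t = Suc (rr k) then - P (st k) l else 0"
  show "?e (Suc t) k + ?e t k = min (\<Sum>j\<in>UNIV. of_bool (j = l) * R t k j) (nbs ?e t k)"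
  proof (cases "t = rr k")
   case True
   thus ?thesis unfolding True nbs_ended_neg[OF k] sum_unit by (simp add: R_rr[OF k])
  next
   case False
   hence t': "t < rr k" using t by simp
   show ?thesis unfolding nbs_le_0[OF k t'] sum_unit using R_nonneg[OF t', of l] t' by simp
  qed
 qed auto
 thus ?thesis by simp
qed

text \<open>The opposite curve measures the degree in \<open>y l\<close>. This degree is the
  coordinate of the preceding root, because the tropical recursion is here the mesh
  relation.\<close>

lemma Fe_asy_down:
 assumes y: "!!l. (y l::real) > 0" and k: "k \<in> J" and t: "t <= Suc (rr k)"
 shows "\<exists>A. asy (%s. Fe (cv y (%j. - of_bool (j = l)) s) t k) (case t of 0 => 0 | Suc t' => - R t' k l) A"
proof -
 let ?e = "%t k. case t of 0 => 0 | Suc t' => - R t' k l"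
 have "\<exists>A. asy (%s. Fe (cv y (%j. - of_bool (j = l)) s) t k) (?e t k) A & (False --> A = 1)"
 proof (rule Fe_asy[where e = ?e, OF y _ _ _ _ k t])
  fix t k assume k: "k \<in> J" and t: "t <= rr k"
  show "?e (Suc t) k + ?e t k = min (\<Sum>j\<in>UNIV. - of_bool (j = l) * R t k j) (nbs ?e t k)"
  proof (cases t)
   case 0
   have "nbs ?e 0 k = - (\<Sum>i\<in>bel k. - a i k * P i l)" by (simp add: nbs_def sum_negf)
   also have "\<dots> = of_bool (l = k) - P k l" unfolding P_rec[of k] by (simp add: sum_negf)
   finally show ?thesis using 0 unfolding sum_unit by simp
  next
   case (Suc t')
   have "nbs ?e (Suc t') k = - nbs (%t k. R t k l) t' k" by (simp add: nbs_def sum_negf)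
   also have "\<dots> = - (R (Suc t') k l + R t' k l)" using nbs_mesh[OF k] by simp
   finally show ?thesis using Suc R_nonneg[of t' k l] t unfolding sum_unit by simp
  qed
 qed auto
 thus ?thesis by simp
qed

lemma sumR_pos: assumes k: "k \<in> J" and t: "t < rr k" shows "0 < (\<Sum>l\<in>UNIV. R t k l)"
proof -
 obtain l where l: "R t k l ~= 0" using root_nonzero[OF _ root_R[OF k]] dpos k by blast
 hence "0 < R t k l" using R_nonneg[OF t, of l] by simp
 thus ?thesis by (intro sum_pos2[of _ l]) (auto intro: R_nonneg[OF t])
qed

text \<open>With all weights equal the two terms never tie, since the coordinate sum of a positive
  root is positive. This normalizes the monomial in \<open>FL_Per\<close>.\<close>

lemma Fe_asy_one:
 assumes k: "k \<in> J" and t: "t <= Suc (rr k)"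
 shows "asy (%s. Fe (cv (%_. 1) (%_. 1) s) t k) (if t = Suc (rr k) then - (\<Sum>l\<in>UNIV. P (st k) l) else 0) 1"
proof -
 let ?e = "%t k. if t = Suc (rr k) then - (\<Sum>l\<in>UNIV. P (st k) l) else 0"
 have n: "nbs ?e (rr k) k = 1 - (\<Sum>l\<in>UNIV. P (st k) l)" if k: "k \<in> J" for k
 proof -
  have "(\<Sum>l\<in>UNIV. P (st k) l) = 1 - (\<Sum>i\<in>bel (st k). a i (st k) * (\<Sum>l\<in>UNIV. P i l))"
   by (subst P_rec) (simp add: sum_subtractf sum_distrib_left sum.swap[of _ UNIV])
  thus ?thesis using nbs_ended[OF k, of "%i. - (\<Sum>l\<in>UNIV. P i l)"] by (simp add: sum_negf)
 qed
 have "\<exists>A. asy (%s. Fe (cv (%_. 1) (%_. 1) s) t k) (?e t k) A & (True --> A = 1)"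
 proof (rule Fe_asy[where e = ?e, OF _ _ _ _ _ k t])
  fix t k assume k: "k \<in> J" and t: "t <= rr k"
  have *: "?e (Suc t) k + ?e t k = min (\<Sum>l\<in>UNIV. 1 * R t k l) (nbs ?e t k) & (\<Sum>l\<in>UNIV. 1 * R t k l) ~= nbs ?e t k"
  proof (cases "t = rr k")
   case True
   thus ?thesis unfolding True n[OF k] by (simp add: R_rr[OF k] sum_negf)
  next
   case False
   hence t': "t < rr k" using t by simp
   show ?thesis unfolding nbs_le_0[OF k t'] using sumR_pos[OF k t'] t' by simp
  qed
  show "?e (Suc t) k + ?e t k = min (\<Sum>l\<in>UNIV. 1 * R t k l) (nbs ?e t k)" using * by blast
  show "(\<Sum>l\<in>UNIV. 1 * R t k l) ~= nbs ?e t k" using * by blast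
 qed auto
 thus ?thesis by simp
qed

lemma of_int_inj0: "of_int c = (0::real) ==> c = 0" by simp

lemma FL_keys:
 assumes k: "k \<in> J" and t: "t <= Suc (rr k)" and m: "m \<in> kys (FL t k)"
 shows "(if t = Suc (rr k) then - P (st k) l else 0) <= lkp m l"
  "lkp m l <= (case t of 0 => 0 | Suc t' => R t' k l)"
proof -
 show "(if t = Suc (rr k) then - P (st k) l else 0) <= lkp m l"
  using conjunct1[OF lev_order[OF ring_hom_of_int of_int_inj0 Fe_asy_up[OF _ k t, unfolded Fe_def]]] m
  unfolding sum_unit by blast
 have "(case t of 0 => 0 | Suc t' => - R t' k l) <= - lkp m l"
  using conjunct1[OF lev_order[OF ring_hom_of_int of_int_inj0 Fe_asy_down[OF _ k t, unfolded Fe_def]]] m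
  unfolding sum_unit by blast
 thus "lkp m l <= (case t of 0 => 0 | Suc t' => R t' k l)" by (cases t) auto
qed

text \<open>One step past the row the two bounds of \<open>FL_keys\<close> coincide and leave a
  single monomial, whose coefficient is 1 by \<open>Fe_asy_one\<close>. This is the periodicity of
  the exchange recursion.\<close>

lemma FL_Per:
 assumes k: "k \<in> J"
 shows "FL (Suc (rr k)) k = pms (pm (%l. - P (st k) l)) 1"
proof -
 let ?L = "FL (Suc (rr k)) k" and ?m = "pm (%l. - P (st k) l)"
 have "m = ?m" if "m \<in> kys ?L" for m
 proof (rule poly_mapping_eqI)
  fix l show "lkp m l = lkp ?m l" using FL_keys[OF k _ that, of l] by (simp add: R_rr[OF k])
 qed
 hence L: "?L = pms ?m (lkp ?L ?m)" by (intro poly_mapping_eqI) (auto simp: lookup_single when_def in_keys_iff)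
 define c where "c = lkp ?L ?m"
 interpret I: fhom "of_int :: int => real" by (rule ring_hom_of_int)
 have F: "Fe y (Suc (rr k)) k = of_int c * mon y (%l. - P (st k) l)" for y :: "'n => real"
  unfolding Fe_def by (subst L) (simp add: I.lev_single c_def)
 have m1: "asy (%s. mon (cv (%_. 1) (%_. 1) s) (%l. - P (st k) l)) (- (\<Sum>l\<in>UNIV. P (st k) l)) 1"
  using asy_mon[of "%_::'n. 1" "%_. 1" "%l. - P (st k) l"] by (simp add: sum_negf mon_def)
 have "asy (%s. Fe (cv (%_. 1) (%_. 1) s) (Suc (rr k)) k / mon (cv (%_. 1) (%_. 1) s) (%l. - P (st k) l)) 0 1"
  using asy_div[OF Fe_asy_one[OF k, of "Suc (rr k)"] m1] by simp
 hence "asy (%s. real_of_int c) 0 1"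
 proof (rule asy_cong)
  fix s :: real assume "0 < s"
  hence "mon (cv (%_. 1) (%_. 1) s) (%l. - P (st k) l) > 0" by (intro mon_pos) (simp add: cv_def)
  thus "Fe (cv (%_. 1) (%_. 1) s) (Suc (rr k)) k / mon (cv (%_. 1) (%_. 1) s) (%l. - P (st k) l) = of_int c" unfolding F by simp
 qed
 hence "c = 1" by (simp add: asy_def tendsto_const_iff)
 thus ?thesis using L by (simp add: c_def)
qed

lemma Fe_Per: "k \<in> J ==> Fe y (Suc (rr k)) k = mon y (%l. - P (st k) l)"
proof -
 interpret I: fhom "of_int :: int => 'a" by (rule ring_hom_of_int)
 assume "k \<in> J" thus ?thesis by (simp add: Fe_def FL_Per I.lev_single)
qed

end

context dynkin
begin

subsection \<open>Separation of coefficients\<close>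

function gz :: "(nat => 'n => int) => ('n => int) => nat => 'n => int" where
 "gz h g 0 k = g k"
| "gz h g (Suc t) k = h t k + ((\<Sum>i\<in>bel k. - a i k * gz h g (Suc t) i) + (\<Sum>i\<in>abv k. - a i k * gz h g t i)) - gz h g t k"
 by pat_completeness auto
termination by (relation "measures [%(h,g,t,k). t, %(h,g,t,k). ht k]") (auto simp: bel_def)
declare gz.simps(2) [simp del]

lemma gz_rec: "gz h g (Suc t) k + gz h g t k = h t k + nbs (gz h g) t k" unfolding nbs_def by (subst gz.simps(2)) simp

lemma nbs_add: "nbs (%t k. X t k + Y t k) t k = nbs X t k + nbs Y t k"
 and nbs_diff: "nbs (%t k. X t k - Y t k) t k = nbs X t k - nbs Y t k"
 by (simp_all add: nbs_def distrib_left right_diff_distrib sum.distrib sum_subtractf sum_negf)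

lemma nbs_shift: "nbs X (Suc t) k + nbs X t k = nbs (%t k. X (Suc t) k + X t k) t k"
 by (simp add: nbs_def distrib_left sum.distrib sum_negf sum_subtractf)

lemma nbs_sum: "nbs (%t k. \<Sum>j\<in>S. c j * X t k j) t k = (\<Sum>j\<in>S. c j * nbs (%t k. X t k j) t k)"
 by (simp add: nbs_def sum_distrib_left sum.distrib distrib_left sum.swap[of _ S] mult.left_commute)

lemma nbs_zero_unique:
 assumes r: "!!t k. k \<in> J ==> D (Suc t) k + D t k = nbs D t k" and 0: "!!k. k \<in> J ==> D 0 k = 0"
 shows "k \<in> J ==> D t k = (0::'b::comm_ring_1)"
proof (induction t arbitrary: k)
 case (Suc t)
 show ?case using Suc(2)
 proof (induction "ht k" arbitrary: k rule: less_induct)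
  case less
  have "nbs D t k = nbs (%_ _. 0) t k" by (rule nbs_cong) (use less(1) Suc(1) in "auto simp: bel_def abv_def")
  thus ?case using r[OF less(2), of t] Suc(1)[OF less(2)] by simp
 qed
qed (simp add: 0)

end

context belt
begin

text \<open>The row entry met at \<open>k\<close>, set to zero for mutable rows so that mutable and
  frozen rows obey the same formulas.\<close>

definition ce :: "int^'n^'v => 'v => nat => 'n => int" where
 "ce b v t k = (if v \<in> \<iota> ` J then 0 else cc t (row b v) k)"

definition gx :: "int^'n^'v => 'v => nat => 'n => int" where
 "gx b v = gz (%t k. max 0 (- ce b v t k)) (%k. of_bool (v = \<iota> k))"

lemma gx_0 [simp]: "gx b v 0 k = of_bool (v = \<iota> k)" by (simp add: gx_def)
lemma gx_rec: "gx b v (Suc t) k + gx b v t k = max 0 (- ce b v t k) + nbs (gx b v) t k"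
 unfolding gx_def by (rule gz_rec)

lemma ce_mesh: "ce b v (Suc t) k + ce b v t k = nbs (%t k. max 0 (ce b v t k)) t k"
 by (simp add: ce_def nbs_def cc_mesh sum_negf)

text \<open>The difference of the two sides satisfies the homogeneous mesh recursion: the
  contributions of \<open>max 0 (- ce b v t k)\<close> to \<open>ce\<close> and to \<open>gx\<close>
  cancel. The shape of the mutable block enters through the initial values.\<close>

lemma ce_sum:
 assumes J: "Jblock b" and k: "k \<in> J"
 shows "ce b v t k = (\<Sum>j\<in>J. b $ v $ j * R t k j) + nbs (gx b v) t k"
proof -
 define c where "c = ce b v"
 define g where "g = gx b v"
 define m where "m = (%t k. max 0 (- c t k))"
 define bR where "bR = (%t k. \<Sum>j\<in>J. b $ v $ j * R t k j)"
 define D where "D = (%t k. c t k - bR t k - nbs g t k)"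
 have r: "D (Suc t) k + D t k = nbs D t k" if k: "k \<in> J" for t k
 proof -
  have 1: "nbs D t k = nbs c t k - nbs bR t k - nbs (nbs g) t k" by (simp only: D_def nbs_diff)
  have 2: "nbs bR t k = bR (Suc t) k + bR t k"
   unfolding bR_def nbs_sum nbs_mesh[OF k] by (simp add: distrib_left sum.distrib)
  have "nbs c t k = nbs (%t k. max 0 (c t k) - m t k) t k" by (rule nbs_cong) (auto simp: m_def)
  also have "\<dots> = c (Suc t) k + c t k - nbs m t k" using ce_mesh[of b v t k] by (simp only: nbs_diff c_def)
  finally have 3: "nbs c t k = c (Suc t) k + c t k - nbs m t k" .
  have "nbs g (Suc t) k + nbs g t k = nbs (%t k. m t k + nbs g t k) t k"
   by (simp only: nbs_shift m_def c_def g_def gx_rec)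
  hence 4: "nbs m t k + nbs (nbs g) t k = nbs g (Suc t) k + nbs g t k" by (simp only: nbs_add)
  show ?thesis using 1 2 3 4 by (simp add: D_def)
 qed
 have "D 0 k = 0" if k: "k \<in> J" for k using k
 proof (induction "ht k" arbitrary: k rule: less_induct)
  case (less k)
  note k = less(2)
  have bP: "(\<Sum>j\<in>J. b $ v $ j * P k j) = b $ v $ k - (\<Sum>i\<in>bel k. a i k * (\<Sum>j\<in>J. b $ v $ j * P i j))"
  proof -
   have "(\<Sum>j\<in>J. b $ v $ j * P k j) = (\<Sum>j\<in>J. b $ v $ j * of_bool (j = k)) - (\<Sum>j\<in>J. \<Sum>i\<in>bel k. a i k * (b $ v $ j * P i j))"
    by (subst P_rec) (simp add: right_diff_distrib sum_subtractf sum_distrib_left mult.left_commute)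
   also have "(\<Sum>j\<in>J. b $ v $ j * of_bool (j = k)) = (\<Sum>j\<in>J. if j = k then b $ v $ k else 0)" by (rule sum.cong) auto
   finally show ?thesis using k finJ by (simp add: sum.swap[of _ J] sum_distrib_left)
  qed
  have n: "nbs (gx b v) 0 k = (\<Sum>i\<in>bel k. - a i k * (max 0 (- ce b v 0 i) + nbs (gx b v) 0 i)) +
    ((\<Sum>i\<in>abv k. - a i k * of_bool (v = \<iota> i)) - (\<Sum>i\<in>bel k. - a i k * of_bool (v = \<iota> i)))"
  proof -
   have "gx b v (Suc 0) i = max 0 (- ce b v 0 i) + nbs (gx b v) 0 i - of_bool (v = \<iota> i)" for i
    using gx_rec[of b v 0 i] by simp
   hence "(\<Sum>i\<in>bel k. - a i k * gx b v (Suc 0) i) =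
     (\<Sum>i\<in>bel k. - a i k * (max 0 (- ce b v 0 i) + nbs (gx b v) 0 i)) - (\<Sum>i\<in>bel k. - a i k * of_bool (v = \<iota> i))"
    unfolding sum_subtractf[symmetric] by (intro sum.cong) (simp_all only: right_diff_distrib)
   thus ?thesis unfolding nbs_def[of _ 0 k] by simp
  qed
  have z: "b $ v $ k = ce b v 0 k - (\<Sum>i\<in>bel k. - a i k * max 0 (ce b v 0 i)) -
    ((\<Sum>i\<in>abv k. - a i k * of_bool (v = \<iota> i)) - (\<Sum>i\<in>bel k. - a i k * of_bool (v = \<iota> i)))"
  proof (cases "v \<in> \<iota> ` J")
   case True
   then obtain j where j: "j \<in> J" "v = \<iota> j" by auto
   have e: "\<iota> j = \<iota> i \<longleftrightarrow> i = j" for i using inj_iota by (auto simp: inj_def)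
   have s: "(\<Sum>i\<in>S. - a i k * of_bool (\<iota> j = \<iota> i)) = (if j \<in> S then - a j k else 0)" if "finite S" for S
   proof -
    have "(\<Sum>i\<in>S. - a i k * of_bool (\<iota> j = \<iota> i)) = (\<Sum>i\<in>S. if i = j then - a j k else 0)"
     by (rule sum.cong) (auto simp: e)
    thus ?thesis using that by simp
   qed
   have "b $ \<iota> j $ k = Bm j k" using J j k by (simp add: Jblock_def)
   moreover have "b $ \<iota> j $ k = - ((if j \<in> abv k then - a j k else 0) - (if j \<in> bel k then - a j k else 0)) ==> ?thesis"
    unfolding j(2) s[OF fin_bel] s[OF fin_abv] using j by (simp add: ce_def)
   ultimately show ?thesis using j by (auto simp: Bm_def bel_def abv_def)
  next
   case False
   hence v: "!!i. i \<in> J ==> v ~= \<iota> i" by auto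
   have "(\<Sum>i\<in>bel k. - a i k * of_bool (v = \<iota> i)) = 0" "(\<Sum>i\<in>abv k. - a i k * of_bool (v = \<iota> i)) = 0"
    by (rule sum.neutral, use v in "auto simp: bel_def abv_def")+
   moreover have "ce b v 0 k = b $ v $ k - (\<Sum>i\<in>bel k. a i k * max 0 (ce b v 0 i))"
    using False by (simp add: ce_def cc_def) (subst crow.simps, simp add: row_def)
   ultimately show ?thesis by (simp add: sum_negf)
  qed
  have "D 0 k = (\<Sum>i\<in>bel k. - a i k * D 0 i)"
  proof -
   have "(\<Sum>i\<in>bel k. - a i k * D 0 i) = (\<Sum>i\<in>bel k. - a i k * max 0 (ce b v 0 i)) + (\<Sum>i\<in>bel k. a i k * (\<Sum>j\<in>J. b $ v $ j * P i j))
     - (\<Sum>i\<in>bel k. - a i k * (max 0 (- ce b v 0 i) + nbs (gx b v) 0 i))"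
    unfolding sum.distrib[symmetric] sum_subtractf[symmetric]
    by (rule sum.cong) (auto simp: D_def c_def g_def bR_def algebra_simps max_def)
   thus ?thesis unfolding D_def c_def g_def bR_def using bP n z by simp
  qed
  also have "\<dots> = 0" by (rule sum.neutral) (use less(1) in "auto simp: bel_def")
  finally show ?case .
 qed
 hence "D t k = 0" using nbs_zero_unique[of D, OF r _ k] by blast
 thus ?thesis by (simp add: D_def c_def g_def bR_def)
qed

lemma fpos_mon: "fpos x c = mon x (%v. if v \<in> \<iota> ` J then 0 else max 0 (c v))"
proof -
 have "mon x (%v. if v \<in> \<iota> ` J then 0 else max 0 (c v)) = (\<Prod>v\<in>UNIV. if v \<in> \<iota> ` J then 1 else x v ^ nat (c v))"
  unfolding mon_def by (rule prod.cong) (auto simp: max_def power_int_def)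
 also have "\<dots> = fpos x c" unfolding fpos_def by (rule prod.mono_neutral_cong_right) auto
 finally show ?thesis ..
qed

lemma fpos_ce: "fpos x (%v. cc t (row b v) k) = mon x (%v. max 0 (ce b v t k))"
 "fpos x (%v. - cc t (row b v) k) = mon x (%v. max 0 (- ce b v t k))"
 unfolding fpos_mon ce_def by (rule arg_cong[of _ _ "mon x"]; auto)+

lemma nbp_mon:
 assumes x: "!!v. x v ~= 0" and k: "k \<in> J"
 shows "nbp (%t k. mon x (m t k) * X t k) t k = mon x (%v. nbs (%t k. m t k v) t k) * nbp X t k"
proof -
 have *: "(\<Prod>i\<in>S. (mon x (f i) * h i) ^ nat (- a i k)) = mon x (%v. \<Sum>i\<in>S. - a i k * f i v) * (\<Prod>i\<in>S. h i ^ nat (- a i k))"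
  if "S \<subseteq> J - {k}" for S f and h :: "'n => 'b"
 proof -
  have "mon x (%v. - a i k * f i v) = mon x (f i) ^ nat (- a i k)" if "i \<in> S" for i
   using offd[of i k] that \<open>S \<subseteq> J - {k}\<close> k unfolding mon_scale by (subst power_int_nonneg_exp) auto
  thus ?thesis by (simp add: power_mult_distrib prod.distrib mon_sum[OF x])
 qed
 have 1: "bel k \<subseteq> J - {k}" "abv k \<subseteq> J - {k}" by (auto simp: bel_def abv_def)
 show ?thesis unfolding nbp_def nbs_def of_int_eq_id id_apply *[OF 1(1)] *[OF 1(2)] mon_add[where x = x, OF x]
  by (simp only: mult.assoc mult.left_commute)
qed

end

locale fbelt = belt J a d ht \<iota> for J :: "'n::{finite,linorder} set" and a d ht and \<iota> :: "'n => 'v::finite"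

sublocale fbelt \<subseteq> F: fdyn J a d ht by unfold_locales

context fbelt
begin

text \<open>The y-hat variables of a seed: columns of the extended matrix read as exponents.\<close>

definition yh :: "('n int_vec, 'v) vec => ('v => 'f::field) => 'n => 'f" where
 "yh b x l = mon x (%v. b $ v $ l)"

lemma mon_yh: "(!!v. x v ~= 0) ==> mon (yh b x) m = mon x (%v. \<Sum>l\<in>UNIV. m l * b $ v $ l)"
 unfolding mon_def[of "yh b x"] yh_def by (simp add: mon_sum mon_scale)

text \<open>The product satisfies the exchange recursion of \<open>Xb\<close>, because
  \<open>ce_sum\<close> matches the exponent of the y-hat monomial with the quotient of the two
  coefficient monomials, corrected by the neighbour sum of the g-exponents. Nonvanishing solutions
  are unique.\<close>

theorem separation:
 assumes J: "Jblock b" and S: "semifield S" and x: "!!v. x v \<in> S" and k: "k \<in> J"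
 shows "Xb b x t k = mon x (%v. gx b v t k) * F.Fe (yh b x) t k" "Xb b x t k \<in> S"
proof -
 have nz: "x v ~= 0" for v using x[of v] S by (auto simp: semifield_def)
 have y: "yh b x l \<in> S" for l unfolding yh_def by (rule semifield_mon[OF S x])
 have ynz: "yh b x l ~= 0" for l using y[of l] S by (auto simp: semifield_def)
 define X where "X = (%t k. mon x (%v. gx b v t k) * F.Fe (yh b x) t k)"
 have XS: "X t k \<in> S" if "k \<in> J" for t k
  using semifield_mon[OF S, of x] x F.Fe_semifield[where y = "yh b x", OF S y that, of t] S by (auto simp: X_def semifield_def)
 have "X (Suc t) k * X t k = fpos x (%v. cc t (row b v) k) + fpos x (%v. - cc t (row b v) k) * nbp X t k" if k: "k \<in> J" for t k
 proof -
  have G: "mon x (%v. gx b v (Suc t) k) * mon x (%v. gx b v t k) = mon x (%v. max 0 (- ce b v t k)) * mon x (%v. nbs (gx b v) t k)"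
   unfolding mon_add[OF nz, symmetric] gx_rec ..
  have "mon (yh b x) (R t k) = mon x (%v. \<Sum>j\<in>J. b $ v $ j * R t k j)" unfolding mon_yh[OF nz]
  proof (intro arg_cong[of _ _ "mon x"] ext)
   fix v show "(\<Sum>l\<in>UNIV. R t k l * b $ v $ l) = (\<Sum>j\<in>J. b $ v $ j * R t k j)"
    by (rule sum.mono_neutral_cong_right) (use supp_R[OF k, of t] in "auto simp: supp_def")
  qed
  hence "mon x (%v. gx b v (Suc t) k) * mon x (%v. gx b v t k) * mon (yh b x) (R t k) = mon x (%v. max 0 (ce b v t k))"
   unfolding mon_add[where x = x, OF nz, symmetric] gx_rec \<open>mon (yh b x) (R t k) = _\<close>
   by (intro arg_cong[where f = "mon x"] ext) (auto simp: max_def ce_sum[OF J k])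
  moreover have "X (Suc t) k * X t k = mon x (%v. gx b v (Suc t) k) * mon x (%v. gx b v t k) * (F.Fe (yh b x) (Suc t) k * F.Fe (yh b x) t k)"
   by (simp add: X_def algebra_simps)
  moreover have "nbp X t k = mon x (%v. nbs (gx b v) t k) * nbp (F.Fe (yh b x)) t k"
   unfolding X_def by (rule nbp_mon[where x = x, OF nz k])
  ultimately show ?thesis unfolding fpos_ce F.Fe_rec[where y = "yh b x", OF ynz k, of t] G distrib_left
   by (simp only: mult.assoc)
 qed
 hence "Xb b x t k = X t k" unfolding Xb_def
 proof (intro Z_unique[OF _ _ _ k])
  show "X t k ~= 0" if "k \<in> J" for t k using XS[OF that, of t] S by (auto simp: semifield_def)
  show "X 0 k = x (\<iota> k)" for k using ynz by (simp add: X_def mon_unit)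
 qed
 thus "Xb b x t k = mon x (%v. gx b v t k) * F.Fe (yh b x) t k" "Xb b x t k \<in> S"
  using XS[OF k] by (auto simp: X_def)
qed

end

section \<open>Explicit solution of the u-equations by F-polynomials\<close>

context dynkin
begin

text \<open>A normalized dimension of homomorphisms (\<open>NN_max\<close>). As a function of
  \<open>r\<close> it is the response of the mesh recursion to a unit source at \<open>q\<close>
  (\<open>NN_nbs\<close>).\<close>

definition NN :: "nat \<times> 'n => nat \<times> 'n => real" where
 "NN q r = (if 0 < fst q & fst q <= fst r then R (fst r - fst q) (snd r) (snd q) else 0)"

text \<open>For the full diagram these are the negatives of the coordinates of
  \<open>gv (tauD q)\<close>, as verified in \<open>solution_exists\<close>.\<close>

definition gM :: "nat \<times> 'n => 'n => real" where
 "gM q l = - eul (rho q) (unit l) / d (snd q)"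

lemma nbs_real: "real_of_int (nbs X t k) = nbs (%t k. real_of_int (X t k)) t k" by (simp add: nbs_def)

lemma NN_0 [simp]: "NN q (0, k) = 0" by (simp add: NN_def)

lemma NN_nbs:
 assumes k: "k \<in> J"
 shows "NN q (Suc t, k) + NN q (t, k) - nbs (%t k. NN q (t, k)) t k = of_bool (q = (Suc t, k))"
proof -
 obtain s0 j where w: "q = (s0, j)" by (cases q)
 have nk: "k \<notin> bel k" by (simp add: bel_def)
 consider "s0 = 0" | s where "s0 = Suc s" "Suc s <= t" | "s0 = Suc t" | s where "s0 = Suc s" "t < s"
  by (metis not0_implies_Suc not_less_eq_eq le_SucE linorder_not_less)
 thus ?thesis
 proof cases
  case 1 thus ?thesis by (simp add: w NN_def)
 next
  case 2
  obtain p where p: "t = Suc s + p" using 2(2) le_Suc_ex by blast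
  have "nbs (%t k. NN q (t, k)) t k = real_of_int (nbs (%t k. R t k j) p k)"
   using 2(1) by (simp add: nbs_def w NN_def p Suc_diff_le)
  thus ?thesis using 2(1) by (simp add: w NN_def nbs_mesh[OF k] p Suc_diff_le)
 next
  case 3
  have "nbs (%t k. NN q (t, k)) t k = real_of_int (\<Sum>i\<in>bel k. - a i k * P i j)"
   using 3 by (simp add: nbs_def w NN_def)
  moreover have "P k j = of_bool (j = k) + (\<Sum>i\<in>bel k. - a i k * P i j)" by (subst P_rec) (simp add: sum_negf)
  ultimately show ?thesis using 3 by (simp add: w NN_def)
 next
  case 4
  hence "nbs (%t k. NN q (t, k)) t k = 0" by (simp add: nbs_def w NN_def)
  thus ?thesis using 4 by (simp add: w NN_def)
 qed
qed

lemma NN_max: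
 assumes "(Suc s, j) \<in> PI" "(Suc t, k) \<in> PI"
 shows "NN (Suc s, j) (Suc t, k) = max 0 (eul (R s j) (R t k) / d j)"
proof -
 have jk: "j \<in> J" "k \<in> J" "s < rr j" "t < rr k" using assms by (auto simp: PI_iff)
 have dj: "d j > 0" "d k > 0" using jk dpos by auto
 show ?thesis
 proof (cases "s <= t")
  case True
  have "eul (R s j) (R t k) = d j * R (t - s) k j" using eul_RR[OF jk(1), of s "t - s" k] True by simp
  moreover have "0 <= R (t - s) k j" using jk by (intro R_nonneg) simp
  ultimately show ?thesis using True dj by (simp add: NN_def)
 next
  case False
  have "eul (R s j) (R t k) = - (d k * R (s - Suc t) j k)" using eul_RR'[OF jk(2), of t "s - Suc t" j] False by simp
  moreover have "0 <= R (s - Suc t) j k" using jk by (intro R_nonneg) simp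
  ultimately show ?thesis using False dj by (simp add: NN_def divide_nonpos_pos)
 qed
qed

text \<open>Splits the degree into a part controlled by the mesh recursion and a part linear in the
  root \<open>R t k\<close>. Under summation against \<open>z\<close> these become
  \<open>phi\<close> and a pairing with \<open>eta\<close>.\<close>

lemma md_NN:
 assumes w: "q \<in> PI" and g: "(Suc t, k) \<in> PI"
 shows "real (md q (Suc t, k)) = NN q (Suc t, k) + NN q (t, k) - eul (rho q) (R t k) / d (snd q)"
proof -
 obtain s0 j where e: "q = (s0, j)" by (cases q)
 have jk: "j \<in> J" "k \<in> J" "s0 <= rr j" "t < rr k" using w g by (auto simp: e PI_iff)
 have dj: "d j > 0" "d k > 0" using jk dpos by auto
 show ?thesis
 proof (cases s0)
  case 0
  thus ?thesis using md_0[OF jk(1) g] dj by (simp add: e NN_def rho_0 eul_minus1 eul_PR[OF jk(1)])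
 next
  case (Suc s)
  show ?thesis
  proof (cases "s <= t")
   case True
   have "eul (R s j) (R t k) = d j * R (t - s) k j" using eul_RR[OF jk(1), of s "t - s" k] True by simp
   thus ?thesis using True dj by (subst md_real[OF w g]) (auto simp: e Suc rho_Suc NN_def rmd_def)
  next
   case False
   have "eul (R s j) (R t k) = - (d k * R (s - Suc t) j k)" using eul_RR'[OF jk(2), of t "s - Suc t" j] False by simp
   thus ?thesis using False dj by (subst md_real[OF w g]) (auto simp: e Suc rho_Suc NN_def rmd_def)
  qed
 qed
qed

lemma eul_unit_sum: "supp v ==> eul u v = (\<Sum>l\<in>J. v l * eul u (unit l))"
proof -
 assume v: "supp v"
 have "eul u v = eul u (%l. \<Sum>i\<in>J. v i * unit i l)" by (rule eul_cong) (auto simp: unit_def finJ)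
 thus ?thesis by (simp add: eul_sum2[OF finJ] eul_scale2)
qed

lemma gM_0: "j \<in> J ==> gM (0, j) l = of_bool (l = j)"
 using dpos[of j] by (simp add: gM_def rho_0 eul_minus1 eul_P unit_def)

lemma gM_pair: "supp v ==> (\<Sum>l\<in>J. v l * gM q l) = - eul (rho q) v / d (snd q)"
 by (simp add: eul_unit_sum[of v "rho q"] gM_def sum_divide_distrib sum_negf)

lemma R_star:
 assumes "(Suc u, i) \<in> PI" "k \<in> J"
 shows "d (st k) * R u i (st k) = d i * NN (Suc u, i) (rr k, k)"
proof -
 have i: "i \<in> J" "u < rr i" using assms by (auto simp: PI_iff)
 have "d (st k) * R u i (st k) = eul (P (st k)) (R u i)" by (simp add: eul_PR st_J assms)
 hence e: "d (st k) * R u i (st k) = - eul (R (rr k) k) (R u i)" by (simp add: R_rr[OF assms(2)] eul_minus1)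
 show ?thesis
 proof (cases "u < rr k")
  case True
  thus ?thesis using e eul_RR'[OF i(1), of u "rr k - Suc u" k] by (simp add: NN_def)
 next
  case False
  have "eul (R (rr k) k) (R u i) = d k * R (u - rr k) i k" using eul_RR[OF assms(2), of "rr k" "u - rr k" i] False by simp
  moreover have "0 <= R (u - rr k) i k" "0 <= R u i (st k)" using i by (auto intro: R_nonneg)
  moreover have "0 < d k" "0 < d (st k)" using dpos assms st_J by auto
  ultimately have "d (st k) * R u i (st k) <= 0" "0 <= d (st k) * R u i (st k)"
   using e mult_nonneg_nonneg[of "d k" "R (u - rr k) i k"] mult_nonneg_nonneg[of "d (st k)" "R u i (st k)"] by auto
  thus ?thesis using False by (simp add: NN_def)
 qed
qed

lemma md_star: "q \<in> PI ==> k \<in> J ==> real (md q (0, st k)) = NN q (rr k, k)"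
proof -
 assume w: "q \<in> PI" and k: "k \<in> J"
 obtain s j where e: "q = (s, j)" by (cases q)
 have "0 < d j" using w dpos by (auto simp: e PI_iff)
 thus ?thesis using md_0'[OF st_J[OF k], of _ j] R_star[OF _ k, of _ j] w by (cases s) (auto simp: e NN_def md_00)
qed

text \<open>The boundary condition at the end of row \<open>k\<close>: the mesh recursion one step
  past the row is compared with the recursion of \<open>P (st k)\<close> by means of
  \<open>nbs_ended\<close>. The truncation at \<open>rr k\<close> discards the entries beyond the
  rows.\<close>

lemma gM_star:
 assumes w: "(Suc s, i) \<in> PI" and k: "k \<in> J"
 shows "gM (Suc s, i) (st k) = nbs (%t k. if t <= rr k then NN (Suc s, i) (t, k) else 0) (rr k) k - NN (Suc s, i) (rr k, k)"
proof -
 let ?N = "%t k. NN (Suc s, i) (t, k)"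
 define M where "M = (%k. ?N (Suc (rr k)) k)"
 have i: "i \<in> J" "s < rr i" and di: "d i > 0" using w dpos by (auto simp: PI_iff)
 note sk = st_J[OF k]
 have g: "gM (Suc s, i) (st k) = M k + (\<Sum>l\<in>bel (st k). of_int (a l (st k)) * M (st l))"
 proof (cases s)
  case 0
  have M: "M k = - P (st k) i" if "k \<in> J" for k using 0 by (simp add: M_def NN_def R_rr[OF that])
  have "(\<Sum>l\<in>bel (st k). of_int (a l (st k)) * M (st l)) = - real_of_int (\<Sum>l\<in>bel (st k). a l (st k) * P l i)"
   by (simp add: sum_negf[symmetric]) (rule sum.cong, auto simp: bel_def M st_J st_st)
  moreover have "P (st k) i = of_bool (i = st k) - (\<Sum>l\<in>bel (st k). a l (st k) * P l i)" by (subst P_rec) simp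
  ultimately show ?thesis using 0 di by (simp add: gM_def rho_Suc eul_P[OF i(1)] M[OF k] unit_def)
 next
  case (Suc u)
  have M: "M k = d (st k) * R u i (st k) / d i" if "k \<in> J" for k
  proof -
   have "NN (Suc u, i) (rr k, k) = M k" by (simp add: M_def Suc NN_def)
   thus ?thesis using R_star[of u i, OF _ that] i di by (simp add: Suc PI_iff)
  qed
  have "eul (R s i) (unit (st k)) = - eul (unit (st k)) (R u i)" by (simp add: Suc R_Suc eul_cox)
  also have "\<dots> = - (d (st k) * R u i (st k) + (\<Sum>l\<in>bel (st k). d (st k) * a (st k) l * R u i l))"
   by (simp add: eul_unit1[OF sk])
  also have "(\<Sum>l\<in>bel (st k). d (st k) * a (st k) l * R u i l) = (\<Sum>l\<in>bel (st k). of_int (a l (st k)) * (d i * M (st l)))"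
   by (rule sum.cong) (use di symd[OF sk] in "auto simp: bel_def M st_J st_st")
  finally show ?thesis using di by (simp add: gM_def rho_Suc M[OF k] add_divide_distrib sum_divide_distrib)
 qed
 have "nbs (%t i'. if t = Suc (rr i') then M (st (st i')) else 0) (rr k) k = - (\<Sum>l\<in>bel (st k). of_int (a l (st k)) * M (st l))"
  by (rule nbs_ended[OF k, of "%l. M (st l)"])
 moreover have "nbs ?N (rr k) k = nbs (%t k. (if t <= rr k then ?N t k else 0) + (if t = Suc (rr k) then M (st (st k)) else 0)) (rr k) k"
  by (rule nbs_cong) (use nbr_dom[OF k] in "fastforce simp: bel_def abv_def M_def st_st")+
 ultimately have "nbs ?N (rr k) k = nbs (%t k. if t <= rr k then ?N t k else 0) (rr k) k
   - (\<Sum>l\<in>bel (st k). of_int (a l (st k)) * M (st l))" unfolding nbs_add by simp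
 moreover have "M k + ?N (rr k) k - nbs ?N (rr k) k = 0"
  using NN_nbs[OF k, of "(Suc s, i)" "rr k"] i by (auto simp: M_def)
 ultimately show ?thesis using g by simp
qed

text \<open>In a solution of the \<open>u\<close>-equations \<open>phi z t k\<close> is the logarithm of an \<open>F\<close>-polynomial and \<open>eta z\<close> that
 of the point at which it is evaluated.\<close>

definition phi :: "(nat \<times> 'n => real) => nat => 'n => real" where
 "phi z t k = - (\<Sum>q\<in>PI. NN q (t, k) * z q)"

definition eta :: "(nat \<times> 'n => real) => 'n => real" where
 "eta z l = (\<Sum>q\<in>PI. gM q l * z q)"

lemma phi_0 [simp]: "phi z 0 k = 0" by (simp add: phi_def)

lemma nbs_neg: "nbs (%t k. - X t k) t k = - nbs X t k" by (simp add: nbs_def sum_negf)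

lemma nbs_phi: "nbs (phi z) t k = - (\<Sum>q\<in>PI. z q * nbs (%t k. NN q (t, k)) t k)"
 unfolding phi_def nbs_neg by (subst nbs_sum[symmetric]) (simp add: mult.commute)

text \<open>By \<open>NN_nbs\<close> the mesh operator inverts the summation against
  \<open>NN\<close>.\<close>

lemma z_phi:
 assumes g: "(Suc t, k) \<in> PI"
 shows "z (Suc t, k) = nbs (phi z) t k - phi z (Suc t) k - phi z t k"
proof -
 have k: "k \<in> J" using g by (simp add: PI_iff)
 have "nbs (phi z) t k - phi z (Suc t) k - phi z t k = (\<Sum>q\<in>PI. z q * (NN q (Suc t, k) + NN q (t, k) - nbs (%t k. NN q (t, k)) t k))"
  unfolding nbs_phi by (simp add: phi_def right_diff_distrib distrib_left sum.distrib sum_subtractf mult.commute)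
 also have "\<dots> = (\<Sum>q\<in>PI. if q = (Suc t, k) then z (Suc t, k) else 0)"
  unfolding NN_nbs[OF k] by (rule sum.cong) auto
 finally show ?thesis using g fin_PI by simp
qed

lemma md_phi:
 assumes g: "(Suc t, k) \<in> PI"
 shows "(\<Sum>q\<in>PI. real (md q (Suc t, k)) * z q) = (\<Sum>l\<in>J. R t k l * eta z l) - phi z (Suc t) k - phi z t k"
proof -
 have k: "k \<in> J" using g by (simp add: PI_iff)
 have "(\<Sum>l\<in>J. R t k l * eta z l) = (\<Sum>q\<in>PI. (\<Sum>l\<in>J. R t k l * gM q l) * z q)"
  unfolding eta_def sum_distrib_left sum_distrib_right by (subst sum.swap) (simp add: mult.assoc)
 also have "\<dots> = (\<Sum>q\<in>PI. - eul (rho q) (R t k) / d (snd q) * z q)"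
  by (simp add: gM_pair[OF supp_R[OF k]])
 finally have e: "(\<Sum>l\<in>J. R t k l * eta z l) = (\<Sum>q\<in>PI. - eul (rho q) (R t k) / d (snd q) * z q)" .
 show ?thesis unfolding e phi_def sum_negf[symmetric] sum_subtractf[symmetric]
  by (rule sum.cong[OF refl]) (simp add: md_NN[OF _ g] algebra_simps)
qed

lemma nbs_cong_le:
 assumes k: "k \<in> J" "t < rr k"
  and e: "!!t' i. i \<in> J ==> t' <= rr i ==> t' = Suc t & ht i < ht k \<or> t' = t ==> X t' i = Y t' i"
 shows "nbs X t k = nbs Y t k"
proof (rule nbs_cong)
 show "X (Suc t) i = Y (Suc t) i" if "i \<in> bel k" "a i k ~= 0" for i
  using nbr_dom(1)[OF k(1), of i] that k(2) by (intro e) (auto simp: bel_def)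
 show "X t i = Y t i" if "i \<in> abv k" "a i k ~= 0" for i
  using nbr_dom(2)[OF k(1), of i] that k(2) by (intro e) (auto simp: abv_def)
qed

lemma rec_unique:
 assumes 0: "!!k. k \<in> J ==> f 0 k = f' 0 k"
  and s: "!!t k. k \<in> J ==> t < rr k ==> f t k = f' t k ==> nbs f t k = nbs f' t k ==> f (Suc t) k = (f' (Suc t) k :: real)"
 shows "k \<in> J ==> t <= rr k ==> f t k = f' t k"
proof (induction t arbitrary: k)
 case (Suc t)
 show ?case using Suc(2,3)
 proof (induction "ht k" arbitrary: k rule: less_induct)
  case (less k)
  have "nbs f t k = nbs f' t k" by (rule nbs_cong_le) (use less Suc(1) in auto)
  thus ?case using s[OF less(2), of t] less Suc(1)[OF less(2)] by simp
 qed
qed (simp add: 0)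

text \<open>\<open>z\<close> stands for the logarithms of the coordinates \<open>u\<close>.\<close>

definition usol :: "(nat \<times> 'n => real) => bool" where
 "usol z \<longleftrightarrow> (\<forall>r\<in>PI. exp (z r) + exp (\<Sum>q\<in>PI. real (md q r) * z q) = 1)"

end

text \<open>An exchange relation divided by its left side.\<close>

lemma exp_split: "exp (x + y) = exp r + exp n ==> exp (n - x - y) + exp (r - x - y) = (1::real)"
 using add_pos_pos[OF exp_gt_zero[of n] exp_gt_zero[of r]]
 by (simp add: exp_diff add_divide_distrib[symmetric] exp_add add.commute)

context fdyn
begin

lemma nbp_exp:
 fixes F :: "nat => 'n => real"
 assumes k: "k \<in> J" and p: "!!t k. k \<in> J ==> F t k > 0"
 shows "nbp F t k = exp (nbs (%t k. ln (F t k)) t k)"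
proof -
 have *: "(\<Prod>i\<in>S. f i ^ nat (- a i k)) = exp (\<Sum>i\<in>S. of_int (- a i k) * ln (f i))"
  if "S \<subseteq> J - {k}" "!!i. i \<in> S ==> f i > 0" for S and f :: "'n => real"
 proof -
  have "finite S" using that(1) finJ finite_subset by blast
  moreover have "f i ^ nat (- a i k) = exp (of_int (- a i k) * ln (f i))" if "i \<in> S" for i
  proof -
   have "a i k <= 0" using offd[of i k] k that \<open>S \<subseteq> J - {k}\<close> by auto
   hence "of_int (- a i k) = real (nat (- a i k))" by (simp add: of_nat_nat)
   thus ?thesis using \<open>!!i. i \<in> S ==> f i > 0\<close>[OF that] by (simp only: exp_of_nat_mult exp_ln)
  qed
  ultimately show ?thesis by (simp add: exp_sum)
 qed
 have "bel k \<subseteq> J - {k}" "abv k \<subseteq> J - {k}" by (auto simp: bel_def abv_def)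
 note b = *[OF this(1)] *[OF this(2)]
 have "(\<Prod>i\<in>bel k. F (Suc t) i ^ nat (- a i k)) = exp (\<Sum>i\<in>bel k. of_int (- a i k) * ln (F (Suc t) i))"
  "(\<Prod>i\<in>abv k. F t i ^ nat (- a i k)) = exp (\<Sum>i\<in>abv k. of_int (- a i k) * ln (F t i))"
  using b p by (auto simp: bel_def abv_def)
 thus ?thesis unfolding nbp_def nbs_def exp_add by simp
qed

lemma mon_exp:
 fixes e :: "'n => real"
 assumes "supp m" shows "mon (%l. exp (e l)) m = exp (\<Sum>l\<in>J. m l * e l)"
proof -
 have "mon (%l. exp (e l)) m = exp (\<Sum>l\<in>UNIV. m l * e l)" by (simp add: mon_def exp_sum exp_power_int mult.commute)
 also have "(\<Sum>l\<in>UNIV. m l * e l) = (\<Sum>l\<in>J. m l * e l)"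
  by (rule sum.mono_neutral_right) (use assms in "auto simp: supp_def")
 finally show ?thesis .
qed

text \<open>Put \<open>u\<close> equal to the neighbour product divided by the product of two
  consecutive F-polynomials. For initial indices \<open>z\<close> is determined by the prescribed
  \<open>eta\<close>; their equations are the exchange relation at the end of row
  \<open>st j\<close>, where \<open>Fe_Per\<close> applies.\<close>

theorem usol_exists:
 fixes e :: "'n => real"
 obtains z where "usol z" "!!l. l \<in> J ==> eta z l = e l"
  "!!t k. k \<in> J ==> t <= rr k ==> Fe (%l. exp (e l)) t k = exp (phi z t k)"
proof -
 define y where "y = (%l. exp (e l))"
 have y: "y l > 0" "y l ~= 0" for l by (auto simp: y_def)
 define f where "f = (%t k. ln (Fe y t k))"
 have Fp: "Fe y t k > 0" if "k \<in> J" for t k by (rule Fe_pos[OF y(1) that])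
 have ef: "exp (f t k) = Fe y t k" if "k \<in> J" for t k using Fp[OF that] by (simp add: f_def)
 have my: "mon y m = exp (\<Sum>l\<in>J. m l * e l)" if "supp m" for m unfolding y_def by (rule mon_exp[OF that])
 have Frec: "exp (f (Suc t) k + f t k) = exp (\<Sum>l\<in>J. R t k l * e l) + exp (nbs f t k)" if "k \<in> J" for t k
  using Fe_rec[where y = y, OF y(2) that, of t] nbp_exp[OF that, of "Fe y", OF Fp] my[OF supp_R[OF that]]
  by (simp add: exp_add ef[OF that] f_def[symmetric])
 define g where "g = (%(t, k). nbs f (t - 1) k - f t k - f (t - 1) k)"
 \<comment> \<open>By \<open>gM_0\<close> the sum \<open>eta z k\<close> contains
   \<open>z (0, k)\<close> with coefficient 1 and no other initial value, so it can be solved for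
   \<open>z (0, k)\<close>.\<close>
 define z where "z = (%(t, k). if t = 0 then e k - (\<Sum>q\<in>PI - {0} \<times> J. gM q k * g q) else g (t, k))"
 have zS: "z (Suc t, k) = nbs f t k - f (Suc t) k - f t k" for t k by (simp add: z_def g_def)
 have "z q = g q" if "q \<in> PI - {0} \<times> J" for q using that by (cases q) (auto simp: z_def PI_iff)
 hence z0: "z (0, j) = e j - (\<Sum>q\<in>PI - {0} \<times> J. gM q j * z q)" for j by (simp add: z_def)
 have et: "eta z j = e j" if j: "j \<in> J" for j
 proof -
  have "eta z j = (\<Sum>q\<in>{0} \<times> J. gM q j * z q) + (\<Sum>q\<in>PI - {0} \<times> J. gM q j * z q)"
   unfolding eta_def by (subst sum.subset_diff[of "{0} \<times> J"]) (auto simp: fin_PI PI_iff)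
  also have "(\<Sum>q\<in>{0} \<times> J. gM q j * z q) = (\<Sum>q\<in>{0} \<times> J. if q = (0::nat, j) then z (0, j) else 0)"
   by (rule sum.cong) (auto simp: gM_0)
  finally show ?thesis using j finJ z0[of j] by simp
 qed
 have ph: "phi z t k = f t k" if "k \<in> J" "t <= rr k" for t k
 proof (rule rec_unique[OF _ _ that])
  show "phi z 0 k = f 0 k" for k using y by (simp add: f_def)
  fix t k assume "k \<in> J" "t < rr k" "phi z t k = f t k" "nbs (phi z) t k = nbs f t k"
  thus "phi z (Suc t) k = f (Suc t) k" using z_phi[of t k z] zS[of t k] by (simp add: PI_iff)
 qed
 have "exp (z r) + exp (\<Sum>q\<in>PI. real (md q r) * z q) = 1" if g: "r \<in> PI" for r
 proof -
  obtain t0 k0 where "r = (t0, k0)" by (cases r)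
  then consider t k where "r = (Suc t, k)" "k \<in> J" "t < rr k" | j where "r = (0, j)" "j \<in> J"
   using g by (cases t0) (auto simp: PI_iff)
  thus ?thesis
  proof cases
   case (1 t k)
   note g1 = g[unfolded 1(1)]
   have m: "(\<Sum>q\<in>PI. real (md q (Suc t, k)) * z q) = (\<Sum>l\<in>J. R t k l * e l) - f (Suc t) k - f t k"
    using md_phi[OF g1, of z] ph[of k t] ph[of k "Suc t"] 1 by (simp add: et)
   show ?thesis unfolding 1(1) zS m by (rule exp_split[OF Frec[OF 1(2)]])
  next
   case (2 j)
   define k where "k = st j"
   have k: "k \<in> J" "st k = j" using 2 st_J st_st by (auto simp: k_def)
   let ?p = "%i. \<Sum>l\<in>J. P i l * e l"
   have m: "(\<Sum>q\<in>PI. real (md q (0, j)) * z q) = - f (rr k) k"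
    using ph[OF k(1) order_refl] md_star[OF _ k(1)] k(2) by (simp add: phi_def)
   have zj: "z (0, j) = ?p j + nbs f (rr k) k - f (rr k) k"
   proof -
    \<comment> \<open>The function \<open>phi z\<close> is known to agree with \<open>f\<close> only
      up to the end of each row; the entries one step later are split off and taken from
      \<open>Fe_Per\<close>.\<close>
    let ?ph = "%t k. if t <= rr k then phi z t k else 0" and ?N = "%q t i. if t <= rr i then NN q (t, i) else 0"
    have "nbs f (rr k) k = nbs (%t i. ?ph t i + (if t = Suc (rr i) then - ?p (st i) else 0)) (rr k) k"
    proof (rule nbs_cong)
     have fe: "f (Suc (rr i)) i = - ?p (st i)" if "i \<in> J" for i
      using my[of "%l. - P (st i) l"] supp_P[OF st_J[OF that]] by (simp add: f_def Fe_Per[OF that] supp_def sum_negf)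
     show "f (Suc (rr k)) i = ?ph (Suc (rr k)) i + (if Suc (rr k) = Suc (rr i) then - ?p (st i) else 0)"
      if i: "i \<in> bel k" "a i k ~= 0" for i
      using nbr_dom(1)[OF k(1), of i] i fe[of i] ph[of i "Suc (rr k)"] by (auto simp: bel_def)
     show "f (rr k) i = ?ph (rr k) i + (if rr k = Suc (rr i) then - ?p (st i) else 0)"
      if i: "i \<in> abv k" "a i k ~= 0" for i
      using nbr_dom(2)[OF k(1), of i] i fe[of i] ph[of i "rr k"] by (auto simp: abv_def)
    qed
    also have "\<dots> = nbs ?ph (rr k) k + (\<Sum>l\<in>bel j. of_int (a l j) * ?p l)"
     unfolding nbs_add using nbs_ended[OF k(1), of "%i. - ?p i"] k(2) by (simp add: sum_negf)
    also have "(\<Sum>l\<in>bel j. of_int (a l j) * ?p l) = e j - ?p j"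
    proof -
     have "?p j = (\<Sum>m\<in>J. (if m = j then e j else 0) - (\<Sum>l\<in>bel j. of_int (a l j) * (P l m * e m)))"
      by (rule sum.cong[OF refl], subst P_rec) (auto simp: left_diff_distrib sum_distrib_right mult.assoc)
     thus ?thesis using 2 finJ by (simp add: sum_subtractf sum_distrib_left sum.swap[of _ J])
    qed
    also have "nbs ?ph (rr k) k = f (rr k) k - (\<Sum>q\<in>PI - {0} \<times> J. gM q j * z q)"
    proof -
     have "nbs ?ph (rr k) k = nbs (%t i. - (\<Sum>q\<in>PI. z q * ?N q t i)) (rr k) k"
      by (rule nbs_cong) (auto simp: phi_def mult.commute)
     also have "\<dots> = - (\<Sum>q\<in>PI. z q * nbs (?N q) (rr k) k)" unfolding nbs_neg nbs_sum ..
     also have "(\<Sum>q\<in>PI. z q * nbs (?N q) (rr k) k) =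
       (\<Sum>q\<in>PI. z q * NN q (rr k, k) + (if q \<in> {0} \<times> J then 0 else gM q j * z q))"
     proof (rule sum.cong[OF refl])
      fix q assume w: "q \<in> PI"
      obtain s i where e: "q = (s, i)" by (cases q)
      show "z q * nbs (?N q) (rr k) k = z q * NN q (rr k, k) + (if q \<in> {0} \<times> J then 0 else gM q j * z q)"
      proof (cases s)
       case 0
       hence "nbs (?N q) (rr k) k = nbs (%_ _. 0) (rr k) k" by (intro nbs_cong) (auto simp: e NN_def)
       thus ?thesis using 0 w by (simp add: e NN_def PI_iff)
      next
       case (Suc s')
       have "nbs (?N q) (rr k) k = gM q j + NN q (rr k, k)"
        using gM_star[OF _ k(1), of s' i] w k(2) unfolding e Suc by simp
       thus ?thesis by (simp add: e Suc algebra_simps)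
      qed
     qed
     also have "\<dots> = - phi z (rr k) k + (\<Sum>q\<in>PI - {0} \<times> J. gM q j * z q)"
     proof -
      have "(\<Sum>q\<in>PI. if q \<in> {0} \<times> J then 0 else gM q j * z q) = (\<Sum>q\<in>PI - {0} \<times> J. gM q j * z q)"
       by (rule sum.mono_neutral_cong_right) (auto simp: fin_PI)
      thus ?thesis by (simp add: sum.distrib phi_def mult.commute)
     qed
     finally show ?thesis using ph[OF k(1) order_refl] by simp
    qed
    finally show ?thesis using z0[of j] by simp
   qed
   have "exp (f (Suc (rr k)) k) = exp (- ?p j)"
    using my[of "%l. - P j l"] supp_P[OF 2(2)] by (simp add: ef[OF k(1)] Fe_Per[OF k(1)] k(2) supp_def sum_negf)
   hence "exp (- ?p j + f (rr k) k) = exp (- ?p j) + exp (nbs f (rr k) k)"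
    using Frec[OF k(1), of "rr k"] by (simp add: R_rr[OF k(1)] k(2) sum_negf exp_add)
   from exp_split[OF this] show ?thesis unfolding 2(1) m unfolding zj by (simp add: algebra_simps)
  qed
 qed
 hence "usol z" by (simp add: usol_def)
 thus ?thesis by (rule that[OF _ et]) (simp_all add: y_def[symmetric] ph ef)
qed

end

section \<open>F-polynomials and cluster variables in a link\<close>

context dynkin
begin

lemma emb_cases:
 assumes sub: "J' \<subseteq> J" and g: "r \<in> dynkin.PI J' a ht"
 obtains k where "r = (0, k)" "emb J' r = (0, k)" "k \<in> J'"
 | t k s l where "r = (Suc t, k)" "emb J' r = (Suc s, l)" "(Suc s, l) \<in> PI" "R s l = dynkin.R J' a ht t k" "d l = d k"
proof -
 interpret D': dynkin J' a d ht by (rule sub_dynkin[OF sub])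
 obtain t0 k where e: "r = (t0, k)" by (cases r)
 show ?thesis
 proof (cases t0)
  case 0 thus ?thesis using that(1) g by (simp add: e D'.PI_iff)
 next
  case (Suc t) thus ?thesis using that(2) emb_Suc[OF sub, of t k] g unfolding e by blast
 qed
qed

lemma emb_gM:
 assumes sub: "J' \<subseteq> J" and g: "r \<in> dynkin.PI J' a ht" and l: "l \<in> J'"
 shows "gM (emb J' r) l = dynkin.gM J' a d ht r l"
proof -
 interpret D': dynkin J' a d ht by (rule sub_dynkin[OF sub])
 show ?thesis
 proof (rule emb_cases[OF sub g])
  fix k assume "r = (0, k)" "emb J' r = (0, k)" "k \<in> J'"
  thus ?thesis using sub by (auto simp: gM_0 D'.gM_0)
 next
  fix t k s m assume *: "r = (Suc t, k)" "emb J' r = (Suc s, m)" "R s m = dynkin.R J' a ht t k" "d m = d k"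
  have "k \<in> J'" using g by (simp add: *(1) D'.PI_iff)
  hence "D'.eul (D'.R t k) (unit l) = eul (D'.R t k) (unit l)"
   using D'.supp_R[of k t] l by (intro sub_eul[OF sub]) (auto simp: D'.supp_def unit_def)
  moreover have "D'.unit l = unit l" by (simp add: unit_def D'.unit_def)
  ultimately have "gM (Suc s, m) l = D'.gM (Suc t, k) l" by (simp add: gM_def D'.gM_def rho_Suc D'.rho_Suc *(3,4))
  thus ?thesis unfolding *(2) unfolding *(1) .
 qed
qed

lemma emb_NN:
 assumes sub: "J' \<subseteq> J" and w: "q \<in> dynkin.PI J' a ht" and g: "r \<in> dynkin.PI J' a ht"
 shows "NN (emb J' q) (emb J' r) = dynkin.NN J' a ht q r"
proof -
 interpret D': dynkin J' a d ht by (rule sub_dynkin[OF sub])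
 consider "fst q = 0" | "fst r = 0" | t k s j where "q = (Suc s, j)" "r = (Suc t, k)"
  by (cases q; cases r; cases "fst q"; cases "fst r") auto
 thus ?thesis
 proof cases
  case 1 hence "emb J' q = q" by (cases q) simp
  thus ?thesis using 1 by (simp add: NN_def D'.NN_def)
 next
  case 2 hence "emb J' r = r" by (cases r) simp
  thus ?thesis using 2 by (simp add: NN_def D'.NN_def)
 next
  case (3 t k s j)
  obtain s' j' where w': "emb J' q = (Suc s', j')" "(Suc s', j') \<in> PI" "R s' j' = D'.R s j" "d j' = d j"
   using emb_Suc[OF sub, of s j] w 3 by auto
  obtain t' k' where g': "emb J' r = (Suc t', k')" "(Suc t', k') \<in> PI" "R t' k' = D'.R t k"
   using emb_Suc[OF sub, of t k] g 3 by auto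
  have "D'.eul (D'.R s j) (D'.R t k) = eul (D'.R s j) (D'.R t k)"
   using D'.supp_R w g by (intro sub_eul[OF sub]) (auto simp: 3 D'.supp_def D'.PI_iff)
  thus ?thesis using NN_max[OF w'(2) g'(2)] D'.NN_max[of s j t k] w g w' g' 3 by simp
 qed
qed

end

context fdyn
begin

lemma mon_upd: "mon (y(i := s)) m = s powi m i * mon (y(i := 1)) m"
proof -
 have "mon (y(i := s)) m = (\<Prod>l\<in>UNIV. (if l = i then s powi m i else 1) * (y(i := 1)) l powi m l)"
  unfolding mon_def by (rule prod.cong) auto
 thus ?thesis by (simp add: prod.distrib mon_def)
qed

text \<open>A solution of the u-equations for \<open>J - {i}\<close> is extended by
  \<open>u = 1\<close> outside the link. Its \<open>phi\<close> obeys the F-recursion of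
  \<open>J\<close> without the monomials that contain \<open>y i\<close>, so it describes the limit
  as \<open>y i\<close> tends to zero. The F-polynomial of a link element does not involve
  \<open>y i\<close> and equals its limit.\<close>

lemma F_link:
 fixes y :: "'n => real"
 assumes i: "i \<in> J" and y: "!!l. y l > 0" and g: "u \<in> dynkin.PI (J - {i}) a ht"
 shows "fdyn.Fe (J - {i}) a ht y (fst u) (snd u) = Fe y (fst (emb (J - {i}) u)) (snd (emb (J - {i}) u))"
proof -
 let ?J = "J - {i}"
 have sub: "?J \<subseteq> J" by auto
 interpret D': fdyn ?J a d ht using sub_dynkin[OF sub] by (simp add: fdyn_def)
 define e where "e = (%l. ln (y l))"
 have ye: "y = (%l. exp (e l))" using y by (simp add: e_def)
 obtain z' where z': "D'.usol z'" "!!l. l \<in> ?J ==> D'.eta z' l = e l"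
  "!!t k. k \<in> ?J ==> t <= D'.rr k ==> D'.Fe y t k = exp (D'.phi z' t k)"
  using D'.usol_exists[of e] unfolding ye by metis
 let ?E = "emb ?J"
 define z where "z = (%q. if q \<in> ?E ` D'.PI then z' (inv_into D'.PI ?E q) else 0)"
 have ze: "z (?E q) = z' q" if "q \<in> D'.PI" for q using that emb_inj[OF sub] by (simp add: z_def)
 have PIs: "?E ` D'.PI \<subseteq> PI" using emb_PI(1)[OF sub] by auto
 have sum: "(\<Sum>q\<in>PI. f q * z q) = (\<Sum>q\<in>D'.PI. f (?E q) * z' q)" for f
 proof -
  have "(\<Sum>q\<in>PI. f q * z q) = (\<Sum>q\<in>?E ` D'.PI. f q * z q)"
   by (rule sum.mono_neutral_right) (use fin_PI PIs in "auto simp: z_def")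
  also have "\<dots> = (\<Sum>q\<in>D'.PI. f (?E q) * z' q)"
   by (subst sum.reindex[OF emb_inj[OF sub]]) (auto intro: sum.cong simp: ze)
  finally show ?thesis .
 qed
 have et: "eta z l = e l" if "l \<in> ?J" for l
  using that z'(2)[OF that] by (simp add: eta_def sum D'.eta_def emb_gM[OF sub])
 have R0: "R t k i ~= 0 \<longleftrightarrow> (Suc t, k) \<notin> ?E ` D'.PI" if "(Suc t, k) \<in> PI" for t k
 proof -
  have "real (md (0, i) (Suc t, k)) = R t k i" by (rule md_0[OF i that])
  moreover have "(Suc t, k) \<in> ?E ` D'.PI \<longleftrightarrow> md (0, i) (Suc t, k) = 0" using that unfolding emb_image[OF i] by simp
  ultimately show ?thesis by (metis of_nat_eq_0_iff of_int_0_eq_iff)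
 qed
 define X where "X = (%t k. if R t k i = 0 then exp (\<Sum>l\<in>J. R t k l * e l) else 0)"
 have E: "exp (phi z (Suc t) k + phi z t k) = X t k + exp (nbs (phi z) t k)" if k: "k \<in> J" "t < rr k" for t k
 proof -
  have g: "(Suc t, k) \<in> PI" using k by (simp add: PI_iff)
  show ?thesis
  proof (cases "(Suc t, k) \<in> ?E ` D'.PI")
   case False
   hence "z (Suc t, k) = 0" by (simp add: z_def)
   hence "nbs (phi z) t k = phi z (Suc t) k + phi z t k" using z_phi[OF g, of z] by simp
   thus ?thesis using False R0[OF g] by (simp add: X_def)
  next
   case True
   then obtain r where c: "r \<in> D'.PI" "(Suc t, k) = ?E r" by auto
   have "(\<Sum>q\<in>PI. real (md q (Suc t, k)) * z q) = (\<Sum>q\<in>D'.PI. real (D'.md q r) * z' q)"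
    unfolding sum c(2) by (rule sum.cong) (auto simp: emb_md[OF sub] c)
   hence "exp (z (Suc t, k)) + exp (\<Sum>q\<in>PI. real (md q (Suc t, k)) * z q) = 1"
    using z'(1) c ze[OF c(1)] by (simp add: D'.usol_def)
   moreover have "(\<Sum>l\<in>J. R t k l * eta z l) = (\<Sum>l\<in>J. R t k l * e l)"
    by (rule sum.cong[OF refl]) (use et R0[OF g] True in fastforce)
   ultimately have "exp (nbs (phi z) t k - phi z (Suc t) k - phi z t k) + exp ((\<Sum>l\<in>J. R t k l * e l) - phi z (Suc t) k - phi z t k) = 1"
    using z_phi[OF g, of z] md_phi[OF g, of z] by simp
   thus ?thesis using R0[OF g] True by (simp add: X_def exp_diff exp_add field_simps)
  qed
 qed
 have lim: "((%s. Fe (y(i := s)) t k) \<longlongrightarrow> exp (phi z t k)) (at_right 0)" if "k \<in> J" "t <= rr k" for t k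
  using that
 proof (induction t arbitrary: k)
  case 0
  have "((%s. 1) \<longlongrightarrow> exp (phi z 0 k)) (at_right (0::real))" by simp
  thus ?case
   by (rule Lim_transform_eventually) (rule eventually_mono[OF ev_pos], use y in "simp add: less_imp_neq[THEN not_sym]")
 next
  case (Suc t)
  show ?case using Suc(2,3)
  proof (induction "ht k" arbitrary: k rule: less_induct)
   case (less k)
   have k: "k \<in> J" "t < rr k" using less by auto
   define c where "c = mon (y(i := 1)) (R t k)"
   have mu: "mon (y(i := s)) (R t k) = s powi R t k i * c" for s unfolding c_def by (rule mon_upd)
   have m: "((%s. mon (y(i := s)) (R t k)) \<longlongrightarrow> X t k) (at_right 0)"
   proof (cases "R t k i = 0")
    case True
    hence "c = mon y (R t k)" using mu[of "y i"] by simp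
    thus ?thesis using True mon_exp[OF supp_R[OF k(1)], of e t, folded ye] by (simp add: X_def mu)
   next
    case False
    hence "0 < R t k i" using R_nonneg[OF k(2), of i] by simp
    from tendsto_mult[OF powi_tendsto_0[OF this] tendsto_const[of c]]
    show ?thesis using False by (simp add: X_def mu)
   qed
   have pw: "((%s. h s ^ nat (- a j k)) \<longlongrightarrow> c ^ nat (- a j k)) (at_right 0)"
    if "a j k ~= 0 ==> (h \<longlongrightarrow> c) (at_right 0)" for h :: "real => real" and c j
    using that by (cases "a j k = 0") (auto intro: tendsto_power)
   have "((%s. nbp (Fe (y(i := s))) t k) \<longlongrightarrow> nbp (%t k. exp (phi z t k)) t k) (at_right 0)"
    unfolding nbp_def
   proof (intro tendsto_mult tendsto_prod pw)
    fix j assume j: "j \<in> bel k" "a j k ~= 0"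
    show "((%s. Fe (y(i := s)) (Suc t) j) \<longlongrightarrow> exp (phi z (Suc t) j)) (at_right 0)"
     using j k nbr_dom(1)[OF k(1), of j] by (intro less(1)) (auto simp: bel_def)
   next
    fix j assume j: "j \<in> abv k" "a j k ~= 0"
    show "((%s. Fe (y(i := s)) t j) \<longlongrightarrow> exp (phi z t j)) (at_right 0)"
     using j k nbr_dom(2)[OF k(1), of j] by (intro Suc(1)) (auto simp: abv_def)
   qed
   also have "nbp (%t k. exp (phi z t k)) t k = exp (nbs (phi z) t k)" by (subst nbp_exp[OF k(1)]) auto
   finally have nb: "((%s. nbp (Fe (y(i := s))) t k) \<longlongrightarrow> exp (nbs (phi z) t k)) (at_right 0)" .
   have "((%s. (mon (y(i := s)) (R t k) + nbp (Fe (y(i := s))) t k) / Fe (y(i := s)) t k) \<longlongrightarrow>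
     (X t k + exp (nbs (phi z) t k)) / exp (phi z t k)) (at_right 0)"
    by (intro tendsto_divide tendsto_add m nb Suc(1) k less_imp_le[OF k(2)]) simp
   also have "(X t k + exp (nbs (phi z) t k)) / exp (phi z t k) = exp (phi z (Suc t) k)"
    unfolding E[OF k, symmetric] by (simp add: exp_add)
   finally show ?case
   proof (rule Lim_transform_eventually)
    show "\<forall>\<^sub>F s in at_right 0. (mon (y(i := s)) (R t k) + nbp (Fe (y(i := s))) t k) / Fe (y(i := s)) t k = Fe (y(i := s)) (Suc t) k"
    proof (rule eventually_mono[OF ev_pos])
     fix s :: real assume "0 < s"
     hence p: "(y(i := s)) l > 0" for l using y by simp
     hence p': "(y(i := s)) l ~= 0" for l by (metis less_irrefl)
     show "(mon (y(i := s)) (R t k) + nbp (Fe (y(i := s))) t k) / Fe (y(i := s)) t k = Fe (y(i := s)) (Suc t) k"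
      using Fe_rec[where y = "y(i := s)" and t = t, OF p' k(1)] Fe_pos[where y = "y(i := s)" and t = t, OF p k(1)]
      by (simp add: divide_eq_eq)
    qed
   qed
  qed
 qed
 obtain t k where tk: "?E u = (t, k)" by (cases "?E u")
 have "?E u \<in> {r \<in> PI. r ~= (0, i) & md (0, i) r = 0}" unfolding emb_image[OF i, symmetric] using g by (rule imageI)
 hence PI: "(t, k) \<in> PI" "md (0, i) (t, k) = 0" unfolding tk by simp_all
 have kJ: "k \<in> J" "t <= rr k" using PI by (auto simp: PI_iff)
 have const: "Fe (y(i := s)) t k = Fe y t k" for s unfolding Fe_def lev_def
 proof (rule sum.cong[OF refl])
  fix m assume m: "m \<in> kys (FL t k)"
  have "(case t of 0 => 0 | Suc t' => R t' k i) = 0" using md_0[OF i, of "t - 1" k] PI by (cases t) auto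
  hence "lkp m i = 0" using FL_keys[OF kJ(1) _ m, of i] kJ(2) by simp
  thus "of_int (lkp (FL t k) m) * mon (y(i := s)) (lkp m) =
    of_int (lkp (FL t k) m) * mon y (lkp m)" using mon_upd[of y i s "lkp m"] mon_upd[of y i "y i" "lkp m"] by simp
 qed
 have "Fe y t k = exp (phi z t k)" using lim[OF kJ] unfolding const by (simp add: tendsto_const_iff)
 moreover have "phi z t k = D'.phi z' (fst u) (snd u)"
  unfolding phi_def D'.phi_def sum tk[symmetric] by (auto intro!: sum.cong simp: emb_NN[OF sub _ g])
 moreover have "D'.Fe y (fst u) (snd u) = exp (D'.phi z' (fst u) (snd u))"
  using g by (intro z'(3)) (auto simp: D'.PI_def)
 ultimately show ?thesis by (simp add: tk)
qed

lemma FL_link: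
 assumes i: "i \<in> J" and g: "z \<in> dynkin.PI (J - {i}) a ht"
 shows "fdyn.FL (J - {i}) a ht (fst z) (snd z) = FL (fst (emb (J - {i}) z)) (snd (emb (J - {i}) z))" (is "?L = ?M")
proof -
 have sub: "J - {i} \<subseteq> J" by auto
 interpret D': fdyn "J - {i}" a d ht using sub_dynkin[OF sub] by (simp add: fdyn_def)
 interpret I: fhom "of_int :: int => real" by (rule ring_hom_of_int)
 have "lev of_int y (?L - ?M) = 0" if y: "!!l. (y l :: real) > 0" for y
 proof -
  have nz: "y l ~= 0" for l using y[of l] by simp
  interpret H: fhom "lev of_int y" by (rule I.lev_hom) (rule nz)
  have "lev of_int y ?L = lev of_int y ?M" using F_link[OF i y g] by (simp add: Fe_def D'.Fe_def)
  thus ?thesis using H.hadd[of ?L "- ?M"] by (simp add: H.hminus)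
 qed
 hence "?L - ?M = 0" by (rule lev_faithful) auto
 thus ?thesis by simp
qed

end

context fbelt
begin

text \<open>The order of vanishing in the variable \<open>x v\<close>: for mutable \<open>v\<close>
  the negative of the denominator exponent, for frozen \<open>v\<close> zero.\<close>

definition ex :: "'v => nat => 'n => int" where
 "ex v t k = (if v \<in> \<iota> ` J then (case t of 0 => of_bool (v = \<iota> k) | Suc t' => - R t' k (inv \<iota> v)) else 0)"

lemma Xb_asy:
 fixes x :: "'v => real"
 assumes b: "Jblock b" and x: "!!v. x v > 0" and kt: "k \<in> J" "t <= rr k"
 shows "\<exists>A. asy (%s. Xb b (cv x (%u. of_bool (u = v)) s) t k) (ex v t k) A"
proof -
 let ?x = "cv x (%u. of_bool (u = v))"
 have xp: "?x s u \<in> {x. 0 < x}" if "s > 0" for s u using x that by (simp add: cv_def)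
 have su: "(\<Sum>u\<in>UNIV. of_bool (u = v) * m u) = (m v :: int)" for m :: "'v => int"
  by (simp add: of_bool_def if_distrib[of "%x. x * _"] cong: if_cong)
 have Xp: "Xb b (?x s) t k > 0" if "s > 0" "k \<in> J" for s t k
  using separation(2)[where x = "?x s", OF b semifield_pos_real xp[OF that(1)] that(2)] by simp
 have "\<exists>A. asy (%s. Xb b (?x s) t k) (ex v t k) A & (False --> A = 1)"
 proof (rule asy_belt[where e = "ex v" and c = 0 and p = "%s t k. mon (?x s) (%v. max 0 (ce b v t k))" and q = "%s t k. mon (?x s) (%v. max 0 (- ce b v t k))"
    and \<alpha> = "%t k. max 0 (ce b v t k)" and \<beta> = "%t k. max 0 (- ce b v t k)", OF _ _ _ _ _ _ _ kt(1)])
  show "Xb b (?x s) t k ~= 0" if "s > 0" "k \<in> J" for s t k using Xp[OF that, of t] by simp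
  show "Xb b (?x s) (Suc t) k * Xb b (?x s) t k = mon (?x s) (%v. max 0 (ce b v t k)) + mon (?x s) (%v. max 0 (- ce b v t k)) * nbp (Xb b (?x s)) t k"
   if "s > 0" "k \<in> J" for s t k
   using Z_rec[of "%t k. fpos (?x s) (%v. cc t (row b v) k)" "%t k. fpos (?x s) (%v. - cc t (row b v) k)" "%k. ?x s (\<iota> k)" t k] Xp[OF that, of t]
   by (simp add: Xb_def fpos_ce)
  show "\<exists>A. asy (%s. mon (?x s) (%v. max 0 (ce b v t k))) (max 0 (ce b v t k)) A & (False --> A = 1)" for t k
   using asy_mon[where y = x and w = "%u. of_bool (u = v)" and m = "%v. max 0 (ce b v t k)", OF x] unfolding su by blast
  show "\<exists>A. asy (%s. mon (?x s) (%v. max 0 (- ce b v t k))) (max 0 (- ce b v t k)) A & (False --> A = 1)" for t k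
   using asy_mon[where y = x and w = "%u. of_bool (u = v)" and m = "%v. max 0 (- ce b v t k)", OF x] unfolding su by blast
  show "\<exists>A. asy (%s. Xb b (?x s) 0 k) (ex v 0 k) A & (False --> A = 1)" if "k \<in> J" for k
  proof -
   have "asy (%s. mon (?x s) (%u. of_bool (u = \<iota> k))) (of_bool (v = \<iota> k)) (mon x (%u. of_bool (u = \<iota> k)))"
    using asy_mon[where y = x and w = "%u. of_bool (u = v)" and m = "%u. of_bool (u = \<iota> k)", OF x] unfolding su .
   moreover have "ex v 0 k = of_bool (v = \<iota> k)" using that by (auto simp: ex_def)
   ultimately show ?thesis by (auto simp: Xb_def mon_unit)
  qed
  fix t k assume k: "k \<in> J" and t: "t < rr k + 0"
  show "ex v (Suc t) k + ex v t k = min (max 0 (ce b v t k)) (max 0 (- ce b v t k) + nbs (ex v) t k)"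
  proof (cases "v \<in> \<iota> ` J")
   case False
   hence "ex v = (%_ _. 0)" by (simp add: ex_def fun_eq_iff)
   thus ?thesis by simp
  next
   case True
   then obtain j where j: "j \<in> J" "v = \<iota> j" by auto
   have inj: "\<iota> j = \<iota> k \<longleftrightarrow> k = j" for k using inj_iota by (auto simp: inj_def)
   have e: "ex v t k = (case t of 0 => of_bool (k = j) | Suc t' => - R t' k j)" for t k
    using j by (cases t) (auto simp: ex_def inj inv_f_f[OF inj_iota])
   have c: "ce b v t k = 0" using True by (simp add: ce_def)
   show ?thesis
   proof (cases t)
    case (Suc t')
    have "nbs (ex v) t k = - nbs (%t k. R t k j) t' k" unfolding Suc nbs_def e by (simp add: sum_negf)
    thus ?thesis using nbs_mesh[OF k, of j t'] R_nonneg[of t k j] R_nonneg[of t' k j] t unfolding c e by (simp add: Suc)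
   next
    case 0
    have "nbs (ex v) 0 k = (\<Sum>i\<in>bel k. a i k * P i j) - (\<Sum>i\<in>abv k. a i k * of_bool (i = j))"
     unfolding nbs_def e by (simp add: sum_negf)
    also have "(\<Sum>i\<in>bel k. a i k * P i j) = of_bool (j = k) - P k j" by (subst (2) P_rec) simp
    also have "(\<Sum>i\<in>abv k. a i k * of_bool (i = j)) = (\<Sum>i\<in>abv k. if i = j then a j k else 0)" by (rule sum.cong) auto
    finally have n: "nbs (ex v) 0 k = of_bool (j = k) - P k j - (if j \<in> abv k then a j k else 0)" by simp
    have "min 0 (nbs (ex v) 0 k) = of_bool (j = k) - P k j"
    proof (cases "j \<in> abv k")
     case True
     hence "P k j = 0" "j ~= k" "a j k <= 0" using P_above[OF k, of j] offd[OF j(1) k] by (auto simp: abv_def)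
     thus ?thesis using n True by simp
    next
     case False
     have "of_bool (j = k) <= P k j" using P_nonneg[OF k, of j] k by auto
     thus ?thesis using n False by simp
    qed
    thus ?thesis unfolding 0 e using c by (auto simp: 0)
   qed
  qed
 qed (use kt in auto)
 thus ?thesis by simp
qed

text \<open>The F-polynomials agree by \<open>FL_link\<close>. The remaining monomials agree in each
  exponent, because along the curve on which only coordinate \<open>v\<close> tends to zero both
  variables have the same order, given by the common root.\<close>

lemma Xb_link:
 fixes x :: "'v => 'f::field"
 assumes i: "i \<in> J" and g: "z \<in> dynkin.PI (J - {i}) a ht" and b: "Jblock b"
  and S: "semifield S" and x: "!!v. x v \<in> S"
 shows "belt.Xb (J - {i}) a ht \<iota> b x (fst z) (snd z) = Xb b x (fst (emb (J - {i}) z)) (snd (emb (J - {i}) z))"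
proof -
 let ?J = "J - {i}"
 have sub: "?J \<subseteq> J" by auto
 interpret D': fbelt ?J a d ht \<iota>
  using sub_dynkin[OF sub] inj_iota by (simp add: fbelt_def belt_def belt_axioms_def)
 have b': "D'.Jblock b" using b by (simp add: Jblock_def D'.Jblock_def)
 obtain t k where d: "z = (t, k)" by (cases z)
 obtain t' k' where d': "emb ?J z = (t', k')" by (cases "emb ?J z")
 have k: "k \<in> ?J" "t <= D'.rr k" using g by (auto simp: d D'.PI_iff)
 have k': "k' \<in> J" "t' <= rr k'" using emb_PI(1)[OF sub g] by (auto simp: d' PI_iff)
 have FL: "D'.F.FL t k = F.FL t' k'" using F.FL_link[OF i, of z] g by (simp add: d d'[unfolded d])
 have Fe: "D'.F.Fe y t k = F.Fe y t' k'" for y :: "'n => 'g::field" by (simp add: F.Fe_def D'.F.Fe_def FL)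
 have exs: "D'.ex v t k = ex v t' k'" for v
 proof (rule emb_cases[OF sub g])
  fix k0 assume "z = (0, k0)" "emb ?J z = (0, k0)" "k0 \<in> ?J"
  thus ?thesis using d d' inj_iota by (auto simp: ex_def D'.ex_def inj_def)
 next
  fix s0 k0 s1 l assume *: "z = (Suc s0, k0)" "emb ?J z = (Suc s1, l)" "R s1 l = D'.R s0 k0"
  have "D'.R s0 k0 i = 0" using D'.supp_R[of k0 s0] k d * by (auto simp: D'.supp_def)
  thus ?thesis using * d d' by (auto simp: ex_def D'.ex_def inv_f_f[OF inj_iota] dest: injD[OF inj_iota])
 qed
 have gx: "D'.gx b v t k = gx b v t' k'" for v
 proof -
  let ?x = "cv (%_. 1 :: real) (%u. of_bool (u = v))"
  have xp: "?x s u \<in> {x. 0 < x}" if "s > 0" for s u using that by (simp add: cv_def)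
  obtain A where A: "asy (%s. D'.Xb b (?x s) t k) (ex v t' k') A" using D'.Xb_asy[OF b' _ k, of "%_. 1" v] exs by auto
  obtain A' where A': "asy (%s. Xb b (?x s) t' k') (ex v t' k') A'" using Xb_asy[OF b _ k', of "%_. 1" v] by auto
  let ?m = "%u. D'.gx b u t k - gx b u t' k'"
  have "asy (%s. mon (?x s) ?m) (ex v t' k' - ex v t' k') (A / A')"
  proof (rule asy_cong[OF asy_div[OF A A']])
   fix s :: real assume s: "0 < s"
   have nz: "?x s u ~= 0" for u using xp[OF s, of u] by auto
   define X where "X = F.Fe (yh b (?x s)) t' k'"
   have "Xb b (?x s) t' k' > 0" using separation(2)[where x = "?x s", OF b semifield_pos_real xp[OF s] k'(1)] by simp
   moreover have "D'.Xb b (?x s) t k = mon (?x s) (%u. D'.gx b u t k) * X"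
    using D'.separation(1)[where x = "?x s", OF b' semifield_pos_real xp[OF s] k(1), of t] by (simp only: Fe X_def)
   moreover have "Xb b (?x s) t' k' = mon (?x s) (%u. gx b u t' k') * X"
    using separation(1)[where x = "?x s", OF b semifield_pos_real xp[OF s] k'(1), of t'] by (simp only: X_def)
   ultimately have "X ~= 0" "D'.Xb b (?x s) t k / Xb b (?x s) t' k' = mon (?x s) (%u. D'.gx b u t k) / mon (?x s) (%u. gx b u t' k')" by auto
   thus "D'.Xb b (?x s) t k / Xb b (?x s) t' k' = mon (?x s) ?m" by (simp only: mon_diff[where x = "?x s", OF nz])
  qed
  moreover have "asy (%s. mon (?x s) ?m) (?m v) 1"
  proof -
   have "(\<Sum>u\<in>UNIV. of_bool (u = v) * ?m u) = ?m v"
    by (simp add: of_bool_def if_distrib[of "%x. x * _"] cong: if_cong)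
   thus ?thesis using asy_mon[of "%_::'v. 1" "%u. of_bool (u = v)" ?m] by (simp add: mon_def)
  qed
  ultimately show ?thesis using asy_unique by fastforce
 qed
 show ?thesis unfolding d' unfolding d fst_conv snd_conv
  using D'.separation(1)[where x = x, OF b' S x k(1), of t] separation(1)[where x = x, OF b S x k'(1), of t']
  by (simp add: Fe gx)
qed

end

context belt
begin

lemma Xb_after:
 assumes A: "after b x t s" shows "k \<in> J ==> Xb (fst s) (snd s) t' k = Xb b x (t + t') k"
proof (induction t' arbitrary: k)
 case 0 thus ?case using A by (simp add: after_def Xb_def)
next
 case (Suc t')
 have c: "cc t' (row (fst s) v) k = cc (t + t') (row b v) k" if v: "v \<in> - \<iota> ` J" and k: "k \<in> J" for v k
 proof -
  have "(nrow ^^ t') (row (fst s) v) l = (nrow ^^ (t' + t)) (row b v) l" if "l \<in> J" for l using that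
  proof (induction t' arbitrary: l)
   case 0 thus ?case using A v by (simp add: after_def row_def[of "fst s" v l])
  next
   case (Suc t') thus ?case using nrow_cong[of "(nrow ^^ t') (row (fst s) v)" "(nrow ^^ (t' + t)) (row b v)" l] by simp
  qed
  thus ?thesis unfolding cc_def by (intro crow_cong[OF _ k]) (simp add: add.commute)
 qed
 have f: "fpos (snd s) (%v. cc t' (row (fst s) v) k) = fpos x (%v. cc (t + t') (row b v) k)"
  "fpos (snd s) (%v. - cc t' (row (fst s) v) k) = fpos x (%v. - cc (t + t') (row b v) k)" if "k \<in> J" for k
  unfolding fpos_def by (rule prod.cong; use A c that in "auto simp: after_def")+
 have "Xb (fst s) (snd s) (Suc t') k = zr (%k. fpos x (%v. cc (t + t') (row b v) k)) (%k. fpos x (%v. - cc (t + t') (row b v) k)) (Xb b x (t + t')) k"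
  unfolding Xb_def Z.simps
 proof (rule zr_cong)
  show "Z (%t k. fpos (snd s) (%v. cc t (row (fst s) v) k)) (%t k. fpos (snd s) (%v. - cc t (row (fst s) v) k)) (%k. snd s (\<iota> k)) t' k =
    Z (%t k. fpos x (%v. cc t (row b v) k)) (%t k. fpos x (%v. - cc t (row b v) k)) (%k. x (\<iota> k)) (t + t') k" if "k \<in> J" for k
   using Suc(1)[OF that] by (simp add: Xb_def)
 qed (fact f(1), fact f(2), fact Suc(2))
 thus ?case by (simp add: Xb_def)
qed

end

lemma fold_mutate_other: "inj \<iota> ==> i \<notin> set ks ==> snd (fold (mutate \<iota>) ks s) (\<iota> i) = snd s (\<iota> i)"
proof (induction ks arbitrary: s)
 case (Cons k ks)
 hence "\<iota> i ~= \<iota> k" by (auto simp: inj_def)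
 thus ?case using Cons by (simp add: mutate_def mutate_cluster_def)
qed simp

text \<open>Let \<open>t\<close> be the least round in \<open>F\<close>. After \<open>t\<close>
  rounds the shifted set contains some \<open>(0, i)\<close>; the variable at \<open>i\<close> is
  kept, and the induction continues on \<open>J - {i}\<close> from the new seed with
  \<open>i\<close> frozen. For this reason the seed is arbitrary apart from its block on
  \<open>J\<close>.\<close>

theorem reachable:
 fixes J :: "'n::{finite,linorder} set" and x :: "'v::finite => 'f::field"
 assumes "fbelt J a d ht \<iota>" "belt.Jblock J a ht \<iota> b" "semifield S" "!!v. x v \<in> S"
  "dynkin.compat J a d ht F" "card F = card J"
 shows "\<exists>ks. (%k. snd (fold (mutate \<iota>) ks (b, x)) (\<iota> k)) ` J = (%(t, k). belt.Xb J a ht \<iota> b x t k) ` F & set ks \<subseteq> J"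
 using assms
proof (induction "card J" arbitrary: J b x F)
 case (0 J)
 hence "J = {}" by (simp add: finite_subset)
 moreover have "F = {}"
 proof -
  interpret fbelt J a d ht \<iota> by fact
  show ?thesis using compat_finite[OF 0(6)] 0 by simp
 qed
 ultimately show ?case by (intro exI[of _ "[]"]) simp
next
 case (Suc n J b x F)
 interpret fbelt J a d ht \<iota> by fact
 note b = Suc(4) and S = Suc(5) and x = Suc(6) and F = Suc(7) and cF = Suc(8)
 have FPI: "F \<subseteq> PI" using F by (simp add: compat_def)
 have finF: "finite F" "F ~= {}" using compat_finite[OF F] cF Suc(2) by auto
 define t where "t = Min (fst ` F)"
 have "t \<in> fst ` F" unfolding t_def using finF by (intro Min_in) auto
 then obtain i where ti: "(t, i) \<in> F" by auto
 have tm: "t <= fst r" if "r \<in> F" for r unfolding t_def using finF that by simp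
 have i: "i \<in> J" using ti FPI by (auto simp: PI_iff)
 have sh: "(tauD ^^ u) (u + s, k) = (s, k)" for u s k
 proof (induction u)
  case (Suc u)
  have "(tauD ^^ Suc u) (Suc u + s, k) = (tauD ^^ u) (tauD (Suc u + s, k))" by (simp add: funpow_swap1)
  moreover have "tauD (Suc u + s, k) = (u + s, k)" by (simp add: tauD_def)
  ultimately show ?case using Suc by simp
 qed simp
 define F1 where "F1 = (tauD ^^ t) ` F"
 have F1: "F1 = (%(s, k). (s - t, k)) ` F" unfolding F1_def
 proof (rule image_cong[OF refl])
  fix r assume "r \<in> F"
  thus "(tauD ^^ t) r = (case r of (s, k) => (s - t, k))"
   using sh[of t "fst r - t" "snd r"] tm[of r] by (simp add: case_prod_unfold)
 qed
 have cF1: "compat F1" "card F1 = card J" unfolding F1_def using compat_pow[OF F] card_pow(1)[OF FPI] cF by auto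
 have "(0, i) \<in> F1" unfolding F1 using ti by force
 then obtain F' where F': "dynkin.compat (J - {i}) a d ht F'" "F1 = insert (0, i) (emb (J - {i}) ` F')" "card F1 = Suc (card F')"
  using compat_emb[OF i cF1(1)] by metis
 obtain ks1 where ks1: "set ks1 \<subseteq> J" "after b x t (fold (mutate \<iota>) ks1 (b, x))" using ex_rounds[OF b, of x t] by blast
 obtain b1 x1 where s: "fold (mutate \<iota>) ks1 (b, x) = (b1, x1)" by (cases "fold (mutate \<iota>) ks1 (b, x)")
 note A = ks1(2)[unfolded s]
 have b1: "Jblock b1" using A by (simp add: after_def)
 have x1: "x1 v \<in> S" for v
  using A separation(2)[where x = x, OF b S x] x[of v] by (cases "v \<in> \<iota> ` J") (auto simp: after_def)
 have sub: "J - {i} \<subseteq> J" by auto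
 interpret D': fbelt "J - {i}" a d ht \<iota>
  using sub_dynkin[OF sub] inj_iota by (simp add: fbelt_def belt_def belt_axioms_def)
 have b1': "D'.Jblock b1" using b1 by (simp add: Jblock_def D'.Jblock_def)
 have "\<exists>ks. (%k. snd (fold (mutate \<iota>) ks (b1, x1)) (\<iota> k)) ` (J - {i}) = (%(t, k). D'.Xb b1 x1 t k) ` F' & set ks \<subseteq> J - {i}"
 proof (rule Suc(1)[where J = "J - {i}" and b = b1 and x = x1 and F = F'])
  show "n = card (J - {i})" using Suc(2) i by simp
  show "fbelt (J - {i}) a d ht \<iota>" by (rule D'.fbelt_axioms)
  show "card F' = card (J - {i})" using F'(3) cF1(2) Suc(2) i by simp
  show "D'.Jblock b1" "semifield S" "!!v. x1 v \<in> S" "D'.compat F'" by (fact b1', fact S, fact x1, fact F'(1))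
 qed
 then obtain ks2 where ks2: "(%k. snd (fold (mutate \<iota>) ks2 (b1, x1)) (\<iota> k)) ` (J - {i}) = (%(t, k). D'.Xb b1 x1 t k) ` F'" "set ks2 \<subseteq> J - {i}"
  by blast
 have "(%(t, k). D'.Xb b1 x1 t k) ` F' = (%(t, k). Xb b1 x1 t k) ` emb (J - {i}) ` F'" unfolding image_image
 proof (rule image_cong[OF refl])
  fix z assume "z \<in> F'"
  hence "z \<in> D'.PI" using F'(1) by (auto simp: D'.compat_def)
  thus "(case z of (t, k) => D'.Xb b1 x1 t k) = (case emb (J - {i}) z of (t, k) => Xb b1 x1 t k)"
   using Xb_link[where x = x1, OF i _ b1 S x1] by (simp add: case_prod_unfold)
 qed
 moreover have "snd (fold (mutate \<iota>) ks2 (b1, x1)) (\<iota> i) = Xb b1 x1 0 i"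
  using fold_mutate_other[OF inj_iota, of i ks2 "(b1, x1)"] subsetD[OF ks2(2), of i] by (auto simp: Xb_def)
 moreover have "J = insert i (J - {i})" using i by auto
 ultimately have "(%k. snd (fold (mutate \<iota>) ks2 (b1, x1)) (\<iota> k)) ` J = (%(t, k). Xb b1 x1 t k) ` F1"
  unfolding F'(2) using ks2(1) by (metis (no_types, lifting) image_insert case_prod_conv)
 also have "\<dots> = (%(t, k). Xb b x t k) ` F" unfolding F1 image_image
 proof (rule image_cong[OF refl])
  fix r assume g: "r \<in> F"
  thus "(case case r of (s, k) => (s - t, k) of (t, k) => Xb b1 x1 t k) = (case r of (t, k) => Xb b x t k)"
   using Xb_after[OF A, of "snd r" "fst r - t"] tm[OF g] FPI by (auto simp: PI_iff split: prod.splits)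
 qed
 finally show ?case using ks1(1) ks2(2) by (intro exI[of _ "ks1 @ ks2"]) (auto simp: s)
qed

subsection \<open>Heights and duality\<close>

text \<open>A vertex with at most one neighbour is removed and afterwards receives the height that
  this neighbour dictates.\<close>

lemma forest_potential:
 fixes E :: "'n => 'n => bool"
 assumes "finite V" and E: "!!i j. \<not> (E i j & E j i)"
  and leaf: "!!W. W \<subseteq> V ==> W ~= {} ==> \<exists>v\<in>W. card {w \<in> W. E v w \<or> E w v} <= 1"
 shows "\<exists>h :: 'n => int. \<forall>i\<in>V. \<forall>j\<in>V. E i j --> h j = h i + 1" using assms(1,3)
proof (induction "card V" arbitrary: V)
 case (Suc n V)
 hence "V ~= {}" by auto
 then obtain v where v: "v \<in> V" "card {w \<in> V. E v w \<or> E w v} <= 1" using Suc(4)[OF order_refl] by blast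
 have fin: "finite {w \<in> V. E v w \<or> E w v}" using Suc(3) by simp
 obtain h :: "'n => int" where h: "!!i j. i \<in> V - {v} ==> j \<in> V - {v} ==> E i j ==> h j = h i + 1"
 proof -
  have "\<exists>h :: 'n => int. \<forall>i\<in>V - {v}. \<forall>j\<in>V - {v}. E i j --> h j = h i + 1"
  proof (rule Suc(1))
   show "n = card (V - {v})" "finite (V - {v})" using Suc(2,3) v(1) by auto
   show "\<exists>u\<in>W. card {w \<in> W. E u w \<or> E w u} <= 1" if "W \<subseteq> V - {v}" "W ~= {}" for W
    using Suc(4)[of W] that by blast
  qed
  thus ?thesis using that by blast
 qed
 have nv: "\<not> E v v" using E by blast
 show ?case
 proof (cases "{w \<in> V. E v w \<or> E w v} = {}")
  case True
  thus ?thesis using h by (intro exI[of _ h] ballI impI) blast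
 next
  case False
  hence "card {w \<in> V. E v w \<or> E w v} = 1" using v(2) card_gt_0_iff[of "{w \<in> V. E v w \<or> E w v}"] fin by linarith
  then obtain w where w: "{w \<in> V. E v w \<or> E w v} = {w}" by (auto simp: card_1_singleton_iff)
  have u: "u = w" if "u \<in> V" "E v u \<or> E u v" for u using w that by blast
  have "w ~= v" using w nv by blast
  define h' where "h' = h(v := if E w v then h w + 1 else h w - 1)"
  have "h' j = h' i + 1" if ij: "i \<in> V" "j \<in> V" "E i j" for i j
  proof (cases "i = v")
   case True
   hence "j = w" "\<not> E w v" using u[of j] ij E[of v w] by auto
   thus ?thesis using True \<open>w ~= v\<close> by (simp add: h'_def)
  next
   case i: False
   show ?thesis
   proof (cases "j = v")
    case True
    hence "i = w" using u[of i] ij by auto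
    thus ?thesis using True ij \<open>w ~= v\<close> by (simp add: h'_def)
   next
    case False
    thus ?thesis using h[of i j] ij i by (simp add: h'_def)
   qed
  qed
  thus ?thesis by blast
 qed
qed simp

text \<open>If every vertex of \<open>W\<close> had two neighbours in \<open>W\<close>, the form
  would be nonpositive at the vector with entries \<open>1 / sqrt (d i)\<close>: there each diagonal
  term is 2 and each neighbour contributes at most \<open>- 1\<close>, as
  \<open>a i j * a j i\<close> is at least 1.\<close>

lemma finite_type_leaf:
 fixes a :: "'n::finite => 'n => int" and d :: "'n => real"
 assumes diag: "!!i. a i i = 2" and off: "!!i j. i ~= j ==> a i j <= 0"
  and d: "!!i. d i > 0" and sym: "!!i j. d i * a i j = d j * a j i"
  and pos: "!!v :: 'n => real. v ~= (%_. 0) ==> (\<Sum>i\<in>UNIV. \<Sum>j\<in>UNIV. v i * (d i * a i j) * v j) > 0"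
  and W: "W ~= {}"
 shows "\<exists>v\<in>W. card {w \<in> W. w ~= v & a v w ~= 0} <= 1"
proof (rule ccontr)
 assume "\<not> ?thesis"
 hence c: "2 <= card {w \<in> W. w ~= v & a v w ~= 0}" if "v \<in> W" for v using that by force
 define x where "x = (%i. if i \<in> W then 1 / sqrt (d i) else 0)"
 define t where "t = (%i j. x i * (d i * a i j) * x j)"
 obtain w where "w \<in> W" using W by blast
 hence "x w ~= 0" using d[of w] by (simp add: x_def)
 hence "x ~= (%_. 0)" by auto
 from pos[OF this] have "(\<Sum>i\<in>UNIV. \<Sum>j\<in>UNIV. t i j) > 0" by (simp add: t_def)
 moreover have "(\<Sum>j\<in>UNIV. t i j) <= 0" for i
 proof (cases "i \<in> W")
  case True
  have tn: "t i j <= 0" if "j ~= i" for j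
   using off[of i j] that d[of i] d[of j] by (auto simp: t_def x_def mult_le_0_iff divide_le_0_iff)
  let ?N = "{w \<in> W. w ~= i & a i w ~= 0}"
  have t1: "t i j <= - 1" if j: "j \<in> ?N" for j
  proof -
   have nz: "a j i ~= 0" using sym[of i j] d[of i] j by auto
   have neg: "a i j <= - 1" "a j i <= - 1" using off[of i j] off[of j i] j nz by force+
   have "x i * x i = 1 / d i" "x j * x j = 1 / d j" using j True d[of i] d[of j] by (simp_all add: x_def)
   moreover have "t i j * t i j = (x i * x i) * (x j * x j) * ((d i * a i j) * (d j * a j i))"
    using sym[of i j] by (simp add: t_def)
   ultimately have "t i j * t i j = (d i * a i j) * (d j * a j i) / (d i * d j)" by simp
   also have "\<dots> = real_of_int (a i j * a j i)" using d[of i] d[of j] by (simp add: field_simps)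
   also have "\<dots> \<ge> 1" unfolding of_int_1_le_iff using mult_mono[of 1 "- a i j" 1 "- a j i"] neg by simp
   finally have "(1 + t i j) * (1 - t i j) <= 0" by (simp add: algebra_simps)
   moreover have "0 < 1 - t i j" using tn[of j] j by simp
   ultimately show ?thesis by (simp add: mult_le_0_iff)
  qed
  have "(\<Sum>j\<in>UNIV. t i j) = t i i + (\<Sum>j\<in>?N. t i j) + (\<Sum>j\<in>- insert i ?N. t i j)"
  proof -
   have "(\<Sum>j\<in>UNIV. t i j) = (\<Sum>j\<in>insert i ?N. t i j) + (\<Sum>j\<in>- insert i ?N. t i j)"
    by (subst sum.union_disjoint[symmetric]) (auto simp: Compl_partition)
   thus ?thesis by simp
  qed
  moreover have "t i i = 2" using True d[of i] diag[of i] by (simp add: t_def x_def)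
  moreover have "(\<Sum>j\<in>?N. t i j) <= - 2"
  proof -
   have "(\<Sum>j\<in>?N. t i j) <= (\<Sum>j\<in>?N. - 1)" using t1 by (intro sum_mono) auto
   thus ?thesis using c[OF True] by simp
  qed
  moreover have "(\<Sum>j\<in>- insert i ?N. t i j) <= 0" using tn by (intro sum_nonpos) auto
  ultimately show ?thesis by linarith
 qed (simp add: t_def x_def)
 ultimately show False using sum_nonpos[of UNIV "%i. \<Sum>j\<in>UNIV. t i j"] by force
qed

lemma ex_heights:
 fixes A :: "'n::finite int_matrix"
 assumes A: "finite_type_cartan A" and E: "orientation A E"
 obtains d ht where "dynkin UNIV (%i j. A $ i $ j) d ht" "!!i j. E i j ==> ht j = ht i + 1"
  "exchange_matrix A E = (\<chi> i j. if ht i < ht j then - (A $ i $ j) else if ht j < ht i then A $ i $ j else 0)"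
  "exchange_matrix (transpose A) E = (\<chi> i j. if ht i < ht j then - (A $ j $ i) else if ht j < ht i then A $ j $ i else 0)"
proof -
 obtain d :: "'n => real" where d: "!!i. d i > 0" "!!i j. d i * of_int (A $ i $ j) = d j * of_int (A $ j $ i)"
  and pv: "!!v :: real^'n. v ~= 0 ==> (\<Sum>i\<in>UNIV. \<Sum>j\<in>UNIV. v $ i * (d i * of_int (A $ i $ j)) * v $ j) > 0"
  using A by (auto simp: finite_type_cartan_def)
 have diag: "A $ i $ i = 2" and off: "i ~= j ==> A $ i $ j <= 0" and z: "A $ i $ j = 0 \<longleftrightarrow> A $ j $ i = 0" for i j
  using A by (auto simp: finite_type_cartan_def)
 have EA: "(i ~= j & A $ i $ j ~= 0) \<longleftrightarrow> (E i j \<or> E j i)" "\<not> (E i j & E j i)" for i j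
  using E by (auto simp: orientation_def)
 have pos: "(\<Sum>i\<in>UNIV. \<Sum>j\<in>UNIV. v i * (d i * A $ i $ j) * v j) > 0" if "v ~= (%_. 0)" for v :: "'n => real"
 proof -
  have "(\<chi> i. v i) ~= 0" using that by (simp add: vec_eq_iff fun_eq_iff)
  from pv[OF this] show ?thesis by simp
 qed
 have "\<exists>h :: 'n => int. \<forall>i\<in>UNIV. \<forall>j\<in>UNIV. E i j --> h j = h i + 1"
 proof (rule forest_potential)
  fix W :: "'n set" assume "W ~= {}"
  have "{w \<in> W. E v w \<or> E w v} = {w \<in> W. w ~= v & A $ v $ w ~= 0}" for v using EA(1)[of v] by auto
  thus "\<exists>v\<in>W. card {w \<in> W. E v w \<or> E w v} <= 1"
   using finite_type_leaf[of "%i j. A $ i $ j" d, OF diag off d pos \<open>W ~= {}\<close>] by simp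
 qed (use EA in auto)
 then obtain h :: "'n => int" where h: "!!i j. E i j ==> h j = h i + 1" by blast
 obtain c where hm: "!!i. c <= h i"
 proof
  show "Min (range h) <= h i" for i by simp
 qed
 define ht where "ht = (%i. nat (h i - c))"
 have ht: "ht j = ht i + 1" if "E i j" for i j using h[OF that] hm[of i] by (simp add: ht_def)
 have adj: "ht j = ht i + 1 \<or> ht i = ht j + 1" if "i ~= j" "A $ i $ j ~= 0" for i j
  using EA(1)[of i j] ht[of i j] ht[of j i] that by auto
 have Elt: "E i j \<longleftrightarrow> ht i < ht j & A $ i $ j ~= 0" for i j
  using EA[of i j] ht[of i j] ht[of j i] by force
 have "\<exists>\<kappa>>0. \<forall>v :: 'n => real. (\<Sum>i\<in>UNIV. \<Sum>j\<in>UNIV. v i * (d i * A $ i $ j) * v j) \<ge> \<kappa> * (\<Sum>i\<in>UNIV. (v i)\<^sup>2)"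
 proof -
  \<comment> \<open>The required constant is the minimum of the form on the unit sphere.\<close>
  define q where "q = (%v :: real^'n. \<Sum>i\<in>UNIV. \<Sum>j\<in>UNIV. v $ i * (d i * of_int (A $ i $ j)) * v $ j)"
  have "continuous_on (sphere 0 1) q" unfolding q_def by (intro continuous_intros)
  moreover have "sphere 0 1 ~= ({} :: (real^'n) set)" by simp
  ultimately obtain v0 where v0: "v0 \<in> sphere 0 1" "!!v. v \<in> sphere 0 1 ==> q v0 <= q v"
   using continuous_attains_inf[of "sphere 0 1" q] compact_sphere by metis
  have "v0 ~= 0" using v0(1) by auto
  hence p: "q v0 > 0" unfolding q_def by (rule pv)
  have "q v0 * (\<Sum>i\<in>UNIV. (v i)\<^sup>2) <= (\<Sum>i\<in>UNIV. \<Sum>j\<in>UNIV. v i * (d i * A $ i $ j) * v j)" for v :: "'n => real"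
  proof -
   let ?v = "\<chi> i. v i"
   have n: "(norm ?v)\<^sup>2 = (\<Sum>i\<in>UNIV. (v i)\<^sup>2)" by (simp add: norm_vec_def L2_set_def sum_nonneg)
   have s: "q (c *\<^sub>R w) = c\<^sup>2 * q w" for c w
    by (simp add: q_def sum_distrib_left power2_eq_square mult_ac)
   have "q v0 * (norm ?v)\<^sup>2 <= q ?v"
   proof (cases "?v = 0")
    case True thus ?thesis by (simp add: q_def)
   next
    case False
    hence "q v0 <= q ((1 / norm ?v) *\<^sub>R ?v)" by (intro v0) simp
    thus ?thesis unfolding s using False by (simp add: power_divide field_simps)
   qed
   thus ?thesis unfolding n by (simp add: q_def)
  qed
  thus ?thesis using p by blast
 qed
 hence "dynkin UNIV (%i j. A $ i $ j) d ht" by unfold_locales (use diag off d adj in auto)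
 moreover have "exchange_matrix A E = (\<chi> i j. if ht i < ht j then - (A $ i $ j) else if ht j < ht i then A $ i $ j else 0)"
  by (auto simp: exchange_matrix_def vec_eq_iff Elt z)
 moreover have "exchange_matrix (transpose A) E = (\<chi> i j. if ht i < ht j then - (A $ j $ i) else if ht j < ht i then A $ j $ i else 0)"
  by (auto simp: exchange_matrix_def transpose_def vec_eq_iff Elt z)
 ultimately show ?thesis using that ht by blast
qed

lemma scaled_sign:
 fixes x y :: real
 assumes "x > 0" "y > 0" "x * real_of_int p = y * real_of_int q"
 shows "(0 <= p \<longleftrightarrow> 0 <= q) & (p = 0 \<longleftrightarrow> q = 0)"
proof -
 have "0 <= p \<longleftrightarrow> 0 <= x * real_of_int p" "0 <= q \<longleftrightarrow> 0 <= y * real_of_int q"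
  "p = 0 \<longleftrightarrow> x * real_of_int p = 0" "q = 0 \<longleftrightarrow> y * real_of_int q = 0"
  using assms(1,2) by (auto simp: zero_le_mult_iff)
 thus ?thesis unfolding assms(3) by blast
qed

context dynkin
begin

lemma dual: "dynkin J (%i j. a j i) (%i. 1 / d i) ht"
proof
 obtain \<kappa> where \<kappa>: "\<kappa> > 0" "!!v::'n => real. (\<Sum>i\<in>J. \<Sum>j\<in>J. v i * (d i * a i j) * v j) \<ge> \<kappa> * (\<Sum>i\<in>J. (v i)\<^sup>2)"
  using pdef by blast
 \<comment> \<open>Substituting \<open>v i / d i\<close> turns the form into that of the dual
   diagram; \<open>m\<close> bounds the loss in the sum of squares.\<close>
 define m where "m = Min (insert 1 ((%i. (1 / d i)\<^sup>2) ` J))"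
 have "m > 0" unfolding m_def using finJ by (subst Min_gr_iff) (auto dest!: dpos)
 have mi: "m <= (1 / d i)\<^sup>2" if "i \<in> J" for i unfolding m_def using finJ that by (intro Min_le) auto
 have "\<kappa> * m * (\<Sum>i\<in>J. (v i)\<^sup>2) <= (\<Sum>i\<in>J. \<Sum>j\<in>J. v i * (1 / d i * a j i) * v j)" for v :: "'n => real"
 proof -
  have "m * (\<Sum>i\<in>J. (v i)\<^sup>2) <= (\<Sum>i\<in>J. (v i / d i)\<^sup>2)" unfolding sum_distrib_left
  proof (rule sum_mono)
   fix i assume "i \<in> J"
   from mult_right_mono[OF mi[OF this], of "(v i)\<^sup>2"] show "m * (v i)\<^sup>2 <= (v i / d i)\<^sup>2" by (simp add: power_divide)
  qed
  hence "\<kappa> * m * (\<Sum>i\<in>J. (v i)\<^sup>2) <= \<kappa> * (\<Sum>i\<in>J. (v i / d i)\<^sup>2)" using \<kappa>(1) by (simp add: mult.assoc)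
  also have "\<dots> <= (\<Sum>i\<in>J. \<Sum>j\<in>J. v i / d i * (d i * a i j) * (v j / d j))" by (rule \<kappa>(2))
  also have "\<dots> = (\<Sum>i\<in>J. \<Sum>j\<in>J. v i * (1 / d i * a j i) * v j)"
  proof (intro sum.cong refl)
   fix i j assume "i \<in> J" "j \<in> J"
   thus "v i / d i * (d i * a i j) * (v j / d j) = v i * (1 / d i * a j i) * v j"
    using symd[of i j] dpos[of i] dpos[of j] by (simp add: field_simps)
  qed
  finally show ?thesis .
 qed
 thus "\<exists>\<kappa>>0. \<forall>v::'n => real. (\<Sum>i\<in>J. \<Sum>j\<in>J. v i * (1 / d i * real_of_int (a j i)) * v j) \<ge> \<kappa> * (\<Sum>i\<in>J. (v i)\<^sup>2)"
  using \<kappa>(1) \<open>m > 0\<close> mult_pos_pos by blast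
 show "finite J" by (rule finJ)
 show "a i i = 2" "0 < 1 / d i" if "i \<in> J" for i using diag dpos that by auto
 show "a j i <= 0" if "i \<in> J" "j \<in> J" "i ~= j" for i j using offd[OF that(2,1)] that(3) by auto
 fix i j assume ij: "i \<in> J" "j \<in> J"
 show "1 / d i * real_of_int (a j i) = 1 / d j * real_of_int (a i j)"
  using symd[OF ij] dpos[OF ij(1)] dpos[OF ij(2)] by (simp add: field_simps)
 show "i ~= j ==> a j i ~= 0 ==> ht j = ht i + 1 \<or> ht i = ht j + 1" using adj_ht[OF ij(2,1)] by auto
qed

lemma symd': "i \<in> J ==> k \<in> J ==> d k * (of_int (a k i) * x) = of_int (a i k) * (d i * x)"
 using symd[of i k] by (simp add: mult.assoc[symmetric] mult.commute)

text \<open>The recursions of both families correspond under \<open>symd'\<close>. Transposition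
  merely rescales coordinates by positive factors, so row lengths, the involution and compatibility
  are common to both diagrams.\<close>

lemma dual_R: "k \<in> J ==> d k * dynkin.R J (%i j. a j i) ht t k l = d l * R t k l"
proof -
 interpret D': dynkin J "%i j. a j i" "%i. 1 / d i" ht by (rule dual)
 have base: "d k * D'.P k l = d l * P k l" if "k \<in> J" for k using that
 proof (induction "ht k" arbitrary: k rule: less_induct)
  case (less k)
  have "d k * D'.P k l = d k * of_bool (l = k) - (\<Sum>i\<in>bel k. d k * (a k i * D'.P i l))"
   by (subst D'.P_rec) (simp add: right_diff_distrib sum_distrib_left)
  moreover have "(\<Sum>i\<in>bel k. d k * (a k i * D'.P i l)) = (\<Sum>i\<in>bel k. a i k * (d l * P i l))"
   by (rule sum.cong[OF refl]) (use less in "auto simp: bel_def symd'")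
  moreover have "d l * P k l = d l * of_bool (l = k) - (\<Sum>i\<in>bel k. a i k * (d l * P i l))"
   by (subst P_rec[of k]) (simp add: right_diff_distrib sum_distrib_left mult.left_commute)
  moreover have "d k * of_bool (l = k) = d l * of_bool (l = k)" by auto
  ultimately show ?case by (cases "l = k") simp_all
 qed
 show "k \<in> J ==> d k * D'.R t k l = d l * R t k l"
 proof (induction t arbitrary: k)
  case 0 thus ?case by (simp add: base)
 next
  case (Suc t)
  show ?case using Suc(2)
  proof (induction "ht k" arbitrary: k rule: less_induct)
   case (less k)
   note k = less(2)
   have "d k * D'.R (Suc t) k l + d k * D'.R t k l =
     - (\<Sum>i\<in>bel k. d k * (a k i * D'.R (Suc t) i l)) - (\<Sum>i\<in>abv k. d k * (a k i * D'.R t i l))"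
    using arg_cong[OF D'.mesh[OF k, of t l], of "%x. d k * real_of_int x"]
    by (simp add: distrib_left right_diff_distrib sum_distrib_left)
   also have "(\<Sum>i\<in>bel k. d k * (a k i * D'.R (Suc t) i l)) = (\<Sum>i\<in>bel k. a i k * (d l * R (Suc t) i l))"
    by (rule sum.cong[OF refl]) (use less in "auto simp: bel_def symd'")
   also have "(\<Sum>i\<in>abv k. d k * (a k i * D'.R t i l)) = (\<Sum>i\<in>abv k. a i k * (d l * R t i l))"
    by (rule sum.cong[OF refl]) (use Suc k in "auto simp: abv_def symd'")
   also have "- (\<Sum>i\<in>bel k. a i k * (d l * R (Suc t) i l)) - (\<Sum>i\<in>abv k. a i k * (d l * R t i l)) = d l * R (Suc t) k l + d l * R t k l"
    using arg_cong[OF mesh[OF k, of t l], of "%x. d l * real_of_int x"]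
    by (simp add: distrib_left right_diff_distrib sum_distrib_left mult.left_commute)
   finally show ?case using Suc(1)[OF k] by simp
  qed
 qed
qed

lemma dual_sign: "k \<in> J ==> 0 <= dynkin.R J (%i j. a j i) ht t k l \<longleftrightarrow> 0 <= R t k l"
 and dual_zero: "k \<in> J ==> dynkin.R J (%i j. a j i) ht t k l = 0 \<longleftrightarrow> R t k l = 0"
proof -
 interpret D': dynkin J "%i j. a j i" "%i. 1 / d i" ht by (rule dual)
 assume k: "k \<in> J"
 show "0 <= D'.R t k l \<longleftrightarrow> 0 <= R t k l" "D'.R t k l = 0 \<longleftrightarrow> R t k l = 0"
 proof -
  have "(0 <= D'.R t k l \<longleftrightarrow> 0 <= R t k l) & (D'.R t k l = 0 \<longleftrightarrow> R t k l = 0)"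
  proof (cases "l \<in> J")
   case True
   hence "d k > 0" "d l > 0" using k dpos by auto
   thus ?thesis by (rule scaled_sign[OF _ _ dual_R[OF k]])
  next
   case False
   thus ?thesis using supp_R[OF k, of t] D'.supp_R[OF k, of t] by (simp add: supp_def D'.supp_def)
  qed
  thus "0 <= D'.R t k l \<longleftrightarrow> 0 <= R t k l" "D'.R t k l = 0 \<longleftrightarrow> R t k l = 0" by auto
 qed
qed

lemma dual_rr: "k \<in> J ==> dynkin.rr J (%i j. a j i) ht k = rr k"
proof -
 interpret D': dynkin J "%i j. a j i" "%i. 1 / d i" ht by (rule dual)
 assume "k \<in> J" thus ?thesis by (simp add: rr_def D'.rr_def nonneg_def D'.nonneg_def dual_sign)
qed

lemma dual_st: assumes k: "k \<in> J" shows "dynkin.st J (%i j. a j i) ht k = st k"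
proof -
 interpret D': dynkin J "%i j. a j i" "%i. 1 / d i" ht by (rule dual)
 have dk: "d k > 0" using dpos k by auto
 have "D'.R (D'.rr k) k = (%l. - D'.P (st k) l)"
 proof
  fix l
  have "d k * D'.R (rr k) k l = - (d k * D'.P (st k) l)"
   using dual_R[OF k, of "rr k" l] dual_R[OF st_J[OF k], of 0 l] by (simp add: R_rr[OF k] d_st[OF k])
  hence "d k * (D'.R (rr k) k l + D'.P (st k) l) = 0" by (simp add: algebra_simps)
  hence "real_of_int (D'.R (rr k) k l + D'.P (st k) l) = 0" using dk by simp
  hence "D'.R (rr k) k l + D'.P (st k) l = 0" by (simp only: of_int_eq_0_iff)
  thus "D'.R (D'.rr k) k l = - D'.P (st k) l" unfolding dual_rr[OF k] by simp
 qed
 hence "(%l. - D'.P (st k) l) = (%l. - D'.P (D'.st k) l)" using D'.R_rr[OF k] by simp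
 hence "D'.P (st k) = D'.P (D'.st k)" by (simp add: fun_eq_iff)
 thus ?thesis using D'.P_inj[OF st_J[OF k] D'.st_J[OF k]] by simp
qed

lemma dual_PI: "dynkin.PI J (%i j. a j i) ht = PI"
proof -
 interpret D': dynkin J "%i j. a j i" "%i. 1 / d i" ht by (rule dual)
 show ?thesis by (auto simp: PI_iff D'.PI_iff dual_rr)
qed

lemma dual_compat: "dynkin.compat J (%i j. a j i) (%i. 1 / d i) ht F \<longleftrightarrow> compat F"
proof -
 interpret D': dynkin J "%i j. a j i" "%i. 1 / d i" ht by (rule dual)
 have "D'.md q r = 0 \<longleftrightarrow> md q r = 0" if "q \<in> PI" "r \<in> PI" for q r
 proof -
  obtain s j t k where e: "q = (s, j)" "r = (t, k)" by (cases q; cases r)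
  have jk: "j \<in> J" "k \<in> J" using that by (auto simp: e PI_iff)
  have "d j > 0" "d k > 0" using jk dpos by auto
  hence "D'.rmd q r = 0 \<longleftrightarrow> rmd q r = 0" using jk by (simp add: rmd_def D'.rmd_def e dual_zero)
  thus ?thesis using md_real[OF that] D'.md_real[of q r] that unfolding dual_PI by (metis of_nat_eq_0_iff)
 qed
 thus ?thesis unfolding compat_def D'.compat_def dual_PI by (intro conj_cong ball_cong refl) (meson subsetD)
qed

end

context fbelt
begin

text \<open>For mutable rows the coefficient terms vanish, so g-exponents obey the bare mesh
  recursion; so do the Euler pairings of the dual roots after scaling by \<open>d k\<close>, and
  both start from the unit vector. This is the source of the dual diagram in the result.\<close>

lemma gx_dual:
 assumes j: "j \<in> J" and k: "k \<in> J"
 shows "real_of_int (gx b (\<iota> j) t k) = d k * dynkin.eul J (%i j. a j i) (%i. 1 / d i) ht (dynkin.R J (%i j. a j i) ht t k) (unit j)"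
proof -
 interpret D': dynkin J "%i j. a j i" "%i. 1 / d i" ht by (rule dual)
 define e where "e = (%t k. D'.eul (D'.R t k) (unit j))"
 define D where "D = (%t k. real_of_int (gx b (\<iota> j) t k) - d k * e t k)"
 have e0: "d k * e 0 k = of_bool (j = k)" if "k \<in> J" for k
  using D'.eul_P[OF that, of "unit j"] dpos[OF that] by (auto simp: e_def unit_def)
 have erec: "d k * e (Suc t) k + d k * e t k = nbs (%t k. d k * e t k) t k" if k: "k \<in> J" for t k
 proof -
  have "(%l. D'.R (Suc t) k l + D'.R t k l) = (%l. - (\<Sum>i\<in>bel k. a k i * D'.R (Suc t) i l) - (\<Sum>i\<in>abv k. a k i * D'.R t i l))"
   using D'.mesh[OF k, of t] by (rule ext)
  from arg_cong[OF this, of "%v. D'.eul v (unit j)"]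
  have "e (Suc t) k + e t k = - (\<Sum>i\<in>bel k. a k i * e (Suc t) i) - (\<Sum>i\<in>abv k. a k i * e t i)"
   unfolding e_def D'.eul_diff1 D'.eul_minus1 D'.eul_add1 D'.eul_sum1 D'.eul_scale1 .
  hence "d k * e (Suc t) k + d k * e t k = - (\<Sum>i\<in>bel k. d k * (a k i * e (Suc t) i)) - (\<Sum>i\<in>abv k. d k * (a k i * e t i))"
   by (simp add: distrib_left[symmetric] right_diff_distrib sum_distrib_left)
  also have "(\<Sum>i\<in>bel k. d k * (a k i * e (Suc t) i)) = (\<Sum>i\<in>bel k. a i k * (d i * e (Suc t) i))"
   by (rule sum.cong[OF refl]) (use k in "auto simp: bel_def symd'")
  also have "(\<Sum>i\<in>abv k. d k * (a k i * e t i)) = (\<Sum>i\<in>abv k. a i k * (d i * e t i))"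
   by (rule sum.cong[OF refl]) (use k in "auto simp: abv_def symd'")
  finally show ?thesis by (simp add: nbs_def sum_negf)
 qed
 have "D (Suc t) k + D t k = nbs D t k" if k: "k \<in> J" for t k
 proof -
  have "gx b (\<iota> j) (Suc t) k + gx b (\<iota> j) t k = nbs (gx b (\<iota> j)) t k" using gx_rec[of b "\<iota> j" t k] j by (simp add: ce_def)
  from arg_cong[OF this, of real_of_int]
  have "D (Suc t) k + D t k = nbs (%t k. real_of_int (gx b (\<iota> j) t k)) t k - nbs (%t k. d k * e t k) t k"
   using erec[OF k, of t] by (simp add: D_def nbs_real)
  thus ?thesis by (simp add: D_def nbs_diff)
 qed
 moreover have "D 0 k = 0" if "k \<in> J" for k using e0[OF that] inj_iota by (simp add: D_def inj_eq)
 ultimately have "D t k = 0" using k by (rule nbs_zero_unique)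
 thus ?thesis by (simp add: D_def e_def)
qed

end

lemma (in ring_hom) hof_int: "\<psi> (of_int c) = of_int c"
proof -
 have "\<psi> (of_nat n) = of_nat n" for n by (induction n) (simp_all add: hadd)
 moreover have "\<psi> (a - b) = \<psi> a - \<psi> b" for a b using hadd[of a "- b"] by (simp add: hminus)
 ultimately show ?thesis by (cases c) (simp_all add: hminus)
qed

lemma ring_hom_single: "ring_hom (%c :: 'k::comm_ring_1. pms (0 :: 'm::comm_monoid_add) c)"
 by unfold_locales (auto simp: mult_single single_add)

lemma single_of_int: "pms m (of_int c * q) = of_int c * pms (m :: 'm::comm_monoid_add) (q :: 'k::comm_ring_1)"
 using ring_hom.hof_int[OF ring_hom_single, of c] mult_single[of 0 "of_int c :: 'k" m q] by simp

lemma powi_hom: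
 fixes f :: "int => 'f::field"
 assumes add: "!!m n. f (m + n) = f m * f n" and 0: "f 0 = 1"
 shows "f 1 powi n = f n"
proof -
 have p: "f 1 ^ m = f (int m)" for m by (induction m) (simp_all add: 0 add)
 show ?thesis
 proof (cases "0 <= n")
  case False
  have "f n * f (- n) = 1" using add[of n "- n"] 0 by simp
  hence "f n = inverse (f (- n))" by (metis inverse_unique mult.commute)
  thus ?thesis using False p[of "nat (- n)"] by (simp add: power_int_def power_inverse)
 qed (use p[of "nat n"] in "simp add: power_int_def")
qed

context fbelt
begin

definition ev :: "('n int_vec, 'v) vec => nat => 'n => ('n \<Rightarrow>\<^sub>0 int) => 'v => int" where
 "ev b t k m v = gx b v t k + (\<Sum>l\<in>UNIV. lkp m l * b $ v $ l)"

lemma Xb_expand: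
 assumes J: "Jblock b" and S: "semifield S" and x: "!!v. x v \<in> S" and k: "k \<in> J"
 shows "Xb b x t k = (\<Sum>m\<in>kys (F.FL t k). of_int (lkp (F.FL t k) m) * mon x (ev b t k m))"
proof -
 have nz: "x v ~= 0" for v using x[of v] S by (auto simp: semifield_def)
 show ?thesis unfolding separation(1)[where x = x, OF J S x k] F.Fe_def lev_def sum_distrib_left ev_def
  by (rule sum.cong) (simp_all add: mon_yh nz mon_add)
qed

end

section \<open>The full diagram: denominators, index set and compatibility degree\<close>

locale full = fdyn "UNIV :: 'n::{finite,linorder} set" a d ht for a d ht

sublocale full \<subseteq> X: fbelt "UNIV :: 'n::{finite,linorder} set" a d ht "id :: 'n => 'n" by unfold_locales

context full
begin

definition B :: "'n int_matrix" where
 "B = (\<chi> i j. if ht i < ht j then - a i j else if ht j < ht i then a i j else 0)"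

text \<open>The terms of \<open>Xb_expand\<close> collected in a Laurent ring; the coefficients are
  integers, so any coefficient ring is possible.\<close>

definition CL :: "nat => 'n => ('n, 'k::comm_ring_1) laurent" where
 "CL t k = (\<Sum>m\<in>kys (FL t k). pms (pm (X.ev B t k m)) (of_int (lkp (FL t k) m)))"

lemma Jblock_B: "Jblock B" by (simp add: Jblock_def B_def Bm_def)

lemma cluster_var_Xb: "cluster_var B (t, k) = Xb B lvar t k"
 using after_source_rounds[OF Jblock_B, of "lvar :: 'n => ('n, rat) laurent fract" t]
 by (simp add: cluster_var_def initial_seed_def after_def lvar_def[abs_def])

lemma semi_rat: "semifield (posf (of_rat :: rat => real) :: ('n, rat) laurent fract set)"
 by (rule semifield_posf) (rule ring_hom_of_rat)

lemma cluster_var_CL: "cluster_var B (t, k) = Fract (CL t k) 1"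
proof -
 interpret H: ring_hom "%L :: ('n, rat) laurent. Fract L 1" by (rule Fract1_hom)
 have "Fract (pms (pm e) (of_int c) :: ('n, rat) laurent) 1 = of_int c * mon lvar e" for e :: "'n => int" and c
  using single_of_int[of "pm e" c "1 :: rat"] by (simp add: H.hmult H.hof_int mon_lvar)
 thus ?thesis unfolding cluster_var_Xb CL_def H.hsum
  by (subst X.Xb_expand[OF Jblock_B semi_rat]) (simp_all add: posf_lvar[OF ring_hom_of_rat])
qed

lemma lev_CL:
 fixes x :: "'n => real"
 assumes x: "!!l. x l > 0" shows "lev of_rat x (CL t k :: ('n, rat) laurent) = Xb B x t k"
proof -
 interpret I: fhom "of_rat :: rat => real" by (rule ring_hom_of_rat)
 show ?thesis by (subst X.Xb_expand[OF Jblock_B semifield_pos_real]) (simp_all add: x CL_def I.lev_sum I.lev_single)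
qed

text \<open>\<open>Xb_asy\<close> gives the order of vanishing in the variable \<open>x i\<close>
  along positive real curves, and \<open>lev_order\<close> identifies it with the least
  exponent.\<close>

lemma denominator:
 assumes t: "t <= rr k"
 shows "denominator_exponent (cluster_var B (t, k)) i = (case t of 0 => - of_bool (i = k) | Suc t' => R t' k i)"
proof -
 let ?L = "CL t k :: ('n, rat) laurent" and ?e = "X.ex i t k"
 have "(\<forall>m\<in>kys ?L. ?e <= (\<Sum>l\<in>UNIV. of_bool (l = i) * lkp m l)) &
  (\<exists>m\<in>kys ?L. ?e = (\<Sum>l\<in>UNIV. of_bool (l = i) * lkp m l))"
 proof (rule lev_order[OF ring_hom_of_rat])
  fix y :: "'n => real" assume y: "!!l. y l > 0"
  obtain A where "asy (%s. Xb B (cv y (%u. of_bool (u = i)) s) t k) ?e A"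
   using X.Xb_asy[where x = y, OF Jblock_B y UNIV_I t] by blast
  hence "asy (%s. lev of_rat (cv y (%l. of_bool (l = i)) s) ?L) ?e A"
   by (rule asy_cong) (subst lev_CL; simp add: cv_def y)
  thus "\<exists>A. asy (%s. lev of_rat (cv y (%l. of_bool (l = i)) s) ?L) ?e A" by blast
 qed simp
 note o = this[unfolded sum_unit]
 have "(THE L. cluster_var B (t, k) = Fract L 1) = ?L" unfolding cluster_var_CL Fract1_inj by (rule the_equality) auto
 moreover have "Max ((%m. - lkp m i) ` kys ?L) = - ?e"
 proof (rule Max_eqI)
  show "- ?e \<in> (%m. - lkp m i) ` kys ?L" using o by force
 qed (use o in auto)
 ultimately have "denominator_exponent (cluster_var B (t, k)) i = - ?e" by (simp add: denominator_exponent_def)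
 thus ?thesis by (cases t) (auto simp: X.ex_def)
qed

lemma cluster_var_0: "cluster_var B (0, j) = lvar j" by (simp add: cluster_var_def initial_seed_def lvar_def)

lemma lvar_inj: "(lvar i :: ('n, 'k::idom) laurent fract) = lvar j \<longleftrightarrow> i = j"
proof
 assume "(lvar i :: ('n, 'k::idom) laurent fract) = lvar j"
 hence "(laurent_var i :: ('n, 'k) laurent) = laurent_var j" by (simp only: lvar_def Fract1_inj)
 from arg_cong[OF this, of "%L. lkp L (pms i 1)"]
 have "pms j (1::int) = pms i 1" by (auto simp: laurent_var_def lookup_single when_def split: if_splits)
 from arg_cong[OF this, of "%m. lkp m i"] show "i = j" by (auto simp: lookup_single when_def split: if_splits)
qed simp

text \<open>By \<open>Fe_Per\<close> only a monomial remains. Its exponent follows from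
  \<open>ce_sum\<close> at the row end, where by \<open>gx_dual\<close> the g-exponents form minus
  the unit vector at \<open>st k\<close>.\<close>

lemma cluster_var_Per: "cluster_var B (Suc (rr k), k) = lvar (st k)"
proof -
 let ?y = "X.yh B (lvar :: 'n => ('n, rat) laurent fract)"
 interpret D': dynkin UNIV "%i j. a j i" "%i. 1 / d i" ht by (rule dual)
 have nz: "lvar i ~= (0 :: ('n, rat) laurent fract)" for i :: 'n by (rule lvar_nz)
 have g: "gx B j (rr k) k = - of_bool (j = st k)" for j
 proof -
  have "real_of_int (gx B j (rr k) k) = d k * D'.eul (D'.R (rr k) k) (unit j)"
   using X.gx_dual[of j k B "rr k"] by simp
  also have "D'.R (rr k) k = (%l. - D'.P (st k) l)" using D'.R_rr[of k] dual_rr[of k] dual_st[of k] by simp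
  also have "d k * D'.eul (%l. - D'.P (st k) l) (unit j) = real_of_int (- of_bool (j = st k))"
   using d_st[of k] dpos[of k] by (simp add: D'.eul_minus1 D'.eul_P unit_def)
  finally show ?thesis by (simp only: of_int_eq_iff)
 qed
 have "gx B v (Suc (rr k)) k + (\<Sum>l\<in>UNIV. - P (st k) l * B $ v $ l) = of_bool (v = st k)" for v
 proof -
  have c: "ce B v t k = 0" for t k by (simp add: ce_def)
  have "0 = (\<Sum>j\<in>UNIV. B $ v $ j * R (rr k) k j) + nbs (gx B v) (rr k) k"
   using ce_sum[OF Jblock_B, of k v "rr k"] c by simp
  moreover have "(\<Sum>j\<in>UNIV. B $ v $ j * R (rr k) k j) = (\<Sum>l\<in>UNIV. - P (st k) l * B $ v $ l)"
   by (rule sum.cong) (simp_all add: R_rr)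
  ultimately show ?thesis using gx_rec[of B v "rr k" k] c g[of v] by simp
 qed
 hence "mon lvar (%v. gx B v (Suc (rr k)) k) * mon ?y (%l. - P (st k) l) = (lvar (st k) :: ('n, rat) laurent fract)"
  unfolding X.mon_yh[OF nz] mon_add[OF nz, symmetric] by (simp add: mon_unit)
 thus ?thesis unfolding cluster_var_Xb
  by (subst X.separation(1)[OF Jblock_B semi_rat]) (simp_all add: posf_lvar[OF ring_hom_of_rat] Fe_Per)
qed

lemma return_time: "return_time B k = Suc (rr k)" unfolding return_time_def
proof (rule Least_equality)
 show "0 < Suc (rr k) & (\<exists>j. cluster_var B (Suc (rr k), k) = cluster_var B (0, j))"
  by (auto simp: cluster_var_Per cluster_var_0)
 fix t assume t: "0 < t & (\<exists>j. cluster_var B (t, k) = cluster_var B (0, j))"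
 show "Suc (rr k) <= t"
 proof (rule ccontr)
  assume n: "\<not> Suc (rr k) <= t"
  obtain t' where t': "t = Suc t'" using t by (cases t) auto
  hence lt: "t' < rr k" "t <= rr k" using n by auto
  obtain j where j: "cluster_var B (t, k) = cluster_var B (0, j)" using t by blast
  \<comment> \<open>An initial variable has a nonpositive denominator vector, so the nonnegative
    root \<open>R t' k\<close> would have to vanish.\<close>
  have "R t' k i = - of_bool (i = j)" for i
   using denominator[OF lt(2), of i] denominator[of 0 j i] j by (simp add: t')
  hence "R t' k = (%_. 0)" using R_nonneg[OF lt(1)] by (smt (verit) ext of_bool_eq_0_iff zero_less_one of_bool_eq_1_iff)
  thus False using sumR_pos[OF UNIV_I lt(1)] by simp
 qed
qed

lemma r_index: "r_index B = rr" by (simp add: fun_eq_iff r_index_def return_time)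
lemma star: "star B = st" by (auto simp: fun_eq_iff star_def r_index cluster_var_Per cluster_var_0 lvar_inj)
lemma Pi_index: "Pi_index B = PI" by (auto simp: Pi_index_def PI_def r_index)
lemma tau: "tau B = tauD" by (auto simp: fun_eq_iff tau_def tauD_def r_index star)

lemma compat_degree: "compat_degree B = (%q r. if q \<in> PI & r \<in> PI then md q r else 0)" (is "_ = ?c")
 unfolding compat_degree_def
proof (rule the_equality)
 have "int (md (0, i) (t, k)) = max 0 (denominator_exponent (cluster_var B (t, k)) i)" if "(t, k) \<in> PI" for i t k
 proof -
  have tk: "t <= rr k" using that by (simp add: PI_iff)
  show ?thesis
  proof (cases t)
   case 0 thus ?thesis using denominator[OF tk, of i] by (simp add: md_00)
  next
   case (Suc t')
   have "int (md (0, i) (t, k)) = R t' k i" using md_0[of i t' k] that Suc by (simp add: of_int_eq_iff[where 'a = real, symmetric] del: of_int_eq_iff)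
   thus ?thesis using denominator[OF tk, of i] R_nonneg[of t' k i] tk Suc by simp
  qed
 qed
 hence "\<forall>i. \<forall>r\<in>PI. int (md (0, i) r) = max 0 (denominator_exponent (cluster_var B r) i)" by auto
 thus c: "is_compat_degree B ?c" unfolding is_compat_degree_def Pi_index tau by (auto simp: tauD_PI md_tau PI_iff)
 fix c assume c': "is_compat_degree B c"
 have eq: "c (s, j) r = md (s, j) r" if "(s, j) \<in> PI" "r \<in> PI" for s j r using that
 proof (induction s arbitrary: r)
  case 0
  have "int (c (0, j) r) = int (?c (0, j) r)" using c c' 0 unfolding is_compat_degree_def Pi_index by metis
  thus ?case using 0 by simp
 next
  case (Suc s)
  have t: "tauD (Suc s, j) = (s, j)" by (simp add: tauD_def)
  have "c (tauD (Suc s, j)) (tauD r) = c (Suc s, j) r" using c' Suc unfolding is_compat_degree_def Pi_index tau by blast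
  thus ?case using Suc(1)[of "tauD r"] md_tau[OF Suc(2,3)] Suc(2,3) tauD_PI unfolding t by (simp add: PI_iff)
 qed
 show "c = ?c"
 proof (intro ext)
  fix q r show "c q r = ?c q r"
   using eq[of "fst q" "snd q" r] c' unfolding is_compat_degree_def Pi_index by (auto simp del: split_paired_All)
 qed
qed

lemma pairwise_compatible: "pairwise_compatible B F \<longleftrightarrow> compat F"
 unfolding pairwise_compatible_def compat_def Pi_index compat_degree by (auto simp: subset_iff)

definition BT :: "'n int_matrix" where
 "BT = (\<chi> i j. if ht i < ht j then - a j i else if ht j < ht i then a j i else 0)"

text \<open>By \<open>g_vector\<close> these are the g-vectors for the transposed matrix
  \<open>BT\<close>, expressed in roots of the original diagram.\<close>

definition gv :: "nat \<times> 'n => 'n real_vec" where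
 "gv r = (\<chi> i. eul (R (fst r) (snd r)) (unit i) / d (snd r))"

end

text \<open>\<open>Y\<close> is the dual diagram with principal coefficients, with mutable rows
  \<open>Inl\<close> and frozen rows \<open>Inr\<close>.\<close>

locale pfull = full a d ht + Y: fbelt "UNIV :: 'n::{finite,linorder} set" "%i j. a j i" "%i. 1 / d i" ht "Inl :: 'n => 'n + 'n"
 for a :: "'n::{finite,linorder} => 'n => int" and d ht
begin

definition xP :: "'n + 'n => 'n principal_field" where "xP = snd (principal_seed BT)"
definition bP :: "('n int_vec, 'n + 'n) vec" where "bP = fst (principal_seed BT)"

lemma bP_Inl: "bP $ Inl i = BT $ i" and bP_Inr: "bP $ Inr i $ j = of_bool (i = j)"
 by (simp_all add: bP_def principal_seed_def mat_def)
lemma xP_Inl: "xP (Inl i) = lvar i" and xP_Inr: "xP (Inr i) = Fract (pms 0 (laurent_var i)) 1"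
 by (simp_all add: xP_def principal_seed_def lvar_def)

lemma Jblock_P: "Y.Jblock bP" by (simp add: Y.Jblock_def bP_Inl BT_def Y.Bm_def)

definition ps :: "('n, rat) laurent => real" where "ps = lev of_rat (%_. 1)"

lemma fhom_ps: "fhom ps"
proof -
 interpret I: fhom "of_rat :: rat => real" by (rule ring_hom_of_rat)
 show ?thesis unfolding ps_def by (rule I.lev_hom) simp
qed

lemma semi_P: "semifield (posf ps :: 'n principal_field set)" by (rule semifield_posf[OF fhom_ps])

lemma xP_pos: "xP v \<in> posf ps"
proof (cases v)
 case (Inl i) thus ?thesis by (simp add: xP_Inl posf_lvar[OF fhom_ps])
next
 case (Inr i)
 interpret P: fhom ps by (rule fhom_ps)
 interpret Q: fhom "lev ps (%_::'n. 1)" by (rule P.lev_hom) simp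
 interpret I: fhom "of_rat :: rat => real" by (rule ring_hom_of_rat)
 have "ps (laurent_var i) = 1" by (simp add: ps_def laurent_var_def I.lev_single mon_def)
 hence "lev ps (%_::'n. 1) (pms 0 (laurent_var i)) = 1" by (simp add: P.lev_single mon_def)
 thus ?thesis unfolding Inr xP_Inr posf_def mem_Collect_eq
  by (intro exI[of _ "pms 0 (laurent_var i)"] exI[of _ 1]) simp
qed

lemma principal_cluster_var_Xb: "principal_cluster_var BT (t, k) = Y.Xb bP xP t k"
 using Y.after_source_rounds[OF Jblock_P, of xP t] by (simp add: principal_cluster_var_def Y.after_def bP_def xP_def)

lemma mon_xP: "mon xP m = Fract (pms (pm (%i. m (Inl i))) (pms (pm (%i. m (Inr i))) 1)) 1"
proof -
 interpret H: ring_hom "%L :: ('n, ('n, rat) laurent) laurent. Fract L 1" by (rule Fract1_hom)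
 interpret S: ring_hom "%c :: ('n, rat) laurent. pms (0 :: 'n \<Rightarrow>\<^sub>0 int) c" by (rule ring_hom_single)
 have r: "xP (Inr i) powi n = Fract (pms 0 (pms (pms i n) 1)) 1" for i n
  using powi_hom[of "%n. Fract (pms 0 (pms (pms i n) 1)) 1 :: 'n principal_field" n]
  by (simp add: xP_Inr laurent_var_def single_add mult_single One_fract_def flip: single_one)
 have "pm (%i. m (Inr i)) = (\<Sum>i\<in>UNIV. pms i (m (Inr i)))"
 proof (rule poly_mapping_eqI)
  fix k
  have "(\<Sum>i\<in>UNIV. m (Inr i) when i = k) = (\<Sum>i\<in>UNIV. if i = k then m (Inr k) else 0)" by (rule sum.cong) (auto simp: when_def)
  thus "lkp (pm (%i. m (Inr i))) k = lkp (\<Sum>i\<in>UNIV. pms i (m (Inr i))) k"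
   by (simp add: lookup_sum lookup_single)
 qed
 hence "(\<Prod>i\<in>UNIV. xP (Inr i) powi m (Inr i)) = Fract (pms 0 (pms (pm (%i. m (Inr i))) 1)) 1"
  unfolding r by (simp only: H.hprod[symmetric] S.hprod[symmetric] prod_single)
 moreover have "(\<Prod>i\<in>UNIV. xP (Inl i) powi m (Inl i)) = Fract (pms (pm (%i. m (Inl i))) 1) 1"
  using mon_lvar[where 'b = "('n, rat) laurent", of "%i. m (Inl i)"] by (simp add: mon_def xP_Inl)
 moreover have "mon xP m = (\<Prod>i\<in>UNIV. xP (Inl i) powi m (Inl i)) * (\<Prod>i\<in>UNIV. xP (Inr i) powi m (Inr i))"
  unfolding mon_def using prod.Plus[of "UNIV :: 'n set" "UNIV :: 'n set" "%v. xP v powi m v"] by simp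
 ultimately show ?thesis by (simp add: mult_single)
qed

definition PL :: "nat => 'n => ('n, ('n, rat) laurent) laurent" where
 "PL t k = (\<Sum>m\<in>kys (Y.F.FL t k). pms (pm (%i. Y.ev bP t k m (Inl i)))
   (pms (pm (%i. Y.ev bP t k m (Inr i))) (of_int (lkp (Y.F.FL t k) m))))"

lemma principal_PL: "principal_cluster_var BT (t, k) = Fract (PL t k) 1"
proof -
 interpret H: ring_hom "%L :: ('n, ('n, rat) laurent) laurent. Fract L 1" by (rule Fract1_hom)
 have "Fract (pms m (pms m' (of_int c)) :: ('n, ('n, rat) laurent) laurent) 1 =
   of_int c * Fract (pms m (pms m' 1)) 1" for m m' c
  using single_of_int[of m' c "1 :: rat"] single_of_int[of m c "pms m' (1 :: rat)"] by (simp add: H.hmult H.hof_int)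
 thus ?thesis unfolding principal_cluster_var_Xb PL_def H.hsum
  by (subst Y.Xb_expand[OF Jblock_P semi_P]) (simp_all add: xP_pos mon_xP)
qed

lemma gx_Inr: "t <= rr k ==> Y.gx bP (Inr i) t k = 0"
proof -
 assume t: "t <= rr k"
 have "real_of_int (Y.gx bP (Inr i) t k) = 0"
 proof (rule Y.rec_unique[where f = "%t k. real_of_int (Y.gx bP (Inr i) t k)" and f' = "%_ _. 0"])
  fix t k assume k: "t < Y.rr k" and 1: "real_of_int (Y.gx bP (Inr i) t k) = 0"
   "Y.nbs (%t k. real_of_int (Y.gx bP (Inr i) t k)) t k = Y.nbs (%_ _. 0) t k"
  have n: "Y.nbs (Y.gx bP (Inr i)) t k = 0" using 1(2) by (simp flip: Y.nbs_real)
  have "Y.ce bP (Inr i) t k = (\<Sum>j\<in>UNIV. (if i = j then Y.R t k i else 0))"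
   using Y.ce_sum[OF Jblock_P, of k "Inr i" t] n by (simp add: bP_Inr of_bool_def if_distrib[of "%x. x * _"] cong: if_cong)
  hence "0 <= Y.ce bP (Inr i) t k" using Y.R_nonneg[OF k, of i] by simp
  thus "real_of_int (Y.gx bP (Inr i) (Suc t) k) = 0" using Y.gx_rec[of bP "Inr i" t k] n 1(1) by simp
 qed (use t dual_rr[of k] in auto)
 thus ?thesis by simp
qed

lemma monomial_degree_nth: "monomial_degree BT u w $ p = lkp u p - (\<Sum>i\<in>UNIV. lkp w i * BT $ p $ i)"
proof -
 have "(BT *v axis i 1) $ p = BT $ p $ i" for i
  by (simp add: matrix_vector_mult_def axis_def if_distrib[of "%x. _ * x"] cong: if_cong)
 moreover have "(\<Sum>i\<in>UNIV. lkp u i * axis i 1 $ p) = lkp u p"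
  by (simp add: axis_def if_distrib[of "%x. _ * x"] cong: if_cong)
 ultimately show ?thesis by (simp add: monomial_degree_def sum_negf)
qed

text \<open>Each y-hat variable has degree zero, since the degree of its frozen factor cancels a
  column of \<open>BT\<close>. All terms thus have the degree of the g-monomial, and as the
  polynomial is nonzero no other degree fits.\<close>

lemma has_degree_PL:
 assumes t: "t <= rr k"
 shows "has_degree BT (principal_cluster_var BT (t, k)) g \<longleftrightarrow> g = (\<chi> i. Y.gx bP (Inl i) t k)"
proof -
 let ?g = "\<chi> i. Y.gx bP (Inl i) t k" and ?L = "PL t k"
 have deg: "monomial_degree BT u w = ?g" if u: "u \<in> kys ?L" "w \<in> kys (lkp ?L u)" for u w
 proof -
  have "lkp (lkp ?L u) w ~= 0" using u by (simp add: in_keys_iff)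
  hence "(\<Sum>m\<in>kys (Y.F.FL t k). lkp (lkp (pms (pm (%i. Y.ev bP t k m (Inl i)))
   (pms (pm (%i. Y.ev bP t k m (Inr i))) (of_int (lkp (Y.F.FL t k) m)))) u) w :: rat) ~= 0"
   by (simp add: PL_def lookup_sum)
  then obtain m where "lkp (lkp (pms (pm (%i. Y.ev bP t k m (Inl i)))
   (pms (pm (%i. Y.ev bP t k m (Inr i))) (of_int (lkp (Y.F.FL t k) m)))) u) w ~= (0 :: rat)"
   by (metis (no_types, lifting) sum.neutral)
  hence uw: "u = pm (%i. Y.ev bP t k m (Inl i))" "w = pm (%i. Y.ev bP t k m (Inr i))"
   by (auto simp: lookup_single when_def split: if_splits)
  have "Y.ev bP t k m (Inr i) = lkp m i" for i
   using gx_Inr[OF t, of i] by (simp add: Y.ev_def bP_Inr of_bool_def if_distrib[of "%x. _ * x"] cong: if_cong)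
  thus ?thesis unfolding vec_eq_iff monomial_degree_nth uw by (simp add: Y.ev_def bP_Inl)
 qed
 have "?L ~= 0"
 proof
  assume "?L = 0"
  hence "principal_cluster_var BT (t, k) = 0" by (simp add: principal_PL Zero_fract_def)
  thus False using Y.separation(2)[where x = xP, OF Jblock_P semi_P xP_pos UNIV_I, of t k] semi_P
   by (simp add: principal_cluster_var_Xb semifield_def)
 qed
 then obtain u where u: "u \<in> kys ?L" by (metis ex_in_conv keys_eq_empty)
 hence "lkp ?L u ~= 0" by (simp add: in_keys_iff)
 then obtain w where w: "w \<in> kys (lkp ?L u)" by (metis ex_in_conv keys_eq_empty)
 show ?thesis
 proof
  assume "has_degree BT (principal_cluster_var BT (t, k)) g"
  thus "g = ?g" using deg[OF u w] u w unfolding has_degree_def principal_PL Fract1_inj by auto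
 next
  assume "g = ?g"
  thus "has_degree BT (principal_cluster_var BT (t, k)) g" unfolding has_degree_def principal_PL using deg by blast
 qed
qed

lemma g_vector: "r \<in> PI ==> g_vector BT (principal_cluster_var BT r) = gv r"
proof -
 assume g: "r \<in> PI"
 obtain t k where e: "r = (t, k)" by (cases r)
 have t: "t <= rr k" using g by (simp add: e PI_iff)
 have "(THE g. has_degree BT (principal_cluster_var BT r) g) = (\<chi> i. Y.gx bP (Inl i) t k)"
  unfolding e has_degree_PL[OF t] by simp
 moreover have "real_of_int (Y.gx bP (Inl i) t k) = eul (R t k) (unit i) / d k" for i
  using Y.gx_dual[of i k bP t] by (simp add: unit_def[abs_def] Y.unit_def[abs_def])
 ultimately show ?thesis by (simp add: g_vector_def gv_def e)
qed

text \<open>\<open>compat_extend\<close> puts \<open>F\<close> into a maximal compatible set; by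
  \<open>dual_compat\<close> it is compatible for the dual diagram too, and by
  \<open>reachable\<close> it is a cluster there.\<close>

lemma cone_in_fan: "compat F ==> convex_cone hull (gv ` F) \<in> cluster_fan BT"
proof -
 assume F: "compat F"
 obtain G where G: "F \<subseteq> G" "compat G" "card G = CARD('n)" using compat_extend[OF F] by auto
 obtain ks where "range (%k. snd (fold (mutate Inl) ks (bP, xP)) (Inl k)) = (%(t, k). Y.Xb bP xP t k) ` G"
  using reachable[where x = xP and F = G, OF Y.fbelt_axioms Jblock_P semi_P xP_pos] G dual_compat by auto
 moreover have "(bP, xP) = principal_seed BT" by (simp add: bP_def xP_def)
 moreover have "(%(t, k). Y.Xb bP xP t k) ` G = principal_cluster_var BT ` G"
  by (rule image_cong) (auto simp: principal_cluster_var_Xb)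
 ultimately have "principal_cluster_var BT ` G \<in> clusters BT" unfolding clusters_def mem_Collect_eq by (intro exI[of _ ks]) simp
 moreover have "gv ` F = g_vector BT ` principal_cluster_var BT ` F"
  unfolding image_image by (rule image_cong) (use F g_vector in "auto simp: compat_def")
 ultimately show ?thesis unfolding cluster_fan_def mem_Collect_eq
  by (intro exI[of _ "principal_cluster_var BT ` F"] exI[of _ "principal_cluster_var BT ` G"]) (use G(1) in auto)
qed

end

lemma (in full) pfull: "pfull a d ht"
 by (intro pfull.intro full_axioms fbelt.intro belt.intro belt_axioms.intro dual) (simp add: inj_def)

subsection \<open>Rigidity\<close>

context full
begin

text \<open>The pairing of \<open>gv r\<close> with \<open>P k\<close> (\<open>gp_gv\<close>). On
  the initial slice it is unitriangular with respect to heights; elsewhere it is minus the degree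
  with \<open>(0, k)\<close>, by Serre duality.\<close>

definition gp :: "'n => nat \<times> 'n => real" where
 "gp k r = eul (R (fst r) (snd r)) (P k) / d (snd r)"

lemma eul_left: "eul u v = (\<Sum>j\<in>UNIV. u j * eul (unit j) v)"
proof -
 have "u = (%l. \<Sum>j\<in>UNIV. u j * unit j l)" by (simp add: fun_eq_iff unit_def of_bool_def if_distrib[of "%x. _ * x"] cong: if_cong)
 hence "eul u v = eul (%l. \<Sum>j\<in>UNIV. u j * unit j l) v" by simp
 thus ?thesis by (simp add: eul_sum1 eul_scale1)
qed

lemma gp_gv: "gv r \<bullet> (\<chi> i. real_of_int (P k i)) = gp k r"
 using eul_unit_sum[of "P k" "R (fst r) (snd r)"]
 by (simp add: inner_vec_def gv_def gp_def supp_def sum_divide_distrib mult.commute)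

lemma gp_0: "gp k (0, m) = P k m" using dpos[of m] by (simp add: gp_def eul_P)

lemma gp_Suc: "(Suc s, i) \<in> PI ==> gp k (Suc s, i) = - real (md (Suc s, i) (0, k))"
 by (simp add: gp_def eul_RP md_0')

lemma sum_PI_0: "(\<Sum>r\<in>PI. f r) = (\<Sum>m\<in>UNIV. f (0, m)) + (\<Sum>r\<in>PI - {0} \<times> UNIV. (f r :: real))"
proof -
 have "(\<Sum>r\<in>PI. f r) = (\<Sum>r\<in>{0} \<times> UNIV. f r) + (\<Sum>r\<in>PI - {0} \<times> UNIV. f r)"
  by (subst sum.subset_diff[of "{0} \<times> UNIV"]) (auto simp: fin_PI PI_iff)
 also have "(\<Sum>r\<in>{0} \<times> UNIV. f r) = (\<Sum>m\<in>UNIV. f (0, m))"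
  by (rule sum.reindex_cong[of "Pair 0"]) (auto simp: inj_on_def)
 finally show ?thesis .
qed

lemma PI_Suc_cases: "r \<in> PI - {0} \<times> UNIV ==> \<exists>s i. r = (Suc s, i) & (Suc s, i) \<in> PI"
 by (cases r; cases "fst r") auto

text \<open>The slices \<open>t = 0, 1, \<dots>\<close> of \<open>\<Pi>\<close> are treated one after the other: pairing the linear relation
 with \<open>P k\<close> expresses \<open>e (0, k)\<close> through the incompatibilities of \<open>(0, k)\<close>, and once \<open>e\<close> vanishes
 on the first slice, the relation passes to \<open>e \<circ> \<tau>\<inverse>\<close>.\<close>

lemma rigid_aux:
 fixes e :: "nat \<times> 'n => real"
 assumes "compat F"
  and "!!r q. r \<in> PI ==> q \<in> F ==> md q r ~= 0 ==> e r = 0"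
  and "!!r. r \<in> PI - F ==> (!!q. q \<in> F ==> md q r = 0) ==> e r ~= 0 ==> e r * (\<Sum>q\<in>PI. md q r * e q) < 0"
  and "!!k. (\<Sum>r\<in>PI. e r * gp k r) = 0"
 shows "(n, k) \<in> PI ==> e (n, k) = 0" using assms
proof (induction n arbitrary: e F k)
 have step: "e (0, k) = 0" if F: "compat F"
  and A: "!!r q. r \<in> PI ==> q \<in> F ==> md q r ~= 0 ==> e r = 0"
  and B: "!!r. r \<in> PI - F ==> (!!q. q \<in> F ==> md q r = 0) ==> e r ~= 0 ==> e r * (\<Sum>q\<in>PI. md q r * e q) < 0"
  and C: "!!k. (\<Sum>r\<in>PI. e r * gp k r) = 0" for F k and e :: "nat \<times> 'n => real"
 proof (induction "ht k" arbitrary: k rule: less_induct)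
  case (less k)
  have k0: "(0, k) \<in> PI" by (simp add: PI_iff)
  have "(\<Sum>m\<in>UNIV. e (0, m) * P k m) = (\<Sum>m\<in>UNIV. if m = k then e (0, k) else 0)"
   using less P_above[of k] by (intro sum.cong) (force simp: not_less)+
  hence "(\<Sum>m\<in>UNIV. e (0, m) * gp k (0, m)) = e (0, k)" by (simp add: gp_0)
  moreover have "(\<Sum>r\<in>PI - {0} \<times> UNIV. e r * gp k r) = - (\<Sum>r\<in>PI - {0} \<times> UNIV. md r (0, k) * e r)"
   unfolding sum_negf[symmetric]
  proof (rule sum.cong[OF refl])
   fix r assume "r \<in> PI - {0} \<times> (UNIV :: 'n set)"
   then obtain s i where "r = (Suc s, i)" "(Suc s, i) \<in> PI" using PI_Suc_cases by blast
   thus "e r * gp k r = - (md r (0, k) * e r)" by (simp add: gp_Suc)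
  qed
  \<comment> \<open>So \<open>e (0, k)\<close> equals its own degree sum, and the product that the
    sign condition wants negative is a square.\<close>
  ultimately have E: "e (0, k) = (\<Sum>r\<in>PI. md r (0, k) * e r)"
   using C[of k] unfolding sum_PI_0 by (simp add: md_00)
  show ?case
  proof (cases "(0, k) \<in> F")
   case True
   have "md r (0, k) * e r = 0" if "r \<in> PI" for r using A[OF that True] md_zero_sym[OF that k0] by auto
   thus ?thesis unfolding E by (intro sum.neutral ballI)
  next
   case False
   show ?thesis
   proof (rule ccontr)
    assume ne: "e (0, k) ~= 0"
    have "e (0, k) * (\<Sum>q\<in>PI. md q (0, k) * e q) < 0" by (rule B) (use k0 False A[OF k0] ne in auto)
    thus False unfolding E[symmetric] using zero_le_square[of "e (0, k)"] by linarith
   qed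
  qed
 qed
 {
  case 0 thus ?case using step[of F e k] by blast
 next
  case (Suc n)
  note F = Suc(3) and A = Suc(4) and B = Suc(5) and C = Suc(6)
  have e0: "e (0, k) = 0" for k by (rule step[OF F A B C]) auto
  have tI: "tauI (n, k) = (Suc n, k)" "(n, k) \<in> PI" using Suc(2) by (auto simp: tauI_def PI_iff)
  have bI: "bij_betw tauI PI PI"
   by (rule bij_betw_byWitness[of _ tauD]) (auto simp: tauI_tau tau_tauI tauI_PI tauD_PI)
  have "e (tauI (n, k)) = 0"
  proof (rule Suc(1)[of k "tauD ` F" "%r. e (tauI r)", OF tI(2)])
   show "compat (tauD ` F)" by (rule compat_tauD[OF F])
   have FPI: "F \<subseteq> PI" using F by (simp add: compat_def)
   have mdI: "md (tauD q) r = md q (tauI r)" if "q \<in> F" "r \<in> PI" for q r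
    using md_tau[of q "tauI r"] that FPI tauI_PI tau_tauI by (metis subsetD)
   show "e (tauI r) = 0" if g: "r \<in> PI" "q \<in> tauD ` F" "md q r ~= 0" for r q
   proof -
    obtain q' where w: "q' \<in> F" "q = tauD q'" using g(2) by blast
    show ?thesis by (rule A[OF tauI_PI[OF g(1)] w(1)]) (use g(3) mdI[OF w(1) g(1)] w(2) in simp)
   qed
   show "e (tauI r) * (\<Sum>q\<in>PI. md q r * e (tauI q)) < 0"
    if g: "r \<in> PI - tauD ` F" "!!q. q \<in> tauD ` F ==> md q r = 0" "e (tauI r) ~= 0" for r
   proof -
    have gP: "r \<in> PI" using g by simp
    have "(\<Sum>q\<in>PI. md q r * e (tauI q)) = (\<Sum>q\<in>PI. md (tauI q) (tauI r) * e (tauI q))"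
     by (rule sum.cong) (simp_all add: md_tauI gP)
    also have "\<dots> = (\<Sum>q\<in>PI. md q (tauI r) * e q)"
     by (rule sum.reindex_bij_betw[OF bI, of "%q. md q (tauI r) * e q"])
    finally show ?thesis
    proof (elim ssubst, intro B)
     show "tauI r \<in> PI - F" using g(1) tau_tauI[OF gP] tauI_PI[OF gP] by (metis DiffD2 DiffI imageI)
     show "md q (tauI r) = 0" if "q \<in> F" for q using g(2)[of "tauD q"] mdI[OF that gP] that by simp
    qed (rule g(3))
   qed
   fix k
   \<comment> \<open>With \<open>e\<close> zero on the first slice, the pairing with
     \<open>P j\<close> picks out coordinate \<open>j\<close> of the root one step back
     (\<open>eul_RP\<close>), so the shifted relation holds coordinate by coordinate.\<close>
   have V: "(\<Sum>r\<in>PI - {0} \<times> UNIV. e r * (R (fst r - 1) (snd r) j / d (snd r))) = 0" for j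
   proof -
    have "0 = (\<Sum>r\<in>PI - {0} \<times> UNIV. e r * gp j r)" using C[of j] unfolding sum_PI_0 by (simp add: e0)
    also have "\<dots> = - d j * (\<Sum>r\<in>PI - {0} \<times> UNIV. e r * (R (fst r - 1) (snd r) j / d (snd r)))"
     unfolding sum_distrib_left
    proof (rule sum.cong[OF refl])
     fix r assume "r \<in> PI - {0} \<times> (UNIV :: 'n set)"
     then obtain s i where "r = (Suc s, i)" using PI_Suc_cases by blast
     thus "e r * gp j r = - d j * (e r * (R (fst r - 1) (snd r) j / d (snd r)))" by (simp add: gp_def eul_RP)
    qed
    finally show ?thesis using dpos[of j] by simp
   qed
   have "(\<Sum>r\<in>PI. e (tauI r) * gp k r) = (\<Sum>r\<in>PI. e (tauI r) * gp k (tauD (tauI r)))"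
    by (rule sum.cong) (simp_all add: tau_tauI)
   also have "\<dots> = (\<Sum>r\<in>PI. e r * gp k (tauD r))" by (rule sum.reindex_bij_betw[OF bI, of "%r. e r * gp k (tauD r)"])
   also have "\<dots> = (\<Sum>r\<in>PI - {0} \<times> UNIV. \<Sum>j\<in>UNIV. eul (unit j) (P k) * (e r * (R (fst r - 1) (snd r) j / d (snd r))))"
   proof -
    have "(\<Sum>r\<in>PI - {0} \<times> UNIV. e r * gp k (tauD r)) =
     (\<Sum>r\<in>PI - {0} \<times> UNIV. \<Sum>j\<in>UNIV. eul (unit j) (P k) * (e r * (R (fst r - 1) (snd r) j / d (snd r))))"
    proof (rule sum.cong[OF refl])
     fix r assume "r \<in> PI - {0} \<times> (UNIV :: 'n set)"
     then obtain s i where g: "r = (Suc s, i)" using PI_Suc_cases by blast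
     show "e r * gp k (tauD r) = (\<Sum>j\<in>UNIV. eul (unit j) (P k) * (e r * (R (fst r - 1) (snd r) j / d (snd r))))"
      unfolding g by (simp add: tauD_def gp_def eul_left[of "R s i"] sum_divide_distrib sum_distrib_left mult_ac)
    qed
    thus ?thesis unfolding sum_PI_0 by (simp add: e0)
   qed
   also have "\<dots> = 0"
    by (subst sum.swap) (simp only: sum_distrib_left[symmetric] V mult_zero_right sum.neutral_const)
   finally show "(\<Sum>r\<in>PI. e (tauI r) * gp k r) = 0" .
  qed
  thus ?case unfolding tI .
 }
qed

text \<open>In the applications \<open>F\<close> consists of the vanishing coordinates. Indices
  incompatible with one of them have \<open>u = 1\<close>, which explains the first condition, and
  on \<open>F\<close> itself \<open>e\<close> is unrestricted.\<close>

theorem rigid: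
 fixes e :: "nat \<times> 'n => real"
 assumes F: "compat F"
  and A: "!!r q. r \<in> PI ==> q \<in> F ==> md q r ~= 0 ==> e r = 0"
  and B: "!!r. r \<in> PI - F ==> (!!q. q \<in> F ==> md q r = 0) ==> e r ~= 0 ==> e r * (\<Sum>q\<in>PI. md q r * e q) < 0"
  and C: "(\<Sum>r\<in>PI. e r *\<^sub>R gv r) = 0" and g: "r \<in> PI"
 shows "e r = 0"
proof -
 have C': "(\<Sum>r\<in>PI. e r * gp k r) = 0" for k
  using arg_cong[OF C, of "%x. x \<bullet> (\<chi> i. real_of_int (P k i))"] by (simp add: inner_sum_left gp_gv)
 have "e (fst r, snd r) = 0"
  by (rule rigid_aux[where e = e and F = F]) (fact F, fact A, fact B, fact C', use g in simp)
 thus ?thesis by simp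
qed

text \<open>Rigidity for \<open>e\<close> supported in \<open>F\<close>, where the sign condition is
  vacuous.\<close>

lemma gv_indep:
 assumes F: "compat F" and s: "(\<Sum>r\<in>F. x r *\<^sub>R gv r) = 0" and g: "r \<in> F"
 shows "x r = 0"
proof -
 have FPI: "F \<subseteq> PI" "!!q r. q \<in> F ==> r \<in> F ==> md q r = 0" using F by (auto simp: compat_def)
 let ?e = "%r. if r \<in> F then x r else 0"
 have "(\<Sum>r\<in>PI. ?e r *\<^sub>R gv r) = (\<Sum>r\<in>F. x r *\<^sub>R gv r)"
  by (rule sum.mono_neutral_cong_right) (use FPI fin_PI in auto)
 hence C: "(\<Sum>r\<in>PI. ?e r *\<^sub>R gv r) = 0" using s by simp
 have "?e r = 0"
 proof (rule rigid[OF F _ _ C])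
  show "r \<in> PI" using FPI g by auto
  show "?e r = 0" if "q \<in> F" "md q r ~= 0" for r q using FPI(2)[of q r] that by auto
 qed simp
 thus ?thesis using g by simp
qed

lemma gv_nz: "r \<in> PI ==> gv r ~= 0" using gv_indep[of "{r}" "%_. 1" r] by (auto simp: compat_def)

text \<open>Rigidity for the relation between two proportional rays: compatible ones are
  independent, and for incompatible ones each degree sum involves only the other coefficient, of
  opposite sign.\<close>

lemma gv_ray:
 assumes g: "r \<in> PI" "z \<in> PI" and c: "gv z = c *\<^sub>R gv r" "0 <= c"
 shows "z = r"
proof (rule ccontr)
 assume ne: "z ~= r"
 have c0: "c > 0" using c gv_nz[OF g(2)] by (cases "c = 0") auto
 let ?e = "%q. if q = z then 1 else if q = r then - c else 0"
 have s: "(\<Sum>q\<in>PI. f q (?e q)) = f z 1 + f r (- c)" if "!!q. f q 0 = 0" for f :: "_ => real => 'b::real_vector"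
 proof -
  have "(\<Sum>q\<in>PI. f q (?e q)) = (\<Sum>q\<in>{z, r}. f q (?e q))"
   by (rule sum.mono_neutral_right) (use g fin_PI that in auto)
  thus ?thesis using ne by simp
 qed
 have C: "(\<Sum>q\<in>PI. ?e q *\<^sub>R gv q) = 0" using s[of "%q x. x *\<^sub>R gv q"] c by simp
 show False
 proof (cases "md z r = 0")
  case True
  hence "compat {z, r}" using g md_zero_sym[OF g(2,1)] by (auto simp: compat_def)
  hence "?e z = 0" by (rule gv_indep) (use ne c in auto)
  thus False by simp
 next
  case False
  hence md: "md z r > 0" "md r z > 0" using md_zero_sym[OF g(2,1)] by auto
  have "?e z = 0"
  proof (rule rigid[of "{}", OF _ _ _ C g(2)])
   fix q assume w: "?e q ~= 0"
   have E: "(\<Sum>q'\<in>PI. real (md q' q) * ?e q') = md z q - md r q * c"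
    using s[of "%q' x. real (md q' q) * x"] by simp
   show "?e q * (\<Sum>q'\<in>PI. real (md q' q) * ?e q') < 0" unfolding E using w md c0 by (auto split: if_splits)
  qed (auto simp: compat_def)
  thus False by simp
 qed
qed

definition maxc :: "(nat \<times> 'n) set => bool" where
 "maxc F \<longleftrightarrow> compat F & card F = CARD('n)"

lemma maxc_fin: "maxc F ==> finite F" and maxc_PI: "maxc F ==> F \<subseteq> PI"
 using compat_finite by (auto simp: maxc_def compat_def)

lemma dual_basis:
 assumes F: "maxc F"
 obtains W where "!!r z. r \<in> F ==> z \<in> F ==> gv z \<bullet> W r = of_bool (z = r)"
  "!!x. (!!r. r \<in> F ==> gv r \<bullet> x = 0) ==> x = 0"
proof -
 have cF: "compat F" and fin: "finite F" using F maxc_fin by (auto simp: maxc_def)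
 have inj: "inj_on gv F"
 proof (rule inj_onI)
  fix x y assume "x \<in> F" "y \<in> F" "gv x = gv y"
  thus "x = y" using gv_ray[of y x 1] maxc_PI[OF F] by auto
 qed
 have ind: "independent (gv ` F)"
 proof (rule independent_if_scalars_zero)
  fix f x assume s: "(\<Sum>x\<in>gv ` F. f x *\<^sub>R x) = 0" and x: "x \<in> gv ` F"
  have "(\<Sum>r\<in>F. f (gv r) *\<^sub>R gv r) = 0" using s by (simp add: sum.reindex[OF inj])
  thus "f x = 0" using gv_indep[OF cF, of "%r. f (gv r)"] x by auto
 qed (simp add: fin)
 have "UNIV \<subseteq> span (gv ` F)"
  by (rule card_ge_dim_independent[OF _ ind]) (use F in "simp_all add: card_image[OF inj] maxc_def")
 hence sp: "span (gv ` F) = UNIV" by auto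
 have "\<exists>w. \<forall>z\<in>F. gv z \<bullet> w = of_bool (z = r)" if "r \<in> F" for r
 proof -
  obtain g :: "'n real_vec => real" where g: "linear g" "!!x. x \<in> gv ` F ==> g x = of_bool (x = gv r)"
   using linear_independent_extend[OF ind, of "%x. of_bool (x = gv r)"] by auto
  have "gv z \<bullet> adjoint g 1 = of_bool (z = r)" if "z \<in> F" for z
   using adjoint_works[OF g(1), of "gv z" 1] g(2)[of "gv z"] that inj_on_eq_iff[OF inj that \<open>r \<in> F\<close>] by simp
  thus ?thesis by blast
 qed
 then obtain W where W: "!!r z. r \<in> F ==> z \<in> F ==> gv z \<bullet> W r = of_bool (z = r)" by metis
 have "x = 0" if "!!r. r \<in> F ==> gv r \<bullet> x = 0" for x
 proof -
  have "orthogonal x y" if "y \<in> span (gv ` F)" for y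
  proof (rule orthogonal_to_span[OF that])
   show "orthogonal x v" if "v \<in> gv ` F" for v
    using \<open>!!r. r \<in> F ==> gv r \<bullet> x = 0\<close> that unfolding orthogonal_def by (metis imageE inner_commute)
  qed
  hence "orthogonal x x" using sp by blast
  thus ?thesis by (simp add: orthogonal_def)
 qed
 thus ?thesis using that[OF W] by blast
qed

lemma gv_separates: assumes z: "!!r. r \<in> PI ==> gv r \<bullet> x = 0" shows "x = 0"
proof -
 obtain F where "maxc F" using compat_extend[of "{}"] by (auto simp: maxc_def compat_def)
 thus ?thesis using dual_basis z maxc_PI by (metis subsetD)
qed

lemma dual_expand:
 assumes F: "maxc F" and W: "!!r z. r \<in> F ==> z \<in> F ==> gv z \<bullet> W r = of_bool (z = r)"
 shows "x = (\<Sum>r\<in>F. (gv r \<bullet> x) *\<^sub>R W r)" "x = (\<Sum>r\<in>F. (x \<bullet> W r) *\<^sub>R gv r)"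
proof -
 obtain W' where sep: "!!x. (!!r. r \<in> F ==> gv r \<bullet> x = 0) ==> x = 0" using dual_basis[OF F] by metis
 have 1: "y = (\<Sum>r\<in>F. (gv r \<bullet> y) *\<^sub>R W r)" for y
 proof -
  have "y - (\<Sum>r\<in>F. (gv r \<bullet> y) *\<^sub>R W r) = 0"
  proof (rule sep)
   fix z assume d: "z \<in> F"
   have "(\<Sum>r\<in>F. (gv r \<bullet> y) * (gv z \<bullet> W r)) = (\<Sum>r\<in>F. if r = z then gv z \<bullet> y else 0)"
    by (rule sum.cong) (auto simp: W d)
   thus "gv z \<bullet> (y - (\<Sum>r\<in>F. (gv r \<bullet> y) *\<^sub>R W r)) = 0"
    using d maxc_fin[OF F] by (simp add: inner_diff_right inner_sum_right)
  qed
  thus ?thesis by simp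
 qed
 show "x = (\<Sum>r\<in>F. (gv r \<bullet> x) *\<^sub>R W r)" by (rule 1)
 have "x \<bullet> y = (\<Sum>r\<in>F. (x \<bullet> W r) *\<^sub>R gv r) \<bullet> y" for y
  by (subst 1) (simp add: inner_sum_left inner_sum_right mult.commute)
 thus "x = (\<Sum>r\<in>F. (x \<bullet> W r) *\<^sub>R gv r)" by (metis inner_commute vector_eq_rdot)
qed

text \<open>\<open>usol_exists\<close> moved by \<open>tauI\<close>, which preserves the equations
  and turns \<open>gM\<close> into \<open>- gv\<close>.\<close>

lemma solution_exists:
 fixes \<xi> :: "'n real_vec"
 obtains z :: "nat \<times> 'n => real" where "!!r. r \<in> PI ==> exp (z r) + exp (\<Sum>q\<in>PI. md q r * z q) = 1" "(\<Sum>r\<in>PI. z r *\<^sub>R gv r) = \<xi>"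
proof -
 obtain z where z: "usol z" "!!l. eta z l = - (\<xi> $ l)" by (rule usol_exists[of "%l. - (\<xi> $ l)"]) simp
 have gM: "gM q l = - gv (tauD q) $ l" if "q \<in> PI" for q l
 proof (cases "fst q")
  case 0
  then obtain j where w: "q = (0, j)" by (cases q) auto
  show ?thesis unfolding w using d_st[of j] rr_st[of j] by (simp add: gM_def gv_def tauD_def rho_0)
 next
  case (Suc s)
  then obtain j where "q = (Suc s, j)" by (cases q) auto
  thus ?thesis by (simp add: gM_def gv_def tauD_def rho_Suc)
 qed
 have bI: "bij_betw tauI PI PI" by (rule bij_betw_byWitness[of _ tauD]) (auto simp: tauI_tau tau_tauI tauI_PI tauD_PI)
 show ?thesis
 proof (rule that[of "%r. z (tauI r)"])
  fix r assume g: "r \<in> PI"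
  have "(\<Sum>q\<in>PI. md q r * z (tauI q)) = (\<Sum>q\<in>PI. md (tauI q) (tauI r) * z (tauI q))"
   by (rule sum.cong) (simp_all add: md_tauI g)
  also have "\<dots> = (\<Sum>q\<in>PI. md q (tauI r) * z q)"
   by (rule sum.reindex_bij_betw[OF bI, of "%q. md q (tauI r) * z q"])
  finally show "exp (z (tauI r)) + exp (\<Sum>q\<in>PI. md q r * z (tauI q)) = 1"
   using z(1) tauI_PI[OF g] by (simp add: usol_def)
 next
  have "(\<Sum>r\<in>PI. z (tauI r) *\<^sub>R gv r) = (\<Sum>r\<in>PI. z (tauI r) *\<^sub>R gv (tauD (tauI r)))"
   by (rule sum.cong) (simp_all add: tau_tauI)
  also have "\<dots> = (\<Sum>r\<in>PI. z r *\<^sub>R gv (tauD r))" by (rule sum.reindex_bij_betw[OF bI, of "%r. z r *\<^sub>R gv (tauD r)"])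
  also have "\<dots> = \<xi>" unfolding vec_eq_iff
  proof
   fix l
   have "(\<Sum>r\<in>PI. z r * gv (tauD r) $ l) = - eta z l"
    unfolding eta_def sum_negf[symmetric] by (rule sum.cong) (simp_all add: gM)
   thus "(\<Sum>r\<in>PI. z r *\<^sub>R gv (tauD r)) $ l = \<xi> $ l" using z(2) by simp
  qed
  finally show "(\<Sum>r\<in>PI. z (tauI r) *\<^sub>R gv r) = \<xi>" .
 qed
qed

end

subsection \<open>Polytopes whose normal fan contains the cones of compatible sets\<close>

lemma cone_hull_image:
 fixes f :: "'b => 'a::real_vector"
 assumes "finite F" "x \<in> convex_cone hull (f ` F)"
 obtains c where "!!i. i \<in> F ==> 0 <= c i" "x = (\<Sum>i\<in>F. c i *\<^sub>R f i)"
proof -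
 let ?T = "{\<Sum>i\<in>F. c i *\<^sub>R f i |c. \<forall>i\<in>F. 0 <= (c i :: real)}"
 have "convex_cone hull (f ` F) \<subseteq> ?T"
 proof (rule hull_minimal)
  show "f ` F \<subseteq> ?T"
  proof
   fix y assume "y \<in> f ` F"
   then obtain j where j: "j \<in> F" "y = f j" by blast
   have "(\<Sum>i\<in>F. (of_bool (i = j) :: real) *\<^sub>R f i) = (\<Sum>i\<in>F. if i = j then f j else 0)" by (rule sum.cong) auto
   thus "y \<in> ?T" using j assms(1) by (intro CollectI exI[of _ "%i. of_bool (i = j)"]) simp
  qed
  show "convex_cone ?T" unfolding convex_cone_iff
  proof (intro conjI ballI allI impI)
   show "0 \<in> ?T" by (intro CollectI exI[of _ "%_. 0"]) simp
   fix x y assume "x \<in> ?T" "y \<in> ?T"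
   then obtain c c' where "x = (\<Sum>i\<in>F. c i *\<^sub>R f i)" "y = (\<Sum>i\<in>F. c' i *\<^sub>R f i)" "\<forall>i\<in>F. 0 <= c i" "\<forall>i\<in>F. 0 <= c' i" by auto
   thus "x + y \<in> ?T" by (intro CollectI exI[of _ "%i. c i + c' i"]) (simp add: sum.distrib scaleR_add_left)
  next
   fix x and k :: real assume "x \<in> ?T" "0 <= k"
   then obtain c where "x = (\<Sum>i\<in>F. c i *\<^sub>R f i)" "\<forall>i\<in>F. 0 <= c i" by auto
   thus "k *\<^sub>R x \<in> ?T" using \<open>0 <= k\<close> by (intro CollectI exI[of _ "%i. k * c i"]) (simp add: scaleR_sum_right)
  qed
 qed
 thus ?thesis using assms(2) that by blast
qed

text \<open>The convex primitive of \<open>ln\<close>, with value and limit 0 at 0.\<close>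

definition xl :: "real => real" where "xl x = x * ln x - x"

lemma xl_ge: assumes "0 <= x" "0 < y" shows "xl y + (x - y) * ln y <= xl x"
proof (cases "x = 0")
 case False
 hence x: "x > 0" using assms by simp
 have "x * ln (y / x) <= x * (y / x - 1)" using x assms by (intro mult_left_mono ln_le_minus_one) auto
 thus ?thesis using x assms by (simp add: xl_def ln_div algebra_simps)
qed (use assms in "simp add: xl_def algebra_simps")

lemma xl_convex:
 assumes "0 <= x" "0 < y" "0 < s" "s < 1"
 shows "xl ((1 - s) * x + s * y) <= (1 - s) * xl x + s * xl y"
proof -
 define m where "m = (1 - s) * x + s * y"
 have m: "m > 0" using assms by (simp add: m_def add_nonneg_pos)
 have "(1 - s) * (xl m + (x - m) * ln m) + s * (xl m + (y - m) * ln m) <= (1 - s) * xl x + s * xl y"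
  using assms m by (intro add_mono mult_left_mono xl_ge) auto
 moreover have "(1 - s) * (xl m + (x - m) * ln m) + s * (xl m + (y - m) * ln m) = xl m + ((1 - s) * x + s * y - m) * ln m"
  by (simp add: algebra_simps)
 ultimately show ?thesis by (simp add: m_def)
qed

text \<open>The term \<open>s * ln s\<close> beats every linear term near zero; this is what repels
  minimizers from the boundary.\<close>

lemma xl_scale: "0 < s ==> 0 < c ==> xl (s * c) = s * xl c + s * c * ln s" by (simp add: xl_def ln_mult algebra_simps)

lemma continuous_xl: "continuous_on {0..} xl"
proof -
 have "continuous (at x within {0..}) xl" if "x \<ge> 0" for x
 proof (cases "x = 0")
  case True
  have "((%x::real. x * ln x - x) \<longlongrightarrow> 0) (at_right 0)" by real_asymp
  hence "(xl \<longlongrightarrow> xl 0) (at 0 within {0..})" unfolding xl_def by (simp add: at_within_Ici_at_right)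
  thus ?thesis using True by (simp add: continuous_within)
 next
  case False
  hence "isCont xl x" unfolding xl_def using that by (intro continuous_intros) auto
  thus ?thesis by (rule continuous_at_imp_continuous_at_within)
 qed
 thus ?thesis by (simp add: continuous_on_eq_continuous_within)
qed

locale poly = full a d ht for a :: "'n::{finite,linorder} => 'n => int" and d ht +
 fixes Q :: "'n real_vec set"
 assumes poly: "polytope Q" and fan: "!!F. compat F ==> convex_cone hull (gv ` F) \<in> normal_fan Q"
begin

definition h :: "nat \<times> 'n => real" where
 "h r = (SOME x. \<exists>p\<in>Q. x = gv r \<bullet> p & (\<forall>p'\<in>Q. gv r \<bullet> p' <= x))"

definition sg :: "nat \<times> 'n => 'n real_vec => real" where "sg r p = h r - gv r \<bullet> p"

lemma fanE:
 assumes "compat F"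
 obtains T where "T ~= {}" "T \<subseteq> Q" "normal_cone Q T = convex_cone hull (gv ` F)"
 using fan[OF assms] face_of_imp_subset unfolding normal_fan_def by blast

lemma Q_ne: "Q ~= {}" and Q_compact: "compact Q" and Q_convex: "convex Q"
proof -
 show "Q ~= {}" using fanE[of "{}"] by (auto simp: compat_def)
qed (use poly polytope_imp_compact polytope_imp_convex in auto)

lemma h: "\<exists>p\<in>Q. h r = gv r \<bullet> p & (\<forall>p'\<in>Q. gv r \<bullet> p' <= h r)" unfolding h_def
proof (rule someI_ex)
 have "continuous_on Q (%p. gv r \<bullet> p)" by (intro continuous_intros)
 thus "\<exists>x. \<exists>p\<in>Q. x = gv r \<bullet> p & (\<forall>p'\<in>Q. gv r \<bullet> p' <= x)"
  using continuous_attains_sup[OF Q_compact Q_ne] by blast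
qed

lemma sg_nonneg: "p \<in> Q ==> 0 <= sg r p" using h[of r] by (auto simp: sg_def)

lemma sg_add: "sg r (p + s *\<^sub>R w) = sg r p - s * (gv r \<bullet> w)" by (simp add: sg_def inner_add_right)

lemma sg_affine: "sg r ((1 - s) *\<^sub>R p + s *\<^sub>R q) = (1 - s) * sg r p + s * sg r q"
 by (simp add: sg_def inner_add_right algebra_simps)

lemma sg_face: "gv r \<in> normal_cone Q T ==> q \<in> T ==> q \<in> Q ==> sg r q = 0"
 using h[of r] by (force simp: normal_cone_def sg_def)

text \<open>A face whose normal cone is spanned by a basis of g-vectors is a point. If a further
  slack, that of \<open>r\<close>, vanished there, \<open>gv r\<close> would be a nonnegative
  combination of rays of \<open>F\<close>. On the face \<open>T'\<close> with normal cone the ray of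
  \<open>r\<close>, the slacks of all rays used in it vanish, so such a ray would be proportional to
  \<open>gv r\<close>, against \<open>gv_ray\<close>.\<close>

lemma vertex:
 assumes F: "maxc F"
 shows "\<exists>v\<in>Q. \<forall>r\<in>PI. sg r v = 0 \<longleftrightarrow> r \<in> F"
proof -
 have cF: "compat F" using F by (simp add: maxc_def)
 obtain T where T: "T ~= {}" "T \<subseteq> Q" "normal_cone Q T = convex_cone hull (gv ` F)" using fanE[OF cF] .
 have 0: "sg r q = 0" if "r \<in> F" "q \<in> T" for r q using sg_face[of r T q] T that by (auto intro: hull_inc)
 obtain q where q: "q \<in> T" using T by blast
 have "q' = q" if "q' \<in> T" for q'
 proof -
  obtain W' where sep: "!!x. (!!r. r \<in> F ==> gv r \<bullet> x = 0) ==> x = 0" using dual_basis[OF F] by metis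
  have "q' - q = 0"
  proof (rule sep)
   fix r assume "r \<in> F"
   thus "gv r \<bullet> (q' - q) = 0" using 0[of r q] 0[of r q'] q that by (simp add: sg_def inner_diff_right)
  qed
  thus ?thesis by simp
 qed
 hence "T \<subseteq> {q}" by blast
 hence Tq: "T = {q}" using q by blast
 have "r \<in> F" if g: "r \<in> PI" "sg r q = 0" for r
 proof (rule ccontr)
  assume nF: "r \<notin> F"
  have "gv r \<in> normal_cone Q {q}" using g(2) h[of r] by (auto simp: normal_cone_def sg_def)
  then obtain c where c: "!!i. i \<in> F ==> 0 <= c i" "gv r = (\<Sum>i\<in>F. c i *\<^sub>R gv i)"
   using cone_hull_image[OF maxc_fin[OF F]] T(3) Tq by metis
  have "\<not> (\<forall>z\<in>F. c z = 0)"
  proof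
   assume "\<forall>z\<in>F. c z = 0"
   hence "(\<Sum>i\<in>F. c i *\<^sub>R gv i) = 0" by (intro sum.neutral) simp
   thus False using c(2) gv_nz[OF g(1)] by simp
  qed
  then obtain z where d: "z \<in> F" "c z ~= 0" by blast
  have "compat {r}" using g(1) by (auto simp: compat_def)
  then obtain T' where T': "T' ~= {}" "T' \<subseteq> Q" "normal_cone Q T' = convex_cone hull (gv ` {r})" using fanE by blast
  have "sg z p = 0" if p: "p \<in> T'" for p
  proof -
   have pQ: "p \<in> Q" using p T' by auto
   have "sg r p = 0" using sg_face[of r T' p] T' p pQ by (auto intro: hull_inc)
   hence "gv r \<bullet> p = gv r \<bullet> q" using g(2) by (simp add: sg_def)
   hence "(\<Sum>i\<in>F. c i * sg i p) = (\<Sum>i\<in>F. c i * sg i q)"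
    unfolding c(2) by (simp add: sg_def right_diff_distrib sum_subtractf inner_sum_left)
   also have "\<dots> = 0" using 0[OF _ q] by simp
   finally have "\<forall>i\<in>F. c i * sg i p = 0"
    using c(1) sg_nonneg[OF pQ] by (subst (asm) sum_nonneg_eq_0_iff) (auto simp: maxc_fin[OF F])
   thus ?thesis using d by auto
  qed
  hence "gv z \<in> normal_cone Q T'" using h[of z] by (auto simp: normal_cone_def sg_def)
  then obtain c' where "gv z = c' *\<^sub>R gv r" "0 <= c'" unfolding T'(3) by (rule cone_hull_image[rotated]) auto
  hence "z = r" using gv_ray g(1) d(1) maxc_PI[OF F] by blast
  thus False using d(1) nF by simp
 qed
 thus ?thesis using 0[OF _ q] q T(2) by blast
qed

definition vx :: "(nat \<times> 'n) set => 'n real_vec" where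
 "vx F = (SOME v. v \<in> Q & (\<forall>r\<in>PI. sg r v = 0 \<longleftrightarrow> r \<in> F))"

lemma vx: "maxc F ==> vx F \<in> Q" "maxc F ==> r \<in> PI ==> sg r (vx F) = 0 \<longleftrightarrow> r \<in> F"
 using someI_ex[of "%v. v \<in> Q & (\<forall>r\<in>PI. sg r v = 0 \<longleftrightarrow> r \<in> F)"] vertex[of F] unfolding vx_def by blast+

text \<open>A vertex maximizing \<open>c\<close> is the vertex of a cone containing \<open>c\<close>, since otherwise a flip would
 increase \<open>c\<close>.\<close>

lemma cone_cover:
 obtains F x where "maxc F" "!!r. r \<in> F ==> 0 <= x r" "c = (\<Sum>r\<in>F. x r *\<^sub>R gv r)"
proof -
 let ?M = "{F. maxc F}"
 have fin: "finite ?M" by (rule finite_subset[of _ "Pow PI"]) (use maxc_PI fin_PI in auto)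
 have ne: "?M ~= {}" using compat_extend[of "{}"] by (auto simp: maxc_def compat_def)
 have "Max ((%F. c \<bullet> vx F) ` ?M) \<in> (%F. c \<bullet> vx F) ` ?M" using fin ne by (intro Max_in) auto
 then obtain F where F: "maxc F" "c \<bullet> vx F = Max ((%F. c \<bullet> vx F) ` ?M)" by auto
 have mx: "c \<bullet> vx F' <= c \<bullet> vx F" if "maxc F'" for F' unfolding F(2) using fin that by (intro Max_ge) auto
 obtain W where W: "!!r z. r \<in> F ==> z \<in> F ==> gv z \<bullet> W r = of_bool (z = r)" using dual_basis[OF F(1)] by metis
 have "0 <= c \<bullet> W r" if g: "r \<in> F" for r
 proof -
  obtain r' where g': "r' \<notin> F" "compat (insert r' (F - {r}))"
   using compat_flip[of F r] F(1) g by (auto simp: maxc_def)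
  let ?F = "insert r' (F - {r})"
  have F': "maxc ?F" using g' g F(1) maxc_fin[OF F(1)] card_Suc_Diff1[of F r] by (auto simp: maxc_def)
  have PI: "z \<in> PI" if "z \<in> F" for z using that maxc_PI[OF F(1)] by auto
  define w where "w = vx ?F - vx F"
  have gw: "gv z \<bullet> w = sg z (vx F) - sg z (vx ?F)" for z by (simp add: w_def sg_def inner_diff_right)
  have "gv z \<bullet> w = 0" if "z \<in> F - {r}" for z
   using vx(2)[OF F(1), of z] vx(2)[OF F', of z] PI[of z] that by (simp add: gw)
  hence "(\<Sum>z\<in>F. (gv z \<bullet> w) *\<^sub>R W z) = (\<Sum>z\<in>F. if z = r then (gv r \<bullet> w) *\<^sub>R W r else 0)"
   by (intro sum.cong) auto
  hence w: "w = (gv r \<bullet> w) *\<^sub>R W r" using dual_expand(1)[OF F(1) W, of w] g maxc_fin[OF F(1)] by simp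
  have "r \<notin> ?F" using g g' by auto
  hence "gv r \<bullet> w < 0"
   using vx(2)[OF F(1) PI[OF g]] vx(2)[OF F' PI[OF g]] sg_nonneg[OF vx(1)[OF F'], of r] g by (auto simp: gw)
  moreover have "(gv r \<bullet> w) * (c \<bullet> W r) <= 0"
  proof -
   have "c \<bullet> w <= 0" using mx[OF F'] by (simp add: w_def inner_diff_right)
   thus ?thesis by (subst (asm) w) simp
  qed
  ultimately show ?thesis by (simp add: mult_le_0_iff)
 qed
 thus ?thesis by (rule that[OF F(1) _ dual_expand(2)[OF F(1) W, of c]])
qed

lemma cover_le:
 assumes "maxc F" "!!r. r \<in> F ==> 0 <= x r" "c = (\<Sum>r\<in>F. x r *\<^sub>R gv r)" "!!r. r \<in> PI ==> 0 <= sg r p"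
 shows "c \<bullet> p <= c \<bullet> vx F"
proof -
 have "gv r \<bullet> p <= gv r \<bullet> vx F" if "r \<in> F" for r
 proof -
  have "r \<in> PI" using that maxc_PI[OF assms(1)] by auto
  thus ?thesis using vx(2)[OF assms(1), of r] assms(4)[of r] that by (simp add: sg_def)
 qed
 thus ?thesis unfolding assms(3) inner_sum_left inner_scaleR_left using assms(2) by (intro sum_mono mult_left_mono)
qed

text \<open>An outside point is separated from \<open>Q\<close> by a functional which, by
  \<open>cone_cover\<close>, lies in the cone of some vertex; but that vertex maximizes it over all
  points with nonnegative slacks.\<close>

lemma Q_iff: "p \<in> Q \<longleftrightarrow> (\<forall>r\<in>PI. 0 <= sg r p)"
proof
 assume s: "\<forall>r\<in>PI. 0 <= sg r p"
 show "p \<in> Q"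
 proof (rule ccontr)
  assume "p \<notin> Q"
  then obtain c b where c: "c \<bullet> p < b" "!!x. x \<in> Q ==> b < c \<bullet> x"
   using separating_hyperplane_closed_point[OF Q_convex compact_imp_closed[OF Q_compact]] by metis
  obtain F x where "maxc F" "!!r. r \<in> F ==> 0 <= x r" "- c = (\<Sum>r\<in>F. x r *\<^sub>R gv r)" by (rule cone_cover[of "- c"], rule that)
  from cover_le[OF this] vx(1)[OF this(1)] s c show False by force
 qed
qed (auto simp: sg_nonneg)

lemma small_step:
 obtains e where "e > 0" "!!s r. \<bar>s\<bar> <= e ==> r \<in> PI ==> 0 < sg r p ==> 0 < sg r (p + s *\<^sub>R w)"
proof
 let ?S = "(%r. sg r p / (\<bar>gv r \<bullet> w\<bar> + 1)) ` {r \<in> PI. 0 < sg r p}"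
 have fin: "finite (insert 1 ?S)" using fin_PI by simp
 show "Min (insert 1 ?S) > 0" using fin by (subst Min_gr_iff) (auto intro!: divide_pos_pos)
 fix s r assume s: "\<bar>s\<bar> <= Min (insert 1 ?S)" and g: "r \<in> PI" "0 < sg r p"
 have "Min (insert 1 ?S) <= sg r p / (\<bar>gv r \<bullet> w\<bar> + 1)" using fin g by (intro Min_le) auto
 hence "\<bar>s\<bar> <= sg r p / (\<bar>gv r \<bullet> w\<bar> + 1)" using s by linarith
 hence "\<bar>s\<bar> * (\<bar>gv r \<bullet> w\<bar> + 1) <= sg r p" by (subst (asm) pos_le_divide_eq) auto
 hence "\<bar>s * (gv r \<bullet> w)\<bar> + \<bar>s\<bar> <= sg r p" by (simp add: abs_mult algebra_simps)
 thus "0 < sg r (p + s *\<^sub>R w)" unfolding sg_add using g(2) by (cases "s = 0") auto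
qed

definition St :: "(nat \<times> 'n) set => 'n real_vec set" where
 "St F = {p \<in> Q. \<forall>r\<in>PI. sg r p = 0 \<longleftrightarrow> r \<in> F}"

definition Fc :: "(nat \<times> 'n) set => 'n real_vec set" where "Fc F = {p \<in> Q. \<forall>r\<in>F. sg r p = 0}"

lemma St_pos: "p \<in> St F ==> r \<in> PI - F ==> 0 < sg r p" using sg_nonneg[of p r] by (force simp: St_def)

lemma St_Fc: "compat F ==> St F \<subseteq> Fc F" by (auto simp: St_def Fc_def compat_def)

lemma Fc_convex: "convex (Fc F)" unfolding convex_alt Fc_def
proof (intro ballI allI impI)
 fix x y and u :: real
 assume "x \<in> {p \<in> Q. \<forall>r\<in>F. sg r p = 0}" "y \<in> {p \<in> Q. \<forall>r\<in>F. sg r p = 0}" "0 <= u & u <= 1"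
 thus "(1 - u) *\<^sub>R x + u *\<^sub>R y \<in> {p \<in> Q. \<forall>r\<in>F. sg r p = 0}"
  using Q_convex by (auto simp: sg_affine convex_alt)
qed

lemma Fc_compact: "compact (Fc F)"
proof -
 have "Fc F = Q \<inter> (\<Inter>r\<in>F. {p. gv r \<bullet> p = h r})" by (auto simp: Fc_def sg_def)
 thus ?thesis using Q_compact by (auto intro!: compact_Int_closed closed_INT closed_hyperplane)
qed

text \<open>At the vertex of a maximal compatible set \<open>G\<close> containing \<open>F\<close>,
  a short step along \<open>w\<close> keeps the slacks of \<open>F\<close> at zero and makes those
  of \<open>G - F\<close> positive.\<close>

lemma St_nonempty: assumes F: "compat F" shows "St F ~= {}"
proof -
 obtain G where G: "F \<subseteq> G" "maxc G" using compat_extend[OF F] by (auto simp: maxc_def)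
 obtain W where W: "!!r z. r \<in> G ==> z \<in> G ==> gv z \<bullet> W r = of_bool (z = r)" using dual_basis[OF G(2)] by metis
 define w where "w = (\<Sum>r\<in>G - F. - W r)"
 have gw: "gv z \<bullet> w = (if z \<in> F then 0 else - 1)" if d: "z \<in> G" for z
 proof -
  have "gv z \<bullet> w = (\<Sum>r\<in>G - F. if r = z then - 1 else 0)"
   unfolding w_def inner_sum_right by (rule sum.cong) (auto simp: W d)
  thus ?thesis using d maxc_fin[OF G(2)] by simp
 qed
 obtain e where e: "e > 0" "!!s r. \<bar>s\<bar> <= e ==> r \<in> PI ==> 0 < sg r (vx G) ==> 0 < sg r (vx G + s *\<^sub>R w)"
  using small_step by blast
 let ?p = "vx G + e *\<^sub>R w"
 have s: "0 < sg r ?p & r \<notin> F \<or> sg r ?p = 0 & r \<in> F" if g: "r \<in> PI" for r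
 proof (cases "r \<in> G")
  case True
  thus ?thesis using vx(2)[OF G(2) g] gw[OF True] e(1) by (simp add: sg_add)
 next
  case False
  hence "0 < sg r (vx G)" using vx(2)[OF G(2) g] sg_nonneg[OF vx(1)[OF G(2)], of r] by auto
  thus ?thesis using e(2)[of e r] e(1) g False G(1) by auto
 qed
 hence "?p \<in> Q" unfolding Q_iff by force
 hence "?p \<in> St F" using s unfolding St_def by force
 thus ?thesis by blast
qed

lemma rel_interior_Fc: assumes F: "compat F" shows "rel_interior (Fc F) = St F"
proof -
 obtain p1 where p1: "p1 \<in> St F" using St_nonempty[OF F] by blast
 have FPI: "F \<subseteq> PI" using F by (simp add: compat_def)
 have ne: "Fc F ~= {}" using p1 St_Fc[OF F] by auto
 have "q \<in> St F" if q: "\<forall>x\<in>Fc F. \<exists>e. e > 1 & (1 - e) *\<^sub>R x + e *\<^sub>R q \<in> Fc F" "q \<in> Fc F" for q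
 proof -
  obtain e where e: "e > 1" "(1 - e) *\<^sub>R p1 + e *\<^sub>R q \<in> Fc F" using q p1 St_Fc[OF F] by blast
  have "sg r q ~= 0" if "r \<in> PI - F" for r
  proof
   assume "sg r q = 0"
   hence "sg r ((1 - e) *\<^sub>R p1 + e *\<^sub>R q) < 0"
    using St_pos[OF p1 that] e(1) unfolding sg_affine by (simp add: mult_neg_pos)
   thus False using sg_nonneg[of "(1 - e) *\<^sub>R p1 + e *\<^sub>R q" r] e(2) by (simp add: Fc_def)
  qed
  thus ?thesis using q(2) by (auto simp: St_def Fc_def)
 qed
 moreover have "\<exists>e. e > 1 & (1 - e) *\<^sub>R x + e *\<^sub>R q \<in> Fc F" if q: "q \<in> St F" and x: "x \<in> Fc F" for q x
 proof -
  obtain e where e: "e > 0" "!!s r. \<bar>s\<bar> <= e ==> r \<in> PI ==> 0 < sg r q ==> 0 < sg r (q + s *\<^sub>R (q - x))"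
   using small_step by blast
  have eq: "(1 - (1 + e)) *\<^sub>R x + (1 + e) *\<^sub>R q = q + e *\<^sub>R (q - x)" by (simp add: algebra_simps)
  have F0: "sg r (q + e *\<^sub>R (q - x)) = 0" if "r \<in> F" for r
   using q x that FPI unfolding eq[symmetric] sg_affine by (auto simp: St_def Fc_def)
  have "0 <= sg r (q + e *\<^sub>R (q - x))" if "r \<in> PI" for r
   using F0[of r] e(2)[of e r] e(1) St_pos[OF q, of r] that by force
  hence "q + e *\<^sub>R (q - x) \<in> Q" unfolding Q_iff by blast
  hence "q + e *\<^sub>R (q - x) \<in> Fc F" using F0 by (simp add: Fc_def)
  thus ?thesis using e(1) unfolding eq[symmetric] by (intro exI[of _ "1 + e"]) simp
 qed
 ultimately show ?thesis using convex_rel_interior_iff[OF Fc_convex ne] rel_interior_subset[of "Fc F"] by blast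
qed

text \<open>Critical points of the Kullback--Leibler divergence \<open>\<Sum>\<^sub>r \<sigma>\<^sub>r ln (\<sigma>\<^sub>r / u\<^sub>r) - \<sigma>\<^sub>r\<close> of the slacks from \<open>u\<close> on
 the open face of \<open>F\<close>.\<close>

definition crit :: "(nat \<times> 'n) set => (nat \<times> 'n => real) => 'n real_vec => bool" where
 "crit F u p \<longleftrightarrow> p \<in> St F &
   (\<forall>w. (\<forall>r\<in>F. gv r \<bullet> w = 0) --> (\<Sum>r\<in>PI - F. (ln (sg r p) - ln (u r)) * (gv r \<bullet> w)) = 0)"

text \<open>The difference of the two critical equations in the direction \<open>p - p'\<close> is a
  sum of terms \<open>(ln x - ln y) * (x - y)\<close>, each nonnegative and zero only if
  \<open>x = y\<close>.\<close>

lemma crit_unique: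
 assumes F: "compat F" and c: "crit F u p" "crit F u p'"
 shows "p = p'"
proof -
 let ?w = "p - p'"
 have St: "p \<in> St F" "p' \<in> St F" using c by (auto simp: crit_def)
 have gw: "gv r \<bullet> ?w = sg r p' - sg r p" for r by (simp add: sg_def inner_diff_right)
 have F0: "gv r \<bullet> ?w = 0" if "r \<in> F" for r
 proof -
  have "r \<in> PI" using F that by (auto simp: compat_def)
  hence "sg r p = 0" "sg r p' = 0" using St that by (auto simp: St_def)
  thus ?thesis by (simp add: gw)
 qed
 have "(\<Sum>r\<in>PI - F. (ln (sg r p) - ln (u r)) * (gv r \<bullet> ?w)) = 0" "(\<Sum>r\<in>PI - F. (ln (sg r p') - ln (u r)) * (gv r \<bullet> ?w)) = 0"
  using c F0 unfolding crit_def by blast+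
 hence "(\<Sum>r\<in>PI - F. (ln (sg r p') - ln (sg r p)) * (sg r p' - sg r p)) = 0"
  unfolding gw by (simp add: left_diff_distrib sum_subtractf)
 moreover have "0 <= (ln (sg r p') - ln (sg r p)) * (sg r p' - sg r p)" if "r \<in> PI - F" for r
  using St_pos[OF St(1) that] St_pos[OF St(2) that] by (cases "sg r p <= sg r p'") (auto simp: mult_nonneg_nonneg mult_nonpos_nonpos)
 ultimately have 0: "(ln (sg r p') - ln (sg r p)) * (sg r p' - sg r p) = 0" if "r \<in> PI - F" for r
  using sum_nonneg_eq_0_iff[of "PI - F" "%r. (ln (sg r p') - ln (sg r p)) * (sg r p' - sg r p)"] fin_PI that by auto
 have "gv r \<bullet> ?w = 0" if "r \<in> PI" for r
  using F0[of r] 0[of r] that St_pos[OF St(1), of r] St_pos[OF St(2), of r] unfolding gw by (cases "r \<in> F") auto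
 hence "?w = 0" by (rule gv_separates)
 thus ?thesis by simp
qed

text \<open>The divergence has a minimizer on the compact face; it remains to keep it in the
  relative interior, where it can be differentiated.\<close>

lemma crit_exists:
 assumes F: "compat F"
 shows "\<exists>p. crit F u p"
proof -
 define K where "K = (%p. \<Sum>r\<in>PI - F. xl (sg r p) - sg r p * ln (u r))"
 obtain p1 where p1: "p1 \<in> St F" using St_nonempty[OF F] by blast
 have p1F: "p1 \<in> Fc F" using p1 St_Fc[OF F] by auto
 have "continuous_on (Fc F) K" unfolding K_def
 proof (intro continuous_on_sum continuous_on_diff continuous_on_mult continuous_on_const)
  fix r
  show s: "continuous_on (Fc F) (sg r)" unfolding sg_def by (intro continuous_intros)
  show "continuous_on (Fc F) (%p. xl (sg r p))"
   by (rule continuous_on_compose2[OF continuous_xl s]) (auto simp: Fc_def sg_nonneg)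
 qed
 then obtain p where p: "p \<in> Fc F" "!!q. q \<in> Fc F ==> K p <= K q"
  using continuous_attains_inf[OF Fc_compact, of F K] p1F by blast
 have pQ: "p \<in> Q" using p(1) by (simp add: Fc_def)
 have "sg z p ~= 0" if d: "z \<in> PI - F" for z
 proof
  assume d0: "sg z p = 0"
  define c where "c = sg z p1"
  have c: "c > 0" using St_pos[OF p1 d] by (simp add: c_def)
  \<comment> \<open>Moving from \<open>p\<close> by the fraction \<open>s\<close> towards
    \<open>p1\<close> raises \<open>K\<close> by at most \<open>s * (K p1 - K p + c * ln s)\<close>;
    this choice makes the bracket negative.\<close>
  define s where "s = exp (- (\<bar>K p1 - K p\<bar> + 1) / c)"
  have s: "0 < s" "s < 1" "c * ln s = - (\<bar>K p1 - K p\<bar> + 1)" using c by (auto simp: s_def divide_neg_pos)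
  let ?q = "(1 - s) *\<^sub>R p + s *\<^sub>R p1"
  have "?q \<in> Fc F" using Fc_convex p(1) p1F s unfolding convex_alt by simp
  hence "K p <= K ?q" by (rule p(2))
  also have "\<dots> <= (\<Sum>r\<in>PI - F. (1 - s) * (xl (sg r p) - sg r p * ln (u r)) + s * (xl (sg r p1) - sg r p1 * ln (u r)) + (if r = z then s * c * ln s else 0))"
   unfolding K_def
  proof (rule sum_mono)
   fix r assume g: "r \<in> PI - F"
   have "xl (sg r ?q) <= (1 - s) * xl (sg r p) + s * xl (sg r p1) + (if r = z then s * c * ln s else 0)"
   proof (cases "r = z")
    case True
    thus ?thesis unfolding sg_affine using d0 xl_scale[OF s(1) c] by (simp add: c_def xl_def)
   next
    case False
    thus ?thesis unfolding sg_affine using xl_convex[OF sg_nonneg[OF pQ] St_pos[OF p1 g] s(1,2)] by simp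
   qed
   thus "xl (sg r ?q) - sg r ?q * ln (u r) <= (1 - s) * (xl (sg r p) - sg r p * ln (u r)) + s * (xl (sg r p1) - sg r p1 * ln (u r)) + (if r = z then s * c * ln s else 0)"
    unfolding sg_affine by (simp add: algebra_simps)
  qed
  also have "\<dots> = (1 - s) * K p + s * K p1 + s * c * ln s"
   using d fin_PI by (simp add: sum.distrib K_def sum_distrib_left)
  also have "\<dots> = K p + s * (K p1 - K p + c * ln s)" by (simp add: algebra_simps)
  also have "\<dots> < K p" using s(1) unfolding s(3) by (simp add: mult_less_0_iff)
  finally show False by simp
 qed
 hence pSt: "p \<in> St F" using p(1) by (auto simp: St_def Fc_def)
 have "(\<Sum>r\<in>PI - F. (ln (sg r p) - ln (u r)) * (gv r \<bullet> w)) = 0" if w: "\<forall>r\<in>F. gv r \<bullet> w = 0" for w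
 proof -
  obtain e where e: "e > 0" "!!s r. \<bar>s\<bar> <= e ==> r \<in> PI ==> 0 < sg r p ==> 0 < sg r (p + s *\<^sub>R w)"
   using small_step by blast
  have "((%s. K (p + s *\<^sub>R w)) has_real_derivative (\<Sum>r\<in>PI - F. - (ln (sg r p) - ln (u r)) * (gv r \<bullet> w))) (at 0)"
   unfolding K_def sg_add xl_def
  proof (rule DERIV_sum)
   fix r assume "r \<in> PI - F"
   hence "sg r p > 0" by (rule St_pos[OF pSt])
   thus "((%s. (sg r p - s * (gv r \<bullet> w)) * ln (sg r p - s * (gv r \<bullet> w)) - (sg r p - s * (gv r \<bullet> w)) - (sg r p - s * (gv r \<bullet> w)) * ln (u r))
     has_real_derivative - (ln (sg r p) - ln (u r)) * (gv r \<bullet> w)) (at 0)"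
    by (auto intro!: derivative_eq_intros simp: algebra_simps)
  qed
  hence "(\<Sum>r\<in>PI - F. - (ln (sg r p) - ln (u r)) * (gv r \<bullet> w)) = 0"
  proof (rule DERIV_local_min[OF _ e(1)], intro allI impI)
   fix s assume s: "\<bar>0 - s\<bar> < e"
   have "sg r (p + s *\<^sub>R w) = 0" if "r \<in> F" for r using w p(1) that by (simp add: sg_add Fc_def)
   moreover have "0 <= sg r (p + s *\<^sub>R w)" if "r \<in> PI" for r
    using e(2)[of s r] s that St_pos[OF pSt, of r] calculation[of r] by force
   ultimately have "p + s *\<^sub>R w \<in> Fc F" by (simp add: Fc_def Q_iff)
   thus "K (p + 0 *\<^sub>R w) <= K (p + s *\<^sub>R w)" using p(2) by simp
  qed
  thus ?thesis unfolding minus_mult_left[symmetric] sum_negf by simp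
 qed
 thus ?thesis using pSt unfolding crit_def by blast
qed

end

subsection \<open>Smooth functions and the inverse function theorem\<close>

lemma Ck_SucE:
 assumes "Ck_on (Suc m) f U" "x \<in> U"
 shows "(f has_derivative frechet_derivative f (at x)) (at x)" using assms frechet_derivative_works by auto

lemma Ck_cong:
 assumes U: "open U" and "!!x. x \<in> U ==> f x = g x" "Ck_on m f U"
 shows "Ck_on m g U" using assms(2,3)
proof (induction m arbitrary: f g)
 case 0
 thus ?case using continuous_on_cong[OF refl, of U f g] by simp
next
 case (Suc m)
 have d: "(g has_derivative frechet_derivative f (at x)) (at x)" if x: "x \<in> U" for x
  by (rule has_derivative_transform_within_open[OF Ck_SucE[OF Suc.prems(2) x] U x]) (rule Suc.prems(1))
 have e: "frechet_derivative f (at x) v = frechet_derivative g (at x) v" if "x \<in> U" for x v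
  using frechet_derivative_at[OF d[OF that]] by simp
 have "Ck_on m (%x. frechet_derivative g (at x) v) U" for v
  by (rule Suc.IH[of "%x. frechet_derivative f (at x) v"]) (use e Suc.prems in auto)
 thus ?case using d by (auto simp: differentiable_def)
qed

lemma Ck_SucI:
 assumes U: "open U" and d: "!!x. x \<in> U ==> (f has_derivative f' x) (at x)" and C: "!!v. Ck_on m (%x. f' x v) U"
 shows "Ck_on (Suc m) f U"
proof -
 have "Ck_on m (%x. frechet_derivative f (at x) v) U" for v
  by (rule Ck_cong[OF U _ C[of v]]) (simp add: frechet_derivative_at[OF d, symmetric])
 thus ?thesis using d by (auto simp: differentiable_def)
qed

lemma Ck_SucD: "Ck_on (Suc m) f U ==> Ck_on m f U"
proof (induction m arbitrary: f)
 case 0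
 thus ?case by (auto intro!: continuous_at_imp_continuous_on differentiable_imp_continuous_within)
next
 case (Suc m)
 have "Ck_on m (%x. frechet_derivative f (at x) v) U" for v
  by (rule Suc.IH) (use Suc.prems in \<open>simp only: Ck_on.simps(2)[of "Suc m"]\<close>)
 thus ?case using Suc.prems by simp
qed

lemma Ck_continuous: "Ck_on m f U ==> continuous_on U f"
proof (induction m)
 case (Suc m)
 thus ?case using Ck_SucD by blast
qed simp

lemma Ck_const: "open U ==> Ck_on m (%x. c) U"
proof (induction m arbitrary: c)
 case (Suc m)
 show ?case by (rule Ck_SucI[OF Suc.prems, where f' = "%x v. 0"]) (use Suc in auto)
qed simp

lemma Ck_linear:
 assumes "open U" "bounded_linear f"
 shows "Ck_on m f U"
proof (cases m)
 case 0
 thus ?thesis using assms linear_continuous_on by simp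
next
 case (Suc k)
 show ?thesis unfolding Suc
  by (rule Ck_SucI[OF assms(1), where f' = "%x. f"]) (use assms Ck_const bounded_linear_imp_has_derivative in auto)
qed

lemma Ck_add:
 assumes "open U"
 shows "Ck_on m f U ==> Ck_on m g U ==> Ck_on m (%x. f x + g x) U"
proof (induction m arbitrary: f g)
 case 0
 thus ?case by (auto intro: continuous_intros)
next
 case (Suc m)
 show ?case
 proof (rule Ck_SucI[OF assms])
  fix x assume x: "x \<in> U"
  show "((%x. f x + g x) has_derivative (%v. frechet_derivative f (at x) v + frechet_derivative g (at x) v)) (at x)"
   by (rule has_derivative_add) (use Suc.prems x Ck_SucE in blast)+
 next
  fix v
  show "Ck_on m (%x. frechet_derivative f (at x) v + frechet_derivative g (at x) v) U"
   by (rule Suc.IH) (use Suc.prems in auto)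
 qed
qed

lemma Ck_bilinear:
 assumes U: "open U" and b: "bounded_bilinear b"
 shows "Ck_on m f U ==> Ck_on m g U ==> Ck_on m (%x. b (f x) (g x)) U"
proof (induction m arbitrary: f g)
 case 0
 thus ?case using bounded_bilinear.continuous_on[OF b] by auto
next
 case (Suc m)
 note D = Suc.prems[THEN Ck_SucD]
 show ?case
 proof (rule Ck_SucI[OF U])
  fix x assume x: "x \<in> U"
  show "((%x. b (f x) (g x)) has_derivative (%v. b (f x) (frechet_derivative g (at x) v) + b (frechet_derivative f (at x) v) (g x))) (at x)"
   by (rule bounded_bilinear.FDERIV[OF b]) (use Suc.prems x Ck_SucE in blast)+
 next
  fix v
  show "Ck_on m (%x. b (f x) (frechet_derivative g (at x) v) + b (frechet_derivative f (at x) v) (g x)) U"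
   by (intro Ck_add U Suc.IH D) (use Suc.prems in auto)
 qed
qed

lemmas Ck_mult = Ck_bilinear[OF _ bounded_bilinear_mult]
 and Ck_scaleR = Ck_bilinear[OF _ bounded_bilinear_scaleR]

lemma Ck_sum:
 assumes "open U" "!!i. i \<in> I ==> Ck_on m (f i) U"
 shows "Ck_on m (%x. \<Sum>i\<in>I. f i x) U"
 using assms(2) by (induction I rule: infinite_finite_induct) (auto simp: Ck_const Ck_add assms(1))

lemma Ck_prod:
 fixes f :: "'i => 'a::euclidean_space => real"
 assumes "open U" "!!i. i \<in> I ==> Ck_on m (f i) U"
 shows "Ck_on m (%x. \<Prod>i\<in>I. f i x) U"
 using assms(2) by (induction I rule: infinite_finite_induct) (auto simp: Ck_const Ck_mult assms(1))

lemma Ck_power: "open U ==> Ck_on m f U ==> Ck_on m (%x. (f x :: real) ^ n) U"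
 by (induction n) (auto simp: Ck_const Ck_mult)

text \<open>The outer derivative is expanded in the basis, since \<open>Ck_on\<close> speaks of
  derivatives in fixed directions only.\<close>

lemma Ck_compose:
 assumes U: "open U" and fU: "!!x. x \<in> U ==> f x \<in> V"
 shows "Ck_on m f U ==> Ck_on m g V ==> Ck_on m (%x. g (f x)) U"
proof (induction m arbitrary: g)
 case 0
 thus ?case using continuous_on_compose2[of V g U f] fU by auto
next
 case (Suc m)
 let ?D = "%x v. \<Sum>b\<in>Basis. (frechet_derivative f (at x) v \<bullet> b) *\<^sub>R frechet_derivative g (at (f x)) b"
 show ?case
 proof (rule Ck_SucI[OF U])
  fix x assume x: "x \<in> U"
  have g: "(g has_derivative frechet_derivative g (at (f x))) (at (f x))" using Suc.prems(2) fU[OF x] by (rule Ck_SucE)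
  hence l: "linear (frechet_derivative g (at (f x)))" by (rule has_derivative_linear)
  have "?D x v = frechet_derivative g (at (f x)) (frechet_derivative f (at x) v)" for v
  proof -
   have "frechet_derivative g (at (f x)) (frechet_derivative f (at x) v) = frechet_derivative g (at (f x)) (\<Sum>b\<in>Basis. (frechet_derivative f (at x) v \<bullet> b) *\<^sub>R b)"
    by (simp only: euclidean_representation)
   thus ?thesis by (simp add: linear_sum[OF l] linear_cmul[OF l])
  qed
  thus "((%x. g (f x)) has_derivative ?D x) (at x)"
   using has_derivative_compose[OF Ck_SucE[OF Suc.prems(1) x] g] by presburger
 next
  fix v
  have "Ck_on m (%x. frechet_derivative f (at x) v \<bullet> b) U" for b
   by (rule Ck_bilinear[OF U bounded_bilinear_inner _ Ck_const[OF U]]) (use Suc.prems in auto)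
  moreover have "Ck_on m (%x. frechet_derivative g (at (f x)) b) U" for b
   by (rule Suc.IH[of "%y. frechet_derivative g (at y) b"]) (use Suc.prems Ck_SucD in auto)
  ultimately show "Ck_on m (%x. ?D x v) U" by (intro Ck_sum Ck_scaleR U)
 qed
qed

lemma Ck_subset: "open V ==> V \<subseteq> U ==> Ck_on m f U ==> Ck_on m f V"
 by (induction m arbitrary: f) (auto intro: continuous_on_subset)

lemma Ck_real:
 fixes f f' :: "real => real"
 assumes U: "open U" and d: "!!x. x \<in> U ==> (f has_real_derivative f' x) (at x)" and C: "Ck_on m f' U"
 shows "Ck_on (Suc m) f U" by (rule Ck_SucI[OF U, where f' = "%x v. f' x * v"])
   (use d Ck_mult[OF U C Ck_const[OF U]] in "auto simp: has_field_derivative_def")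

lemma Ck_inverse_real: "Ck_on m (inverse :: real => real) (- {0})"
proof (induction m)
 case 0
 thus ?case by (auto intro!: continuous_intros)
next
 case (Suc m)
 have o: "open (- {0::real})" by auto
 have "Ck_on m (%x::real. - (inverse x * inverse x)) (- {0})"
  using Ck_mult[OF o Ck_const[OF o, of _ "- 1"] Ck_mult[OF o Suc Suc]] by simp
 thus ?case by (intro Ck_real[OF o]) (auto intro!: derivative_eq_intros simp: power2_eq_square)
qed

lemma Ck_inverse: "open U ==> (!!x. x \<in> U ==> f x ~= 0) ==> Ck_on m f U ==> Ck_on m (%x. inverse (f x :: real)) U"
 by (rule Ck_compose[where V = "- {0}", OF _ _ _ Ck_inverse_real]) auto

lemma Ck_exp: "open U ==> Ck_on m f U ==> Ck_on m (%x. exp (f x :: real)) U"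
proof (rule Ck_compose[where g = exp and V = UNIV])
 show "Ck_on m (exp :: real => real) UNIV"
 proof (induction m)
  case 0
  thus ?case by (auto intro!: continuous_intros)
 next
  case (Suc m)
  show ?case by (rule Ck_real[where f' = exp]) (auto intro!: derivative_eq_intros Suc)
 qed
qed auto

lemma Ck_ln: "open U ==> (!!x. x \<in> U ==> 0 < f x) ==> Ck_on m f U ==> Ck_on m (%x. ln (f x :: real)) U"
proof (rule Ck_compose[where g = ln and V = "{0<..}"])
 show "Ck_on m (ln :: real => real) {0<..}"
 proof (cases m)
  case 0
  thus ?thesis by (auto intro!: continuous_intros)
 next
  case (Suc k)
  show ?thesis unfolding Suc by (rule Ck_real[where f' = inverse])
     (auto intro!: derivative_eq_intros Ck_subset[OF _ _ Ck_inverse_real] simp: inverse_eq_divide)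
 qed
qed auto

lemma Ck_vec:
 assumes "open U" "!!i. Ck_on m (f i) U"
 shows "Ck_on m (%x. (\<chi> i. f i x) :: real^'m) U"
proof -
 have "Ck_on m (%x. \<Sum>i\<in>UNIV. f i x *\<^sub>R (axis i 1 :: real^'m)) U"
  by (intro Ck_sum Ck_scaleR Ck_const assms)
 moreover have "(\<Sum>i\<in>UNIV. f i x *\<^sub>R (axis i 1 :: real^'m)) = (\<chi> i. f i x)" for x
  by (simp add: vec_eq_iff axis_def if_distrib cong: if_cong)
 ultimately show ?thesis by simp
qed

lemma Ck_nth: "open U ==> Ck_on m f U ==> Ck_on m (%x. f x $ i) U"
 by (rule Ck_compose[where V = UNIV, OF _ _ _ Ck_linear]) auto

lemma Ck_det:
 fixes M :: "'a::euclidean_space => real^'m^'m"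
 assumes "open U" "!!i j. Ck_on m (%x. M x $ i $ j) U"
 shows "Ck_on m (%x. det (M x)) U" unfolding det_def by (intro Ck_sum Ck_mult Ck_const Ck_prod assms)

text \<open>The derivative of the inverse in a fixed direction is, by Cramer's rule, a rational
  expression in the partial derivatives of \<open>f\<close> composed with the inverse itself. Its
  order of smoothness therefore rises by induction.\<close>

theorem smooth_inverse:
 fixes f :: "real^'m => real^'m"
 assumes U: "open U" "x0 \<in> U" and C: "!!m. Ck_on m f U"
  and f': "(f has_derivative f') (at x0)" and inj: "!!v. f' v = 0 ==> v = 0"
 obtains U' V g where "open U'" "U' \<subseteq> U" "x0 \<in> U'" "open V" "f x0 \<in> V" "homeomorphism U' V f g" "!!m. Ck_on m g V"
proof -
 define D where "D = (%x. frechet_derivative f (at x))"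
 have D: "(f has_derivative D x) (at x)" if "x \<in> U" for x unfolding D_def using Ck_SucE[OF C that] .
 have CD: "Ck_on m (%x. D x v) U" for m v using C[of "Suc m"] by (simp add: D_def)
 have bl: "bounded_linear (D x)" if "x \<in> U" for x using D[OF that] by (rule has_derivative_bounded_linear)
 have D0: "D x0 = f'" unfolding D_def using frechet_derivative_at[OF f'] by simp
 have lf': "linear f'" using f' by (rule has_derivative_linear)
 have "inj f'" unfolding linear_injective_0[OF lf'] using inj by blast
 then obtain L where L: "linear L" "L \<circ> f' = id" using linear_injective_left_inverse[OF lf'] by blast
 have bL: "bounded_linear L" using L(1) by (simp add: linear_linear)
 have id: "Blinfun L o\<^sub>L Blinfun (D x0) = id_blinfun"
  by (rule blinfun_eqI) (use L(2) bl[OF U(2)] in "auto simp: bounded_linear_Blinfun_apply bL D0 fun_eq_iff")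
 have cont: "continuous_on U (%x. Blinfun (D x))"
 proof (rule continuous_on_blinfun_componentwise)
  fix i :: "real^'m"
  show "continuous_on U (%x. blinfun_apply (Blinfun (D x)) i)"
   using Ck_continuous[OF CD[of 0 i]] continuous_on_cong[OF refl, of U "%x. blinfun_apply (Blinfun (D x)) i" "%x. D x i"]
   by (simp add: bl bounded_linear_Blinfun_apply)
 qed
 have der: "(f has_derivative blinfun_apply (Blinfun (D x))) (at x)" if "x \<in> U" for x
  using D[OF that] by (simp add: bl that bounded_linear_Blinfun_apply)
 obtain U' V g g' where *: "open U'" "U' \<subseteq> U" "x0 \<in> U'" "open V" "f x0 \<in> V" and hom: "homeomorphism U' V f g"
  and g: "!!y. y \<in> V ==> (g has_derivative g' y) (at y)" "!!y. y \<in> V ==> g' y = inv (blinfun_apply (Blinfun (D (g y))))"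
   "!!y. y \<in> V ==> bij (blinfun_apply (Blinfun (D (g y))))"
  using inverse_function_theorem[OF U(1) der cont U(2) id] by metis
 have gU: "g y \<in> U" if "y \<in> V" for y using hom that *(2) by (auto simp: homeomorphism_def)
 define M where "M = (%y. matrix (D (g y)))"
 have bij: "bij (D (g y))" if "y \<in> V" for y using g(3)[OF that] by (simp add: bl gU that bounded_linear_Blinfun_apply)
 have lD: "linear (D (g y))" if "y \<in> V" for y using bl[OF gU[OF that]] by (simp add: linear_linear)
 have dM: "det (M y) ~= 0" if "y \<in> V" for y
  unfolding M_def det_nz_iff_inj[OF lD[OF that]] using bij[OF that] by (rule bij_is_inj)
 let ?c = "%v y. \<chi> k. det (\<chi> i j. if j = k then v $ i else M y $ i $ j) * inverse (det (M y))"
 have g': "g' y v = ?c v y" if "y \<in> V" for y v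
 proof -
  have "g' y = inv (D (g y))" using g(2)[OF that] by (simp add: bl gU that bounded_linear_Blinfun_apply)
  hence "D (g y) (g' y v) = v" using bij[OF that] by (simp add: bij_is_surj surj_f_inv_f)
  hence "M y *v g' y v = v" using fun_cong[OF matrix_vector_mul(2)[OF lD[OF that]]] by (simp add: M_def)
  thus ?thesis using cramer[OF dM[OF that]] by (simp add: divide_inverse)
 qed
 have "Ck_on m g V" for m
 proof (induction m)
  case 0
  thus ?case using hom by (simp add: homeomorphism_def)
 next
  case (Suc m)
  have CM: "Ck_on m (%y. M y $ i $ j) V" for i j unfolding M_def matrix_def
   using Ck_nth[OF *(4) Ck_compose[OF *(4) gU Suc CD[of m "axis j 1"]], of i] by simp
  have "Ck_on m (%y. (\<chi> i j. if j = k then v $ i else M y $ i $ j) $ i $ j) V" for k v i j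
   by (cases "j = k") (auto intro: CM Ck_const *(4))
  hence c: "Ck_on m (?c v) V" for v by (intro Ck_vec Ck_mult Ck_det Ck_inverse CM *(4) dM)
  have "Ck_on m (%y. g' y v) V" for v by (rule Ck_cong[OF *(4) _ c[of v]]) (rule g'[symmetric])
  thus ?case by (intro Ck_SucI[OF *(4) g(1)])
 qed
 thus ?thesis using that * hom by metis
qed

lemma has_derivative_line:
 assumes f: "(f has_derivative f') (at y)" "f' w = 0" and l: "bounded_linear l"
 shows "((%s. l (f (y + s *\<^sub>R w))) has_real_derivative 0) (at 0)"
proof -
 have "((%s::real. y + s *\<^sub>R w) has_derivative (%s. s *\<^sub>R w)) (at 0)"
  by (auto intro!: derivative_eq_intros)
 from has_derivative_compose[OF this, of f f'] f(1)
 have "((%s. f (y + s *\<^sub>R w)) has_derivative (%s. f' (s *\<^sub>R w))) (at 0)" by simp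
 from bounded_linear.has_derivative[OF l this]
 have "((%s. l (f (y + s *\<^sub>R w))) has_derivative (%s. l (f' (s *\<^sub>R w)))) (at 0)" .
 moreover have "(%s. l (f' (s *\<^sub>R w))) = (*) 0"
  using linear_cmul[OF has_derivative_linear[OF f(1)]] f(2) linear_0[OF bounded_linear.linear[OF l]] by auto
 ultimately show ?thesis by (simp only: has_field_derivative_def)
qed

subsection \<open>Coordinates along a maximal compatible set\<close>

context poly
begin

definition perp :: "(nat \<times> 'n) set => (nat \<times> 'n => real) => bool" where
 "perp F x \<longleftrightarrow> (\<forall>w. (\<forall>r\<in>F. gv r \<bullet> w = 0) --> (\<Sum>r\<in>PI - F. x r * (gv r \<bullet> w)) = 0)"

lemma crit_perp: "crit F u p \<longleftrightarrow> p \<in> St F & perp F (%r. ln (sg r p) - ln (u r))"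
 by (simp add: crit_def perp_def)

lemma maxc_extend: assumes "compat F" obtains G W where "F \<subseteq> G" "maxc G"
  "!!r z. r \<in> G ==> z \<in> G ==> gv z \<bullet> W r = of_bool (z = r)"
proof -
 obtain G where G: "F \<subseteq> G" "maxc G" using compat_extend[OF assms] by (auto simp: maxc_def)
 show ?thesis by (rule dual_basis[OF G(2)], rule that[OF G])
qed

text \<open>By orthogonality the sum over \<open>PI - F\<close> lies in the span of the g-vectors of
  \<open>F\<close>, so suitable values on \<open>F\<close> complete \<open>x\<close> to a linear
  relation. They do not affect the sign conditions, which concern only indices compatible with all
  of \<open>F\<close>.\<close>

lemma rigid_perp:
 fixes x :: "nat \<times> 'n => real"
 assumes F: "compat F"
  and A: "!!r q. r \<in> PI - F ==> q \<in> F ==> md q r ~= 0 ==> x r = 0"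
  and Bx: "!!r. r \<in> PI - F ==> (!!q. q \<in> F ==> md q r = 0) ==> x r ~= 0 ==> x r * (\<Sum>q\<in>PI - F. md q r * x q) < 0"
  and p: "perp F x" and g: "r \<in> PI - F"
 shows "x r = 0"
proof -
 obtain G W where G: "F \<subseteq> G" "maxc G" and W: "!!r z. r \<in> G ==> z \<in> G ==> gv z \<bullet> W r = of_bool (z = r)"
  using maxc_extend[OF F] by blast
 have FPI: "F \<subseteq> PI" using F by (simp add: compat_def)
 define X where "X = (\<Sum>r\<in>PI - F. x r *\<^sub>R gv r)"
 have XW: "X \<bullet> W r = 0" if "r \<in> G - F" for r
 proof -
  have "gv z \<bullet> W r = 0" if "z \<in> F" for z using W[of r z] that \<open>r \<in> G - F\<close> G(1) by auto
  thus ?thesis using p unfolding perp_def X_def inner_sum_left by simp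
 qed
 have "X = (\<Sum>r\<in>G. (X \<bullet> W r) *\<^sub>R gv r)" by (rule dual_expand(2)[OF G(2) W])
 also have "\<dots> = (\<Sum>r\<in>F. (X \<bullet> W r) *\<^sub>R gv r)"
  by (rule sum.mono_neutral_right) (use G XW maxc_fin in auto)
 finally have X: "X = (\<Sum>r\<in>F. (X \<bullet> W r) *\<^sub>R gv r)" .
 let ?e = "%r. if r \<in> F then - (X \<bullet> W r) else x r"
 have "?e r = 0"
 proof (rule rigid[OF F])
  fix r q assume "r \<in> PI" "q \<in> F" "md q r ~= 0"
  thus "?e r = 0" using A[of r q] F by (auto simp: compat_def)
 next
  fix r assume h: "r \<in> PI - F" "!!q. q \<in> F ==> md q r = 0" "?e r ~= 0"
  have "(\<Sum>q\<in>PI. md q r * ?e q) = (\<Sum>q\<in>PI - F. md q r * x q)"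
   by (rule sum.mono_neutral_cong_right) (use h(2) fin_PI in auto)
  thus "?e r * (\<Sum>q\<in>PI. md q r * ?e q) < 0" using Bx[OF h(1,2)] h(1,3) by auto
 next
  have "(\<Sum>r\<in>PI. ?e r *\<^sub>R gv r) = (\<Sum>r\<in>PI - F. ?e r *\<^sub>R gv r) + (\<Sum>r\<in>F. ?e r *\<^sub>R gv r)"
   by (rule sum.subset_diff[OF FPI fin_PI])
  also have "(\<Sum>r\<in>PI - F. ?e r *\<^sub>R gv r) = X" unfolding X_def by (rule sum.cong) auto
  also have "(\<Sum>r\<in>F. ?e r *\<^sub>R gv r) = - (\<Sum>r\<in>F. (X \<bullet> W r) *\<^sub>R gv r)" by (simp add: sum_negf)
  also have "X + - (\<Sum>r\<in>F. (X \<bullet> W r) *\<^sub>R gv r) = 0" using X by simp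
  finally show "(\<Sum>r\<in>PI. ?e r *\<^sub>R gv r) = 0" .
 qed (use g in auto)
 thus ?thesis using g by simp
qed

text \<open>For a maximal compatible set \<open>F\<close> and the basis \<open>W\<close> dual to the \<open>g\<close>-vectors of \<open>F\<close>, these are smooth
 coordinates up to the boundary, and \<open>ln (tc F W x r)\<close> is the pairing of \<open>\<Sum>\<^sub>q ln (x q) g\<^sub>q\<close> with \<open>W r\<close>.\<close>

definition tc :: "(nat \<times> 'n) set => (nat \<times> 'n => 'n real_vec) => (nat \<times> 'n => real) => nat \<times> 'n => real" where
 "tc F W x r = x r * exp (\<Sum>q\<in>PI - F. (gv q \<bullet> W r) * ln (x q))"

definition TT :: "(nat \<times> 'n) set => (nat \<times> 'n => 'n real_vec) => (nat \<times> 'n => real) => 'n real_vec" where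
 "TT F W x = (\<Sum>r\<in>F. tc F W x r *\<^sub>R gv r)"

lemma Ck_TT:
 assumes U: "open U" and F: "F \<subseteq> PI" and x: "!!q. q \<in> PI ==> Ck_on m (%y. x y q) U" "!!y q. y \<in> U ==> q \<in> PI - F ==> 0 < x y q"
 shows "Ck_on m (%y. TT F W (x y)) U" unfolding TT_def tc_def using F
 by (intro Ck_sum Ck_scaleR Ck_mult Ck_exp Ck_const Ck_ln U x) auto

end

locale coord = poly a d ht Q for a :: "'n::{finite,linorder} => 'n => int" and d ht Q +
 fixes F :: "(nat \<times> 'n) set" and W :: "nat \<times> 'n => 'n real_vec"
 assumes F: "maxc F" and W: "!!r z. r \<in> F ==> z \<in> F ==> gv z \<bullet> W r = of_bool (z = r)"
begin

lemma FPI: "F \<subseteq> PI" and finF: "finite F" using F maxc_PI maxc_fin by auto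

lemma TT_W: "r \<in> F ==> TT F W x \<bullet> W r = tc F W x r" unfolding TT_def inner_sum_left by (simp add: W finF)

abbreviation "lc x r \<equiv> \<Sum>q\<in>PI - F. (gv q \<bullet> W r) * x q"

lemma perp_coord:
 assumes Y: "Y \<subseteq> F"
 shows "perp Y x \<longleftrightarrow> (\<forall>r\<in>F - Y. x r + lc x r = 0)"
proof -
 have s: "(\<Sum>q\<in>PI - Y. x q * (gv q \<bullet> W r)) = x r + lc x r" if g: "r \<in> F - Y" for r
 proof -
  have "(\<Sum>q\<in>PI - Y. x q * (gv q \<bullet> W r)) = (\<Sum>q\<in>PI - Y - (F - Y). x q * (gv q \<bullet> W r)) + (\<Sum>q\<in>F - Y. x q * (gv q \<bullet> W r))"
   by (rule sum.subset_diff) (use FPI fin_PI in auto)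
  also have "PI - Y - (F - Y) = PI - F" using Y by auto
  also have "(\<Sum>q\<in>F - Y. x q * (gv q \<bullet> W r)) = (\<Sum>q\<in>F - Y. if q = r then x r else 0)"
   by (rule sum.cong) (use W g in auto)
  also have "\<dots> = x r" using finF g by simp
  finally show ?thesis by (simp add: mult_ac)
 qed
 show ?thesis
 proof
  assume p: "perp Y x"
  show "\<forall>r\<in>F - Y. x r + lc x r = 0"
  proof
   fix r assume g: "r \<in> F - Y"
   have "gv z \<bullet> W r = 0" if "z \<in> Y" for z using W[of r z] that g Y by auto
   thus "x r + lc x r = 0" using p s[OF g] by (simp add: perp_def)
  qed
 next
  assume r: "\<forall>r\<in>F - Y. x r + lc x r = 0"
  show "perp Y x" unfolding perp_def
  proof (intro allI impI)
   fix w assume w: "\<forall>r\<in>Y. gv r \<bullet> w = 0"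
   have "w = (\<Sum>r\<in>F. (gv r \<bullet> w) *\<^sub>R W r)" by (rule dual_expand(1)[OF F W])
   also have "\<dots> = (\<Sum>r\<in>F - Y. (gv r \<bullet> w) *\<^sub>R W r)"
    by (rule sum.mono_neutral_right) (use w finF in auto)
   finally have gw: "gv q \<bullet> w = (\<Sum>r\<in>F - Y. (gv r \<bullet> w) * (gv q \<bullet> W r))" for q
    by (metis (no_types, lifting) inner_scaleR_right inner_sum_right sum.cong)
   have "(\<Sum>q\<in>PI - Y. x q * (gv q \<bullet> w)) = (\<Sum>q\<in>PI - Y. \<Sum>r\<in>F - Y. (gv r \<bullet> w) * (x q * (gv q \<bullet> W r)))"
    by (rule sum.cong[OF refl], subst gw) (simp add: sum_distrib_left mult_ac)
   also have "\<dots> = (\<Sum>r\<in>F - Y. (gv r \<bullet> w) * (\<Sum>q\<in>PI - Y. x q * (gv q \<bullet> W r)))"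
    by (subst sum.swap) (simp add: sum_distrib_left)
   also have "\<dots> = 0" using r s by simp
   finally show "(\<Sum>q\<in>PI - Y. x q * (gv q \<bullet> w)) = 0" .
  qed
 qed
qed

lemma ln_tc: "0 < x r ==> ln (tc F W x r) = ln (x r) + (\<Sum>q\<in>PI - F. (gv q \<bullet> W r) * ln (x q))"
 by (simp add: tc_def ln_mult)

lemma same_sign:
 fixes x y :: real
 assumes "x * exp c = y * exp c'" "0 <= x"
 shows "(y = 0 \<longleftrightarrow> x = 0) & 0 <= y"
proof -
 have "y = x * exp (c - c')" using assms(1) by (simp add: exp_diff field_simps)
 thus ?thesis using assms(2) by simp
qed

text \<open>Where \<open>x r\<close> is positive, equality of coordinates is the critical equation
  in the direction \<open>W r\<close>, after exponentiation; where \<open>x r = 0\<close>, it says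
  that the slack is zero. So criticality on faces of all dimensions becomes a single smooth
  equation.\<close>

lemma crit_coord:
 assumes x: "!!r. r \<in> F ==> 0 <= x r" "!!r. r \<in> PI - F ==> 0 < x r" and sp: "!!r. r \<in> PI - F ==> 0 < sg r p"
 shows "crit {r \<in> PI. x r = 0} x p \<longleftrightarrow> TT F W x = TT F W (%r. sg r p)" (is "crit ?Y x p \<longleftrightarrow> _")
proof -
 let ?D = "%r. ln (sg r p) - ln (x r)" and ?s = "%r. sg r p"
 have Y: "?Y \<subseteq> F" using x(2) by force
 have tt: "TT F W x = TT F W ?s \<longleftrightarrow> (\<forall>r\<in>F. tc F W x r = tc F W ?s r)"
  using TT_W by (metis (no_types, lifting) TT_def sum.cong)
 have e: "tc F W x r = tc F W ?s r \<longleftrightarrow> ?D r + lc ?D r = 0" if "0 < x r" "0 < sg r p" for r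
 proof -
  have "0 < tc F W x r" "0 < tc F W ?s r" using that by (auto simp: tc_def)
  hence "tc F W x r = tc F W ?s r \<longleftrightarrow> ln (tc F W ?s r) - ln (tc F W x r) = 0" by auto
  also have "ln (tc F W ?s r) - ln (tc F W x r) = ?D r + lc ?D r"
   using that by (simp add: ln_tc right_diff_distrib sum_subtractf)
  finally show ?thesis .
 qed
 show ?thesis unfolding tt
 proof
  assume c: "crit ?Y x p"
  hence p: "p \<in> St ?Y" "perp ?Y ?D" by (auto simp: crit_perp)
  show "\<forall>r\<in>F. tc F W x r = tc F W ?s r"
  proof
   fix r assume g: "r \<in> F"
   show "tc F W x r = tc F W ?s r"
   proof (cases "x r = 0")
    case True
    hence "sg r p = 0" using p(1) g FPI by (auto simp: St_def)
    thus ?thesis using True by (simp add: tc_def)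
   next
    case False
    hence "0 < sg r p" "0 < x r" using St_pos[OF p(1), of r] x(1)[OF g] g FPI by auto
    thus ?thesis using p(2) False g unfolding perp_coord[OF Y] by (subst e) auto
   qed
  qed
 next
  assume t: "\<forall>r\<in>F. tc F W x r = tc F W ?s r"
  have z: "(sg r p = 0 \<longleftrightarrow> x r = 0) & 0 <= sg r p" if "r \<in> PI" for r
  proof (cases "r \<in> F")
   case True
   hence "x r * exp (\<Sum>q\<in>PI - F. (gv q \<bullet> W r) * ln (x q)) = sg r p * exp (\<Sum>q\<in>PI - F. (gv q \<bullet> W r) * ln (sg q p))"
    using t by (simp add: tc_def)
   from same_sign[OF this x(1)[OF True]] show ?thesis by simp
  next
   case False
   thus ?thesis using x(2)[of r] sp[of r] that by auto
  qed
  have St: "p \<in> St ?Y" unfolding St_def using z by (auto simp: Q_iff)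
  have "perp ?Y ?D" unfolding perp_coord[OF Y]
  proof
   fix r assume g: "r \<in> F - ?Y"
   have "0 < sg r p" using St_pos[OF St, of r] g FPI by auto
   moreover have "0 < x r" using x(1)[of r] g FPI by force
   ultimately show "?D r + lc ?D r = 0" using e t g by blast
  qed
  thus "crit ?Y x p" using St by (simp add: crit_perp)
 qed
qed

lemma tc_deriv:
 assumes x: "!!q. q \<in> PI ==> ((%s. x s q) has_real_derivative v q) (at 0)" "!!q. q \<in> PI - F ==> 0 < x 0 q" and g: "r \<in> F"
 shows "((%s. tc F W (x s) r) has_real_derivative
  exp (\<Sum>q\<in>PI - F. (gv q \<bullet> W r) * ln (x 0 q)) * (v r + x 0 r * (\<Sum>q\<in>PI - F. (gv q \<bullet> W r) * (v q / x 0 q)))) (at 0)"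
proof -
 have "((%s. \<Sum>q\<in>PI - F. (gv q \<bullet> W r) * ln (x s q)) has_real_derivative (\<Sum>q\<in>PI - F. (gv q \<bullet> W r) * (v q / x 0 q))) (at 0)"
 proof (rule DERIV_sum)
  fix q assume w: "q \<in> PI - F"
  show "((%s. (gv q \<bullet> W r) * ln (x s q)) has_real_derivative (gv q \<bullet> W r) * (v q / x 0 q)) (at 0)"
   using DERIV_cmult[OF DERIV_chain2[OF DERIV_ln_divide[OF x(2)[OF w]] x(1)[of q]], of "gv q \<bullet> W r"] w by simp
 qed
 from DERIV_mult[OF x(1)[of r] DERIV_fun_exp[OF this]] show ?thesis
  unfolding tc_def using g FPI by (auto simp: algebra_simps)
qed

text \<open>A direction killed by the coordinates is tangent to the stratum, and its logarithmic
  derivatives satisfy the same orthogonality as logarithms of quotients do.\<close>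

lemma TT_kernel:
 fixes y :: "'b::euclidean_space"
 assumes T: "((%y. TT F W (x y)) has_derivative T') (at y)" and T0: "T' w = 0"
  and x: "!!q. q \<in> PI ==> ((%s. x (y + s *\<^sub>R w) q) has_real_derivative v q) (at 0)" "!!q. q \<in> PI - F ==> 0 < x y q"
 shows "r \<in> PI ==> x y r = 0 ==> v r = 0" "perp {r \<in> PI. x y r = 0} (%r. v r / x y r)"
proof -
 let ?Y = "{r \<in> PI. x y r = 0}"
 have Y: "?Y \<subseteq> F" using x(2) by force
 have k: "v r + x y r * (\<Sum>q\<in>PI - F. (gv q \<bullet> W r) * (v q / x y q)) = 0" if g: "r \<in> F" for r
 proof -
  have "((%s. tc F W (x (y + s *\<^sub>R w)) r) has_real_derivative 0) (at 0)"
   using has_derivative_line[OF T T0 bounded_linear_inner_left[of "W r"]] by (simp add: TT_W g)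
  with tc_deriv[of "%s. x (y + s *\<^sub>R w)" v r] x g show ?thesis using DERIV_unique by fastforce
 qed
 show "v r = 0" if "r \<in> PI" "x y r = 0" using k[of r] Y that by auto
 show "perp ?Y (%r. v r / x y r)" unfolding perp_coord[OF Y]
 proof
  fix r assume g: "r \<in> F - ?Y"
  hence "x y r ~= 0" using FPI by auto
  thus "v r / x y r + (\<Sum>q\<in>PI - F. (gv q \<bullet> W r) * (v q / x y q)) = 0"
   using k[of r] g by (simp add: field_simps)
 qed
qed

abbreviation Ts :: "'n real_vec => 'n real_vec" where "Ts \<equiv> %p. TT F W (%r. sg r p)"

abbreviation Us :: "'n real_vec set" where "Us \<equiv> {p. \<forall>r\<in>PI - F. 0 < sg r p}"

lemma Ck_sg: "open U ==> Ck_on m (sg r) U"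
proof -
 assume U: "open U"
 have "Ck_on m (%p. h r + (- gv r) \<bullet> p) U" by (intro Ck_add Ck_const U Ck_linear bounded_linear_inner_right)
 thus ?thesis by (simp add: sg_def[abs_def])
qed

lemma open_Us: "open Us"
proof -
 have "Us = (\<Inter>r\<in>PI - F. {p. gv r \<bullet> p < h r})" by (auto simp: sg_def)
 thus ?thesis using fin_PI by (auto intro!: open_INT open_halfspace_lt)
qed

lemma Ck_Ts: "Ck_on m Ts Us" by (rule Ck_TT[OF open_Us FPI]) (auto intro: Ck_sg open_Us)

text \<open>For \<open>w\<close> in the kernel, the orthogonality relation paired with
  \<open>w\<close> itself is a vanishing sum of the nonnegative terms
  \<open>(gv r \<bullet> w)\<^sup>2 / sg r p\<close>.\<close>

lemma Ts_local_inverse: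
 assumes p: "p \<in> Us" "!!r. r \<in> F ==> 0 <= sg r p"
 obtains U' V g where "open U'" "U' \<subseteq> Us" "p \<in> U'" "open V" "Ts p \<in> V" "homeomorphism U' V Ts g" "!!m. Ck_on m g V"
proof -
 let ?T = "frechet_derivative Ts (at p)"
 have T: "(Ts has_derivative ?T) (at p)" using Ck_SucE[OF Ck_Ts p(1)] .
 show ?thesis
 proof (rule smooth_inverse[OF open_Us p(1) Ck_Ts T, OF _ that])
  fix w assume w: "?T w = 0"
  let ?Y = "{r \<in> PI. sg r p = 0}"
  have "((%s. sg q (p + s *\<^sub>R w)) has_real_derivative - (gv q \<bullet> w)) (at 0)" for q
   unfolding sg_add by (auto intro!: derivative_eq_intros)
  note K = TT_kernel[of "%p r. sg r p", OF T w this]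
  have z: "gv r \<bullet> w = 0" if "r \<in> ?Y" for r using K(1)[of r] that p(1) by auto
  have "perp ?Y (%r. - (gv r \<bullet> w) / sg r p)" using K(2) p(1) by auto
  hence "(\<Sum>r\<in>PI - ?Y. - (gv r \<bullet> w) / sg r p * (gv r \<bullet> w)) = 0" using z unfolding perp_def by blast
  hence e0: "(\<Sum>r\<in>PI - ?Y. (gv r \<bullet> w)\<^sup>2 / sg r p) = 0" by (simp add: power2_eq_square sum_negf)
  have pos: "0 < sg r p" if "r \<in> PI - ?Y" for r using p(1) p(2)[of r] that by (cases "r \<in> F") force+
  have nn: "0 <= (gv r \<bullet> w)\<^sup>2 / sg r p" if "r \<in> PI - ?Y" for r using pos[OF that] by simp
  have *: "\<forall>r\<in>PI - ?Y. (gv r \<bullet> w)\<^sup>2 / sg r p = 0"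
   by (rule iffD1[OF sum_nonneg_eq_0_iff[OF finite_Diff[OF fin_PI] nn] e0])
  have "gv r \<bullet> w = 0" if "r \<in> PI" for r
   using bspec[OF *, of r] z[of r] pos[of r] that by (cases "r \<in> ?Y") force+
  thus "w = 0" by (rule gv_separates)
 qed
qed

end

lemma smooth_imp_continuous: assumes "smooth_map_on S f" shows "continuous_on S f"
 unfolding continuous_on_eq_continuous_within
proof
 fix x assume x: "x \<in> S"
 then obtain U g where U: "open U" "x \<in> U" "Ck_on 0 g U" "\<forall>y\<in>S \<inter> U. g y = f y"
  using assms unfolding smooth_map_on_def by blast
 have "isCont g x" using U(1-3) continuous_on_eq_continuous_at by auto
 hence "(g \<longlongrightarrow> f x) (at x within S)"
  using U x by (auto simp: isCont_def intro: tendsto_within_subset)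
 moreover have "\<forall>\<^sub>F y in at x within S. g y = f y" unfolding eventually_at_topological using U by blast
 ultimately show "continuous (at x within S) f" unfolding continuous_within by (rule Lim_transform_eventually)
qed

lemma prod_log_deriv:
 fixes f :: "'b => real => real"
 assumes "finite I" "!!i. i \<in> I ==> (f i has_real_derivative f i x * e i) (at x)"
 shows "((%s. \<Prod>i\<in>I. f i s) has_real_derivative (\<Prod>i\<in>I. f i x) * (\<Sum>i\<in>I. e i)) (at x)"
 using assms
proof (induction I rule: finite_induct)
 case (insert i I)
 have "((%s. f i s * (\<Prod>i\<in>I. f i s)) has_real_derivative f i x * e i * (\<Prod>i\<in>I. f i x) + (\<Prod>i\<in>I. f i x) * (\<Sum>i\<in>I. e i) * f i x) (at x)"
  by (rule DERIV_mult) (use insert in auto)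
 thus ?case using insert(1,2) by (simp add: algebra_simps)
qed simp

lemma opposite_sign:
 fixes v p s c :: real
 assumes "- v = p * s" "0 < p" "0 < c" "v / c ~= 0"
 shows "v / c * s < 0"
proof -
 have v: "v = - (p * s)" using assms(1) by simp
 hence "s ~= 0" using assms(4) by auto
 hence "0 < p * s\<^sup>2 / c" using assms(2,3) by simp
 thus ?thesis unfolding v by (simp add: power2_eq_square mult_ac)
qed

subsection \<open>The configuration space\<close>

locale conf = poly a d ht Q for a :: "'n::{finite,linorder} => 'n => int" and d ht Q +
 fixes lab :: "'k::finite => nat \<times> 'n"
 assumes lab: "bij_betw lab UNIV PI"
begin

definition co :: "real^'k => nat \<times> 'n => real" where "co u r = u $ inv lab r"

definition rel :: "real^'k => nat \<times> 'n => real" where "rel u r = co u r + (\<Prod>q\<in>PI. co u q ^ md q r)"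

text \<open>All nonnegative solutions, without the closure; they are shown to form the nonnegative
  part in \<open>M_nonneg_eq\<close>.\<close>

definition Nn :: "(real^'k) set" where "Nn = {u. \<forall>r\<in>PI. 0 <= co u r & rel u r = 1}"

definition zs :: "real^'k => (nat \<times> 'n) set" where "zs u = {r \<in> PI. co u r = 0}"

lemma co_lab: "co u (lab k) = u $ k" using lab by (simp add: co_def bij_betw_def inv_f_f)

lemma ball_PI: "(\<forall>r\<in>PI. p r) \<longleftrightarrow> (\<forall>k. p (lab k))"
 unfolding bij_betw_imp_surj_on[OF lab, symmetric] by simp

lemma co_eqI: "(!!r. r \<in> PI ==> co u r = co u' r) ==> u = u'"
 using ball_PI[of "%r. co u r = co u' r"] by (simp add: co_lab vec_eq_iff)

lemma co_add: "co (u + s *\<^sub>R v) r = co u r + s * co v r" by (simp add: co_def)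

lemma Ck_co: "open U ==> Ck_on m (%u. co u r) U"
 unfolding co_def by (rule Ck_linear) (auto intro: bounded_linear_vec_nth)

lemma rel_lab: "u $ k + (\<Prod>l\<in>UNIV. (u $ l) ^ compat_degree B (lab l) (lab k)) = rel u (lab k)"
proof -
 have P: "lab k \<in> PI" for k using lab by (auto simp: bij_betw_def)
 have "(\<Prod>q\<in>PI. co u q ^ md q (lab k)) = (\<Prod>l\<in>UNIV. co u (lab l) ^ md (lab l) (lab k))"
  by (rule prod.reindex_bij_betw[OF lab, symmetric])
 thus ?thesis by (simp add: rel_def co_lab compat_degree P)
qed

lemma M_tilde_iff: "u \<in> M_tilde B lab \<longleftrightarrow> (\<forall>r\<in>PI. rel u r = 1)"
 unfolding M_tilde_def ball_PI by (simp add: rel_lab)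

lemma M_pos_iff: "u \<in> M_pos B lab \<longleftrightarrow> (\<forall>r\<in>PI. 0 < co u r & rel u r = 1)"
 unfolding M_pos_def M_open_def ball_PI by (simp add: M_tilde_iff ball_PI co_lab) (metis less_irrefl)

lemma M_pos_Nn: "M_pos B lab \<subseteq> Nn" by (auto simp: M_pos_iff Nn_def intro: less_imp_le)

lemma M_nonneg_Nn: "M_nonneg B lab \<subseteq> Nn"
proof -
 have "closed {u :: real^'k. \<forall>k. 0 <= u $ k}"
  by (intro closed_Collect_all closed_Collect_le continuous_intros)
 hence "closure (M_pos B lab) \<subseteq> {u. \<forall>k. 0 <= u $ k}"
  using M_pos_Nn by (intro closure_minimal) (auto simp: Nn_def ball_PI co_lab)
 thus ?thesis by (auto simp: M_nonneg_def M_tilde_iff Nn_def ball_PI co_lab)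
qed

lemma M_nonneg_compact: "compact (M_nonneg B lab)"
proof -
 have 1: "u $ k <= 1" if "u \<in> Nn" for u k
 proof -
  have "0 <= (\<Prod>q\<in>PI. co u q ^ md q (lab k))" using that by (intro prod_nonneg) (auto simp: Nn_def)
  thus ?thesis using that by (auto simp: Nn_def ball_PI rel_def co_lab dest!: spec[of _ k])
 qed
 have "closed (M_nonneg B lab)" unfolding M_nonneg_def M_tilde_def
  by (intro closed_Int closed_closure closed_Collect_all closed_Collect_eq continuous_intros)
 hence "compact (cbox 0 (\<chi> k. 1) \<inter> M_nonneg B lab)" by (intro compact_Int_closed compact_cbox)
 moreover have "M_nonneg B lab \<subseteq> cbox 0 (\<chi> k. 1)"
  using M_nonneg_Nn 1 by (auto simp: mem_box_cart Nn_def ball_PI co_lab subset_iff)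
 ultimately show ?thesis by (simp add: Int_absorb1)
qed

lemma zs_one:
 assumes "u \<in> Nn" "r \<in> PI" "q \<in> zs u" "md q r ~= 0" shows "co u r = 1"
proof -
 have "(\<Prod>q\<in>PI. co u q ^ md q r) = 0" by (rule prod_zero) (use assms fin_PI in "auto simp: zs_def")
 thus ?thesis using assms by (auto simp: Nn_def rel_def)
qed

text \<open>A coordinate incompatible with a vanishing one equals 1 by its equation.\<close>

lemma zs_compat: assumes u: "u \<in> Nn" shows "compat (zs u)" unfolding compat_def
proof (intro conjI ballI)
 fix q r assume g: "q \<in> zs u" "r \<in> zs u"
 thus "md q r = 0" using zs_one[OF u _ g(1), of r] by (cases "md q r = 0") (auto simp: zs_def)
qed (auto simp: zs_def)

lemma zs_prod_pos:
 assumes "u \<in> Nn" "!!q. q \<in> zs u ==> md q r = 0"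
 shows "(\<Prod>q\<in>PI. co u q ^ md q r) = exp (\<Sum>q\<in>PI - zs u. md q r * ln (co u q))"
proof -
 have "(\<Prod>q\<in>PI. co u q ^ md q r) = (\<Prod>q\<in>PI - zs u. exp (md q r * ln (co u q)))"
 proof (rule prod.mono_neutral_cong_right)
  fix q assume w: "q \<in> PI - zs u"
  hence "0 <= co u q" "co u q ~= 0" using assms(1) by (auto simp: Nn_def zs_def)
  hence "0 < co u q" by simp
  thus "co u q ^ md q r = exp (md q r * ln (co u q))" by (simp add: exp_of_nat_mult)
 qed (use fin_PI assms(2) in auto)
 thus ?thesis using fin_PI by (simp add: exp_sum)
qed

definition fm :: "real^'k => 'n real_vec" where "fm u = (THE p. crit (zs u) (co u) p)"

lemma fm: "u \<in> Nn ==> crit (zs u) (co u) (fm u)" and fm_eq: "u \<in> Nn ==> crit (zs u) (co u) p ==> fm u = p"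
proof -
 have "\<exists>!p. crit (zs u) (co u) p" if "u \<in> Nn"
  using crit_exists[OF zs_compat[OF that]] crit_unique[OF zs_compat[OF that]] by blast
 thus "u \<in> Nn ==> crit (zs u) (co u) (fm u)" "u \<in> Nn ==> crit (zs u) (co u) p ==> fm u = p"
  unfolding fm_def by (blast intro: theI' the1_equality)+
qed

lemma fm_St: "u \<in> Nn ==> fm u \<in> St (zs u)" using fm by (simp add: crit_def)

lemma zs_eq:
 assumes "u \<in> Nn" "fm u \<in> St F" "F \<subseteq> PI" shows "zs u = F"
 using fm_St[OF assms(1)] assms(2,3) unfolding St_def zs_def by auto

text \<open>Equal images make the logarithms of the coordinate quotients orthogonal to the face. If
  a coordinate grows, the product in its equation shrinks, which is the sign condition of
  \<open>rigid_perp\<close>.\<close>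

lemma fm_inj: "inj_on fm Nn"
proof (rule inj_onI)
 fix u u' assume u: "u \<in> Nn" "u' \<in> Nn" "fm u = fm u'"
 define F where "F = zs u"
 have F: "compat F" using u zs_compat by (simp add: F_def)
 have F': "zs u' = F" using zs_eq[OF u(2)] fm_St[OF u(1)] u(3) by (auto simp: F_def zs_def)
 let ?x = "%r. ln (co u r) - ln (co u' r)"
 have pos: "0 < co u r" "0 < co u' r" if "r \<in> PI - F" for r
  using that u F' unfolding F_def Nn_def zs_def by force+
 have "?x r = 0" if "r \<in> PI - F" for r
 proof (rule rigid_perp[OF F _ _ _ that])
  fix r q assume "r \<in> PI - F" "q \<in> F" "md q r ~= 0"
  thus "?x r = 0" using zs_one[OF u(1), of r q] zs_one[OF u(2), of r q] F' by (simp add: F_def)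
 next
  fix r assume g: "r \<in> PI - F" "!!q. q \<in> F ==> md q r = 0" "?x r ~= 0"
  let ?S = "%u. \<Sum>q\<in>PI - F. md q r * ln (co u q)"
  have e: "co u r = 1 - exp (?S u)" "co u' r = 1 - exp (?S u')"
   using zs_prod_pos[OF u(1), of r] zs_prod_pos[OF u(2), of r] g u F' by (auto simp: F_def Nn_def rel_def algebra_simps)
  have S: "(\<Sum>q\<in>PI - F. md q r * ?x q) = ?S u - ?S u'" by (simp add: right_diff_distrib sum_subtractf)
  show "?x r * (\<Sum>q\<in>PI - F. md q r * ?x q) < 0"
  proof (cases "co u r < co u' r")
   case True
   hence "?S u > ?S u'" unfolding e by simp
   thus ?thesis unfolding S using True pos[OF g(1)] by (simp add: mult_neg_pos)
  next
   case False
   hence l: "co u' r < co u r" using g(3) by (cases "co u r = co u' r") auto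
   hence "?S u < ?S u'" unfolding e by simp
   thus ?thesis unfolding S using l pos[OF g(1)] by (simp add: mult_pos_neg)
  qed
 next
  have "perp F (%r. ln (sg r (fm u)) - ln (co u r))" "perp F (%r. ln (sg r (fm u)) - ln (co u' r))"
   using fm[OF u(1)] fm[OF u(2)] u(3) F' by (auto simp: crit_perp F_def)
  thus "perp F ?x" unfolding perp_def by (simp add: left_diff_distrib sum_subtractf)
 qed
 note 0 = this
 have "co u r = co u' r" if g: "r \<in> PI" for r
 proof (cases "r \<in> F")
  case True
  hence "r \<in> zs u" "r \<in> zs u'" using F' by (auto simp: F_def)
  thus ?thesis by (simp add: zs_def)
 qed (use 0[of r] pos[of r] g in simp)
 thus "u = u'" by (rule co_eqI)
qed

text \<open>On the open face criticality says that logarithms of slacks and of coordinates have the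
  same combination of g-vectors, and \<open>solution_exists\<close> attains every value of
  it.\<close>

lemma fm_pos: "St {} \<subseteq> fm ` M_pos B lab"
proof
 fix p assume p: "p \<in> St {}"
 obtain z :: "nat \<times> 'n => real" where z: "!!r. r \<in> PI ==> exp (z r) + exp (\<Sum>q\<in>PI. md q r * z q) = 1"
   "(\<Sum>r\<in>PI. z r *\<^sub>R gv r) = (\<Sum>r\<in>PI. ln (sg r p) *\<^sub>R gv r)"
  using solution_exists by blast
 define u where "u = (\<chi> k. exp (z (lab k)))"
 have co: "co u r = exp (z r)" if "r \<in> PI" for r
  using ball_PI[of "%r. co u r = exp (z r)"] that by (auto simp: co_lab u_def)
 have "rel u r = 1" if "r \<in> PI" for r
  using z(1)[OF that] by (simp add: rel_def co that exp_sum[OF fin_PI] exp_of_nat_mult)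
 hence u: "u \<in> M_pos B lab" by (simp add: M_pos_iff co)
 have zs: "zs u = {}" using co by (auto simp: zs_def)
 have "(\<Sum>r\<in>PI. (ln (sg r p) - z r) * (gv r \<bullet> w)) = 0" for w
  using arg_cong[OF z(2), of "%x. x \<bullet> w"] by (simp add: inner_sum_left left_diff_distrib sum_subtractf)
 hence "crit (zs u) (co u) p" using p by (simp add: zs crit_def co)
 hence "fm u = p" using u M_pos_Nn by (intro fm_eq) auto
 thus "p \<in> fm ` M_pos B lab" using u by blast
qed

lemma fm_Q: "u \<in> Nn ==> fm u \<in> Q" using fm_St by (auto simp: St_def)

end

locale chart = conf a d ht Q lab + coord a d ht Q F W
 for a :: "'n::{finite,linorder} => 'n => int" and d ht Q and lab :: "'k::finite => nat \<times> 'n" and F W +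
 fixes u0 assumes u0: "u0 \<in> Nn" "zs u0 \<subseteq> F"
begin

abbreviation "Tu \<equiv> %u. TT F W (co u)"

abbreviation "Uu \<equiv> {u. \<forall>r\<in>PI - F. 0 < co u r}"

lemma open_Uu: "open Uu"
proof -
 have "Uu = (\<Inter>r\<in>PI - F. {u. 0 < u $ inv lab r})" by (auto simp: co_def)
 thus ?thesis using fin_PI by (auto intro!: open_INT open_Collect_less continuous_intros)
qed

lemma Ck_Tu: "Ck_on m Tu Uu" by (rule Ck_TT[OF open_Uu FPI]) (auto intro: Ck_co open_Uu)

lemma u0_Uu: "u0 \<in> Uu" using u0 by (force simp: Nn_def zs_def)

lemma fm_Us: "fm u0 \<in> Us" using St_pos[OF fm_St[OF u0(1)]] u0(2) by auto

lemma Tu_fm: assumes "u \<in> Nn" "u \<in> Uu" "p \<in> Us" shows "fm u = p \<longleftrightarrow> Tu u = Ts p"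
proof -
 have "crit (zs u) (co u) p \<longleftrightarrow> Tu u = Ts p"
  unfolding zs_def by (rule crit_coord) (use assms FPI in "auto simp: Nn_def")
 thus ?thesis using fm[OF assms(1)] fm_eq[OF assms(1)] by metis
qed

text \<open>By \<open>Tu_fm\<close> the map is locally \<open>Tu\<close> followed by the inverse of
  \<open>Ts\<close>.\<close>

lemma fm_smooth_at: "\<exists>U g. open U & u0 \<in> U & (\<forall>m. Ck_on m g U) & (\<forall>u\<in>Nn \<inter> U. g u = fm u)"
proof -
 obtain U' V g where g: "open U'" "U' \<subseteq> Us" "fm u0 \<in> U'" "open V" "Ts (fm u0) \<in> V" "homeomorphism U' V Ts g" "!!m. Ck_on m g V"
  by (rule Ts_local_inverse[OF fm_Us sg_nonneg[OF fm_Q[OF u0(1)]]], rule that)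
 let ?O = "Uu \<inter> Tu -` V"
 have o: "open ?O" using continuous_open_preimage[OF Ck_continuous[OF Ck_Tu] open_Uu g(4)] by simp
 have T0: "Tu u0 = Ts (fm u0)" using Tu_fm[OF u0(1) u0_Uu fm_Us] by simp
 have C: "Ck_on m (%u. g (Tu u)) ?O" for m by (rule Ck_compose[OF o _ Ck_subset[OF o _ Ck_Tu] g(7)]) auto
 have "g (Tu u) = fm u" if "u \<in> Nn \<inter> ?O" for u
 proof -
  have "g (Tu u) \<in> U'" "Ts (g (Tu u)) = Tu u" using g(6) that by (auto simp: homeomorphism_def)
  thus ?thesis using Tu_fm[of u "g (Tu u)"] g(2) that by auto
 qed
 thus ?thesis using o C T0 g(5) u0_Uu by (intro exI[of _ ?O] exI[of _ "%u. g (Tu u)"]) auto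
qed

definition Eq :: "real^'k => real^'k" where "Eq u = (\<chi> k. rel u (lab k))"

lemma Ck_Eq: "open U ==> Ck_on m Eq U" unfolding Eq_def rel_def by (intro Ck_vec Ck_add Ck_prod Ck_power Ck_co)

lemma Eq_Nn: "u \<in> Nn ==> Eq u = (\<chi> k. 1)" by (simp add: Eq_def Nn_def ball_PI)

text \<open>The immersion property: the differentiated equations give the logarithmic derivatives of
  \<open>v\<close> the signs demanded by \<open>rigid_perp\<close>. If \<open>r\<close> is
  incompatible with a vanishing coordinate, the product in its equation is zero along the whole
  line, hence \<open>co v r = 0\<close>.\<close>

lemma kernel:
 assumes T: "(Tu has_derivative T') (at u0)" "T' v = 0" and E: "(Eq has_derivative E') (at u0)" "E' v = 0"
 shows "v = 0"
proof -
 let ?Y = "zs u0"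
 have cd: "((%s. co (u0 + s *\<^sub>R v) q) has_real_derivative co v q) (at 0)" for q
  unfolding co_add by (auto intro!: derivative_eq_intros)
 note K = TT_kernel[of co, OF T cd, folded zs_def]
 have v0: "co v r = 0" if "r \<in> ?Y" for r using K(1)[of r] that u0_Uu by (auto simp: zs_def)
 have p: "perp ?Y (%r. co v r / co u0 r)" using K(2) u0_Uu by auto
 have D: "((%s. \<Prod>q\<in>PI. (co u0 q + s * co v q) ^ md q r) has_real_derivative - co v r) (at 0)" if g: "r \<in> PI" for r
 proof -
  obtain k where k: "r = lab k" using lab g by (auto simp: bij_betw_def)
  have "((%s. rel (u0 + s *\<^sub>R v) r) has_real_derivative 0) (at 0)"
   using has_derivative_line[OF E bounded_linear_vec_nth[of k]] by (simp add: Eq_def k)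
  from DERIV_diff[OF this cd[of r]] show ?thesis by (simp add: rel_def co_add)
 qed
 have "co v r / co u0 r = 0" if g: "r \<in> PI - ?Y" for r
 proof (rule rigid_perp[OF zs_compat[OF u0(1)] _ _ p g])
  fix r q assume g: "r \<in> PI - ?Y" and w: "q \<in> ?Y" "md q r ~= 0"
  have "(co u0 q + s * co v q) ^ md q r = 0" for s using w v0[of q] by (simp add: zs_def)
  hence "(\<Prod>q\<in>PI. (co u0 q + s * co v q) ^ md q r) = 0" for s
   by (intro prod_zero fin_PI bexI[of _ q]) (use w in "auto simp: zs_def")
  hence "co v r = 0" using D[of r] g DERIV_unique[OF DERIV_const] by fastforce
  thus "co v r / co u0 r = 0" by simp
 next
  fix r assume g: "r \<in> PI - ?Y" and w: "!!q. q \<in> ?Y ==> md q r = 0" and n: "co v r / co u0 r ~= 0"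
  let ?P = "\<Prod>q\<in>PI. co u0 q ^ md q r" and ?S = "\<Sum>q\<in>PI - ?Y. md q r * (co v q / co u0 q)"
  have "((%s. \<Prod>q\<in>PI. (co u0 q + s * co v q) ^ md q r) has_real_derivative
   (\<Prod>q\<in>PI. (co u0 q + 0 * co v q) ^ md q r) * (\<Sum>q\<in>PI. md q r * (co v q / co u0 q))) (at 0)"
  proof (rule prod_log_deriv[OF fin_PI])
   fix q assume i: "q \<in> PI"
   have l: "((%s. co u0 q + s * co v q) has_real_derivative co v q) (at 0)" by (auto intro!: derivative_eq_intros)
   show "((%s. (co u0 q + s * co v q) ^ md q r) has_real_derivative (co u0 q + 0 * co v q) ^ md q r * (md q r * (co v q / co u0 q))) (at 0)"
   proof (cases "md q r")
    case (Suc n)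
    hence "co u0 q ~= 0" using w[of q] i by (auto simp: zs_def)
    hence "md q r * (co v q * (co u0 q + 0 * co v q) ^ (md q r - Suc 0)) =
     (co u0 q + 0 * co v q) ^ md q r * (md q r * (co v q / co u0 q))" by (simp add: Suc)
    from DERIV_cong[OF DERIV_power[OF l] this] show ?thesis .
   qed simp
  qed
  moreover have "(\<Sum>q\<in>PI. md q r * (co v q / co u0 q)) = ?S"
   by (rule sum.mono_neutral_right) (use fin_PI in "auto simp: zs_def")
  ultimately have "- co v r = ?P * ?S" using D[of r] g DERIV_unique by fastforce
  moreover have "?P > 0" using zs_prod_pos[of u0 r, OF u0(1) w] by simp
  moreover have "0 < co u0 r" using g u0(1) by (force simp: Nn_def zs_def)
  ultimately show "co v r / co u0 r * ?S < 0" using n by (rule opposite_sign)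
 qed
 hence "co v r = co 0 r" if "r \<in> PI" for r using v0[of r] that by (cases "r \<in> ?Y") (auto simp: zs_def co_def)
 thus ?thesis by (rule co_eqI)
qed

text \<open>The solutions do not fill their ambient space, so the inverse function theorem is
  applied to \<open>H\<close>, a map of the ambient space into itself built from \<open>Tu\<close>,
  the equations \<open>Eq\<close> and a linear left inverse \<open>L\<close> of their joint
  derivative. On solutions \<open>Eq\<close> is constant and \<open>Tu\<close> becomes
  \<open>Ts q\<close>, so \<open>H (i q)\<close> is smooth in \<open>q\<close>; continuity of
  \<open>i\<close> keeps \<open>i q\<close> where \<open>H\<close> is invertible.\<close>

lemma inverse_smooth_at:
 assumes i: "continuous_on Q i" "!!q. q \<in> Q ==> i q \<in> Nn & fm (i q) = q"
 shows "\<exists>U g. open U & fm u0 \<in> U & (\<forall>m. Ck_on m g U) & (\<forall>q\<in>Q \<inter> U. g q = i q)"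
proof -
 define T' where "T' = frechet_derivative Tu (at u0)"
 define E' where "E' = frechet_derivative Eq (at u0)"
 have T: "(Tu has_derivative T') (at u0)" unfolding T'_def by (rule Ck_SucE[OF Ck_Tu u0_Uu])
 have E: "(Eq has_derivative E') (at u0)" unfolding E'_def by (rule Ck_SucE[OF Ck_Eq[OF open_UNIV]]) simp
 have GD: "((%u. (Tu u, Eq u)) has_derivative (%v. (T' v, E' v))) (at u0)" by (rule has_derivative_Pair[OF T E])
 have lin: "linear (%v. (T' v, E' v))" by (rule has_derivative_linear[OF GD])
 have "inj (%v. (T' v, E' v))" unfolding linear_injective_0[OF lin] using kernel[OF T _ E] by (simp add: zero_prod_def)
 then obtain L where L: "linear L" "L \<circ> (%v. (T' v, E' v)) = id" using linear_injective_left_inverse[OF lin] by blast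
 have bL: "bounded_linear L" using L(1) by (simp add: linear_linear)
 have CL: "Ck_on m (%x. L (s x, t x)) U" if U: "open U" and s: "Ck_on m s U" and t: "Ck_on m t U" for s t m and U :: "'b::euclidean_space set"
 proof -
  have b: "bounded_linear (%x. L (x, 0))" "bounded_linear (%x. L (0, x))"
   by (intro bounded_linear_compose[OF bL] bounded_linear_Pair bounded_linear_ident bounded_linear_zero)+
  have "Ck_on m (%x. L (s x, 0) + L (0, t x)) U"
   by (intro Ck_add U Ck_compose[OF U _ s Ck_linear[OF open_UNIV b(1)]] Ck_compose[OF U _ t Ck_linear[OF open_UNIV b(2)]]) auto
  thus ?thesis by (simp add: linear_add[OF L(1), symmetric])
 qed
 define H where "H = (%u. L (Tu u, Eq u))"
 have HD: "(H has_derivative (%v. L (T' v, E' v))) (at u0)" unfolding H_def by (rule bounded_linear.has_derivative[OF bL GD])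
 have "v = 0" if "L (T' v, E' v) = 0" for v using fun_cong[OF L(2), of v] that by simp
 note H0 = this
 have CH: "Ck_on m H Uu" for m unfolding H_def by (rule CL[OF open_Uu Ck_Tu Ck_Eq[OF open_Uu]])
 obtain U' V g where g: "open U'" "U' \<subseteq> Uu" "u0 \<in> U'" "open V" "H u0 \<in> V" "homeomorphism U' V H g" "!!m. Ck_on m g V"
  by (rule smooth_inverse[OF open_Uu u0_Uu CH HD H0], assumption, rule that)
 obtain A where A: "open A" "A \<inter> Q = i -` U' \<inter> Q" using i(1) g(1) unfolding continuous_on_open_invariant by blast
 let ?K = "%q. L (Ts q, \<chi> k. 1)"
 have CK: "Ck_on m ?K Us" for m by (intro CL open_Us Ck_Ts Ck_const)
 let ?O = "A \<inter> (Us \<inter> ?K -` V)"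
 have o: "open ?O" using A(1) continuous_open_preimage[OF Ck_continuous[OF CK] open_Us g(4)] by blast
 have C: "Ck_on m (%q. g (?K q)) ?O" for m by (rule Ck_compose[OF o _ Ck_subset[OF o _ CK] g(7)]) auto
 have HK: "?K q = H (i q)" if "q \<in> Q" "q \<in> Us" "i q \<in> Uu" for q
  using Tu_fm[of "i q" q] i(2)[of q] that by (simp add: H_def Eq_Nn)
 have i0: "i (fm u0) = u0" using i(2)[OF fm_Q[OF u0(1)]] fm_inj u0(1) by (auto simp: inj_on_def)
 have "fm u0 \<in> ?O" using A(2) HK[of "fm u0"] i0 g(3,5) u0_Uu fm_Us fm_Q[OF u0(1)] by auto
 moreover have "g (?K q) = i q" if "q \<in> Q \<inter> ?O" for q
 proof -
  have "i q \<in> U'" using A(2) that by auto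
  thus ?thesis using HK[of q] g(2,6) that by (auto simp: homeomorphism_def)
 qed
 ultimately show ?thesis using o C by (intro exI[of _ ?O] exI[of _ "%q. g (?K q)"]) auto
qed

end

context conf
begin

lemma obtain_chart:
 assumes "u \<in> Nn" obtains F W where "chart a d ht Q lab F W u"
proof -
 obtain F W where "zs u \<subseteq> F" "maxc F" "!!r z. r \<in> F ==> z \<in> F ==> gv z \<bullet> W r = of_bool (z = r)"
  using maxc_extend[OF zs_compat[OF assms]] by blast
 hence "chart a d ht Q lab F W u" using assms by unfold_locales
 thus ?thesis by (rule that)
qed

lemma fm_smooth: "smooth_map_on Nn fm" unfolding smooth_map_on_def
proof
 fix u assume "u \<in> Nn"
 then obtain F W where "chart a d ht Q lab F W u" by (rule obtain_chart)
 then interpret chart a d ht Q lab F W u .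
 show "\<exists>U g. open U & u \<in> U & (\<forall>m. Ck_on m g U) & (\<forall>y\<in>Nn \<inter> U. g y = fm y)" by (rule fm_smooth_at)
qed

text \<open>The image of the compact nonnegative part is closed and contains the open face, which is
  dense in \<open>Q\<close>.\<close>

lemma fm_onto: "Q \<subseteq> fm ` M_nonneg B lab"
proof -
 have "compact (fm ` M_nonneg B lab)"
  using continuous_on_subset[OF smooth_imp_continuous[OF fm_smooth] M_nonneg_Nn] M_nonneg_compact by (rule compact_continuous_image)
 moreover have "M_pos B lab \<subseteq> M_nonneg B lab"
  using closure_subset by (auto simp: M_nonneg_def M_tilde_iff M_pos_iff)
 hence "St {} \<subseteq> fm ` M_nonneg B lab" using fm_pos by blast
 ultimately have "closure (St {}) \<subseteq> fm ` M_nonneg B lab" by (intro closure_minimal compact_imp_closed)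
 moreover have "closure (St {}) = Q"
 proof -
  have "Fc {} = Q" by (simp add: Fc_def)
  hence "St {} = rel_interior Q" using rel_interior_Fc[of "{}"] by (simp add: compat_def)
  thus ?thesis using convex_closure_rel_interior[OF Q_convex] compact_imp_closed[OF Q_compact] by simp
 qed
 ultimately show ?thesis by simp
qed

text \<open>A nonnegative solution has the same image as some point of the closure, and
  \<open>fm\<close> is injective on all nonnegative solutions.\<close>

lemma M_nonneg_eq: "M_nonneg B lab = Nn"
proof (intro equalityI M_nonneg_Nn subsetI)
 fix u assume u: "u \<in> Nn"
 obtain u' where u': "u' \<in> M_nonneg B lab" "fm u = fm u'" using fm_onto fm_Q[OF u] by blast
 hence "u = u'" using fm_inj u M_nonneg_Nn by (auto simp: inj_on_def)
 thus "u \<in> M_nonneg B lab" using u' by simp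
qed

lemma fm_image: "fm ` Nn = Q" using fm_onto fm_Q M_nonneg_eq by auto

lemma fm_diffeomorphism: "diffeomorphism (M_nonneg B lab) Q fm"
proof -
 let ?i = "inv_into Nn fm"
 have "compact Nn" using M_nonneg_compact M_nonneg_eq by simp
 hence ci: "continuous_on Q ?i"
  using continuous_on_inv[OF smooth_imp_continuous[OF fm_smooth], of ?i] fm_image inv_into_f_f[OF fm_inj] by simp
 have i: "?i q \<in> Nn & fm (?i q) = q" if "q \<in> Q" for q
  using that fm_image by (metis f_inv_into_f inv_into_into)
 have "smooth_map_on Q ?i" unfolding smooth_map_on_def
 proof
  fix q assume "q \<in> Q"
  then obtain u where u: "u \<in> Nn" "q = fm u" using fm_image by blast
  obtain F W where "chart a d ht Q lab F W u" using u(1) by (rule obtain_chart)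
  then interpret chart a d ht Q lab F W u .
  show "\<exists>U g. open U & q \<in> U & (\<forall>m. Ck_on m g U) & (\<forall>y\<in>Q \<inter> U. g y = ?i y)"
   unfolding u(2) by (rule inverse_smooth_at[OF ci i])
 qed
 thus ?thesis using fm_smooth fm_inj fm_image by (simp add: diffeomorphism_def bij_betw_def M_nonneg_eq)
qed

lemma fm_stratum: assumes F: "compat F" shows "fm ` M_stratum B lab F = St F"
proof -
 have FPI: "F \<subseteq> PI" using F by (simp add: compat_def)
 have S: "M_stratum B lab F = {u \<in> Nn. zs u = F}"
 proof -
  have "(\<forall>k. u $ k = 0 \<longleftrightarrow> lab k \<in> F) \<longleftrightarrow> zs u = F" for u
   unfolding co_lab[symmetric] ball_PI[of "%r. co u r = 0 \<longleftrightarrow> r \<in> F", symmetric] using FPI by (auto simp: zs_def)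
  thus ?thesis by (simp add: M_stratum_def M_nonneg_eq)
 qed
 show ?thesis
 proof
  show "fm ` M_stratum B lab F \<subseteq> St F" using fm_St by (auto simp: S)
  show "St F \<subseteq> fm ` M_stratum B lab F"
  proof
   fix p assume p: "p \<in> St F"
   then obtain u where u: "u \<in> Nn" "p = fm u" using fm_image by (auto simp: St_def)
   thus "p \<in> fm ` M_stratum B lab F" using zs_eq[OF u(1), of F] p FPI by (auto simp: S)
  qed
 qed
qed

lemma associahedron_face:
 assumes F: "compat F" and g: "!!r. r \<in> PI ==> g_vector BT (principal_cluster_var BT r) = gv r"
 shows "associahedron_face BT Q F = Fc F"
proof -
 have FPI: "F \<subseteq> PI" using F by (simp add: compat_def)
 hence e: "(%r. g_vector BT (principal_cluster_var BT r)) ` F = gv ` F" using g by (intro image_cong) auto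
 have "(\<forall>c \<in> convex_cone hull (gv ` F). \<forall>p\<in>Q. c \<bullet> p <= c \<bullet> q) \<longleftrightarrow> (\<forall>r\<in>F. sg r q = 0)" if q: "q \<in> Q" for q
 proof
  assume *: "\<forall>c \<in> convex_cone hull (gv ` F). \<forall>p\<in>Q. c \<bullet> p <= c \<bullet> q"
  show "\<forall>r\<in>F. sg r q = 0"
  proof
   fix r assume "r \<in> F"
   hence "gv r \<in> convex_cone hull (gv ` F)" by (intro hull_inc) simp
   thus "sg r q = 0" using h[of r] * q by (force simp: sg_def)
  qed
 next
  assume *: "\<forall>r\<in>F. sg r q = 0"
  show "\<forall>c \<in> convex_cone hull (gv ` F). \<forall>p\<in>Q. c \<bullet> p <= c \<bullet> q"
  proof (intro ballI)
   fix c p assume c: "c \<in> convex_cone hull (gv ` F)" and p: "p \<in> Q"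
   obtain x where x: "!!r. r \<in> F ==> 0 <= x r" "c = (\<Sum>r\<in>F. x r *\<^sub>R gv r)"
    using cone_hull_image[OF compat_finite[OF F] c] by metis
   have "gv r \<bullet> p <= gv r \<bullet> q" if "r \<in> F" for r using * sg_nonneg[OF p, of r] that by (force simp: sg_def)
   thus "c \<bullet> p <= c \<bullet> q" unfolding x(2) inner_sum_left inner_scaleR_left
    using x(1) by (intro sum_mono mult_left_mono)
  qed
 qed
 thus ?thesis unfolding associahedron_face_def e Fc_def by auto
qed

end

theorem theorem8p1:
 fixes A :: "'n::{finite,linorder} int_matrix"
  and E :: "'n => 'n => bool"
  and lab :: "'k::finite => nat \<times> 'n"
  and P :: "'n real_vec set"
 assumes "finite_type_cartan A" and "connected_diagram A"
  and "orientation A E"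
  and "bij_betw lab UNIV (Pi_index (exchange_matrix A E))"
  and "generalized_associahedron (exchange_matrix (transpose A) E) P"
 shows "\<exists>f. diffeomorphism (M_nonneg (exchange_matrix A E) lab) P f &
       face_preserving (exchange_matrix A E) (exchange_matrix (transpose A) E) lab P f"
proof -
 let ?a = "%i j. A $ i $ j"
 obtain d ht where dy: "dynkin UNIV ?a d ht"
  and B: "exchange_matrix A E = (\<chi> i j. if ht i < ht j then - (A $ i $ j) else if ht j < ht i then A $ i $ j else 0)"
   "exchange_matrix (transpose A) E = (\<chi> i j. if ht i < ht j then - (A $ j $ i) else if ht j < ht i then A $ j $ i else 0)"
  by (rule ex_heights[OF assms(1,3)], rule that)
 interpret full ?a d ht using dy by (simp add: full_def fdyn_def)
 interpret pfull ?a d ht by (rule pfull)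
 have BB: "exchange_matrix A E = B" "exchange_matrix (transpose A) E = BT" unfolding B B_def BT_def by simp_all
 have P: "polytope P" "normal_fan P = cluster_fan BT" using assms(5) by (simp_all add: generalized_associahedron_def BB)
 interpret conf ?a d ht P lab by unfold_locales (use P cone_in_fan assms(4) Pi_index BB in auto)
 have "face_preserving B BT lab P fm" unfolding face_preserving_def pairwise_compatible
  using fm_stratum rel_interior_Fc associahedron_face g_vector by auto
 thus ?thesis using fm_diffeomorphism unfolding BB by blast
qed

end
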